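(* Let $k$ be a commutative ring with unit, $I$ a finite index set, and let $(M_{ab})$, $(M^{ab})$, $(R^{ab}_{cd})$, $(\overline{R}^{ab}_{cd})$ be arrays of elements of $k$ indexed by $I$ that satisfy, for all values of the free indices (repeated indices are summed over $I$), $$M^{ai}M_{ib}=\delta^a_b,$$ $$R^{ab}_{ij}\overline{R}^{ij}_{cd}=\delta^a_c\delta^b_d,$$ $$R^{ab}_{ij}R^{jc}_{kf}R^{ik}_{de}=R^{bc}_{ij}R^{ai}_{dk}R^{kj}_{ef},$$ $$R^{ai}_{bc}M_{id}=M_{bi}\overline{R}^{ia}_{cd},\qquad \overline{R}^{ai}_{bc}M_{id}=M_{bi}R^{ia}_{cd}.$$ Let $Z$ be the corresponding quantum link invariant of unoriented classical link diagrams (an invariant of regular isotopy). Extend $Z$ to virtual link diagrams by assigning to each virtual crossing the tensor $V^{ab}_{cd}=\delta^a_d\delta^b_c$. Then $Z(K)$ is an invariant of virtual rotational isotopy of virtual link diagrams $K$, that is, it is invariant under all the extended Reidemeister moves for virtual diagrams except the classical and the virtual Reidemeister move I.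
   Context: A virtual link diagram is a generic immersion of circles in the plane whose double points are marked as classical crossings (with over/under information) or virtual crossings (neither over nor under). The extended Reidemeister moves are: the classical Reidemeister moves I, II, III; the virtual Reidemeister moves I, II, III (the same moves with all crossings virtual); and the mixed move in which an arc with two consecutive virtual crossings passes across a classical crossing; planar isotopy is always allowed. Virtual rotational isotopy here is the equivalence generated by all of these except the classical move I and the virtual move I. Regular isotopy of classical diagrams is generated by planar isotopy and the classical moves II and III. Evaluation $Z(K)$: put $K$ in general position with respect to a vertical direction, so that it is composed of maxima, minima, classical crossings and virtual crossings joined by arcs without vertical critical points. Label the arcs between these pieces by indices in $I$. To a maximum with left leg $a$ and right leg $b$ assign $M_{ab}$; to a minimum with left end $a$ and right end $b$ assign $M^{ab}$; to a classical crossing with upper ends $a,b$ (left, right) and lower ends $c,d$ (left, right) assign $R^{ab}_{cd}$ if the over-strand runs from lower right to upper left, and $\overline{R}^{ab}_{cd}$ if the over-strand runs from lower left to upper right; to a virtual crossing with ends labeled in the same way assign $V^{ab}_{cd}$. $Z(K)\in k$ is the sum over all assignments of indices of the product of the corresponding entries. $\delta$ is the Kronecker delta. *)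

theory Defs
  imports "HOL-Analysis.Analysis"
begin

section \<open>Virtual link diagrams\<close>

text \<open>
  The plane is \<^typ>\<open>complex\<close>, with the imaginary part as height. Circles are \<open>\<real>/\<int>\<close>: component \<open>j\<close>
  of a diagram is the 1-periodic map \<open>curve K j\<close>, and a point of the source is written \<open>(j, t)\<close>
  with \<open>0 \<le> t < 1\<close>. Two source points form a crossing if they have the same image; \<open>mark\<close> tells for
  each of them whether the branch through it is the upper or the lower one, or whether the crossing
  is virtual. Values of \<open>mark\<close> at other source points carry no information.

  Regularity is \<open>C\<^sup>1\<close> throughout, which covers smooth diagrams and smooth isotopies.
\<close>

datatype passage = Over | Under | Virt

record virtual_link_data =
  comps :: nat
  curve :: "nat \<Rightarrow> real \<Rightarrow> complex"
  mark :: "nat \<times> real \<Rightarrow> passage"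

definition source :: "virtual_link_data \<Rightarrow> (nat \<times> real) set" where
  "source K = {..<comps K} \<times> {0..<1}"

definition pos :: "virtual_link_data \<Rightarrow> nat \<times> real \<Rightarrow> complex" where
  "pos K P = curve K (fst P) (snd P)"

definition tangent :: "virtual_link_data \<Rightarrow> nat \<times> real \<Rightarrow> complex" where
  "tangent K P = vector_derivative (curve K (fst P)) (at (snd P))"

definition double :: "virtual_link_data \<Rightarrow> nat \<times> real \<Rightarrow> nat \<times> real \<Rightarrow> bool" where
  "double K P Q \<longleftrightarrow> P \<in> source K \<and> Q \<in> source K \<and> P \<noteq> Q \<and> pos K P = pos K Q"

definition double_points :: "virtual_link_data \<Rightarrow> (nat \<times> real) set" where
  "double_points K = {P. \<exists>Q. double K P Q}"

text \<open>The determinant of two plane vectors; positive iff \<open>w\<close> points to the left of \<open>z\<close>.\<close>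

definition wedge :: "complex \<Rightarrow> complex \<Rightarrow> real" where
  "wedge z w = Re z * Im w - Im z * Re w"

definition virtual_link_diagram :: "virtual_link_data \<Rightarrow> bool" where
  "virtual_link_diagram K \<longleftrightarrow>
     (\<forall>j<comps K. curve K j C1_differentiable_on UNIV \<and>
        (\<forall>t. curve K j (t + 1) = curve K j t) \<and>
        (\<forall>t. vector_derivative (curve K j) (at t) \<noteq> 0)) \<and>
     finite (double_points K) \<and>
     (\<forall>P Q Q'. double K P Q \<and> double K P Q' \<longrightarrow> Q = Q') \<and>
     (\<forall>P Q. double K P Q \<longrightarrow> wedge (tangent K P) (tangent K Q) \<noteq> 0) \<and>
     (\<forall>P Q. double K P Q \<longrightarrow>
        (mark K P, mark K Q) \<in> {(Over, Under), (Under, Over), (Virt, Virt)})"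


section \<open>Virtual rotational isotopy\<close>

subsection \<open>Planar isotopy\<close>

text \<open>Two parametrizations of one unoriented diagram: the components may be renumbered, and each
  circle reparametrized by a diffeomorphism of \<open>\<real>/\<int>\<close>, of either orientation (\<open>\<psi> j\<close> is its lift).\<close>

definition reparametrization :: "virtual_link_data \<Rightarrow> virtual_link_data \<Rightarrow> bool" where
  "reparametrization K K' \<longleftrightarrow> comps K' = comps K \<and>
     (\<exists>\<pi> \<psi>. bij_betw \<pi> {..<comps K} {..<comps K} \<and>
        (\<forall>j<comps K. \<psi> j C1_differentiable_on (UNIV :: real set) \<and>
           (\<forall>t. vector_derivative (\<psi> j) (at t) \<noteq> (0 :: real)) \<and>
           ((\<forall>t. \<psi> j (t + 1) = \<psi> j t + 1) \<or> (\<forall>t. \<psi> j (t + 1) = \<psi> j t - 1)) \<and>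
           (\<forall>t. curve K' j t = curve K (\<pi> j) (\<psi> j t))) \<and>
        (\<forall>(j, t)\<in>double_points K'. mark K' (j, t) = mark K (\<pi> j, frac (\<psi> j t))))"

text \<open>A path, starting at the identity, of \<open>C\<^sup>1\<close> diffeomorphisms \<open>H s\<close> of the plane.\<close>

definition ambient_isotopy :: "(real \<Rightarrow> complex \<Rightarrow> complex) \<Rightarrow> bool" where
  "ambient_isotopy H \<longleftrightarrow>
     (\<forall>z. H 0 z = z) \<and>
     continuous_on ({0..1} \<times> UNIV) (\<lambda>(s, z). H s z) \<and>
     (\<forall>s\<in>{0..1}. bij (H s)) \<and>
     (\<exists>D. (\<forall>s\<in>{0..1}. \<forall>z. (H s has_derivative D s z) (at z) \<and> inj (D s z)) \<and>
          (\<forall>w. continuous_on ({0..1} \<times> UNIV) (\<lambda>(s, z). D s z w)))"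

definition planar_isotopy :: "virtual_link_data \<Rightarrow> virtual_link_data \<Rightarrow> bool" where
  "planar_isotopy K K' \<longleftrightarrow> comps K' = comps K \<and>
     (\<exists>H. ambient_isotopy H \<and>
        (\<forall>j<comps K. \<forall>t. curve K' j t = H 1 (curve K j t)) \<and>
        (\<forall>P\<in>double_points K. mark K' P = mark K P))"

subsection \<open>Moves\<close>

text \<open>
  The pictures of the moves are drawn in the rectangle \<open>cbox p q\<close> with sides parallel to the axes.
  The part of the diagram inside consists of \<open>m\<close> strands, each running monotonically in height between
  the bottom and the top side; strand \<open>i\<close> is the part \<open>u i \<le> t \<le> v i\<close> of component \<open>c i\<close>, and may be
  traversed upwards or downwards. By planar isotopy any occurrence of a move in a disc can be brought
  into such a position, and by reparametrization the strands avoid the base points of the circles.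
\<close>

definition strands_in_box ::
  "virtual_link_data \<Rightarrow> nat \<Rightarrow> (nat \<Rightarrow> nat) \<Rightarrow> (nat \<Rightarrow> real) \<Rightarrow> (nat \<Rightarrow> real) \<Rightarrow> complex \<Rightarrow> complex \<Rightarrow> bool"
where
  "strands_in_box K m c u v p q \<longleftrightarrow>
     Re p < Re q \<and> Im p < Im q \<and>
     (\<forall>i<m. c i < comps K \<and> 0 < u i \<and> u i < v i \<and> v i < 1) \<and>
     {P \<in> source K. pos K P \<in> cbox p q} = (\<Union>i<m. {c i} \<times> {u i..v i}) \<and>
     (\<forall>i<m. \<forall>i'<m. i \<noteq> i' \<longrightarrow> ({c i} \<times> {u i..v i}) \<inter> ({c i'} \<times> {u i'..v i'}) = {}) \<and>
     (\<forall>i<m. \<forall>t\<in>{u i..v i}. Im (tangent K (c i, t)) \<noteq> 0 \<and>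
        Re p < Re (pos K (c i, t)) \<and> Re (pos K (c i, t)) < Re q) \<and>
     (\<forall>i<m. {Im (pos K (c i, u i)), Im (pos K (c i, v i))} = {Im p, Im q}) \<and>
     (\<forall>P\<in>double_points K. pos K P \<in> cbox p q \<longrightarrow> Im p < Im (pos K P) \<and> Im (pos K P) < Im q)"

definition local_change ::
  "virtual_link_data \<Rightarrow> virtual_link_data \<Rightarrow>
   nat \<Rightarrow> (nat \<Rightarrow> nat) \<Rightarrow> (nat \<Rightarrow> real) \<Rightarrow> (nat \<Rightarrow> real) \<Rightarrow> complex \<Rightarrow> complex \<Rightarrow> bool"
where
  "local_change K K' m c u v p q \<longleftrightarrow>
     comps K' = comps K \<and>
     strands_in_box K m c u v p q \<and> strands_in_box K' m c u v p q \<and>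
     (\<forall>P\<in>source K. pos K P \<notin> cbox p q \<longrightarrow> pos K' P = pos K P) \<and>
     (\<forall>P\<in>double_points K. pos K P \<notin> cbox p q \<longrightarrow> mark K' P = mark K P)"

text \<open>The parameters at which strands \<open>i\<close> and \<open>i'\<close> meet.\<close>

definition meets ::
  "virtual_link_data \<Rightarrow> (nat \<Rightarrow> nat) \<Rightarrow> (nat \<Rightarrow> real) \<Rightarrow> (nat \<Rightarrow> real) \<Rightarrow> nat \<Rightarrow> nat \<Rightarrow> (real \<times> real) set"
where
  "meets K c u v i i' =
     {(t, t'). t \<in> {u i..v i} \<and> t' \<in> {u i'..v i'} \<and> pos K (c i, t) = pos K (c i', t')}"

text \<open>
  Move II: two strands that are disjoint in \<open>K\<close> and cross exactly twice in \<open>K'\<close>, with strand \<open>0\<close> being of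
  the same type \<open>x\<close> at both crossings.
\<close>

definition move_II :: "passage set \<Rightarrow> virtual_link_data \<Rightarrow> virtual_link_data \<Rightarrow> bool" where
  "move_II X K K' \<longleftrightarrow> (\<exists>c u v p q. local_change K K' 2 c u v p q \<and>
     meets K c u v 0 1 = {} \<and>
     card (meets K' c u v 0 1) = 2 \<and>
     (\<exists>x\<in>X. \<forall>(t, t')\<in>meets K' c u v 0 1. mark K' (c 0, t) = x))"

definition classical_II where "classical_II = move_II {Over, Under}"
definition virtual_II where "virtual_II = move_II {Virt}"

text \<open>
  Moves of type III: three strands, any two of which cross exactly once, in \<open>K\<close> as in \<open>K'\<close>. The crossing
  of strands \<open>i\<close> and \<open>i'\<close> has parameter \<open>\<tau> i i'\<close> on strand \<open>i\<close> in \<open>K\<close>, and \<open>\<tau>' i i'\<close> in \<open>K'\<close>. The move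
  preserves the types of the crossings and reverses, on each strand, the order in which the other two
  are met. The predicate \<open>A\<close> is the restriction on the types; \<open>y i i'\<close> is the type of strand \<open>i\<close> where
  it crosses strand \<open>i'\<close>.
\<close>

definition move_III ::
  "((nat \<Rightarrow> nat \<Rightarrow> passage) \<Rightarrow> bool) \<Rightarrow> virtual_link_data \<Rightarrow> virtual_link_data \<Rightarrow> bool"
where
  "move_III A K K' \<longleftrightarrow> (\<exists>c u v p q. local_change K K' 3 c u v p q \<and>
     (\<exists>\<tau> \<tau>' y.
        (\<forall>i<3. \<forall>i'<3. i \<noteq> i' \<longrightarrow>
           meets K c u v i i' = {(\<tau> i i', \<tau> i' i)} \<and>
           meets K' c u v i i' = {(\<tau>' i i', \<tau>' i' i)} \<and>
           mark K (c i, \<tau> i i') = y i i' \<and> mark K' (c i, \<tau>' i i') = y i i') \<and>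
        (\<forall>i<3. \<forall>i'<3. \<forall>i''<3. distinct [i, i', i''] \<longrightarrow>
           (\<tau> i i' < \<tau> i i'' \<longleftrightarrow> \<tau>' i i'' < \<tau>' i i')) \<and>
        A y))"

text \<open>Classical: one strand passes over and one under the two others.\<close>

definition classical_III where
  "classical_III = move_III (\<lambda>y. \<exists>i<3. \<exists>i'<3. \<exists>i''<3. distinct [i, i', i''] \<and>
     y i i' = Over \<and> y i i'' = Over \<and> y i' i'' = Over)"

definition virtual_III where
  "virtual_III = move_III (\<lambda>y. \<forall>i<3. \<forall>i'<3. i \<noteq> i' \<longrightarrow> y i i' = Virt)"

text \<open>Mixed: strand \<open>i\<close> crosses the two others virtually, and these cross classically.\<close>

definition mixed_move where
  "mixed_move = move_III (\<lambda>y. \<exists>i<3. \<exists>i'<3. \<exists>i''<3. distinct [i, i', i''] \<and>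
     y i i' = Virt \<and> y i i'' = Virt \<and> y i' i'' \<noteq> Virt)"

definition rotational_step :: "virtual_link_data \<Rightarrow> virtual_link_data \<Rightarrow> bool" where
  "rotational_step K K' \<longleftrightarrow> virtual_link_diagram K \<and> virtual_link_diagram K' \<and>
     (reparametrization K K' \<or> planar_isotopy K K' \<or>
      classical_II K K' \<or> classical_III K K' \<or>
      virtual_II K K' \<or> virtual_III K K' \<or> mixed_move K K')"

definition virtual_rotational_isotopic :: "virtual_link_data \<Rightarrow> virtual_link_data \<Rightarrow> bool" where
  "virtual_rotational_isotopic = equivclp rotational_step"


section \<open>The evaluation\<close>

definition critical_points :: "virtual_link_data \<Rightarrow> (nat \<times> real) set" where
  "critical_points K = {P \<in> source K. Im (tangent K P) = 0}"

definition maxima :: "virtual_link_data \<Rightarrow> (nat \<times> real) set" where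
  "maxima K = {(j, t) \<in> critical_points K.
     eventually (\<lambda>s. Im (curve K j s) < Im (curve K j t)) (at t)}"

definition minima :: "virtual_link_data \<Rightarrow> (nat \<times> real) set" where
  "minima K = {(j, t) \<in> critical_points K.
     eventually (\<lambda>s. Im (curve K j s) > Im (curve K j t)) (at t)}"

text \<open>Distinct pieces are not required to have distinct heights, as the evaluation does not need it.\<close>

definition general_position :: "virtual_link_data \<Rightarrow> bool" where
  "general_position K \<longleftrightarrow> virtual_link_diagram K \<and>
     finite (critical_points K) \<and>
     critical_points K = maxima K \<union> minima K \<and>
     critical_points K \<inter> double_points K = {}"

text \<open>
  The arcs are labelled by the source points at which they start: the arc that leaves \<open>P\<close> in the
  direction of the parametrization has label \<open>P\<close>, and \<open>arc_in K P\<close> is the label of the arc that arrives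
  at \<open>P\<close>. (Every component of a diagram contains a node, as it has a highest point.)
\<close>

definition nodes :: "virtual_link_data \<Rightarrow> (nat \<times> real) set" where
  "nodes K = critical_points K \<union> double_points K"

definition arc_in :: "virtual_link_data \<Rightarrow> nat \<times> real \<Rightarrow> nat \<times> real" where
  "arc_in K P = (let S = {s. (fst P, s) \<in> nodes K}; S' = {s \<in> S. s < snd P}
                 in (fst P, if S' \<noteq> {} then Max S' else Max S))"

definition arc_out :: "virtual_link_data \<Rightarrow> nat \<times> real \<Rightarrow> nat \<times> real" where
  "arc_out K P = P"

definition arc_left :: "virtual_link_data \<Rightarrow> nat \<times> real \<Rightarrow> nat \<times> real" where
  "arc_left K P = (if Re (tangent K P) > 0 then arc_in K P else arc_out K P)"

definition arc_right :: "virtual_link_data \<Rightarrow> nat \<times> real \<Rightarrow> nat \<times> real" where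
  "arc_right K P = (if Re (tangent K P) > 0 then arc_out K P else arc_in K P)"

definition arc_up :: "virtual_link_data \<Rightarrow> nat \<times> real \<Rightarrow> nat \<times> real" where
  "arc_up K P = (if Im (tangent K P) > 0 then arc_out K P else arc_in K P)"

definition arc_down :: "virtual_link_data \<Rightarrow> nat \<times> real \<Rightarrow> nat \<times> real" where
  "arc_down K P = (if Im (tangent K P) > 0 then arc_in K P else arc_out K P)"

definition up_tangent :: "virtual_link_data \<Rightarrow> nat \<times> real \<Rightarrow> complex" where
  "up_tangent K P = (if Im (tangent K P) > 0 then tangent K P else - tangent K P)"

text \<open>A crossing is represented by the pair \<open>(P, Q)\<close> of its source points, ordered such that \<open>P\<close> lies on
  the branch from lower right to upper left, and \<open>Q\<close> on the branch from lower left to upper right.\<close>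

definition crossings :: "virtual_link_data \<Rightarrow> ((nat \<times> real) \<times> (nat \<times> real)) set" where
  "crossings K = {(P, Q). double K P Q \<and> wedge (up_tangent K Q) (up_tangent K P) > 0}"

definition crossing_tensor ::
  "('i \<Rightarrow> 'i \<Rightarrow> 'i \<Rightarrow> 'i \<Rightarrow> 'k) \<Rightarrow> ('i \<Rightarrow> 'i \<Rightarrow> 'i \<Rightarrow> 'i \<Rightarrow> 'k) \<Rightarrow> ('i \<Rightarrow> 'i \<Rightarrow> 'i \<Rightarrow> 'i \<Rightarrow> 'k) \<Rightarrow>
   passage \<Rightarrow> 'i \<Rightarrow> 'i \<Rightarrow> 'i \<Rightarrow> 'i \<Rightarrow> 'k"
where
  "crossing_tensor R Rbar V x = (case x of Over \<Rightarrow> R | Under \<Rightarrow> Rbar | Virt \<Rightarrow> V)"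

text \<open>Index conventions: \<open>Mmax a b\<close> is $M_{ab}$, \<open>Mmin a b\<close> is $M^{ab}$, and \<open>R a b c d\<close> is $R^{ab}_{cd}$
  (likewise for \<open>Rbar\<close> and \<open>V\<close>).\<close>

definition evaluation ::
  "'i set \<Rightarrow> ('i \<Rightarrow> 'i \<Rightarrow> 'k) \<Rightarrow> ('i \<Rightarrow> 'i \<Rightarrow> 'k) \<Rightarrow>
   ('i \<Rightarrow> 'i \<Rightarrow> 'i \<Rightarrow> 'i \<Rightarrow> 'k) \<Rightarrow> ('i \<Rightarrow> 'i \<Rightarrow> 'i \<Rightarrow> 'i \<Rightarrow> 'k) \<Rightarrow> ('i \<Rightarrow> 'i \<Rightarrow> 'i \<Rightarrow> 'i \<Rightarrow> 'k) \<Rightarrow>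
   virtual_link_data \<Rightarrow> 'k::comm_ring_1"
where
  "evaluation I Mmax Mmin R Rbar V K =
     (\<Sum>\<sigma> \<in> nodes K \<rightarrow>\<^sub>E I.
        (\<Prod>P\<in>maxima K. Mmax (\<sigma> (arc_left K P)) (\<sigma> (arc_right K P))) *
        (\<Prod>P\<in>minima K. Mmin (\<sigma> (arc_left K P)) (\<sigma> (arc_right K P))) *
        (\<Prod>(P, Q)\<in>crossings K. crossing_tensor R Rbar V (mark K P)
           (\<sigma> (arc_up K P)) (\<sigma> (arc_up K Q)) (\<sigma> (arc_down K Q)) (\<sigma> (arc_down K P))))"

definition kronecker :: "'i \<Rightarrow> 'i \<Rightarrow> 'k::comm_ring_1" where
  "kronecker a b = (if a = b then 1 else 0)"

end

theory Submission
  imports Defs "Jordan_Normal_Form.Determinant"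
begin

text \<open>The evaluation is defined only in general position, but the diagrams in a chain of moves need not
  be in general position. The proof therefore extends it to a quantity \<open>invariant K\<close> that is defined
  for every virtual link diagram, and shows that each step of a rotational isotopy preserves it.

  For the extension, the tensors of maxima and minima are spread over the arcs. Let \<open>\<theta>\<close> be a continuous
  angle of the tangent. Each time \<open>\<theta>\<close> passes a multiple of \<open>\<pi>\<close>, the curve passes a maximum or a minimum,
  and contributes the matrix of that extremum, with the row index at the start of the passage. As \<open>Mmax\<close> and \<open>Mmin\<close> are inverse to each other, opposite turns cancel, so that the
  holonomy of an arc depends only on the half turns \<open>\<lfloor>\<theta>/\<pi>\<rfloor>\<close> at its two ends. These matrices on the
  arcs, together with the tensors at the crossings, form a state sum that makes sense without any
  assumption on critical points (\<open>diagram_sum\<close>). In general position it is the evaluation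
  (\<open>invariant_general_position\<close>).

  Planar isotopy: the relations between \<open>R\<close>, \<open>Rbar\<close> and \<open>Mmax\<close> say that a crossing may be rotated if
  its legs are conjugated with the holonomy of the rotation; the virtual crossing satisfies the same
  relation. After the change of basis that undoes all rotations, the tensor of a crossing depends only on
  its type and on the sector of the angle between its two passages (\<open>normal_tensor_const\<close>), and the
  matrix of an arc only on a number of full turns. So the state sum is a function of discrete data
  (\<open>diagram_sum_eqI\<close>), which an isotopy cannot change. Reparametrization merely relabels the state
  sum.

  Moves: inside the box the strands are never horizontal, hence have trivial holonomy, and the state
  sum is a sum over labels at the boundary of the box of an outer factor times the tensor of the box
  (\<open>diagram_sum_box\<close>). The outer factor is common to both diagrams, so it suffices to compare the
  tensors of the two boxes (\<open>invariant_box_change\<close>). As graphs over the height, the strands cross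
  where the difference of their horizontal positions changes sign; this determines which strand goes
  to the upper left at each crossing, and the order of the crossings. For moves of type II the
  comparison is then the statement that \<open>R\<close> and \<open>Rbar\<close> are inverse to each other and that \<open>V\<close> is its
  own inverse. For moves of type III it is a braid relation: with at most one classical crossing it
  holds because \<open>V\<close> permutes the strands, and the relations for the six classical stackings follow
  from the given one by multiplication with inverses (\<open>braid_relations\<close>). One-sided inverses of
  square matrices over a commutative ring are two-sided, which gives the inverse relations that
  are not among the assumptions.\<close>

section \<open>Sums over labellings\<close>

lemma sum_PiE_Un:
  assumes "A \<inter> B = {}" "finite A" "finite B"
  shows "(\<Sum>\<gamma>\<in>(A \<union> B) \<rightarrow>\<^sub>E J. F \<gamma>) =
    (\<Sum>\<gamma>1\<in>A \<rightarrow>\<^sub>E J. \<Sum>\<gamma>2\<in>B \<rightarrow>\<^sub>E J. F (\<lambda>x. if x \<in> A then \<gamma>1 x else \<gamma>2 x))"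
  unfolding sum.cartesian_product
proof (rule sum.reindex_bij_witness[of _
      "\<lambda>(\<gamma>1, \<gamma>2). (\<lambda>x. if x \<in> A then \<gamma>1 x else \<gamma>2 x)" "\<lambda>\<gamma>. (restrict \<gamma> A, restrict \<gamma> B)"])
  fix \<gamma> assume \<gamma>: "\<gamma> \<in> A \<union> B \<rightarrow>\<^sub>E J"
  have e: "(\<lambda>x. if x \<in> A then restrict \<gamma> A x else restrict \<gamma> B x) = \<gamma>"
    using \<gamma> by (auto simp: fun_eq_iff PiE_def extensional_def)
  then show "(case (restrict \<gamma> A, restrict \<gamma> B) of
      (\<gamma>1, \<gamma>2) \<Rightarrow> \<lambda>x. if x \<in> A then \<gamma>1 x else \<gamma>2 x) = \<gamma>"
    by (simp only: prod.case)
  show "(restrict \<gamma> A, restrict \<gamma> B) \<in> (A \<rightarrow>\<^sub>E J) \<times> (B \<rightarrow>\<^sub>E J)"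
    using \<gamma> by auto
  show "(case (restrict \<gamma> A, restrict \<gamma> B) of
          (\<gamma>1, \<gamma>2) \<Rightarrow> F (\<lambda>x. if x \<in> A then \<gamma>1 x else \<gamma>2 x)) = F \<gamma>"
    by (simp only: prod.case e)
next
  fix p assume "p \<in> (A \<rightarrow>\<^sub>E J) \<times> (B \<rightarrow>\<^sub>E J)"
  then show "(restrict (case p of (\<gamma>1, \<gamma>2) \<Rightarrow> \<lambda>x. if x \<in> A then \<gamma>1 x else \<gamma>2 x) A,
           restrict (case p of (\<gamma>1, \<gamma>2) \<Rightarrow> \<lambda>x. if x \<in> A then \<gamma>1 x else \<gamma>2 x) B) = p"
    and "(case p of (\<gamma>1, \<gamma>2) \<Rightarrow> \<lambda>x. if x \<in> A then \<gamma>1 x else \<gamma>2 x) \<in> A \<union> B \<rightarrow>\<^sub>E J"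
    using assms(1) by (auto simp: fun_eq_iff PiE_def extensional_def restrict_def Pi_def)
qed

lemma sum_PiE_singleton:
  "(\<Sum>\<gamma>\<in>{a} \<rightarrow>\<^sub>E J. F \<gamma>) = (\<Sum>x\<in>J. F (\<lambda>y. if y = a then x else undefined))"
proof (rule sum.reindex_bij_witness[of _ "\<lambda>x y. if y = a then x else undefined" "\<lambda>\<gamma>. \<gamma> a"])
  fix \<gamma> assume "\<gamma> \<in> {a} \<rightarrow>\<^sub>E J"
  then show e: "(\<lambda>y. if y = a then \<gamma> a else undefined) = \<gamma>" and "\<gamma> a \<in> J"
    by (auto simp: PiE_def extensional_def fun_eq_iff)
  show "F (\<lambda>y. if y = a then \<gamma> a else undefined) = F \<gamma>" by (simp only: e)
qed (auto simp: PiE_def extensional_def)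

lemma sum_PiE_pair:
  assumes "a \<noteq> b"
  shows "(\<Sum>\<gamma>\<in>{a, b} \<rightarrow>\<^sub>E J. F \<gamma>) =
    (\<Sum>x\<in>J. \<Sum>y\<in>J. F (\<lambda>z. if z = a then x else if z = b then y else undefined))"
proof -
  have "(\<Sum>\<gamma>\<in>{a, b} \<rightarrow>\<^sub>E J. F \<gamma>) = (\<Sum>\<gamma>\<in>({a} \<union> {b}) \<rightarrow>\<^sub>E J. F \<gamma>)"
    by (simp add: insert_commute)
  also have "\<dots> = (\<Sum>x\<in>J. \<Sum>y\<in>J. F (\<lambda>z. if z = a then x else if z = b then y else undefined))"
    using assms by (subst sum_PiE_Un) (simp_all add: sum_PiE_singleton cong: if_cong)
  finally show ?thesis .
qed

text \<open>A sum over labellings of a union of disjoint blocks, of a product with one factor for each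
  block, is a product of sums: this evaluates the tensors that sit at the pieces of a diagram
  one by one.\<close>

lemma sum_PiE_blocks:
  fixes f :: "'c \<Rightarrow> ('a \<Rightarrow> 'j) \<Rightarrow> 'k::comm_ring_1"
  assumes "finite C" "\<And>c. c \<in> C \<Longrightarrow> finite (b c)"
    and "\<And>c d. c \<in> C \<Longrightarrow> d \<in> C \<Longrightarrow> c \<noteq> d \<Longrightarrow> b c \<inter> b d = {}"
    and "\<And>c \<gamma> \<gamma>'. c \<in> C \<Longrightarrow> (\<And>x. x \<in> b c \<Longrightarrow> \<gamma> x = \<gamma>' x) \<Longrightarrow> f c \<gamma> = f c \<gamma>'"
  shows "(\<Sum>\<gamma>\<in>(\<Union>c\<in>C. b c) \<rightarrow>\<^sub>E J. \<Prod>c\<in>C. f c \<gamma>) = (\<Prod>c\<in>C. \<Sum>\<gamma>\<in>b c \<rightarrow>\<^sub>E J. f c \<gamma>)"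
  using assms
proof (induction C rule: finite_induct)
  case empty
  show ?case by simp
next
  case (insert c C)
  have IH: "(\<Sum>\<gamma>\<in>(\<Union>c\<in>C. b c) \<rightarrow>\<^sub>E J. \<Prod>c\<in>C. f c \<gamma>) = (\<Prod>c\<in>C. \<Sum>\<gamma>\<in>b c \<rightarrow>\<^sub>E J. f c \<gamma>)"
    by (rule insert.IH) (use insert.prems(1,2) in auto, rule insert.prems(3), auto)
  have disj: "b c \<inter> (\<Union>c\<in>C. b c) = {}"
    using insert.prems(2)[of c] insert.hyps by auto
  let ?m = "\<lambda>\<gamma>1 \<gamma>2 x. if x \<in> b c then \<gamma>1 x else \<gamma>2 x"
  have "(\<Sum>\<gamma>\<in>(\<Union>d\<in>insert c C. b d) \<rightarrow>\<^sub>E J. \<Prod>d\<in>insert c C. f d \<gamma>)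
     = (\<Sum>\<gamma>\<in>(b c \<union> (\<Union>d\<in>C. b d)) \<rightarrow>\<^sub>E J. f c \<gamma> * (\<Prod>d\<in>C. f d \<gamma>))"
    using insert.hyps by simp
  also have "\<dots> = (\<Sum>\<gamma>1\<in>b c \<rightarrow>\<^sub>E J. \<Sum>\<gamma>2\<in>(\<Union>d\<in>C. b d) \<rightarrow>\<^sub>E J. f c (?m \<gamma>1 \<gamma>2) * (\<Prod>d\<in>C. f d (?m \<gamma>1 \<gamma>2)))"
    using disj insert.prems(1) insert.hyps by (intro sum_PiE_Un) auto
  also have "\<dots> = (\<Sum>\<gamma>1\<in>b c \<rightarrow>\<^sub>E J. \<Sum>\<gamma>2\<in>(\<Union>d\<in>C. b d) \<rightarrow>\<^sub>E J. f c \<gamma>1 * (\<Prod>d\<in>C. f d \<gamma>2))"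
  proof (intro sum.cong refl arg_cong2[where f="(*)"] prod.cong)
    fix \<gamma>1 \<gamma>2
    show "f c (?m \<gamma>1 \<gamma>2) = f c \<gamma>1" by (rule insert.prems(3)) auto
    fix d assume d: "d \<in> C"
    show "f d (?m \<gamma>1 \<gamma>2) = f d \<gamma>2"
      by (rule insert.prems(3)) (use d disj in auto)
  qed
  also have "\<dots> = (\<Sum>\<gamma>1\<in>b c \<rightarrow>\<^sub>E J. f c \<gamma>1) * (\<Prod>d\<in>C. \<Sum>\<gamma>\<in>b d \<rightarrow>\<^sub>E J. f d \<gamma>)"
    by (simp add: sum_distrib_left[symmetric] sum_distrib_right[symmetric] IH)
  finally show ?case using insert.hyps by simp
qed

section \<open>Square matrices over a commutative ring\<close>

text \<open>Determinants show that the left factor has an invertible determinant, so that a multiple of its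
  adjugate is a left inverse of it; this left inverse must coincide with the right factor.\<close>

lemma left_inverse_imp_right_inverse:
  fixes X Y :: "'a \<Rightarrow> 'a \<Rightarrow> 'k::comm_ring_1"
  assumes fin: "finite J"
    and inv: "\<And>a b. a \<in> J \<Longrightarrow> b \<in> J \<Longrightarrow> (\<Sum>i\<in>J. X a i * Y i b) = (if a = b then 1 else 0)"
    and ab: "a \<in> J" "b \<in> J"
  shows "(\<Sum>i\<in>J. Y a i * X i b) = (if a = b then 1 else 0)"
proof -
  define n where "n = card J"
  obtain h where h: "bij_betw h {..<n} J"
    using ex_bij_betw_nat_finite[OF fin] by (auto simp: n_def atLeast0LessThan)
  have hJ: "h i \<in> J" if "i < n" for i using h that by (auto simp: bij_betw_def)
  have hinj: "h i = h j \<longleftrightarrow> i = j" if "i < n" "j < n" for i j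
    using h that by (auto simp: bij_betw_def inj_on_def)
  have sumJ: "(\<Sum>i\<in>J. F i) = (\<Sum>i<n. F (h i))" for F :: "'a \<Rightarrow> 'k"
    using sum.reindex_bij_betw[OF h, of F] by simp
  define MX where "MX = Matrix.mat n n (\<lambda>(i, j). X (h i) (h j))"
  define MY where "MY = Matrix.mat n n (\<lambda>(i, j). Y (h i) (h j))"
  have c: "MX \<in> carrier_mat n n" "MY \<in> carrier_mat n n" by (auto simp: MX_def MY_def)
  have XY: "MX * MY = 1\<^sub>m n"
    using inv by (intro Matrix.eq_matI)
      (auto simp: MX_def MY_def Matrix.scalar_prod_def atLeast0LessThan hJ hinj sumJ)
  define d where "d = Determinant.det MY"
  define Z where "Z = Determinant.det MX \<cdot>\<^sub>m adj_mat MX"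
  have adj: "adj_mat MX \<in> carrier_mat n n" "adj_mat MX * MX = Determinant.det MX \<cdot>\<^sub>m 1\<^sub>m n"
    using adj_mat[OF c(1)] by auto
  have dd: "Determinant.det MX * d = 1"
    using Determinant.det_mult[OF c] XY by (simp add: d_def)
  have ZX: "(d \<cdot>\<^sub>m adj_mat MX) * MX = 1\<^sub>m n"
  proof -
    have "(d \<cdot>\<^sub>m adj_mat MX) * MX = d \<cdot>\<^sub>m (adj_mat MX * MX)"
      using adj c by (intro Matrix.mult_smult_assoc_mat) auto
    also have "\<dots> = 1\<^sub>m n"
      unfolding adj using dd by (intro Matrix.eq_matI) (auto simp: ac_simps)
    finally show ?thesis .
  qed
  define Z' where "Z' = d \<cdot>\<^sub>m adj_mat MX"
  have Z': "Z' \<in> carrier_mat n n" "Z' * MX = 1\<^sub>m n" using adj ZX by (auto simp: Z'_def)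
  have "Z' = Z' * (MX * MY)" unfolding XY using Z'(1) by (rule Matrix.right_mult_one_mat[symmetric])
  also have "\<dots> = Z' * MX * MY" by (rule assoc_mult_mat[OF Z'(1) c, symmetric])
  also have "\<dots> = MY" unfolding Z'(2) using c(2) by (rule Matrix.left_mult_one_mat)
  finally have YX: "MY * MX = 1\<^sub>m n" using Z' by simp
  obtain i j where ij: "i < n" "j < n" "a = h i" "b = h j"
    using ab h by (auto simp: bij_betw_def)
  have "(MY * MX) $$ (i, j) = (\<Sum>k<n. Y (h i) (h k) * X (h k) (h j))"
    using ij by (simp add: MX_def MY_def Matrix.scalar_prod_def atLeast0LessThan)
  then show ?thesis using ij YX by (simp add: sumJ hinj)
qed

section \<open>Holonomy of a turning arc\<close>

text \<open>\<open>A\<close> is the tensor of a maximum, \<open>B\<close> that of a minimum, and \<open>X x\<close> that of a crossing whose branch from lower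
  right to upper left is of type \<open>x\<close>.\<close>

locale link_tensors =
  fixes I :: "'i set" and A B :: "'i \<Rightarrow> 'i \<Rightarrow> 'k::comm_ring_1"
    and X :: "passage \<Rightarrow> 'i \<Rightarrow> 'i \<Rightarrow> 'i \<Rightarrow> 'i \<Rightarrow> 'k"
  assumes finI: "finite I"
    and AB: "\<And>a b. a \<in> I \<Longrightarrow> b \<in> I \<Longrightarrow> (\<Sum>i\<in>I. A a i * B i b) = kronecker a b"
    and BA: "\<And>a b. a \<in> I \<Longrightarrow> b \<in> I \<Longrightarrow> (\<Sum>i\<in>I. B a i * A i b) = kronecker a b"
begin

text \<open>Square matrices with index set \<open>I\<close> are functions that vanish off \<open>I\<close>, so that identities between
  them are equations between functions.\<close>

definition one :: "'i \<Rightarrow> 'i \<Rightarrow> 'k" where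
  "one a b = (if a \<in> I \<and> a = b then 1 else 0)"

definition mat_mul :: "('i \<Rightarrow> 'i \<Rightarrow> 'k) \<Rightarrow> ('i \<Rightarrow> 'i \<Rightarrow> 'k) \<Rightarrow> ('i \<Rightarrow> 'i \<Rightarrow> 'k)" where
  "mat_mul Y Z a b = (if a \<in> I \<and> b \<in> I then \<Sum>i\<in>I. Y a i * Z i b else 0)"

definition supp :: "('i \<Rightarrow> 'i \<Rightarrow> 'k) \<Rightarrow> bool" where
  "supp Y \<longleftrightarrow> (\<forall>a b. a \<notin> I \<or> b \<notin> I \<longrightarrow> Y a b = 0)"

definition transposed :: "('i \<Rightarrow> 'i \<Rightarrow> 'k) \<Rightarrow> ('i \<Rightarrow> 'i \<Rightarrow> 'k)" where
  "transposed Y a b = Y b a"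

lemma supp_simps [simp]: "supp one" "supp (mat_mul Y Z)" "supp Y \<Longrightarrow> supp (transposed Y)"
  by (auto simp: supp_def one_def mat_mul_def transposed_def)

lemma mat_mul_one [simp]: "supp Y \<Longrightarrow> mat_mul one Y = Y" "supp Y \<Longrightarrow> mat_mul Y one = Y"
  using finI by (auto simp: fun_eq_iff mat_mul_def one_def supp_def if_distrib[where f="\<lambda>x. x * _"]
      if_distrib[where f="\<lambda>x. _ * x"] cong: if_cong)

lemma mat_mul_assoc: "mat_mul (mat_mul Y Z) W = mat_mul Y (mat_mul Z W)"
proof -
  have "(\<Sum>i\<in>I. (\<Sum>j\<in>I. Y a j * Z j i) * W i b) = (\<Sum>j\<in>I. Y a j * (\<Sum>i\<in>I. Z j i * W i b))" for a b
    by (simp add: sum_distrib_left sum_distrib_right mult.assoc) (rule sum.swap)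
  then show ?thesis by (auto simp: fun_eq_iff mat_mul_def)
qed

lemma transposed_mat_mul: "transposed (mat_mul Y Z) = mat_mul (transposed Z) (transposed Y)"
  by (auto simp: fun_eq_iff mat_mul_def transposed_def mult.commute)

lemma transposed_one [simp]: "transposed one = one"
  by (auto simp: fun_eq_iff one_def transposed_def)

lemma transposed_transposed [simp]: "transposed (transposed Y) = Y"
  by (simp add: fun_eq_iff transposed_def)

text \<open>The direction in sector \<open>k\<close> points upward for even \<open>k\<close> and downward for odd \<open>k\<close>. A counterclockwise turn
  from sector \<open>k\<close> to \<open>k + 1\<close> passes, for even \<open>k\<close>, a maximum from right to left, and for odd \<open>k\<close> a minimum
  from left to right; the row index belongs to the start of the arc. The clockwise turn back passes
  the other kind of extremum in the opposite direction, with the inverse matrix \<open>step_inv k\<close>.\<close>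

definition step :: "int \<Rightarrow> 'i \<Rightarrow> 'i \<Rightarrow> 'k" where
  "step k a b = (if a \<in> I \<and> b \<in> I then if even k then A b a else B a b else 0)"

definition step_inv :: "int \<Rightarrow> 'i \<Rightarrow> 'i \<Rightarrow> 'k" where
  "step_inv k a b = (if a \<in> I \<and> b \<in> I then if even k then B b a else A a b else 0)"

lemma supp_step [simp]: "supp (step k)" "supp (step_inv k)"
  by (auto simp: step_def step_inv_def supp_def)

lemma step_inverse [simp]: "mat_mul (step k) (step_inv k) = one" "mat_mul (step_inv k) (step k) = one"
  using AB BA by (cases "even k"; auto simp: fun_eq_iff mat_mul_def step_def step_inv_def one_def kronecker_def mult.commute
      cong: sum.cong)+

lemma step_periodic: "step (k + 2) = step k" "step_inv (k + 2) = step_inv k"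
  by (auto simp: fun_eq_iff step_def step_inv_def)

lemma transposed_step: "transposed (step_inv (k + 1)) = step k" "transposed (step (k + 1)) = step_inv k"
  by (auto simp: fun_eq_iff step_def step_inv_def transposed_def)

text \<open>\<open>turn k\<close> is the matrix of an arc that starts in sector \<open>0\<close> and ends in sector \<open>k\<close>.\<close>

primrec turn_ccw :: "nat \<Rightarrow> 'i \<Rightarrow> 'i \<Rightarrow> 'k" where
  "turn_ccw 0 = one"
| "turn_ccw (Suc n) = mat_mul (turn_ccw n) (step (int n))"

primrec turn_cw :: "nat \<Rightarrow> 'i \<Rightarrow> 'i \<Rightarrow> 'k" where
  "turn_cw 0 = one"
| "turn_cw (Suc n) = mat_mul (turn_cw n) (step_inv (- int (Suc n)))"

definition turn :: "int \<Rightarrow> 'i \<Rightarrow> 'i \<Rightarrow> 'k" where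
  "turn k = (if k \<ge> 0 then turn_ccw (nat k) else turn_cw (nat (- k)))"

lemma supp_turn [simp]: "supp (turn k)"
proof -
  have "supp (turn_ccw n)" "supp (turn_cw n)" for n by (cases n; simp)+
  then show ?thesis by (simp add: turn_def)
qed

lemma turn_Suc: "turn (k + 1) = mat_mul (turn k) (step k)"
proof (cases "k \<ge> 0")
  case True
  then show ?thesis by (simp add: turn_def nat_add_distrib)
next
  case False
  define n where "n = nat (- k) - 1"
  have k: "k = - int (Suc n)" using False by (simp add: n_def)
  have "turn k = mat_mul (turn (k + 1)) (step_inv k)"
  proof (cases n)
    case 0
    then show ?thesis by (simp add: turn_def k)
  next
    case (Suc m)
    have "k + 1 < 0" "nat (- (k + 1)) = n" "nat (- k) = Suc n" using k Suc by auto
    then show ?thesis using k by (simp add: turn_def)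
  qed
  then show ?thesis by (simp add: mat_mul_assoc)
qed

lemma turn_pred: "turn (k - 1) = mat_mul (turn k) (step_inv (k - 1))"
  using turn_Suc[of "k - 1"] by (simp add: mat_mul_assoc)

definition turn_inv :: "int \<Rightarrow> 'i \<Rightarrow> 'i \<Rightarrow> 'k" where
  "turn_inv k = (SOME Y. supp Y \<and> mat_mul (turn k) Y = one \<and> mat_mul Y (turn k) = one)"

lemma turn_inv: "supp (turn_inv k)" "mat_mul (turn k) (turn_inv k) = one" "mat_mul (turn_inv k) (turn k) = one"
proof -
  have "\<exists>Y. supp Y \<and> mat_mul (turn k) Y = one \<and> mat_mul Y (turn k) = one"
  proof (induction k rule: int_induct[where k=0])
    case base
    then show ?case by (auto simp: turn_def intro!: exI[of _ one])
  next
    case (step1 i)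
    then obtain Y where Y: "supp Y" "mat_mul (turn i) Y = one" "mat_mul Y (turn i) = one" by blast
    have "mat_mul (turn (i + 1)) (mat_mul (step_inv i) Y) = one"
    proof -
      have "mat_mul (turn (i + 1)) (mat_mul (step_inv i) Y) = mat_mul (turn i) (mat_mul (mat_mul (step i) (step_inv i)) Y)"
        by (simp only: turn_Suc mat_mul_assoc)
      then show ?thesis using Y by simp
    qed
    moreover have "mat_mul (mat_mul (step_inv i) Y) (turn (i + 1)) = one"
    proof -
      have "mat_mul (mat_mul (step_inv i) Y) (turn (i + 1)) = mat_mul (step_inv i) (mat_mul (mat_mul Y (turn i)) (step i))"
        by (simp only: turn_Suc mat_mul_assoc)
      then show ?thesis using Y by simp
    qed
    ultimately show ?case by (intro exI[of _ "mat_mul (step_inv i) Y"]) simp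
  next
    case (step2 i)
    then obtain Y where Y: "supp Y" "mat_mul (turn i) Y = one" "mat_mul Y (turn i) = one" by blast
    have "mat_mul (turn (i - 1)) (mat_mul (step (i - 1)) Y) = one"
    proof -
      have "mat_mul (turn (i - 1)) (mat_mul (step (i - 1)) Y) = mat_mul (turn i) (mat_mul (mat_mul (step_inv (i - 1)) (step (i - 1))) Y)"
        by (simp only: turn_pred mat_mul_assoc)
      then show ?thesis using Y by simp
    qed
    moreover have "mat_mul (mat_mul (step (i - 1)) Y) (turn (i - 1)) = one"
    proof -
      have "mat_mul (mat_mul (step (i - 1)) Y) (turn (i - 1)) = mat_mul (step (i - 1)) (mat_mul (mat_mul Y (turn i)) (step_inv (i - 1)))"
        by (simp only: turn_pred mat_mul_assoc)
      then show ?thesis using Y by simp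
    qed
    ultimately show ?case by (intro exI[of _ "mat_mul (step (i - 1)) Y"]) simp
  qed
  from someI_ex[OF this] show "supp (turn_inv k)" "mat_mul (turn k) (turn_inv k) = one" "mat_mul (turn_inv k) (turn k) = one"
    unfolding turn_inv_def by auto
qed

text \<open>The matrix of an arc whose direction starts in sector \<open>k\<close> and ends in sector \<open>l\<close>. The way in which it
  turns in between does not matter, since opposite turns cancel.\<close>

definition hol :: "int \<Rightarrow> int \<Rightarrow> 'i \<Rightarrow> 'i \<Rightarrow> 'k" where
  "hol k l = mat_mul (turn_inv k) (turn l)"

lemma supp_hol [simp]: "supp (hol k l)"
  by (simp add: hol_def)

lemma hol_refl [simp]: "hol k k = one"
  by (simp add: hol_def turn_inv)

lemma hol_trans [simp]: "mat_mul (hol k l) (hol l n) = hol k n"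
proof -
  have "mat_mul (hol k l) (hol l n) = mat_mul (turn_inv k) (mat_mul (mat_mul (turn l) (turn_inv l)) (turn n))"
    by (simp only: hol_def mat_mul_assoc)
  then show ?thesis by (simp add: turn_inv hol_def)
qed

lemma hol_Suc: "hol k (l + 1) = mat_mul (hol k l) (step l)"
  by (simp add: hol_def turn_Suc mat_mul_assoc)

lemma hol_pred: "hol k (l - 1) = mat_mul (hol k l) (step_inv (l - 1))"
  by (simp add: hol_def turn_pred mat_mul_assoc)

lemma hol_step: "hol k (k + 1) = step k"
  by (simp add: hol_Suc)

lemma hol_step_inv: "hol (k + 1) k = step_inv k"
  using hol_pred[of "k + 1" "k + 1"] by simp

lemma hol_periodic: "hol (k + 2 * n) (l + 2 * n) = hol k l"
proof -
  have 1: "hol (k + 2) (l + 2) = hol k l" for k l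
  proof (induction l rule: int_induct[where k=k])
    case (step1 i)
    have "hol (k + 2) (i + 1 + 2) = mat_mul (hol (k + 2) (i + 2)) (step (i + 2))"
      using hol_Suc[of "k + 2" "i + 2"] by (simp add: ac_simps)
    then show ?case using step1 by (simp add: hol_Suc step_periodic)
  next
    case (step2 i)
    have "hol (k + 2) (i - 1 + 2) = mat_mul (hol (k + 2) (i + 2)) (step_inv (i - 1 + 2))"
      using hol_pred[of "k + 2" "i + 2"] by (simp add: algebra_simps)
    moreover have "step_inv (i - 1 + 2) = step_inv (i - 1)" by (rule step_periodic)
    ultimately show ?case using step2 by (simp only: hol_pred)
  qed simp
  show ?thesis
  proof (induction n rule: int_induct[where k=0])
    case (step1 i)
    then show ?case using 1[of "k + 2 * i" "l + 2 * i"] by (simp add: algebra_simps)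
  next
    case (step2 i)
    then show ?case using 1[of "k + 2 * (i - 1)" "l + 2 * (i - 1)"] by (simp add: algebra_simps)
  qed simp
qed

text \<open>Traversing an arc backwards reverses the two directions at its ends, which shifts the sectors
  by one half turn.\<close>

lemma hol_reverse: "hol (l + 1) (k + 1) a b = hol k l b a"
proof -
  have "hol k l = transposed (hol (l + 1) (k + 1))"
  proof (induction l rule: int_induct[where k=k])
    case (step1 i)
    have "hol (i + 1 + 1) (k + 1) = mat_mul (step_inv (i + 1)) (hol (i + 1) (k + 1))"
      using hol_trans[of "i + 1 + 1" "i + 1" "k + 1"] by (simp only: hol_step_inv)
    then show ?case using step1 by (simp add: transposed_mat_mul transposed_step hol_Suc)
  next
    case (step2 i)
    have "hol (i - 1 + 1) (k + 1) = mat_mul (step i) (hol (i + 1) (k + 1))"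
      using hol_trans[of i "i + 1" "k + 1"] by (simp add: hol_step)
    moreover have "transposed (step i) = step_inv (i - 1)" using transposed_step(2)[of "i - 1"] by simp
    ultimately show ?case using step2 by (simp add: transposed_mat_mul hol_pred)
  qed simp
  then show ?thesis by (simp add: transposed_def)
qed

end

section \<open>State sums\<close>

context link_tensors
begin

text \<open>
  Every node \<open>P\<close> carries a pair of labels: \<open>fst (\<gamma> P)\<close> where the circle arrives at \<open>P\<close>, and
  \<open>snd (\<gamma> P)\<close> where it leaves \<open>P\<close>. The arc that arrives at \<open>P\<close> comes from \<open>pv P\<close> and contributes
  the matrix \<open>H P\<close>; the pieces of the diagram at the nodes contribute \<open>T\<close>. Two labels instead of one
  for each arc make changes of basis at the nodes expressible.
\<close>

definition state_sum ::
  "'n set \<Rightarrow> ('n \<Rightarrow> 'n) \<Rightarrow> ('n \<Rightarrow> 'i \<Rightarrow> 'i \<Rightarrow> 'k) \<Rightarrow> (('n \<Rightarrow> 'i \<times> 'i) \<Rightarrow> 'k) \<Rightarrow> 'k" where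
  "state_sum N pv H T =
     (\<Sum>\<gamma>\<in>N \<rightarrow>\<^sub>E I \<times> I. (\<Prod>P\<in>N. H P (snd (\<gamma> (pv P))) (fst (\<gamma> P))) * T \<gamma>)"

lemma state_sum_cong:
  assumes "\<And>P. P \<in> N \<Longrightarrow> pv P \<in> N" "\<And>P. P \<in> N \<Longrightarrow> pv' P = pv P"
    and "\<And>P a b. P \<in> N \<Longrightarrow> a \<in> I \<Longrightarrow> b \<in> I \<Longrightarrow> H P a b = H' P a b"
    and "\<And>\<gamma>. \<gamma> \<in> N \<rightarrow>\<^sub>E I \<times> I \<Longrightarrow> T \<gamma> = T' \<gamma>"
  shows "state_sum N pv H T = state_sum N pv' H' T'"
  unfolding state_sum_def
proof (intro sum.cong refl arg_cong2[where f="(*)"] prod.cong)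
  fix \<gamma> P assume \<gamma>: "\<gamma> \<in> N \<rightarrow>\<^sub>E I \<times> I" and P: "P \<in> N"
  have "\<gamma> P \<in> I \<times> I" "\<gamma> (pv P) \<in> I \<times> I" using \<gamma> P assms(1) by (auto simp: PiE_iff)
  then show "H P (snd (\<gamma> (pv P))) (fst (\<gamma> P)) = H' P (snd (\<gamma> (pv' P))) (fst (\<gamma> P))"
    using assms(2,3) P by (auto simp: mem_Times_iff)
qed (use assms(4) in auto)

text \<open>A change of basis at every node moves factors from the matrices of the arcs to the tensors at the
  nodes.\<close>

lemma state_sum_gauge:
  assumes N: "finite N" and pv: "bij_betw pv N N"
    and H': "\<And>P. P \<in> N \<Longrightarrow> H' P = mat_mul (gi (pv P)) (mat_mul (H P) (g P))"
  shows "state_sum N pv H' T = state_sum N pv H (\<lambda>\<gamma>'. \<Sum>\<gamma>\<in>N \<rightarrow>\<^sub>E I \<times> I.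
    (\<Prod>P\<in>N. g P (fst (\<gamma>' P)) (fst (\<gamma> P)) * gi P (snd (\<gamma> P)) (snd (\<gamma>' P))) * T \<gamma>)"
    (is "_ = state_sum N pv H ?T")
proof -
  define ip where "ip = inv_into N pv"
  have pvN: "pv P \<in> N" if "P \<in> N" for P using pv that by (auto simp: bij_betw_def)
  have ip: "ip P \<in> N" "pv (ip P) = P" "ip (pv P) = P" if "P \<in> N" for P
    using pv that bij_betw_inv_into_right[OF pv] bij_betw_inv_into_left[OF pv] pvN
    by (auto simp: ip_def bij_betw_def inv_into_into)
  let ?K = "\<lambda>\<gamma> \<gamma>'. \<Prod>P\<in>N. g P (fst (\<gamma>' P)) (fst (\<gamma> P)) * gi P (snd (\<gamma> P)) (snd (\<gamma>' P))"
  let ?h = "\<lambda>\<gamma>. \<Prod>P\<in>N. H P (snd (\<gamma> (pv P))) (fst (\<gamma> P))"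
  have main: "(\<Prod>P\<in>N. H' P (snd (\<gamma> (pv P))) (fst (\<gamma> P))) = (\<Sum>\<gamma>'\<in>N \<rightarrow>\<^sub>E I \<times> I. ?h \<gamma>' * ?K \<gamma> \<gamma>')"
    if \<gamma>: "\<gamma> \<in> N \<rightarrow>\<^sub>E I \<times> I" for \<gamma>
  proof -
    have lab: "fst (\<gamma> P) \<in> I" "snd (\<gamma> P) \<in> I" if "P \<in> N" for P
      using \<gamma> that by (auto simp: PiE_iff mem_Times_iff)
    have "(\<Prod>P\<in>N. H' P (snd (\<gamma> (pv P))) (fst (\<gamma> P))) =
        (\<Prod>P\<in>N. \<Sum>x\<in>I \<times> I. gi (pv P) (snd (\<gamma> (pv P))) (fst x) * (H P (fst x) (snd x) * g P (snd x) (fst (\<gamma> P))))"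
    proof (intro prod.cong refl)
      fix P assume P: "P \<in> N"
      show "H' P (snd (\<gamma> (pv P))) (fst (\<gamma> P)) =
        (\<Sum>x\<in>I \<times> I. gi (pv P) (snd (\<gamma> (pv P))) (fst x) * (H P (fst x) (snd x) * g P (snd x) (fst (\<gamma> P))))"
        using P pvN[OF P] lab
        by (simp add: H' mat_mul_def sum_distrib_left sum.cartesian_product[symmetric]
            sum.cartesian_product case_prod_unfold)
    qed
    also have "\<dots> = (\<Sum>\<delta>\<in>N \<rightarrow>\<^sub>E I \<times> I. \<Prod>P\<in>N. gi (pv P) (snd (\<gamma> (pv P))) (fst (\<delta> P)) *
        (H P (fst (\<delta> P)) (snd (\<delta> P)) * g P (snd (\<delta> P)) (fst (\<gamma> P))))"
      using N finI by (intro prod_sum_PiE) auto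
    also have "\<dots> = (\<Sum>\<gamma>'\<in>N \<rightarrow>\<^sub>E I \<times> I. ?h \<gamma>' * ?K \<gamma> \<gamma>')"
    proof (rule sum.reindex_bij_witness[of _
          "\<lambda>\<gamma>'. \<lambda>P\<in>N. (snd (\<gamma>' (pv P)), fst (\<gamma>' P))"
          "\<lambda>\<delta>. \<lambda>P\<in>N. (snd (\<delta> P), fst (\<delta> (ip P)))"])
      fix \<delta> assume \<delta>: "\<delta> \<in> N \<rightarrow>\<^sub>E I \<times> I"
      let ?d = "\<lambda>P\<in>N. (snd (\<delta> P), fst (\<delta> (ip P)))"
      show "(\<lambda>P\<in>N. (snd (?d (pv P)), fst (?d P))) = \<delta>"
        using \<delta> by (auto simp: fun_eq_iff pvN ip PiE_iff extensional_def)
      show "?d \<in> N \<rightarrow>\<^sub>E I \<times> I" using \<delta> ip by (auto simp: PiE_iff mem_Times_iff)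
      have "(\<Prod>P\<in>N. gi P (snd (\<gamma> P)) (snd (?d P))) = (\<Prod>P\<in>N. gi (pv P) (snd (\<gamma> (pv P))) (snd (?d (pv P))))"
        using prod.reindex_bij_betw[OF pv, of "\<lambda>P. gi P (snd (\<gamma> P)) (snd (?d P))"] by simp
      then show "?h ?d * ?K \<gamma> ?d = (\<Prod>P\<in>N. gi (pv P) (snd (\<gamma> (pv P))) (fst (\<delta> P)) *
        (H P (fst (\<delta> P)) (snd (\<delta> P)) * g P (snd (\<delta> P)) (fst (\<gamma> P))))"
        by (simp add: prod.distrib pvN ip ac_simps)
    next
      fix \<gamma>' assume g': "\<gamma>' \<in> N \<rightarrow>\<^sub>E I \<times> I"
      show "(\<lambda>P\<in>N. (snd ((\<lambda>P\<in>N. (snd (\<gamma>' (pv P)), fst (\<gamma>' P))) P),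
          fst ((\<lambda>P\<in>N. (snd (\<gamma>' (pv P)), fst (\<gamma>' P))) (ip P)))) = \<gamma>'"
        using g' by (auto simp: fun_eq_iff pvN ip PiE_iff extensional_def)
      show "(\<lambda>P\<in>N. (snd (\<gamma>' (pv P)), fst (\<gamma>' P))) \<in> N \<rightarrow>\<^sub>E I \<times> I"
        using g' pvN by (auto simp: PiE_iff mem_Times_iff)
    qed
    finally show ?thesis .
  qed
  have "state_sum N pv H' T = (\<Sum>\<gamma>\<in>N \<rightarrow>\<^sub>E I \<times> I. \<Sum>\<gamma>'\<in>N \<rightarrow>\<^sub>E I \<times> I. ?h \<gamma>' * (?K \<gamma> \<gamma>' * T \<gamma>))"
    unfolding state_sum_def by (intro sum.cong refl) (simp add: main sum_distrib_right mult.assoc)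
  also have "\<dots> = state_sum N pv H ?T"
    unfolding state_sum_def by (subst sum.swap) (simp add: sum_distrib_left)
  finally show ?thesis .
qed

text \<open>For a product tensor, a change of basis acts on each piece separately: it cancels at a node with the
  identity matrix, and conjugates the legs of the two passages at a crossing.\<close>

lemma conj_blocks:
  fixes t :: "'n \<times> 'n \<Rightarrow> 'i \<times> 'i \<Rightarrow> 'i \<times> 'i \<Rightarrow> 'k"
  assumes D: "finite D" and C: "finite C"
    and N: "N = D \<union> (\<Union>(P, Q)\<in>C. {P, Q})"
    and dist: "\<And>P Q. (P, Q) \<in> C \<Longrightarrow> P \<noteq> Q \<and> P \<notin> D \<and> Q \<notin> D"
    and disj: "\<And>P Q P' Q'. (P, Q) \<in> C \<Longrightarrow> (P', Q') \<in> C \<Longrightarrow> (P, Q) \<noteq> (P', Q') \<Longrightarrow> {P, Q} \<inter> {P', Q'} = {}"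
    and g: "\<And>P. P \<in> D \<Longrightarrow> mat_mul (g P) (gi P) = one"
    and \<gamma>': "\<gamma>' \<in> N \<rightarrow>\<^sub>E I \<times> I"
  shows "(\<Sum>\<gamma>\<in>N \<rightarrow>\<^sub>E I \<times> I.
      (\<Prod>P\<in>N. g P (fst (\<gamma>' P)) (fst (\<gamma> P)) * gi P (snd (\<gamma> P)) (snd (\<gamma>' P))) *
      ((\<Prod>P\<in>D. one (fst (\<gamma> P)) (snd (\<gamma> P))) * (\<Prod>(P, Q)\<in>C. t (P, Q) (\<gamma> P) (\<gamma> Q)))) =
    (\<Prod>P\<in>D. one (fst (\<gamma>' P)) (snd (\<gamma>' P))) *
    (\<Prod>(P, Q)\<in>C. \<Sum>x\<in>I \<times> I. \<Sum>y\<in>I \<times> I.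
      (g P (fst (\<gamma>' P)) (fst x) * gi P (snd x) (snd (\<gamma>' P))) *
      (g Q (fst (\<gamma>' Q)) (fst y) * gi Q (snd y) (snd (\<gamma>' Q))) * t (P, Q) x y)"
proof -
  define di where "di = (\<lambda>P::'n. (P, P))"
  define b where "b = (\<lambda>(P::'n, Q). {P, Q})"
  define S where "S = di ` D \<union> C"
  define w where "w \<gamma> P = g P (fst (\<gamma>' P)) (fst (\<gamma> P)) * gi P (snd (\<gamma> P)) (snd (\<gamma>' P))" for \<gamma> P
  define f where "f = (\<lambda>(P, Q) \<gamma>. (if P = Q then w \<gamma> P * one (fst (\<gamma> P)) (snd (\<gamma> P))
     else w \<gamma> P * w \<gamma> Q * t (P, Q) (\<gamma> P) (\<gamma> Q)))"
  have dC: "di ` D \<inter> C = {}" using dist by (auto simp: di_def)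
  have finS: "finite S" using D C by (simp add: S_def)
  have NS: "N = (\<Union>c\<in>S. b c)" by (auto simp: N S_def b_def di_def)
  have bdisj: "b c \<inter> b d = {}" if "c \<in> S" "d \<in> S" "c \<noteq> d" for c d
  proof -
    obtain P Q P' Q' where cd: "c = (P, Q)" "d = (P', Q')" by (meson surj_pair)
    show ?thesis using that dist disj[of P Q P' Q'] dist[of P Q] dist[of P' Q']
      by (auto simp: cd S_def di_def b_def)
  qed
  have inj: "inj_on di D" by (auto simp: inj_on_def di_def)
  have prodN: "(\<Prod>P\<in>N. w \<gamma> P) = (\<Prod>P\<in>D. w \<gamma> P) * (\<Prod>(P, Q)\<in>C. w \<gamma> P * w \<gamma> Q)" for \<gamma>
  proof -
    have "(\<Prod>P\<in>N. w \<gamma> P) = (\<Prod>c\<in>S. \<Prod>P\<in>b c. w \<gamma> P)"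
      unfolding NS using finS bdisj by (intro prod.UNION_disjoint) (auto simp: b_def)
    also have "\<dots> = (\<Prod>c\<in>di ` D. \<Prod>P\<in>b c. w \<gamma> P) * (\<Prod>c\<in>C. \<Prod>P\<in>b c. w \<gamma> P)"
      unfolding S_def using D C dC by (intro prod.union_disjoint) auto
    also have "(\<Prod>c\<in>di ` D. \<Prod>P\<in>b c. w \<gamma> P) = (\<Prod>P\<in>D. w \<gamma> P)"
      using inj by (simp add: prod.reindex) (simp add: di_def b_def)
    also have "(\<Prod>c\<in>C. \<Prod>P\<in>b c. w \<gamma> P) = (\<Prod>(P, Q)\<in>C. w \<gamma> P * w \<gamma> Q)"
      using dist by (intro prod.cong refl) (auto simp: b_def)
    finally show ?thesis .
  qed
  have prodS: "(\<Prod>c\<in>S. F c) = (\<Prod>P\<in>D. F (P, P)) * (\<Prod>(P, Q)\<in>C. F (P, Q))" for F :: "_ \<Rightarrow> 'k"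
    unfolding S_def using D C dC inj
    by (subst prod.union_disjoint) (auto simp: prod.reindex di_def case_prod_unfold)
  have "(\<Sum>\<gamma>\<in>N \<rightarrow>\<^sub>E I \<times> I. (\<Prod>P\<in>N. w \<gamma> P) *
      ((\<Prod>P\<in>D. one (fst (\<gamma> P)) (snd (\<gamma> P))) * (\<Prod>(P, Q)\<in>C. t (P, Q) (\<gamma> P) (\<gamma> Q))))
     = (\<Sum>\<gamma>\<in>N \<rightarrow>\<^sub>E I \<times> I. \<Prod>c\<in>S. f c \<gamma>)"
  proof (intro sum.cong refl)
    fix \<gamma>
    have "(\<Prod>(P, Q)\<in>C. f (P, Q) \<gamma>) = (\<Prod>(P, Q)\<in>C. (w \<gamma> P * w \<gamma> Q) * t (P, Q) (\<gamma> P) (\<gamma> Q))"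
      using dist by (intro prod.cong refl) (auto simp: f_def)
    then show "(\<Prod>P\<in>N. w \<gamma> P) *
      ((\<Prod>P\<in>D. one (fst (\<gamma> P)) (snd (\<gamma> P))) * (\<Prod>(P, Q)\<in>C. t (P, Q) (\<gamma> P) (\<gamma> Q)))
      = (\<Prod>c\<in>S. f c \<gamma>)"
      unfolding prodN prodS by (simp add: f_def prod.distrib case_prod_unfold ac_simps)
  qed
  also have "\<dots> = (\<Prod>c\<in>S. \<Sum>\<gamma>\<in>b c \<rightarrow>\<^sub>E I \<times> I. f c \<gamma>)"
    unfolding NS
  proof (rule sum_PiE_blocks[OF finS])
    fix c and \<gamma> \<gamma>'' :: "'n \<Rightarrow> 'i \<times> 'i"
    assume "\<And>x. x \<in> b c \<Longrightarrow> \<gamma> x = \<gamma>'' x"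
    then show "f c \<gamma> = f c \<gamma>''" by (cases c) (auto simp: f_def b_def w_def)
  qed (use bdisj in \<open>auto simp: b_def\<close>)
  also have "\<dots> = (\<Prod>P\<in>D. one (fst (\<gamma>' P)) (snd (\<gamma>' P))) *
    (\<Prod>(P, Q)\<in>C. \<Sum>x\<in>I \<times> I. \<Sum>y\<in>I \<times> I.
      (g P (fst (\<gamma>' P)) (fst x) * gi P (snd x) (snd (\<gamma>' P))) *
      (g Q (fst (\<gamma>' Q)) (fst y) * gi Q (snd y) (snd (\<gamma>' Q))) * t (P, Q) x y)"
    unfolding prodS
  proof (intro arg_cong2[where f="(*)"] prod.cong refl)
    fix P assume P: "P \<in> D"
    then have l: "fst (\<gamma>' P) \<in> I" "snd (\<gamma>' P) \<in> I" using \<gamma>' N by (auto simp: PiE_iff mem_Times_iff)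
    have "(\<Sum>\<gamma>\<in>b (P, P) \<rightarrow>\<^sub>E I \<times> I. f (P, P) \<gamma>) =
      (\<Sum>x\<in>I \<times> I. g P (fst (\<gamma>' P)) (fst x) * gi P (snd x) (snd (\<gamma>' P)) * one (fst x) (snd x))"
      by (simp add: b_def sum_PiE_singleton f_def w_def)
    also have "\<dots> = mat_mul (g P) (gi P) (fst (\<gamma>' P)) (snd (\<gamma>' P))"
      using l finI
      by (simp add: mat_mul_def one_def sum.cartesian_product[symmetric] case_prod_unfold
         if_distrib[where f="\<lambda>x. _ * x"] sum.cartesian_product' cong: if_cong)
    finally show "(\<Sum>\<gamma>\<in>b (P, P) \<rightarrow>\<^sub>E I \<times> I. f (P, P) \<gamma>) = one (fst (\<gamma>' P)) (snd (\<gamma>' P))"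
      using g P by simp
  next
    fix c assume "c \<in> C"
    then obtain P Q where c: "c = (P, Q)" "(P, Q) \<in> C" "P \<noteq> Q" using dist by (metis surj_pair)
    show "(case c of (P, Q) \<Rightarrow> \<Sum>\<gamma>\<in>b (P, Q) \<rightarrow>\<^sub>E I \<times> I. f (P, Q) \<gamma>) = (case c of (P, Q) \<Rightarrow>
      \<Sum>x\<in>I \<times> I. \<Sum>y\<in>I \<times> I. (g P (fst (\<gamma>' P)) (fst x) * gi P (snd x) (snd (\<gamma>' P))) *
      (g Q (fst (\<gamma>' Q)) (fst y) * gi Q (snd y) (snd (\<gamma>' Q))) * t (P, Q) x y)"
      using c by (simp add: b_def sum_PiE_pair f_def w_def)
  qed
  finally show ?thesis by (simp add: w_def)
qed

text \<open>A new node \<open>Q\<close> with the identity matrix splits the arc that ends at \<open>R\<close>; summing over its two equal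
  labels multiplies the matrices of the two parts.\<close>

lemma state_sum_insert:
  assumes N: "finite N" "Q \<notin> N" "R \<in> N" and pvN: "\<And>P. P \<in> N \<Longrightarrow> pv P \<in> N"
    and pv': "pv' R = Q" "pv' Q = pv R" "\<And>P. P \<in> N \<Longrightarrow> P \<noteq> R \<Longrightarrow> pv' P = pv P"
    and H: "H R = mat_mul (H' Q) (H' R)" "\<And>P. P \<in> N \<Longrightarrow> P \<noteq> R \<Longrightarrow> H' P = H P"
    and T: "\<And>\<gamma> \<gamma>'. (\<And>P. P \<in> N \<Longrightarrow> \<gamma> P = \<gamma>' P) \<Longrightarrow> T \<gamma> = T \<gamma>'"
  shows "state_sum (insert Q N) pv' H' (\<lambda>\<gamma>. one (fst (\<gamma> Q)) (snd (\<gamma> Q)) * T \<gamma>) = state_sum N pv H T"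
proof -
  let ?J = "I \<times> I"
  let ?m = "\<lambda>\<gamma> x P. if P \<in> N then \<gamma> P else if P = Q then x else undefined"
  have "state_sum (insert Q N) pv' H' (\<lambda>\<gamma>. one (fst (\<gamma> Q)) (snd (\<gamma> Q)) * T \<gamma>) =
    (\<Sum>\<gamma>\<in>(N \<union> {Q}) \<rightarrow>\<^sub>E ?J. (\<Prod>P\<in>insert Q N. H' P (snd (\<gamma> (pv' P))) (fst (\<gamma> P))) *
      (one (fst (\<gamma> Q)) (snd (\<gamma> Q)) * T \<gamma>))"
    unfolding state_sum_def by (rule sum.cong) simp_all
  also have "\<dots> = (\<Sum>\<gamma>\<in>N \<rightarrow>\<^sub>E ?J. \<Sum>x\<in>?J. (\<Prod>P\<in>insert Q N. H' P (snd (?m \<gamma> x (pv' P))) (fst (?m \<gamma> x P))) *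
      (one (fst (?m \<gamma> x Q)) (snd (?m \<gamma> x Q)) * T (?m \<gamma> x)))"
    using N by (subst sum_PiE_Un) (simp_all add: sum_PiE_singleton)
  also have "\<dots> = (\<Sum>\<gamma>\<in>N \<rightarrow>\<^sub>E ?J. (\<Prod>P\<in>N. H P (snd (\<gamma> (pv P))) (fst (\<gamma> P))) * T \<gamma>)"
  proof (intro sum.cong refl)
    fix \<gamma> assume \<gamma>: "\<gamma> \<in> N \<rightarrow>\<^sub>E ?J"
    define W where "W = (\<Prod>P\<in>N - {R}. H P (snd (\<gamma> (pv P))) (fst (\<gamma> P)))"
    have lab: "fst (\<gamma> P) \<in> I" "snd (\<gamma> P) \<in> I" if "P \<in> N" for P
      using \<gamma> that by (auto simp: PiE_iff mem_Times_iff)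
    have p1: "(\<Prod>P\<in>insert Q N. H' P (snd (?m \<gamma> x (pv' P))) (fst (?m \<gamma> x P))) =
       H' Q (snd (\<gamma> (pv R))) (fst x) * (H' R (snd x) (fst (\<gamma> R)) * W)" for x
    proof -
      have "(\<Prod>P\<in>insert Q N. H' P (snd (?m \<gamma> x (pv' P))) (fst (?m \<gamma> x P))) =
         H' Q (snd (?m \<gamma> x (pv' Q))) (fst x) * (\<Prod>P\<in>N. H' P (snd (?m \<gamma> x (pv' P))) (fst (?m \<gamma> x P)))"
        using N by simp
      also have "(\<Prod>P\<in>N. H' P (snd (?m \<gamma> x (pv' P))) (fst (?m \<gamma> x P))) =
        H' R (snd (?m \<gamma> x (pv' R))) (fst (?m \<gamma> x R)) *
        (\<Prod>P\<in>N - {R}. H' P (snd (?m \<gamma> x (pv' P))) (fst (?m \<gamma> x P)))"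
        using N by (intro prod.remove) auto
      also have "(\<Prod>P\<in>N - {R}. H' P (snd (?m \<gamma> x (pv' P))) (fst (?m \<gamma> x P))) = W"
        unfolding W_def using pv' H pvN by (intro prod.cong) auto
      finally show ?thesis using pv' N pvN by simp
    qed
    have "(\<Sum>x\<in>?J. (\<Prod>P\<in>insert Q N. H' P (snd (?m \<gamma> x (pv' P))) (fst (?m \<gamma> x P))) *
      (one (fst (?m \<gamma> x Q)) (snd (?m \<gamma> x Q)) * T (?m \<gamma> x))) =
      (\<Sum>x\<in>?J. (H' Q (snd (\<gamma> (pv R))) (fst x) * (H' R (snd x) (fst (\<gamma> R)) * W)) * (one (fst x) (snd x) * T \<gamma>))"
    proof -
      have "T (?m \<gamma> x) = T \<gamma>" for x by (rule T) simp
      then show ?thesis unfolding p1 using N by simp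
    qed
    also have "\<dots> = (\<Sum>a\<in>I. \<Sum>b\<in>I. if a = b then (H' Q (snd (\<gamma> (pv R))) a * H' R b (fst (\<gamma> R))) * (W * T \<gamma>) else 0)"
      unfolding sum.cartesian_product case_prod_unfold
      by (intro sum.cong refl) (auto simp: one_def)
    also have "\<dots> = (\<Sum>a\<in>I. H' Q (snd (\<gamma> (pv R))) a * H' R a (fst (\<gamma> R))) * (W * T \<gamma>)"
      using finI by (simp add: sum_distrib_right)
    also have "\<dots> = (H R (snd (\<gamma> (pv R))) (fst (\<gamma> R)) * W) * T \<gamma>"
      using lab N pvN by (simp add: H mat_mul_def ac_simps)
    also have "H R (snd (\<gamma> (pv R))) (fst (\<gamma> R)) * W = (\<Prod>P\<in>N. H P (snd (\<gamma> (pv P))) (fst (\<gamma> P)))"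
      unfolding W_def using N by (intro prod.remove[symmetric]) auto
    finally show "(\<Sum>x\<in>?J. (\<Prod>P\<in>insert Q N. H' P (snd (?m \<gamma> x (pv' P))) (fst (?m \<gamma> x P))) *
      (one (fst (?m \<gamma> x Q)) (snd (?m \<gamma> x Q)) * T (?m \<gamma> x))) =
      (\<Prod>P\<in>N. H P (snd (\<gamma> (pv P))) (fst (\<gamma> P))) * T \<gamma>" .
  qed
  finally show ?thesis by (simp add: state_sum_def)
qed

definition relabel :: "'n set \<Rightarrow> ('n \<Rightarrow> bool) \<Rightarrow> ('n \<Rightarrow> 'm) \<Rightarrow> ('m \<Rightarrow> 'i \<times> 'i) \<Rightarrow> 'n \<Rightarrow> 'i \<times> 'i" where
  "relabel N bw f \<gamma> = (\<lambda>P\<in>N. if bw P then prod.swap (\<gamma> (f P)) else \<gamma> (f P))"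

text \<open>Isomorphic state sums agree; \<open>bw\<close> marks the nodes on circles that are traversed backwards by
  the isomorphism, where the labels at arrival and at departure change places.\<close>

lemma state_sum_iso:
  assumes N': "finite N'" and f: "bij_betw f N' N"
    and pv': "bij_betw pv' N' N'" and bw: "\<And>P. P \<in> N' \<Longrightarrow> bw (pv' P) = bw P"
    and fwd: "\<And>P. P \<in> N' \<Longrightarrow> \<not> bw P \<Longrightarrow> f (pv' P) = pv (f P) \<and> H' P = H (f P)"
    and bwd: "\<And>P. P \<in> N' \<Longrightarrow> bw P \<Longrightarrow> pv (f (pv' P)) = f P \<and> H' P = transposed (H (f (pv' P)))"
    and T: "\<And>\<gamma>. \<gamma> \<in> N \<rightarrow>\<^sub>E I \<times> I \<Longrightarrow> T' (relabel N' bw f \<gamma>) = T \<gamma>"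
  shows "state_sum N' pv' H' T' = state_sum N pv H T"
proof -
  have pvN: "pv' P \<in> N'" if "P \<in> N'" for P using pv' that by (auto simp: bij_betw_def)
  have fN: "f P \<in> N" if "P \<in> N'" for P using f that by (auto simp: bij_betw_def)
  define h where "h = inv_into N' f"
  have h: "h Q \<in> N'" "f (h Q) = Q" if "Q \<in> N" for Q
    using f that bij_betw_inv_into_right[OF f] by (auto simp: h_def bij_betw_def inv_into_into)
  have hf: "h (f P) = P" if "P \<in> N'" for P
    using that bij_betw_inv_into_left[OF f] by (auto simp: h_def)
  define p where "p P = (if bw P then pv' P else P)" for P
  have "bij_betw p N' N'"
  proof (rule bij_betwI')
    fix x y assume xy: "x \<in> N'" "y \<in> N'"
    have "bw (p z) = bw z" if "z \<in> N'" for z using bw that by (simp add: p_def)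
    then show "(p x = p y) = (x = y)"
      using xy pv' unfolding p_def bij_betw_def inj_on_def by metis
  next
    fix y assume y: "y \<in> N'"
    then have "y \<in> pv' ` N'" using pv' by (simp add: bij_betw_def)
    then obtain x where "x \<in> N'" "pv' x = y" by blast
    then show "\<exists>x\<in>N'. y = p x" using bw y by (cases "bw y") (force simp: p_def)+
  qed (auto simp: p_def pvN)
  then have e: "bij_betw (f \<circ> p) N' N" using f by (rule bij_betw_trans)
  show ?thesis
    unfolding state_sum_def
  proof (rule sum.reindex_bij_witness[of _ "relabel N' bw f" "relabel N (bw \<circ> h) h"])
    fix \<gamma> assume \<gamma>: "\<gamma> \<in> N \<rightarrow>\<^sub>E I \<times> I"
    show "relabel N (bw \<circ> h) h (relabel N' bw f \<gamma>) = \<gamma>"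
      using \<gamma> by (auto simp: relabel_def fun_eq_iff h PiE_iff extensional_def)
    show "relabel N' bw f \<gamma> \<in> N' \<rightarrow>\<^sub>E I \<times> I"
      using \<gamma> fN by (auto simp: relabel_def PiE_iff mem_Times_iff)
  next
    fix \<gamma>' assume g': "\<gamma>' \<in> N' \<rightarrow>\<^sub>E I \<times> I"
    let ?\<gamma> = "relabel N (bw \<circ> h) h \<gamma>'"
    show eq: "relabel N' bw f ?\<gamma> = \<gamma>'"
      using g' by (auto simp: relabel_def fun_eq_iff hf fN PiE_iff extensional_def)
    show gN: "?\<gamma> \<in> N \<rightarrow>\<^sub>E I \<times> I"
      using g' h by (auto simp: relabel_def PiE_iff mem_Times_iff)
    have "(\<Prod>P\<in>N. H P (snd (?\<gamma> (pv P))) (fst (?\<gamma> P))) =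
      (\<Prod>P\<in>N'. H ((f \<circ> p) P) (snd (?\<gamma> (pv ((f \<circ> p) P)))) (fst (?\<gamma> ((f \<circ> p) P))))"
      using prod.reindex_bij_betw[OF e, of "\<lambda>P. H P (snd (?\<gamma> (pv P))) (fst (?\<gamma> P))"] by simp
    also have "\<dots> = (\<Prod>P\<in>N'. H' P (snd (\<gamma>' (pv' P))) (fst (\<gamma>' P)))"
    proof (intro prod.cong refl)
      fix P assume P: "P \<in> N'"
      have g: "?\<gamma> (f Q) = (if bw Q then prod.swap (\<gamma>' Q) else \<gamma>' Q)" if "Q \<in> N'" for Q
        using that by (simp add: relabel_def fN hf)
      show "H ((f \<circ> p) P) (snd (?\<gamma> (pv ((f \<circ> p) P)))) (fst (?\<gamma> ((f \<circ> p) P))) =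
        H' P (snd (\<gamma>' (pv' P))) (fst (\<gamma>' P))"
      proof (cases "bw P")
        case True
        then show ?thesis using P bwd[OF P True] pvN[OF P] bw[OF P]
          by (simp add: p_def g transposed_def)
      next
        case False
        then have "pv (f P) = f (pv' P)" "H' P = H (f P)" using fwd[OF P] by auto
        then show ?thesis using P False pvN[OF P] bw[OF P] by (simp add: p_def g)
      qed
    qed
    finally show "(\<Prod>P\<in>N. H P (snd (?\<gamma> (pv P))) (fst (?\<gamma> P))) * T ?\<gamma> =
      (\<Prod>P\<in>N'. H' P (snd (\<gamma>' (pv' P))) (fst (\<gamma>' P))) * T' \<gamma>'"
      using T[OF gN] eq by simp
  qed
qed

text \<open>Cutting a state sum along the boundary of a region: \<open>Nin\<close> are the nodes inside, and \<open>E\<close> the nodes outside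
  at which an arc arrives from inside.\<close>

lemma state_sum_split:
  fixes Nout Nin :: "'n set"
  assumes fin: "finite Nout" "finite Nin" and disj: "Nout \<inter> Nin = {}" and E: "E \<subseteq> Nout"
    and pvO: "\<And>P. P \<in> Nout - E \<Longrightarrow> pv P \<in> Nout"
    and T: "\<And>\<gamma>. T \<gamma> = T0 \<gamma> * T1 \<gamma>"
    and T0: "\<And>\<gamma> \<gamma>'. (\<And>P. P \<in> Nout \<Longrightarrow> \<gamma> P = \<gamma>' P) \<Longrightarrow> T0 \<gamma> = T0 \<gamma>'"
  shows "state_sum (Nout \<union> Nin) pv H T = (\<Sum>\<gamma>\<in>Nout \<rightarrow>\<^sub>E I \<times> I.
    ((\<Prod>P\<in>Nout - E. H P (snd (\<gamma> (pv P))) (fst (\<gamma> P))) * T0 \<gamma>) *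
    (\<Sum>\<delta>\<in>Nin \<rightarrow>\<^sub>E I \<times> I. let \<epsilon> = (\<lambda>P. if P \<in> Nout then \<gamma> P else \<delta> P) in
       (\<Prod>P\<in>Nin \<union> E. H P (snd (\<epsilon> (pv P))) (fst (\<epsilon> P))) * T1 \<epsilon>))"
  unfolding state_sum_def sum_PiE_Un[OF disj fin] sum_distrib_left
proof (intro sum.cong refl)
  fix \<gamma> \<delta> :: "'n \<Rightarrow> 'i \<times> 'i"
  let ?e = "\<lambda>P. if P \<in> Nout then \<gamma> P else \<delta> P"
  have "(\<Prod>P\<in>Nout \<union> Nin. H P (snd (?e (pv P))) (fst (?e P))) =
    (\<Prod>P\<in>Nout - E. H P (snd (?e (pv P))) (fst (?e P))) * (\<Prod>P\<in>Nin \<union> E. H P (snd (?e (pv P))) (fst (?e P)))"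
  proof (subst prod.union_disjoint[symmetric])
    show "(\<Prod>P\<in>Nout \<union> Nin. H P (snd (?e (pv P))) (fst (?e P))) =
      (\<Prod>P\<in>Nout - E \<union> (Nin \<union> E). H P (snd (?e (pv P))) (fst (?e P)))"
      using E by (intro prod.cong) auto
  qed (use fin E disj in \<open>auto intro: finite_subset\<close>)
  also have "(\<Prod>P\<in>Nout - E. H P (snd (?e (pv P))) (fst (?e P))) =
     (\<Prod>P\<in>Nout - E. H P (snd (\<gamma> (pv P))) (fst (\<gamma> P)))"
    using pvO by (intro prod.cong) auto
  also have "T ?e = T0 \<gamma> * T1 ?e" using T T0[of ?e \<gamma>] by simp
  ultimately show "(\<Prod>P\<in>Nout \<union> Nin. H P (snd (?e (pv P))) (fst (?e P))) * T ?e =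
    (\<Prod>P\<in>Nout - E. H P (snd (\<gamma> (pv P))) (fst (\<gamma> P))) * T0 \<gamma> *
    (let \<epsilon> = ?e in (\<Prod>P\<in>Nin \<union> E. H P (snd (\<epsilon> (pv P))) (fst (\<epsilon> P))) * T1 \<epsilon>)"
    by (simp add: Let_def ac_simps)
qed

end

section \<open>Nodes on circles\<close>

text \<open>Nodes are looked at in the universal cover \<open>\<real>\<close> of the circle, where the node before a given
  one is simply the greatest smaller one.\<close>

definition cov :: "(nat \<times> real) set \<Rightarrow> nat \<Rightarrow> real set" where
  "cov N j = {t. (j, frac t) \<in> N}"

definition consec :: "real set \<Rightarrow> real \<Rightarrow> real \<Rightarrow> bool" where
  "consec S s t \<longleftrightarrow> s \<in> S \<and> s < t \<and> S \<inter> {s<..<t} = {}"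

definition before :: "(nat \<times> real) set \<Rightarrow> nat \<Rightarrow> real \<Rightarrow> real" where
  "before N j t = (THE s. consec (cov N j) s t)"

definition prev_node :: "(nat \<times> real) set \<Rightarrow> nat \<times> real \<Rightarrow> nat \<times> real" where
  "prev_node N P = (fst P, frac (before N (fst P) (snd P)))"

definition circle_nodes :: "nat \<Rightarrow> (nat \<times> real) set \<Rightarrow> bool" where
  "circle_nodes n N \<longleftrightarrow> finite N \<and> N \<subseteq> {..<n} \<times> {0..<1} \<and> (\<forall>j<n. \<exists>t. (j, t) \<in> N)"

lemma cov_shift [simp]: "t + of_int n \<in> cov N j \<longleftrightarrow> t \<in> cov N j"
  by (simp add: cov_def)

lemma cov_shift1 [simp]: "t + 1 \<in> cov N j \<longleftrightarrow> t \<in> cov N j" "t - 1 \<in> cov N j \<longleftrightarrow> t \<in> cov N j"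
  using cov_shift[of t 1 N j] cov_shift[of t "-1" N j] by simp_all

lemma cov_unit: "0 \<le> t \<Longrightarrow> t < 1 \<Longrightarrow> t \<in> cov N j \<longleftrightarrow> (j, t) \<in> N"
  by (simp add: cov_def frac_eq)

lemma consec_unique: "consec S s t \<Longrightarrow> consec S s' t \<Longrightarrow> s = s'"
  unfolding consec_def by (metis disjoint_iff greaterThanLessThan_iff linorder_neqE_linordered_idom)

lemma consec_unique_right: "consec S s t \<Longrightarrow> consec S s t' \<Longrightarrow> t \<in> S \<Longrightarrow> t' \<in> S \<Longrightarrow> t = t'"
  unfolding consec_def by (metis disjoint_iff greaterThanLessThan_iff linorder_neqE_linordered_idom)

lemma consec_shift: "consec (cov N j) (s + of_int n) (t + of_int n) \<longleftrightarrow> consec (cov N j) s t"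
proof -
  have *: "consec (cov N j) (s + of_int n) (t + of_int n)" if "consec (cov N j) s t" for s t and n :: int
  proof -
    have "x \<notin> cov N j" if x: "x \<in> {s + of_int n<..<t + of_int n}" for x
    proof -
      have "x - of_int n \<in> {s<..<t}" using x by auto
      then have "x - of_int n \<notin> cov N j" using \<open>consec (cov N j) s t\<close> by (auto simp: consec_def)
      then show ?thesis using cov_shift[of "x - of_int n" n N j] by simp
    qed
    then show ?thesis using that by (auto simp: consec_def)
  qed
  show ?thesis using *[of s t n] *[of "s + of_int n" "t + of_int n" "- n"] by auto
qed

lemma finite_cov_window:
  assumes "finite N" shows "finite (cov N j \<inter> {a..<a + 1})"
proof -
  have "inj_on frac {a..<a + 1}" using bij_betw_frac[of a] by (simp add: bij_betw_def)
  then have "inj_on (\<lambda>t. (j, frac t)) (cov N j \<inter> {a..<a + 1})" by (auto simp: inj_on_def)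
  moreover have "(\<lambda>t. (j, frac t)) ` (cov N j \<inter> {a..<a + 1}) \<subseteq> N" by (auto simp: cov_def)
  ultimately show ?thesis using assms inj_on_finite by blast
qed

lemma ex_cov_window:
  assumes "(j, x) \<in> N" "0 \<le> x" "x < 1" shows "\<exists>s\<in>cov N j. a \<le> s \<and> s < a + 1"
proof -
  have "x \<in> frac ` {a..<a + 1}" using bij_betw_frac[of a] assms by (simp add: bij_betw_def)
  then show ?thesis using assms by (auto simp: cov_def)
qed

lemma ex_consec:
  assumes N: "circle_nodes n N" and j: "j < n"
  shows "\<exists>s. consec (cov N j) s t"
proof -
  obtain x where x: "(j, x) \<in> N" using N j by (auto simp: circle_nodes_def)
  then have x01: "0 \<le> x" "x < 1" using N by (auto simp: circle_nodes_def)
  let ?S = "cov N j \<inter> {t - 1..<t - 1 + 1}"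
  have fin: "finite ?S" using N by (intro finite_cov_window) (simp add: circle_nodes_def)
  have ne: "?S \<noteq> {}" using ex_cov_window[OF x x01, of "t - 1"] by auto
  have M: "Max ?S \<in> ?S" using fin ne by (rule Max_in)
  have "consec (cov N j) (Max ?S) t"
    unfolding consec_def
  proof (intro conjI equals0I)
    fix y assume y: "y \<in> cov N j \<inter> {Max ?S<..<t}"
    then have "y \<in> ?S" using M by auto
    then have "y \<le> Max ?S" using fin by (intro Max_ge) auto
    then show False using y by auto
  qed (use M in auto)
  then show ?thesis ..
qed

lemma before_consec:
  assumes "circle_nodes n N" "j < n" shows "consec (cov N j) (before N j t) t"
  unfolding before_def
  using ex_consec[OF assms, of t] consec_unique by (metis theI)

lemma before_eqI:
  assumes "consec (cov N j) s t" shows "before N j t = s"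
  unfolding before_def using assms consec_unique by (metis the_equality)

lemma before_shift:
  assumes "circle_nodes n N" "j < n"
  shows "before N j (t + of_int k) = before N j t + of_int k"
  using before_consec[OF assms, of t] by (intro before_eqI) (simp add: consec_shift)

lemma prev_node_in:
  assumes "circle_nodes n N" "P \<in> N" shows "prev_node N P \<in> N"
proof -
  have "fst P < n" using assms by (auto simp: circle_nodes_def)
  from before_consec[OF assms(1) this, of "snd P"] show ?thesis
    by (simp add: prev_node_def consec_def cov_def)
qed

lemma node_in_cov: "circle_nodes n N \<Longrightarrow> (j, t) \<in> N \<Longrightarrow> t \<in> cov N j"
  by (subst cov_unit) (auto simp: circle_nodes_def)

lemma prev_node_bij:
  assumes N: "circle_nodes n N" shows "bij_betw (prev_node N) N N"
proof -
  have inj: "inj_on (prev_node N) N"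
  proof (rule inj_onI)
    fix P Q assume PQ: "P \<in> N" "Q \<in> N" "prev_node N P = prev_node N Q"
    obtain j t u where P: "P = (j, t)" and Q: "Q = (j, u)" using PQ(3) by (cases P; cases Q) (auto simp: prev_node_def)
    have j: "j < n" and tu: "0 \<le> t" "t < 1" "0 \<le> u" "u < 1" using PQ P Q N by (auto simp: circle_nodes_def)
    have "frac (before N j t) = frac (before N j u)" using PQ(3) by (simp add: prev_node_def P Q)
    then obtain k :: int where k: "before N j t = before N j u + of_int k" by (elim frac_eqE)
    have "consec (cov N j) (before N j t) (u + of_int k)"
      unfolding k consec_shift by (rule before_consec[OF N j])
    moreover have "consec (cov N j) (before N j t) t" by (rule before_consec[OF N j])
    ultimately have "t = u + of_int k"
      using node_in_cov[OF N] PQ P Q by (intro consec_unique_right) auto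
    then have "of_int k < (1::real)" "of_int k > (-1::real)" using tu by auto
    then have "k = 0" by linarith
    then show "P = Q" using \<open>t = u + of_int k\<close> by (simp add: P Q)
  qed
  moreover have "prev_node N ` N \<subseteq> N" using prev_node_in[OF N] by auto
  ultimately have "prev_node N ` N = N" using N by (intro endo_inj_surj) (auto simp: circle_nodes_def)
  with inj show ?thesis by (simp add: bij_betw_def)
qed

text \<open>The case distinction in the definition of \<open>arc_in\<close> is the passage through the base point of the
  circle, which disappears in the universal cover.\<close>

lemma arc_in_prev_node:
  assumes N: "circle_nodes n (nodes K)" and P: "P \<in> nodes K"
  shows "arc_in K P = prev_node (nodes K) P"
proof -
  define N where "N = nodes K"
  obtain j t where Pj: "P = (j, t)" by (cases P)
  have cn: "circle_nodes n N" and PN: "(j, t) \<in> N" using assms by (auto simp: N_def Pj)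
  have j: "j < n" and t: "0 \<le> t" "t < 1" using cn PN by (auto simp: circle_nodes_def)
  define S where "S = {s. (j, s) \<in> N}"
  have S01: "0 \<le> s" "s < 1" if "s \<in> S" for s using cn that by (auto simp: S_def circle_nodes_def)
  have finS: "finite S"
  proof -
    have "S = snd ` (N \<inter> {j} \<times> UNIV)" by (force simp: S_def image_iff)
    then show ?thesis using cn by (simp add: circle_nodes_def)
  qed
  have Scov: "s \<in> cov N j \<longleftrightarrow> s \<in> S" if "0 \<le> s" "s < 1" for s
    using that by (simp add: cov_unit S_def)
  have "frac (before N j t) = (if {s \<in> S. s < t} \<noteq> {} then Max {s \<in> S. s < t} else Max S)"
  proof (cases "{s \<in> S. s < t} = {}")
    case False
    let ?M = "Max {s \<in> S. s < t}"
    have M: "?M \<in> {s \<in> S. s < t}" using finS False by (intro Max_in) auto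
    then have M01: "0 \<le> ?M" "?M < 1" using S01 by auto
    have "consec (cov N j) ?M t"
      unfolding consec_def
    proof (intro conjI equals0I)
      fix y assume y: "y \<in> cov N j \<inter> {?M<..<t}"
      then have "y \<in> {s \<in> S. s < t}" using Scov[of y] M01 t by auto
      then have "y \<le> ?M" using finS by (intro Max_ge) auto
      then show False using y by auto
    qed (use M Scov[OF M01] in auto)
    then have "before N j t = ?M" by (rule before_eqI)
    then show ?thesis using False M01 by (simp add: frac_eq)
  next
    case True
    have tS: "t \<in> S" using PN by (simp add: S_def)
    have M: "Max S \<in> S" using finS tS by (intro Max_in) auto
    have M01: "0 \<le> Max S" "Max S < 1" using S01 M by auto
    have tM: "t \<le> Max S" using finS tS by (rule Max_ge)
    have "consec (cov N j) (Max S - 1) t"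
      unfolding consec_def
    proof (intro conjI equals0I)
      fix y assume y: "y \<in> cov N j \<inter> {Max S - 1<..<t}"
      show False
      proof (cases "y \<ge> 0")
        case True
        then have "y \<in> {s \<in> S. s < t}" using Scov[of y] y t by auto
        then show False using \<open>{s \<in> S. s < t} = {}\<close> by auto
      next
        case False
        then have "y + 1 \<in> S" using Scov[of "y + 1"] y M01 by auto
        then have "y + 1 \<le> Max S" using finS by (intro Max_ge) auto
        then show False using y by auto
      qed
    qed (use M Scov[OF M01] M01 t in auto)
    then have "before N j t = Max S - 1" by (rule before_eqI)
    then show ?thesis using True M01 frac_1_eq[of "Max S - 1"] by (simp add: frac_eq)
  qed
  then show ?thesis
    unfolding arc_in_def prev_node_def Let_def Pj fst_conv snd_conv N_def[symmetric] S_def[symmetric]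
    by (simp only: simp_thms)
qed

text \<open>The effect on the arcs of a new node \<open>Q\<close>: it splits one arc, which ends at \<open>R\<close>.\<close>

lemma prev_node_insert:
  assumes N: "circle_nodes n N" and Q: "Q \<in> {..<n} \<times> {0..<1}" "Q \<notin> N"
  obtains R where "R \<in> N" "prev_node (insert Q N) R = Q" "prev_node (insert Q N) Q = prev_node N R"
    "fst R = fst Q"
    "before (insert Q N) (fst Q) (before (insert Q N) (fst Q) (snd R)) = before N (fst Q) (snd R)"
    "\<And>P. P \<in> N \<Longrightarrow> P \<noteq> R \<Longrightarrow> before (insert Q N) (fst P) (snd P) = before N (fst P) (snd P)"
proof -
  define N' where "N' = insert Q N"
  obtain j q where Qj: "Q = (j, q)" by (cases Q)
  have j: "j < n" and q: "0 \<le> q" "q < 1" using Q by (auto simp: Qj)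
  have N': "circle_nodes n N'" using N Q by (auto simp: N'_def circle_nodes_def)
  obtain x where x: "(j, x) \<in> N" "0 \<le> x" "x < 1"
    using N j unfolding circle_nodes_def by (metis atLeastLessThan_iff mem_Sigma_iff subsetD)
  have covN': "y \<in> cov N' i \<longleftrightarrow> y \<in> cov N i \<or> (i = j \<and> frac y = q)" for y i
    by (auto simp: cov_def N'_def Qj)
  have "Q \<in> prev_node N' ` N'" using prev_node_bij[OF N'] by (simp add: bij_betw_def N'_def)
  then obtain R where R: "R \<in> N'" "prev_node N' R = Q" by auto
  have RQ: "R \<noteq> Q"
  proof
    assume "R = Q"
    then have "frac (before N' j q) = q" using R by (simp add: prev_node_def Qj)
    then have "frac (before N' j q) = frac q" using q by (simp add: frac_eq)
    then obtain k :: int where k: "before N' j q = q + of_int k" by (elim frac_eqE)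
    have c: "consec (cov N' j) (q + of_int k) q" using before_consec[OF N' j, of q] by (simp add: k)
    then have "k < 0" by (simp add: consec_def)
    then have k1: "of_int k \<le> (-1::real)" by simp
    obtain y where y: "y \<in> cov N j" "q - 1 \<le> y" "y < q"
      using ex_cov_window[OF x, of "q - 1"] by auto
    have "y \<noteq> q - 1" using y(1) Q q by (auto simp: cov_def Qj frac_1_eq[of "q - 1", symmetric] frac_eq simp del: cov_shift1)
    then have "y \<in> cov N' j \<inter> {q + of_int k<..<q}" using y k1 covN' by auto
    then show False using c by (auto simp: consec_def)
  qed
  then have RN: "R \<in> N" using R by (simp add: N'_def)
  obtain t where Rt: "R = (j, t)" using R(2) by (cases R) (auto simp: prev_node_def Qj)
  let ?s = "before N' j t"
  have fs: "frac ?s = q" using R(2) by (simp add: prev_node_def Rt Qj)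
  then have "frac ?s = frac q" using q by (simp add: frac_eq)
  then obtain k :: int where k: "?s = q + of_int k"
    by (elim frac_eqE)
  have cs: "consec (cov N' j) ?s t" by (rule before_consec[OF N' j])
  let ?r = "before N' j ?s"
  have cr: "consec (cov N' j) ?r ?s" by (rule before_consec[OF N' j])
  have prevQ: "prev_node N' Q = (j, frac ?r)"
    using before_shift[OF N' j, of q k] by (simp add: prev_node_def Qj k)
  have nq: "frac ?r \<noteq> q"
  proof
    assume "frac ?r = q"
    then have "prev_node N' Q = Q" using prevQ by (simp add: Qj)
    then show False using R RQ prev_node_bij[OF N'] by (auto simp: bij_betw_def inj_on_def N'_def)
  qed
  have rt: "before N j t = ?r"
  proof (rule before_eqI, unfold consec_def, intro conjI equals0I)
    show "?r \<in> cov N j" using cr nq covN' by (auto simp: consec_def)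
    show "?r < t" using cr cs by (auto simp: consec_def)
    fix y assume y: "y \<in> cov N j \<inter> {?r<..<t}"
    then have "y \<in> cov N' j" using covN' by auto
    then have "y = ?s" using y cr cs
      by (auto simp: consec_def) (metis IntI empty_iff greaterThanLessThan_iff linorder_neqE_linordered_idom)
    then show False using y fs Q by (auto simp: cov_def Qj)
  qed
  have other: "before N' (fst P) (snd P) = before N (fst P) (snd P)" if P: "P \<in> N" "P \<noteq> R" for P
  proof -
    have i: "fst P < n" using N P by (auto simp: circle_nodes_def)
    have c: "consec (cov N' (fst P)) (before N' (fst P) (snd P)) (snd P)" by (rule before_consec[OF N' i])
    have "prev_node N' P \<noteq> Q"
    proof
      assume "prev_node N' P = Q"
      then have "prev_node N' P = prev_node N' R" using R by simp
      then show False using P R prev_node_bij[OF N'] by (auto simp: bij_betw_def inj_on_def N'_def)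
    qed
    then have "before N' (fst P) (snd P) \<in> cov N (fst P)"
      using c covN' by (auto simp: consec_def prev_node_def Qj)
    then have "consec (cov N (fst P)) (before N' (fst P) (snd P)) (snd P)"
      using c covN' by (auto simp: consec_def)
    then show ?thesis by (simp add: before_eqI)
  qed
  show ?thesis
  proof (rule that[of R])
    show "prev_node (insert Q N) Q = prev_node N R"
      using prevQ by (simp add: N'_def prev_node_def[of N "(j, t)"] Rt rt)
  qed (use RN R other rt in \<open>auto simp: N'_def Rt Qj\<close>)
qed


section \<open>Lifts of the tangent direction\<close>

text \<open>The number of half turns in an angle: crossing a multiple of \<open>\<pi>\<close> means a horizontal tangent.\<close>

definition sector :: "real \<Rightarrow> int" where
  "sector x = \<lfloor>x / pi\<rfloor>"

lemma sector_eq_iff: "sector x = k \<longleftrightarrow> of_int k * pi \<le> x \<and> x < (of_int k + 1) * pi"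
  by (simp add: sector_def floor_eq_iff pos_le_divide_eq pos_divide_less_eq)

lemma sector_shift: "sector (x + 2 * pi * of_int n) = sector x + 2 * n"
proof -
  have "(x + 2 * pi * of_int n) / pi = x / pi + of_int (2 * n)" by (simp add: add_divide_distrib)
  then show ?thesis unfolding sector_def by (simp only: floor_add_int)
qed

definition direction :: "complex \<Rightarrow> real \<Rightarrow> bool" where
  "direction z x \<longleftrightarrow> (\<exists>r>0. z = of_real r * cis x)"

lemma direction_unique:
  assumes "direction z x" "direction z y"
  shows "\<exists>n::int. y = x + 2 * pi * of_int n"
proof -
  obtain r s where rs: "r > 0" "s > 0" "z = of_real r * cis x" "z = of_real s * cis y"
    using assms by (auto simp: direction_def)
  then have "cmod (of_real r * cis x) = cmod (of_real s * cis y)" by simp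
  then have "r = s" using rs by (simp add: norm_mult)
  then have "cis x = cis y" using rs by auto
  then have "sin y = sin x \<and> cos y = cos x" by (simp add: complex_eq_iff)
  then show ?thesis by (simp add: sin_cos_eq_iff)
qed

lemma int_valued_constant:
  fixes f :: "'a::topological_space \<Rightarrow> real"
  assumes "connected S" "continuous_on S f" "\<And>x. x \<in> S \<Longrightarrow> \<exists>n::int. f x = of_int n"
  shows "\<exists>n::int. \<forall>x\<in>S. f x = of_int n"
proof -
  have "f constant_on S"
  proof (rule continuous_discrete_range_constant[OF assms(1,2)])
    fix x assume x: "x \<in> S"
    have "1 \<le> norm (f y - f x)" if y: "y \<in> S" "f y \<noteq> f x" for y
    proof -
      obtain m n :: int where mn: "f x = of_int n" "f y = of_int m" using assms(3) x y by meson
      then have "m \<noteq> n" using y by auto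
      then have "\<bar>m - n\<bar> \<ge> 1" by linarith
      then have "of_int 1 \<le> (of_int \<bar>m - n\<bar> :: real)" by (simp only: of_int_le_iff)
      then show ?thesis using mn by simp
    qed
    then show "\<exists>e>0. \<forall>y. y \<in> S \<and> f y \<noteq> f x \<longrightarrow> e \<le> norm (f y - f x)" by (intro exI[of _ 1]) auto
  qed
  then obtain c where c: "\<And>x. x \<in> S \<Longrightarrow> f x = c" by (auto simp: constant_on_def)
  show ?thesis
  proof (cases "S = {}")
    case False
    then show ?thesis using c assms(3) by (metis all_not_in_conv)
  qed auto
qed

lemma direction_lift_unique:
  fixes v :: "'a::topological_space \<Rightarrow> complex"
  assumes "connected S" "continuous_on S x" "continuous_on S y"
    and "\<And>t. t \<in> S \<Longrightarrow> direction (v t) (x t)" "\<And>t. t \<in> S \<Longrightarrow> direction (v t) (y t)"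
  shows "\<exists>n::int. \<forall>t\<in>S. y t = x t + 2 * pi * of_int n"
proof -
  have "\<exists>n::int. \<forall>t\<in>S. (y t - x t) / (2 * pi) = of_int n"
  proof (rule int_valued_constant[OF assms(1)])
    show "continuous_on S (\<lambda>t. (y t - x t) / (2 * pi))"
      using assms(2,3) by (intro continuous_intros) auto
    fix t assume "t \<in> S"
    then obtain n :: int where "y t = x t + 2 * pi * of_int n" using direction_unique assms(4,5) by blast
    then show "\<exists>n::int. (y t - x t) / (2 * pi) = of_int n" by (intro exI[of _ n]) (simp add: field_simps)
  qed
  then obtain n :: int where "\<And>t. t \<in> S \<Longrightarrow> (y t - x t) / (2 * pi) = of_int n" by blast
  then show ?thesis by (intro exI[of _ n]) (auto simp: field_simps)
qed

text \<open>A direction at angle \<open>x\<close> counts as upward if its sector is even: a horizontal tangent is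
  treated as if it were rotated counterclockwise by an infinitesimal angle.\<close>

definition upward :: "complex \<Rightarrow> bool" where
  "upward z \<longleftrightarrow> Im z > 0 \<or> (Im z = 0 \<and> Re z > 0)"

lemma cis_int_pi: "cis (of_int k * pi + y) = (if even k then cis y else - cis y)"
proof -
  have "cis (of_int k * pi) = (if even k then 1 else - 1)"
    by (simp add: complex_eq_iff mult.commute[of _ pi] cos_npi_int sin_npi_int)
  then show ?thesis by (simp add: cis_mult[symmetric])
qed

lemma upward_direction:
  assumes "direction z x" shows "upward z \<longleftrightarrow> even (sector x)"
proof -
  obtain r where r: "r > 0" "z = of_real r * cis x" using assms by (auto simp: direction_def)
  define k where "k = sector x"
  define y where "y = x - of_int k * pi"
  have y: "0 \<le> y" "y < pi" using sector_eq_iff[of x k] by (auto simp: y_def k_def algebra_simps)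
  have x: "x = of_int k * pi + y" by (simp add: y_def)
  have "upward (of_real r * cis y)"
  proof (cases "y = 0")
    case False
    then have "sin y > 0" using y by (intro sin_gt_zero) auto
    then show ?thesis using r by (simp add: upward_def)
  qed (use r in \<open>simp add: upward_def\<close>)
  moreover have "\<not> upward (- (of_real r * cis y))"
    using calculation by (auto simp: upward_def)
  moreover have "z = (if even k then of_real r * cis y else - (of_real r * cis y))"
    unfolding r x cis_int_pi by simp
  ultimately show ?thesis by (auto simp: k_def)
qed

definition tangent_lift :: "virtual_link_data \<Rightarrow> (nat \<Rightarrow> real \<Rightarrow> real) \<Rightarrow> bool" where
  "tangent_lift K \<theta> \<longleftrightarrow> (\<forall>j<comps K. continuous_on UNIV (\<theta> j) \<and>
     (\<forall>t. direction (vector_derivative (curve K j) (at t)) (\<theta> j t)))"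

lemma diagram_curve:
  assumes "virtual_link_diagram K" "j < comps K"
  shows "curve K j C1_differentiable_on UNIV" "curve K j (t + 1) = curve K j t"
    "vector_derivative (curve K j) (at t) \<noteq> 0" "curve K j differentiable at t"
    "continuous_on UNIV (\<lambda>t. vector_derivative (curve K j) (at t))"
  using assms by (auto simp: virtual_link_diagram_def C1_differentiable_on_eq)

lemma derivative_periodic:
  assumes "virtual_link_diagram K" "j < comps K"
  shows "vector_derivative (curve K j) (at (t + 1)) = vector_derivative (curve K j) (at t)"
proof -
  have "(curve K j has_vector_derivative vector_derivative (curve K j) (at (t + 1))) (at (t + 1))"
    using diagram_curve(4)[OF assms] by (simp add: vector_derivative_works)
  then have "((curve K j \<circ> (\<lambda>t. t + 1)) has_vector_derivative
      1 *\<^sub>R vector_derivative (curve K j) (at (t + 1))) (at t)"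
    by (intro vector_diff_chain_at) (auto intro!: derivative_eq_intros simp: has_vector_derivative_def)
  moreover have "curve K j \<circ> (\<lambda>t. t + 1) = curve K j" using diagram_curve(2)[OF assms] by auto
  ultimately show ?thesis using vector_derivative_at by fastforce
qed

lemma int_shift:
  fixes f :: "real \<Rightarrow> 'a"
  assumes "\<And>t. f (t + 1) = f t" shows "f (t + of_int n) = f t"
proof (induction n rule: int_induct[where k=0])
  case (step1 i)
  then show ?case using assms[of "t + of_int i"] by (simp add: ac_simps)
next
  case (step2 i)
  then show ?case using assms[of "t + of_int (i - 1)"] by (simp add: ac_simps)
qed simp

lemma frac_shift:
  fixes f :: "real \<Rightarrow> 'a"
  assumes "\<And>t. f (t + 1) = f t" shows "f (frac t) = f t"
  using int_shift[of f "frac t" "\<lfloor>t\<rfloor>"] assms by (simp add: frac_def)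

lemma ex_direction_lift:
  fixes v :: "'a::real_normed_vector \<Rightarrow> complex"
  assumes "contractible S" "continuous_on S v" "\<And>x. x \<in> S \<Longrightarrow> v x \<noteq> 0"
  shows "\<exists>\<theta>. continuous_on S \<theta> \<and> (\<forall>x\<in>S. direction (v x) (\<theta> x))"
proof -
  obtain g where g: "continuous_on S g" "\<And>x. x \<in> S \<Longrightarrow> v x = exp (g x)"
    using continuous_logarithm_on_contractible assms by metis
  show ?thesis
  proof (intro exI conjI ballI)
    show "continuous_on S (\<lambda>x. Im (g x))" using g(1) by (intro continuous_intros)
    fix x assume "x \<in> S"
    then have "v x = of_real (exp (Re (g x))) * cis (Im (g x))" using g(2) by (simp add: exp_eq_polar)
    then show "direction (v x) (Im (g x))" unfolding direction_def by (intro exI[of _ "exp (Re (g x))"]) simp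
  qed
qed

lemma ex_tangent_lift:
  assumes "virtual_link_diagram K" shows "\<exists>\<theta>. tangent_lift K \<theta>"
proof -
  have "\<exists>\<theta>. continuous_on UNIV \<theta> \<and> (\<forall>t\<in>UNIV. direction (vector_derivative (curve K j) (at t)) (\<theta> t))"
    if "j < comps K" for j
    using diagram_curve[OF assms that] by (intro ex_direction_lift convex_imp_contractible) auto
  then show ?thesis unfolding tangent_lift_def by (metis UNIV_I)
qed

lemma lift_periodic:
  assumes K: "virtual_link_diagram K" and \<theta>: "tangent_lift K \<theta>" and j: "j < comps K"
  shows "\<exists>n::int. \<forall>t. \<theta> j (t + 1) = \<theta> j t + 2 * pi * of_int n"
proof -
  have c: "continuous_on UNIV (\<theta> j)" "\<And>t. direction (vector_derivative (curve K j) (at t)) (\<theta> j t)"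
    using \<theta> j by (auto simp: tangent_lift_def)
  have "\<exists>n::int. \<forall>t\<in>UNIV. \<theta> j (t + 1) = \<theta> j t + 2 * pi * of_int n"
  proof (rule direction_lift_unique)
    show "continuous_on UNIV (\<lambda>t. \<theta> j (t + 1))"
      by (rule continuous_on_compose2[OF c(1)]) (auto intro!: continuous_intros)
    show "direction (vector_derivative (curve K j) (at t)) (\<theta> j (t + 1))" for t
      using c(2)[of "t + 1"] by (simp add: derivative_periodic[OF K j])
  qed (use c in auto)
  then show ?thesis by simp
qed

lemma sector_periodic:
  assumes K: "virtual_link_diagram K" and \<theta>: "tangent_lift K \<theta>" and j: "j < comps K"
  shows "\<exists>n::int. \<forall>t. sector (\<theta> j (t + of_int k)) = sector (\<theta> j t) + 2 * n"
proof -
  obtain m :: int where m: "\<And>t. \<theta> j (t + 1) = \<theta> j t + 2 * pi * of_int m"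
    using lift_periodic[OF assms] by auto
  define f where "f t = \<theta> j t - 2 * pi * of_int m * t" for t
  have "f (t + 1) = f t" for t unfolding f_def m by (simp add: algebra_simps)
  then have "f (t + of_int k) = f t" for t by (rule int_shift[of f])
  then have "\<theta> j (t + of_int k) = \<theta> j t + 2 * pi * of_int (m * k)" for t
    by (simp add: f_def algebra_simps)
  then show ?thesis by (metis sector_shift)
qed


section \<open>The state sum of a diagram\<close>

definition up_vec :: "complex \<Rightarrow> complex" where
  "up_vec z = (if upward z then z else - z)"

text \<open>This extends \<open>crossings\<close> to diagrams with horizontal tangents at the crossings.\<close>

definition cross :: "virtual_link_data \<Rightarrow> ((nat \<times> real) \<times> (nat \<times> real)) set" where
  "cross K = {(P, Q). double K P Q \<and> wedge (up_vec (tangent K Q)) (up_vec (tangent K P)) > 0}"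

text \<open>The set of nodes may be larger than that of the double points: every circle needs a node to have arcs,
  and additional nodes are convenient for comparing diagrams.\<close>

definition admissible :: "virtual_link_data \<Rightarrow> (nat \<times> real) set \<Rightarrow> bool" where
  "admissible K N \<longleftrightarrow> circle_nodes (comps K) N \<and> double_points K \<subseteq> N"

definition lab_up :: "virtual_link_data \<Rightarrow> (nat \<times> real \<Rightarrow> 'i \<times> 'i) \<Rightarrow> nat \<times> real \<Rightarrow> 'i" where
  "lab_up K \<gamma> P = (if upward (tangent K P) then snd (\<gamma> P) else fst (\<gamma> P))"

definition lab_down :: "virtual_link_data \<Rightarrow> (nat \<times> real \<Rightarrow> 'i \<times> 'i) \<Rightarrow> nat \<times> real \<Rightarrow> 'i" where
  "lab_down K \<gamma> P = (if upward (tangent K P) then fst (\<gamma> P) else snd (\<gamma> P))"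

lemma double_sym: "double K P Q \<Longrightarrow> double K Q P"
  by (auto simp: double_def)

lemma doubleD:
  assumes "double K P Q" shows "P \<in> double_points K" "Q \<in> double_points K"
  using assms double_sym[OF assms] unfolding double_points_def by blast+

lemma crossD:
  assumes "(P, Q) \<in> cross K"
  shows "double K P Q" "P \<noteq> Q" "P \<in> double_points K" "Q \<in> double_points K"
  using assms doubleD[of K P Q] by (auto simp: cross_def double_def)

lemma ex_admissible:
  assumes "virtual_link_diagram K" shows "\<exists>N. admissible K N"
proof (intro exI)
  have "finite (double_points K)" using assms by (simp add: virtual_link_diagram_def)
  moreover have "double_points K \<subseteq> {..<comps K} \<times> {0..<1}"
    by (auto simp: double_points_def double_def source_def)
  ultimately show "admissible K (double_points K \<union> {..<comps K} \<times> {0})"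
    unfolding admissible_def circle_nodes_def by auto
qed

context link_tensors
begin

definition arc_hol :: "(nat \<times> real) set \<Rightarrow> (nat \<Rightarrow> real \<Rightarrow> real) \<Rightarrow> nat \<Rightarrow> real \<Rightarrow> 'i \<Rightarrow> 'i \<Rightarrow> 'k" where
  "arc_hol N \<theta> j t = hol (sector (\<theta> j (before N j t))) (sector (\<theta> j t))"

definition node_tensor :: "virtual_link_data \<Rightarrow> (nat \<times> real) set \<Rightarrow> (nat \<times> real \<Rightarrow> 'i \<times> 'i) \<Rightarrow> 'k" where
  "node_tensor K N \<gamma> = (\<Prod>P\<in>N - double_points K. one (fst (\<gamma> P)) (snd (\<gamma> P))) *
     (\<Prod>(P, Q)\<in>cross K. X (mark K P) (lab_up K \<gamma> P) (lab_up K \<gamma> Q) (lab_down K \<gamma> Q) (lab_down K \<gamma> P))"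

text \<open>The tensor network of a diagram: the holonomies on the arcs, the identity at the nodes that are not double
  points, and the tensors of the crossings.\<close>

definition diagram_sum :: "virtual_link_data \<Rightarrow> (nat \<times> real) set \<Rightarrow> (nat \<Rightarrow> real \<Rightarrow> real) \<Rightarrow> 'k" where
  "diagram_sum K N \<theta> =
     state_sum N (prev_node N) (\<lambda>P. arc_hol N \<theta> (fst P) (snd P)) (node_tensor K N)"

lemma arc_hol_shift:
  assumes "virtual_link_diagram K" "tangent_lift K \<theta>" "j < comps K" "circle_nodes (comps K) N"
  shows "arc_hol N \<theta> j (t + of_int k) = arc_hol N \<theta> j t"
proof -
  obtain n :: int where "\<And>t. sector (\<theta> j (t + of_int k)) = sector (\<theta> j t) + 2 * n"
    using sector_periodic[OF assms(1-3)] by blast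
  then show ?thesis
    by (simp add: arc_hol_def before_shift[OF assms(4,3)] hol_periodic)
qed

text \<open>Two lifts differ by full turns, under which the holonomy is periodic.\<close>

lemma diagram_sum_lift:
  assumes \<theta>: "tangent_lift K \<theta>" and \<theta>': "tangent_lift K \<theta>'" and N: "circle_nodes (comps K) N"
  shows "diagram_sum K N \<theta> = diagram_sum K N \<theta>'"
  unfolding diagram_sum_def
proof (rule state_sum_cong)
  fix P a b assume P: "P \<in> N"
  then have j: "fst P < comps K" using N by (auto simp: circle_nodes_def)
  have "\<exists>n::int. \<forall>t\<in>UNIV. \<theta>' (fst P) t = \<theta> (fst P) t + 2 * pi * of_int n"
    using \<theta> \<theta>' j unfolding tangent_lift_def
    by (intro direction_lift_unique[of UNIV _ _ "\<lambda>t. vector_derivative (curve K (fst P)) (at t)"]) auto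
  then obtain n :: int where "\<And>t. \<theta>' (fst P) t = \<theta> (fst P) t + 2 * pi * of_int n" by auto
  then show "arc_hol N \<theta> (fst P) (snd P) a b = arc_hol N \<theta>' (fst P) (snd P) a b"
    by (simp add: arc_hol_def sector_shift hol_periodic)
qed (use prev_node_in[OF N] in auto)

text \<open>This is the composition of holonomies. If the base point of the circle lies between the new node and
  the next one, the lift used on the first part is shifted by full turns.\<close>

lemma diagram_sum_insert:
  assumes K: "virtual_link_diagram K" and \<theta>: "tangent_lift K \<theta>" and N: "admissible K N"
    and Q: "Q \<in> source K"
  shows "diagram_sum K (insert Q N) \<theta> = diagram_sum K N \<theta>"
proof (cases "Q \<in> N")
  case False
  have cn: "circle_nodes (comps K) N" and dp: "double_points K \<subseteq> N" using N by (auto simp: admissible_def)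
  have Q': "Q \<in> {..<comps K} \<times> {0..<1}" using Q by (simp add: source_def)
  then have j: "fst Q < comps K" by auto
  have cn': "circle_nodes (comps K) (insert Q N)" using cn Q' by (auto simp: circle_nodes_def)
  obtain R where R: "R \<in> N" "prev_node (insert Q N) R = Q" "prev_node (insert Q N) Q = prev_node N R"
    "fst R = fst Q"
    "before (insert Q N) (fst Q) (before (insert Q N) (fst Q) (snd R)) = before N (fst Q) (snd R)"
    "\<And>P. P \<in> N \<Longrightarrow> P \<noteq> R \<Longrightarrow> before (insert Q N) (fst P) (snd P) = before N (fst P) (snd P)"
    using prev_node_insert[OF cn Q' False] by metis
  let ?H = "\<lambda>N P. arc_hol N \<theta> (fst P) (snd P)"
  have fin: "finite N" using cn by (simp add: circle_nodes_def)
  have Qd: "Q \<notin> double_points K" using False dp by auto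
  have "node_tensor K (insert Q N) = (\<lambda>\<gamma>. one (fst (\<gamma> Q)) (snd (\<gamma> Q)) * node_tensor K N \<gamma>)"
    using False fin Qd by (simp add: node_tensor_def fun_eq_iff insert_Diff_if mult.assoc)
  moreover have "state_sum (insert Q N) (prev_node (insert Q N)) (?H (insert Q N))
      (\<lambda>\<gamma>. one (fst (\<gamma> Q)) (snd (\<gamma> Q)) * node_tensor K N \<gamma>) = state_sum N (prev_node N) (?H N) (node_tensor K N)"
  proof (rule state_sum_insert[where R=R])
    show "prev_node N P \<in> N" if "P \<in> N" for P using prev_node_in[OF cn that] .
    show "prev_node (insert Q N) P = prev_node N P" if "P \<in> N" "P \<noteq> R" for P
      using R(6)[OF that] by (simp add: prev_node_def)
    show "?H (insert Q N) P = ?H N P" if "P \<in> N" "P \<noteq> R" for P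
      using R(6)[OF that] by (simp add: arc_hol_def)
    let ?s = "before (insert Q N) (fst Q) (snd R)"
    have "frac ?s = snd Q" using R(2,4) by (cases Q) (simp add: prev_node_def)
    then have "?s = snd Q + of_int \<lfloor>?s\<rfloor>" by (simp add: frac_def)
    then have "arc_hol (insert Q N) \<theta> (fst Q) ?s = arc_hol (insert Q N) \<theta> (fst Q) (snd Q)"
      using arc_hol_shift[OF K \<theta> j cn', of "snd Q" "\<lfloor>?s\<rfloor>"] by simp
    then have "arc_hol (insert Q N) \<theta> (fst Q) (snd Q) =
        hol (sector (\<theta> (fst Q) (before N (fst Q) (snd R)))) (sector (\<theta> (fst Q) ?s))"
      by (simp add: arc_hol_def[of _ _ _ ?s] R(5))
    then show "?H N R = mat_mul (?H (insert Q N) Q) (?H (insert Q N) R)"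
      unfolding R(4) by (simp add: arc_hol_def[of _ _ _ "snd R"])
    show "finite N" "Q \<notin> N" "R \<in> N" by fact+
    show "prev_node (insert Q N) R = Q" "prev_node (insert Q N) Q = prev_node N R" by fact+
    show "node_tensor K N \<gamma> = node_tensor K N \<gamma>'" if "\<And>P. P \<in> N \<Longrightarrow> \<gamma> P = \<gamma>' P" for \<gamma> \<gamma>'
    proof -
      have "P \<in> N \<and> Q \<in> N" if "(P, Q) \<in> cross K" for P Q
        using crossD[OF that] dp by auto
      then show ?thesis using that unfolding node_tensor_def lab_up_def lab_down_def
        by (intro arg_cong2[where f="(*)"] prod.cong refl) (auto split: prod.split)
    qed
  qed
  ultimately show ?thesis by (simp add: diagram_sum_def)
qed (simp add: insert_absorb)

lemma diagram_sum_nodes: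
  assumes K: "virtual_link_diagram K" and \<theta>: "tangent_lift K \<theta>"
    and N: "admissible K N" and N': "admissible K N'"
  shows "diagram_sum K N \<theta> = diagram_sum K N' \<theta>"
proof -
  have *: "admissible K (N \<union> F) \<and> diagram_sum K (N \<union> F) \<theta> = diagram_sum K N \<theta>"
    if "finite F" "F \<subseteq> source K" "admissible K N" for N F
    using that
  proof (induction F rule: finite_induct)
    case (insert Q F)
    then have "admissible K (insert Q (N \<union> F))"
      by (auto simp: admissible_def circle_nodes_def source_def)
    then show ?case using insert diagram_sum_insert[OF K \<theta>, of "N \<union> F" Q] by simp
  qed simp
  have "finite N" "N \<subseteq> source K" "finite N'" "N' \<subseteq> source K"
    using N N' by (auto simp: admissible_def circle_nodes_def source_def)
  then show ?thesis using *[of N' N] *[of N N'] N N' by (simp add: Un_commute)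
qed

end

section \<open>Rotating a crossing\<close>

definition opp :: "passage \<Rightarrow> passage" where
  "opp x = (case x of Over \<Rightarrow> Under | Under \<Rightarrow> Over | Virt \<Rightarrow> Virt)"

lemma opp_simps [simp]: "opp Over = Under" "opp Under = Over" "opp Virt = Virt" "opp (opp x) = x"
  by (auto simp: opp_def split: passage.split)

text \<open>The label at the upper and at the lower end of a passage with direction in sector \<open>k\<close> and with labels \<open>x\<close>
  (arrival, departure).\<close>

definition end_up :: "int \<Rightarrow> 'i \<times> 'i \<Rightarrow> 'i" where
  "end_up k x = (if even k then snd x else fst x)"

definition end_down :: "int \<Rightarrow> 'i \<times> 'i \<Rightarrow> 'i" where
  "end_down k x = (if even k then fst x else snd x)"

lemma end_in [simp]: "x \<in> I \<times> I \<Longrightarrow> end_up k x \<in> I" "x \<in> I \<times> I \<Longrightarrow> end_down k x \<in> I"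
  by (auto simp: end_up_def end_down_def)

text \<open>A crossing slides past a maximum. Sliding replaces the branch that runs from lower right to upper
  left by the other one, and hence its type by the opposite one.\<close>

locale rotational_tensors = link_tensors I A B X
  for I :: "'i set" and A B :: "'i \<Rightarrow> 'i \<Rightarrow> 'k::comm_ring_1"
    and X :: "passage \<Rightarrow> 'i \<Rightarrow> 'i \<Rightarrow> 'i \<Rightarrow> 'i \<Rightarrow> 'k" +
  assumes rotate: "\<And>x a b c d. a \<in> I \<Longrightarrow> b \<in> I \<Longrightarrow> c \<in> I \<Longrightarrow> d \<in> I \<Longrightarrow>
    (\<Sum>i\<in>I. X (opp x) a i b c * A i d) = (\<Sum>i\<in>I. A b i * X x i a c d)"
begin

text \<open>The action of a change of basis on the two legs of a passage: \<open>g\<close> acts at the arrival, \<open>gi\<close> at the departure.\<close>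

definition leg_conj :: "('i \<Rightarrow> 'i \<Rightarrow> 'k) \<Rightarrow> ('i \<Rightarrow> 'i \<Rightarrow> 'k) \<Rightarrow> ('i \<times> 'i \<Rightarrow> 'k) \<Rightarrow> 'i \<times> 'i \<Rightarrow> 'k" where
  "leg_conj g gi F x' = (\<Sum>x\<in>I \<times> I. g (fst x') (fst x) * gi (snd x) (snd x') * F x)"

lemma leg_conj_leg_conj:
  assumes "x'' \<in> I \<times> I"
  shows "leg_conj g gi (leg_conj h hi F) x'' = leg_conj (mat_mul g h) (mat_mul hi gi) F x''"
proof -
  have "leg_conj g gi (leg_conj h hi F) x'' = (\<Sum>x\<in>I \<times> I. \<Sum>x'\<in>I \<times> I.
      (g (fst x'') (fst x') * h (fst x') (fst x)) * (hi (snd x) (snd x') * gi (snd x') (snd x'')) * F x)"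
    unfolding leg_conj_def sum_distrib_left by (subst sum.swap) (simp add: ac_simps)
  also have "\<dots> = (\<Sum>x\<in>I \<times> I. mat_mul g h (fst x'') (fst x) * mat_mul hi gi (snd x) (snd x'') * F x)"
  proof (intro sum.cong refl)
    fix x assume x: "x \<in> I \<times> I"
    have "mat_mul g h (fst x'') (fst x) * mat_mul hi gi (snd x) (snd x'') =
      (\<Sum>x'\<in>I \<times> I. (g (fst x'') (fst x') * h (fst x') (fst x)) * (hi (snd x) (snd x') * gi (snd x') (snd x'')))"
      using assms x by (auto simp: mat_mul_def sum_product sum.cartesian_product case_prod_unfold)
    then show "(\<Sum>x'\<in>I \<times> I. (g (fst x'') (fst x') * h (fst x') (fst x)) *
        (hi (snd x) (snd x') * gi (snd x') (snd x'')) * F x) =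
      mat_mul g h (fst x'') (fst x) * mat_mul hi gi (snd x) (snd x'') * F x"
      by (simp add: sum_distrib_right)
  qed
  finally show ?thesis by (simp add: leg_conj_def)
qed

lemma leg_conj_cong: "(\<And>x. x \<in> I \<times> I \<Longrightarrow> F x = F' x) \<Longrightarrow> leg_conj g gi F x' = leg_conj g gi F' x'"
  unfolding leg_conj_def by (intro sum.cong refl arg_cong2[where f="(*)"]) blast

lemma leg_conj_swap: "leg_conj g gi (\<lambda>x. leg_conj h hi (F x) y') x' = leg_conj h hi (\<lambda>y. leg_conj g gi (\<lambda>x. F x y) x') y'"
  unfolding leg_conj_def sum_distrib_left by (subst sum.swap) (simp add: ac_simps)

text \<open>The tensor of a crossing, given the sectors \<open>k\<close> and \<open>l\<close> of its two passages; the first one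
  has type \<open>p\<close> and runs from lower right to upper left.\<close>

definition left_tensor :: "int \<Rightarrow> int \<Rightarrow> passage \<Rightarrow> 'i \<times> 'i \<Rightarrow> 'i \<times> 'i \<Rightarrow> 'k" where
  "left_tensor k l p x y = X p (end_up k x) (end_up l y) (end_down l y) (end_down k x)"

text \<open>Solving the sliding relation for one of the two crossings expresses it as the rotation of the other one
  by a quarter turn, with a maximum and a minimum on two legs.\<close>

lemma rotate_tensor:
  assumes "a \<in> I" "b \<in> I" "c \<in> I" "d \<in> I"
  shows "X (opp p) a b c d = (\<Sum>f\<in>I. \<Sum>s\<in>I. B f b * A c s * X p s a d f)"
proof -
  have "(\<Sum>f\<in>I. \<Sum>s\<in>I. B f b * A c s * X p s a d f) = (\<Sum>f\<in>I. B f b * (\<Sum>s\<in>I. A c s * X p s a d f))"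
    by (simp add: sum_distrib_left mult.assoc)
  also have "\<dots> = (\<Sum>f\<in>I. B f b * (\<Sum>i\<in>I. X (opp p) a i c d * A i f))"
    using rotate assms by (intro sum.cong refl) simp
  also have "\<dots> = (\<Sum>i\<in>I. X (opp p) a i c d * (\<Sum>f\<in>I. A i f * B f b))"
    unfolding sum_distrib_left by (subst sum.swap) (simp add: ac_simps)
  also have "\<dots> = (\<Sum>i\<in>I. X (opp p) a i c d * kronecker i b)"
    using AB assms by (intro sum.cong refl) simp
  also have "\<dots> = X (opp p) a b c d"
    using finI assms by (simp add: kronecker_def if_distrib[where f="\<lambda>x. _ * x"] cong: if_cong)
  finally show ?thesis ..
qed

text \<open>When a passage turns counterclockwise through the horizontal, the other passage becomes the one
  from lower right to upper left.\<close>

lemma left_tensor_turn: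
  assumes x': "x' \<in> I \<times> I" and y: "y \<in> I \<times> I"
  shows "left_tensor l (k + 1) (opp p) y x' = leg_conj (hol (k + 1) k) (hol k (k + 1)) (\<lambda>x. left_tensor k l p x y) x'"
proof -
  have l: "fst x' \<in> I" "snd x' \<in> I" "end_up l y \<in> I" "end_down l y \<in> I" using assms by auto
  show ?thesis
  proof (cases "even k")
    case True
    have "leg_conj (hol (k + 1) k) (hol k (k + 1)) (\<lambda>x. left_tensor k l p x y) x' =
      (\<Sum>x\<in>I \<times> I. B (fst x) (fst x') * A (snd x') (snd x) * X p (snd x) (end_up l y) (end_down l y) (fst x))"
      unfolding leg_conj_def hol_step hol_step_inv using True l
      by (intro sum.cong refl) (auto simp: step_def step_inv_def left_tensor_def end_up_def end_down_def)
    also have "\<dots> = X (opp p) (end_up l y) (fst x') (snd x') (end_down l y)"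
      using l by (subst rotate_tensor) (simp_all add: sum.cartesian_product case_prod_unfold)
    finally show ?thesis using True by (simp add: left_tensor_def end_up_def[of "k + 1"] end_down_def[of "k + 1"])
  next
    case False
    have "leg_conj (hol (k + 1) k) (hol k (k + 1)) (\<lambda>x. left_tensor k l p x y) x' =
      (\<Sum>x\<in>I \<times> I. B (snd x) (snd x') * A (fst x') (fst x) * X p (fst x) (end_up l y) (end_down l y) (snd x))"
      unfolding leg_conj_def hol_step hol_step_inv using False l
      by (intro sum.cong refl) (auto simp: step_def step_inv_def left_tensor_def end_up_def end_down_def)
    also have "\<dots> = (\<Sum>s\<in>I. \<Sum>f\<in>I. B f (snd x') * A (fst x') s * X p s (end_up l y) (end_down l y) f)"
      by (simp add: sum.cartesian_product case_prod_unfold)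
    also have "\<dots> = X (opp p) (end_up l y) (snd x') (fst x') (end_down l y)"
      using l by (subst rotate_tensor, simp_all) (rule sum.swap)
    finally show ?thesis using False by (simp add: left_tensor_def end_up_def[of "k + 1"] end_down_def[of "k + 1"])
  qed
qed

text \<open>Let \<open>m\<close> be the sector of the angle from the second passage to the first one. If the sectors of the passages
  differ by \<open>m\<close>, the first one runs from lower right to upper left; otherwise they differ by \<open>m + 1\<close>, and the
  second one does.\<close>

definition sector_tensor :: "int \<Rightarrow> int \<Rightarrow> int \<Rightarrow> passage \<Rightarrow> 'i \<times> 'i \<Rightarrow> 'i \<times> 'i \<Rightarrow> 'k" where
  "sector_tensor m k l p x y =
     (if k - l = m then left_tensor k l p x y else left_tensor l k (opp p) y x)"

text \<open>The legs are conjugated so that both passages are referred to sector \<open>0\<close>.\<close>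

definition normal_tensor :: "int \<Rightarrow> int \<Rightarrow> int \<Rightarrow> passage \<Rightarrow> 'i \<times> 'i \<Rightarrow> 'i \<times> 'i \<Rightarrow> 'k" where
  "normal_tensor m k l p x' y' =
     leg_conj (hol 0 k) (hol k 0) (\<lambda>x. leg_conj (hol 0 l) (hol l 0) (\<lambda>y. sector_tensor m k l p x y) y') x'"

lemma normal_tensor_turn1:
  assumes "x' \<in> I \<times> I" "y' \<in> I \<times> I"
  shows "normal_tensor m (l + m + 1) l p x' y' = normal_tensor m (l + m) l p x' y'"
proof -
  let ?k = "l + m"
  let ?F = "\<lambda>x. leg_conj (hol 0 l) (hol l 0) (\<lambda>y. left_tensor ?k l p x y) y'"
  have turn: "leg_conj (hol 0 l) (hol l 0) (\<lambda>y. left_tensor l (?k + 1) (opp p) y x) y' =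
      leg_conj (hol (?k + 1) ?k) (hol ?k (?k + 1)) ?F x" if x: "x \<in> I \<times> I" for x
  proof -
    have "leg_conj (hol 0 l) (hol l 0) (\<lambda>y. left_tensor l (?k + 1) (opp p) y x) y' =
      leg_conj (hol 0 l) (hol l 0) (\<lambda>y. leg_conj (hol (?k + 1) ?k) (hol ?k (?k + 1)) (\<lambda>x. left_tensor ?k l p x y) x) y'"
      by (rule leg_conj_cong) (rule left_tensor_turn[OF x])
    then show ?thesis by (simp only: leg_conj_swap[of "hol (?k + 1) ?k" _ "hol 0 l" _ "left_tensor ?k l p"])
  qed
  have "normal_tensor m (?k + 1) l p x' y' = leg_conj (hol 0 (?k + 1)) (hol (?k + 1) 0)
      (\<lambda>x. leg_conj (hol 0 l) (hol l 0) (\<lambda>y. left_tensor l (?k + 1) (opp p) y x) y') x'"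
    by (simp add: normal_tensor_def sector_tensor_def)
  also have "\<dots> = leg_conj (hol 0 (?k + 1)) (hol (?k + 1) 0) (leg_conj (hol (?k + 1) ?k) (hol ?k (?k + 1)) ?F) x'"
    by (rule leg_conj_cong) (rule turn)
  also have "\<dots> = leg_conj (hol 0 ?k) (hol ?k 0) ?F x'"
    using assms by (simp add: leg_conj_leg_conj)
  finally show ?thesis by (simp add: normal_tensor_def sector_tensor_def)
qed

lemma normal_tensor_turn2:
  assumes "x' \<in> I \<times> I" "y' \<in> I \<times> I"
  shows "normal_tensor m (l + m + 1) (l + 1) p x' y' = normal_tensor m (l + m + 1) l p x' y'"
proof -
  let ?k = "l + m + 1"
  have "normal_tensor m ?k (l + 1) p x' y' =
    leg_conj (hol 0 ?k) (hol ?k 0) (\<lambda>x. leg_conj (hol 0 (l + 1)) (hol (l + 1) 0)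
      (leg_conj (hol (l + 1) l) (hol l (l + 1)) (\<lambda>y. left_tensor l ?k (opp p) y x)) y') x'"
  proof -
    have "left_tensor ?k (l + 1) p x y =
        leg_conj (hol (l + 1) l) (hol l (l + 1)) (\<lambda>y. left_tensor l ?k (opp p) y x) y"
      if "x \<in> I \<times> I" "y \<in> I \<times> I" for x y
      using left_tensor_turn[OF that(2,1), of ?k l "opp p"] by simp
    then show ?thesis
      unfolding normal_tensor_def by (auto simp: sector_tensor_def intro!: leg_conj_cong)
  qed
  also have "\<dots> = leg_conj (hol 0 ?k) (hol ?k 0) (\<lambda>x. leg_conj (hol 0 l) (hol l 0) (\<lambda>y. left_tensor l ?k (opp p) y x) y') x'"
    using assms by (simp add: leg_conj_leg_conj)
  finally show ?thesis by (simp add: normal_tensor_def sector_tensor_def)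
qed

text \<open>Up to the changes of basis given by the holonomies, the tensor of a crossing depends only on its type and
  on the sector of the angle between its passages.\<close>

lemma normal_tensor_const:
  assumes "x' \<in> I \<times> I" "y' \<in> I \<times> I" and kl: "k - l = m \<or> k - l = m + 1"
  shows "normal_tensor m k l p x' y' = normal_tensor m m 0 p x' y'"
proof -
  have *: "normal_tensor m (l + m) l p x' y' = normal_tensor m m 0 p x' y'" for l
  proof (induction l rule: int_induct[where k=0])
    case (step1 i)
    have "normal_tensor m (i + 1 + m) (i + 1) p x' y' = normal_tensor m (i + m + 1) (i + 1) p x' y'"
      by (simp add: ac_simps)
    also have "\<dots> = normal_tensor m (i + m) i p x' y'"
      by (simp only: normal_tensor_turn2[OF assms(1,2)] normal_tensor_turn1[OF assms(1,2)])
    finally show ?case using step1 by simp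
  next
    case (step2 i)
    have "normal_tensor m (i - 1 + m) (i - 1) p x' y' = normal_tensor m (i - 1 + m + 1) (i - 1 + 1) p x' y'"
      by (simp only: normal_tensor_turn2[OF assms(1,2)] normal_tensor_turn1[OF assms(1,2)])
    then show ?case using step2 by simp
  qed simp
  from kl show ?thesis
  proof
    assume "k - l = m"
    then have "k = l + m" by simp
    then show ?thesis using * by simp
  next
    assume "k - l = m + 1"
    then have "k = l + m + 1" by simp
    then show ?thesis using * normal_tensor_turn1[OF assms(1,2)] by simp
  qed
qed

end

section \<open>Normal form of the state sum\<close>

text \<open>The two passages of a crossing are ordered by their position in the source and not by their directions
  in the plane, because the latter change in an isotopy.\<close>

definition node_less :: "nat \<times> real \<Rightarrow> nat \<times> real \<Rightarrow> bool" where
  "node_less P Q \<longleftrightarrow> fst P < fst Q \<or> (fst P = fst Q \<and> snd P < snd Q)"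

lemma node_less_linear: "P \<noteq> Q \<Longrightarrow> node_less P Q \<longleftrightarrow> \<not> node_less Q P"
  by (cases P; cases Q) (auto simp: node_less_def)

definition pairs :: "virtual_link_data \<Rightarrow> ((nat \<times> real) \<times> (nat \<times> real)) set" where
  "pairs K = {(P, Q). double K P Q \<and> node_less P Q}"

definition angle :: "(nat \<Rightarrow> real \<Rightarrow> real) \<Rightarrow> nat \<times> real \<Rightarrow> real" where
  "angle \<theta> P = \<theta> (fst P) (snd P)"

lemma wedge_antisym: "wedge z w = - wedge w z"
  by (simp add: wedge_def)

lemma up_vec_direction:
  assumes "direction z x"
  shows "\<exists>r>0. up_vec z = of_real r * cis (x - of_int (sector x) * pi)"
proof -
  obtain r where r: "r > 0" "z = of_real r * cis x" using assms by (auto simp: direction_def)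
  have "cis x = (if even (sector x) then cis (x - of_int (sector x) * pi) else - cis (x - of_int (sector x) * pi))"
    using cis_int_pi[of "sector x" "x - of_int (sector x) * pi"] by simp
  moreover have "up_vec z = (if even (sector x) then z else - z)"
    by (simp add: up_vec_def upward_direction[OF assms])
  ultimately have "up_vec z = of_real r * cis (x - of_int (sector x) * pi)"
    using r(2) by (auto split: if_splits)
  then show ?thesis using r(1) by blast
qed

lemma wedge_polar: "wedge (of_real r * cis x) (of_real s * cis y) = r * s * sin (y - x)"
  by (simp add: wedge_def sin_diff algebra_simps)

text \<open>Reducing both angles modulo \<open>\<pi>\<close> gives the angles of the two branches, traversed upwards; which of these is
  greater decides both the kind of the crossing and the rounding of the difference.\<close>

lemma sector_diff:
  assumes x: "direction z x" and y: "direction w y" and nz: "wedge z w \<noteq> 0"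
  shows "if wedge (up_vec w) (up_vec z) > 0 then sector x - sector y = sector (x - y)
     else sector x - sector y = sector (x - y) + 1" "wedge (up_vec w) (up_vec z) \<noteq> 0"
proof -
  define k l where "k = sector x" and "l = sector y"
  define a b where "a = x - of_int k * pi" and "b = y - of_int l * pi"
  have a: "0 \<le> a" "a < pi" using sector_eq_iff[of x k] by (auto simp: a_def k_def algebra_simps)
  have b: "0 \<le> b" "b < pi" using sector_eq_iff[of y l] by (auto simp: b_def l_def algebra_simps)
  obtain r s where rs: "r > 0" "s > 0" "up_vec z = of_real r * cis a" "up_vec w = of_real s * cis b"
    using up_vec_direction[OF x] up_vec_direction[OF y] by (auto simp: a_def b_def k_def l_def)
  have w: "wedge (up_vec w) (up_vec z) = s * r * sin (a - b)" using rs by (simp add: wedge_polar)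
  have "wedge (up_vec w) (up_vec z) = wedge z w \<or> wedge (up_vec w) (up_vec z) = - wedge z w"
    by (auto simp: up_vec_def wedge_def)
  then show nz': "wedge (up_vec w) (up_vec z) \<noteq> 0" using nz by auto
  then have ab: "a \<noteq> b" using w by auto
  show "if wedge (up_vec w) (up_vec z) > 0 then sector x - sector y = sector (x - y)
     else sector x - sector y = sector (x - y) + 1"
  proof (cases "a > b")
    case True
    have "sin (a - b) > 0" using a b True by (intro sin_gt_zero) auto
    then have "wedge (up_vec w) (up_vec z) > 0" using w rs by simp
    moreover have "sector (x - y) = k - l" using True a b unfolding sector_eq_iff a_def b_def by (simp add: algebra_simps)
    ultimately show ?thesis by (simp add: k_def l_def)
  next
    case False
    have "sin (b - a) > 0" using a b False ab by (intro sin_gt_zero) auto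
    then have "sin (a - b) < 0" using sin_minus[of "b - a"] by simp
    then have "wedge (up_vec w) (up_vec z) < 0" using w rs by (simp add: mult_pos_neg)
    moreover have "sector (x - y) = k - l - 1"
      using False a b ab unfolding sector_eq_iff a_def b_def by (simp add: algebra_simps)
    ultimately show ?thesis by (simp add: k_def l_def)
  qed
qed

lemma diagram_double:
  assumes "virtual_link_diagram K" "double K P Q"
  shows "wedge (tangent K P) (tangent K Q) \<noteq> 0" "mark K Q = opp (mark K P)"
    "double K P Q' \<Longrightarrow> Q' = Q"
proof -
  show "wedge (tangent K P) (tangent K Q) \<noteq> 0"
    using assms unfolding virtual_link_diagram_def by blast
  have "(mark K P, mark K Q) \<in> {(Over, Under), (Under, Over), (Virt, Virt)}"
    using assms unfolding virtual_link_diagram_def by blast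
  then show "mark K Q = opp (mark K P)" by auto
  show "double K P Q' \<Longrightarrow> Q' = Q"
    using assms unfolding virtual_link_diagram_def by blast
qed

lemma finite_double_points: "virtual_link_diagram K \<Longrightarrow> finite (double_points K)"
  by (simp add: virtual_link_diagram_def)

lemma tangent_direction:
  assumes "tangent_lift K \<theta>" "P \<in> source K"
  shows "direction (tangent K P) (angle \<theta> P)"
  using assms by (auto simp: tangent_lift_def tangent_def angle_def source_def)

lemma pairs_finite: "virtual_link_diagram K \<Longrightarrow> finite (pairs K)"
  by (rule finite_subset[of _ "double_points K \<times> double_points K"])
    (auto simp: pairs_def finite_double_points dest: doubleD)

lemma prod_cross:
  fixes f :: "_ \<Rightarrow> _ \<Rightarrow> 'k::comm_monoid_mult"
  assumes K: "virtual_link_diagram K"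
  shows "(\<Prod>(P, Q)\<in>cross K. f P Q) = (\<Prod>(P, Q)\<in>pairs K. if (P, Q) \<in> cross K then f P Q else f Q P)"
proof -
  obtain \<theta> where \<theta>: "tangent_lift K \<theta>" using ex_tangent_lift[OF K] ..
  have one_of: "(P, Q) \<in> cross K \<longleftrightarrow> (Q, P) \<notin> cross K" if d: "double K P Q" for P Q
  proof -
    have "P \<in> source K" "Q \<in> source K" using d by (auto simp: double_def)
    from sector_diff(2)[OF this[THEN tangent_direction[OF \<theta>]] diagram_double(1)[OF K d]]
    show ?thesis
      using d double_sym[OF d] wedge_antisym[of "up_vec (tangent K Q)" "up_vec (tangent K P)"]
      by (auto simp: cross_def)
  qed
  let ?s = "\<lambda>(P, Q). if node_less P Q then (P, Q) else (Q, P)"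
  let ?t = "\<lambda>(P, Q). if (P, Q) \<in> cross K then (P, Q) else (Q, P)"
  show ?thesis
  proof (rule prod.reindex_bij_witness[of _ ?t ?s])
    fix c assume c: "c \<in> cross K"
    obtain P Q where PQ: "c = (P, Q)" by (cases c)
    have d: "double K P Q" "P \<noteq> Q" using crossD c by (auto simp: PQ)
    then show "?t (?s c) = c" using c one_of[OF d(1)] by (auto simp: PQ)
    show "?s c \<in> pairs K"
      using d node_less_linear[OF d(2)] double_sym[OF d(1)] by (simp add: PQ pairs_def)
    show "(case ?s c of (P, Q) \<Rightarrow> if (P, Q) \<in> cross K then f P Q else f Q P) = (case c of (P, Q) \<Rightarrow> f P Q)"
      using c one_of[OF d(1)] by (auto simp: PQ)
  next
    fix c assume c: "c \<in> pairs K"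
    obtain P Q where PQ: "c = (P, Q)" by (cases c)
    have d: "double K P Q" "node_less P Q" using c by (auto simp: PQ pairs_def)
    then have "P \<noteq> Q" by (auto simp: double_def)
    then have "\<not> node_less Q P" using d node_less_linear by blast
    then show "?s (?t c) = c" using d by (auto simp: PQ)
    show "?t c \<in> cross K" using one_of[OF d(1)] by (auto simp: PQ)
  qed
qed

context rotational_tensors
begin

lemma node_tensor_pairs:
  assumes K: "virtual_link_diagram K" and \<theta>: "tangent_lift K \<theta>"
  shows "node_tensor K N \<gamma> = (\<Prod>P\<in>N - double_points K. one (fst (\<gamma> P)) (snd (\<gamma> P))) *
    (\<Prod>(P, Q)\<in>pairs K. sector_tensor (sector (angle \<theta> P - angle \<theta> Q))
       (sector (angle \<theta> P)) (sector (angle \<theta> Q)) (mark K P) (\<gamma> P) (\<gamma> Q))"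
  unfolding node_tensor_def prod_cross[OF K]
proof (intro arg_cong2[where f="(*)"] prod.cong refl)
  fix c assume c: "c \<in> pairs K"
  obtain P Q where PQ: "c = (P, Q)" by (cases c)
  have d: "double K P Q" using c by (auto simp: PQ pairs_def)
  have s: "P \<in> source K" "Q \<in> source K" using d by (auto simp: double_def)
  note dir = s[THEN tangent_direction[OF \<theta>]]
  have lab: "lab_up K \<gamma> P = end_up (sector (angle \<theta> P)) (\<gamma> P)"
    "lab_up K \<gamma> Q = end_up (sector (angle \<theta> Q)) (\<gamma> Q)"
    "lab_down K \<gamma> P = end_down (sector (angle \<theta> P)) (\<gamma> P)"
    "lab_down K \<gamma> Q = end_down (sector (angle \<theta> Q)) (\<gamma> Q)"
    using dir by (simp_all add: lab_up_def lab_down_def end_up_def end_down_def upward_direction)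
  note sd = sector_diff(1)[OF dir diagram_double(1)[OF K d]]
  show "(case c of (P, Q) \<Rightarrow> if (P, Q) \<in> cross K
      then X (mark K P) (lab_up K \<gamma> P) (lab_up K \<gamma> Q) (lab_down K \<gamma> Q) (lab_down K \<gamma> P)
      else X (mark K Q) (lab_up K \<gamma> Q) (lab_up K \<gamma> P) (lab_down K \<gamma> P) (lab_down K \<gamma> Q)) =
    (case c of (P, Q) \<Rightarrow> sector_tensor (sector (angle \<theta> P - angle \<theta> Q))
       (sector (angle \<theta> P)) (sector (angle \<theta> Q)) (mark K P) (\<gamma> P) (\<gamma> Q))"
    using sd d diagram_double(2)[OF K d]
    by (auto simp: PQ cross_def lab sector_tensor_def left_tensor_def split: if_splits)
qed

lemma conj_node_tensor:
  assumes K: "virtual_link_diagram K" and N: "admissible K N" and \<gamma>': "\<gamma>' \<in> N \<rightarrow>\<^sub>E I \<times> I"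
    and g: "\<And>P. P \<in> N - double_points K \<Longrightarrow> mat_mul (g P) (gi P) = one"
  shows "(\<Sum>\<gamma>\<in>N \<rightarrow>\<^sub>E I \<times> I.
      (\<Prod>P\<in>N. g P (fst (\<gamma>' P)) (fst (\<gamma> P)) * gi P (snd (\<gamma> P)) (snd (\<gamma>' P))) *
      ((\<Prod>P\<in>N - double_points K. one (fst (\<gamma> P)) (snd (\<gamma> P))) * (\<Prod>(P, Q)\<in>pairs K. t (P, Q) (\<gamma> P) (\<gamma> Q)))) =
    (\<Prod>P\<in>N - double_points K. one (fst (\<gamma>' P)) (snd (\<gamma>' P))) *
    (\<Prod>(P, Q)\<in>pairs K. leg_conj (g P) (gi P) (\<lambda>x. leg_conj (g Q) (gi Q) (\<lambda>y. t (P, Q) x y) (\<gamma>' Q)) (\<gamma>' P))"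
proof -
  have dp: "double_points K = (\<Union>(P, Q)\<in>pairs K. {P, Q})"
  proof (intro equalityI subsetI)
    fix P assume "P \<in> double_points K"
    then obtain Q where Q: "double K P Q" by (auto simp: double_points_def)
    then have "P \<noteq> Q" by (auto simp: double_def)
    then have "(P, Q) \<in> pairs K \<or> (Q, P) \<in> pairs K"
      using Q double_sym[OF Q] node_less_linear[of P Q] unfolding pairs_def by blast
    then show "P \<in> (\<Union>(P, Q)\<in>pairs K. {P, Q})" by auto
  qed (auto simp: pairs_def dest: doubleD)
  have "(\<Sum>\<gamma>\<in>N \<rightarrow>\<^sub>E I \<times> I.
      (\<Prod>P\<in>N. g P (fst (\<gamma>' P)) (fst (\<gamma> P)) * gi P (snd (\<gamma> P)) (snd (\<gamma>' P))) *
      ((\<Prod>P\<in>N - double_points K. one (fst (\<gamma> P)) (snd (\<gamma> P))) * (\<Prod>(P, Q)\<in>pairs K. t (P, Q) (\<gamma> P) (\<gamma> Q)))) =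
    (\<Prod>P\<in>N - double_points K. one (fst (\<gamma>' P)) (snd (\<gamma>' P))) *
    (\<Prod>(P, Q)\<in>pairs K. \<Sum>x\<in>I \<times> I. \<Sum>y\<in>I \<times> I.
      (g P (fst (\<gamma>' P)) (fst x) * gi P (snd x) (snd (\<gamma>' P))) *
      (g Q (fst (\<gamma>' Q)) (fst y) * gi Q (snd y) (snd (\<gamma>' Q))) * t (P, Q) x y)"
  proof (rule conj_blocks[OF _ pairs_finite[OF K] _ _ _ g \<gamma>'])
    show "finite (N - double_points K)" using N by (simp add: admissible_def circle_nodes_def)
    show "N = N - double_points K \<union> (\<Union>(P, Q)\<in>pairs K. {P, Q})"
      using N dp by (auto simp: admissible_def)
    show "P \<noteq> Q \<and> P \<notin> N - double_points K \<and> Q \<notin> N - double_points K" if "(P, Q) \<in> pairs K" for P Q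
      using that doubleD[of K P Q] by (auto simp: pairs_def double_def)
    show "{P, Q} \<inter> {P', Q'} = {}"
      if "(P, Q) \<in> pairs K" "(P', Q') \<in> pairs K" "(P, Q) \<noteq> (P', Q')" for P Q P' Q'
    proof -
      have d: "double K P Q" "double K Q P" "double K P' Q'" "double K Q' P'" "node_less P Q" "node_less P' Q'"
        using that double_sym[of K P Q] double_sym[of K P' Q'] by (auto simp: pairs_def)
      then have "P \<noteq> Q" by (auto simp: double_def)
      then show ?thesis using d that(3) node_less_linear[of P Q] diagram_double(3)[OF K] by blast
    qed
  qed
  then show ?thesis by (simp add: leg_conj_def sum_distrib_left mult.assoc)
qed

text \<open>The change of basis at each node by the holonomy from sector \<open>0\<close> to the sector of its direction. On the
  arcs only the full turns \<open>w\<close> remain, which come from passing the base point of the circle.\<close>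

lemma diagram_sum_normal_form:
  assumes K: "virtual_link_diagram K" and \<theta>: "tangent_lift K \<theta>" and N: "admissible K N"
    and w: "\<And>P. P \<in> N \<Longrightarrow> \<theta> (fst P) (before N (fst P) (snd P)) =
      angle \<theta> (prev_node N P) + 2 * pi * of_int (w P)"
  shows "diagram_sum K N \<theta> = state_sum N (prev_node N) (\<lambda>P. hol (2 * w P) 0)
    (\<lambda>\<gamma>. (\<Prod>P\<in>N - double_points K. one (fst (\<gamma> P)) (snd (\<gamma> P))) *
      (\<Prod>(P, Q)\<in>pairs K. normal_tensor (sector (angle \<theta> P - angle \<theta> Q))
         (sector (angle \<theta> P - angle \<theta> Q)) 0 (mark K P) (\<gamma> P) (\<gamma> Q)))"
proof -
  have cn: "circle_nodes (comps K) N" using N by (simp add: admissible_def)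
  have fin: "finite N" using cn by (simp add: circle_nodes_def)
  let ?k = "\<lambda>P. sector (angle \<theta> P)"
  let ?m = "\<lambda>P Q. sector (angle \<theta> P - angle \<theta> Q)"
  have "diagram_sum K N \<theta> = state_sum N (prev_node N) (\<lambda>P. hol (2 * w P) 0)
    (\<lambda>\<gamma>'. \<Sum>\<gamma>\<in>N \<rightarrow>\<^sub>E I \<times> I. (\<Prod>P\<in>N. hol 0 (?k P) (fst (\<gamma>' P)) (fst (\<gamma> P)) *
       hol (?k P) 0 (snd (\<gamma> P)) (snd (\<gamma>' P))) * node_tensor K N \<gamma>)"
    unfolding diagram_sum_def
  proof (rule state_sum_gauge[OF fin prev_node_bij[OF cn]])
    fix P assume P: "P \<in> N"
    have "sector (\<theta> (fst P) (before N (fst P) (snd P))) = ?k (prev_node N P) + 2 * w P"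
      unfolding w[OF P] by (rule sector_shift)
    then have "arc_hol N \<theta> (fst P) (snd P) = hol (?k (prev_node N P) + 2 * w P) (?k P)"
      by (simp add: arc_hol_def angle_def)
    moreover have "hol (?k (prev_node N P)) 0 = hol (?k (prev_node N P) + 2 * w P) (2 * w P)"
      using hol_periodic[of "?k (prev_node N P)" "w P" 0] by simp
    ultimately show "arc_hol N \<theta> (fst P) (snd P) =
        mat_mul (hol (?k (prev_node N P)) 0) (mat_mul (hol (2 * w P) 0) (hol 0 (?k P)))"
      by simp
  qed
  also have "\<dots> = state_sum N (prev_node N) (\<lambda>P. hol (2 * w P) 0)
    (\<lambda>\<gamma>. (\<Prod>P\<in>N - double_points K. one (fst (\<gamma> P)) (snd (\<gamma> P))) *
      (\<Prod>(P, Q)\<in>pairs K. normal_tensor (?m P Q) (?m P Q) 0 (mark K P) (\<gamma> P) (\<gamma> Q)))"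
  proof (rule state_sum_cong)
    fix \<gamma>' assume g': "\<gamma>' \<in> N \<rightarrow>\<^sub>E I \<times> I"
    have "(\<Sum>\<gamma>\<in>N \<rightarrow>\<^sub>E I \<times> I. (\<Prod>P\<in>N. hol 0 (?k P) (fst (\<gamma>' P)) (fst (\<gamma> P)) *
        hol (?k P) 0 (snd (\<gamma> P)) (snd (\<gamma>' P))) * node_tensor K N \<gamma>) =
      (\<Prod>P\<in>N - double_points K. one (fst (\<gamma>' P)) (snd (\<gamma>' P))) *
      (\<Prod>(P, Q)\<in>pairs K. normal_tensor (?m P Q) (?k P) (?k Q) (mark K P) (\<gamma>' P) (\<gamma>' Q))"
      unfolding node_tensor_pairs[OF K \<theta>] normal_tensor_def
      using conj_node_tensor[OF K N g', of "\<lambda>P. hol 0 (?k P)" "\<lambda>P. hol (?k P) 0"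
          "\<lambda>(P, Q). sector_tensor (?m P Q) (?k P) (?k Q) (mark K P)"]
      by simp
    also have "\<dots> = (\<Prod>P\<in>N - double_points K. one (fst (\<gamma>' P)) (snd (\<gamma>' P))) *
      (\<Prod>(P, Q)\<in>pairs K. normal_tensor (?m P Q) (?m P Q) 0 (mark K P) (\<gamma>' P) (\<gamma>' Q))"
    proof (intro arg_cong2[where f="(*)"] prod.cong refl)
      fix c assume c: "c \<in> pairs K"
      obtain P Q where PQ: "c = (P, Q)" by (cases c)
      have d: "double K P Q" using c by (auto simp: PQ pairs_def)
      have s: "P \<in> source K" "Q \<in> source K" using d by (auto simp: double_def)
      have PN: "P \<in> N" "Q \<in> N" using doubleD[OF d] N by (auto simp: admissible_def)
      have l: "\<gamma>' P \<in> I \<times> I" "\<gamma>' Q \<in> I \<times> I" using g' PN by (auto simp: PiE_iff)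
      have "?k P - ?k Q = ?m P Q \<or> ?k P - ?k Q = ?m P Q + 1"
        using sector_diff(1)[OF s[THEN tangent_direction[OF \<theta>]] diagram_double(1)[OF K d]]
        by (auto split: if_splits)
      from normal_tensor_const[OF l this]
      show "(case c of (P, Q) \<Rightarrow> normal_tensor (?m P Q) (?k P) (?k Q) (mark K P) (\<gamma>' P) (\<gamma>' Q)) =
        (case c of (P, Q) \<Rightarrow> normal_tensor (?m P Q) (?m P Q) 0 (mark K P) (\<gamma>' P) (\<gamma>' Q))"
        by (simp add: PQ)
    qed
    finally show "(\<Sum>\<gamma>\<in>N \<rightarrow>\<^sub>E I \<times> I. (\<Prod>P\<in>N. hol 0 (?k P) (fst (\<gamma>' P)) (fst (\<gamma> P)) *
        hol (?k P) 0 (snd (\<gamma> P)) (snd (\<gamma>' P))) * node_tensor K N \<gamma>) = \<dots>" .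
  qed (use prev_node_in[OF cn] in auto)
  finally show ?thesis .
qed

text \<open>The state sum is determined by the Gauss diagram, the rotation numbers of the circles, and the
  sectors of the differences of the lifted tangent angles at the crossings. These are discrete, so that they do not
  change in an isotopy.\<close>

lemma diagram_sum_eqI:
  assumes K: "virtual_link_diagram K" and K': "virtual_link_diagram K'"
    and \<theta>: "tangent_lift K \<theta>" and \<theta>': "tangent_lift K' \<theta>'" and N: "admissible K N"
    and c: "comps K' = comps K" and d: "double K' = double K"
    and m: "\<And>P. P \<in> double_points K \<Longrightarrow> mark K' P = mark K P"
    and rot: "\<And>j t. j < comps K \<Longrightarrow> \<theta>' j (t + 1) - \<theta>' j t = \<theta> j (t + 1) - \<theta> j t"
    and sec: "\<And>P Q. double K P Q \<Longrightarrow>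
      sector (angle \<theta>' P - angle \<theta>' Q) = sector (angle \<theta> P - angle \<theta> Q)"
  shows "diagram_sum K' N \<theta>' = diagram_sum K N \<theta>"
proof -
  have N': "admissible K' N" using N c d by (simp add: admissible_def double_points_def)
  have cn: "circle_nodes (comps K) N" using N by (simp add: admissible_def)
  have shift: "\<theta>' j (t + of_int n) - \<theta>' j t = \<theta> j (t + of_int n) - \<theta> j t" if j: "j < comps K" for j t n
  proof -
    have "\<theta>' j (t + 1) - \<theta> j (t + 1) = \<theta>' j t - \<theta> j t" for t using rot[OF j, of t] by simp
    from int_shift[of "\<lambda>t. \<theta>' j t - \<theta> j t", OF this] show ?thesis by (simp add: algebra_simps)
  qed
  have "\<exists>w::int. \<theta> (fst P) (before N (fst P) (snd P)) = angle \<theta> (prev_node N P) + 2 * pi * of_int w"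
    if P: "P \<in> N" for P
  proof -
    have j: "fst P < comps K" using cn P by (auto simp: circle_nodes_def)
    let ?s = "before N (fst P) (snd P)"
    have "vector_derivative (curve K (fst P)) (at (frac ?s)) = vector_derivative (curve K (fst P)) (at ?s)"
      using derivative_periodic[OF K j] by (rule frac_shift[where f="\<lambda>t. vector_derivative (curve K (fst P)) (at t)"])
    then have "direction (vector_derivative (curve K (fst P)) (at ?s)) (angle \<theta> (prev_node N P))"
      using \<theta> j unfolding tangent_lift_def angle_def prev_node_def by (metis fst_conv snd_conv)
    moreover have "direction (vector_derivative (curve K (fst P)) (at ?s)) (\<theta> (fst P) ?s)"
      using \<theta> j by (simp add: tangent_lift_def)
    ultimately show ?thesis by (rule direction_unique)
  qed
  then obtain w :: "nat \<times> real \<Rightarrow> int" where w: "\<And>P. P \<in> N \<Longrightarrow>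
      \<theta> (fst P) (before N (fst P) (snd P)) = angle \<theta> (prev_node N P) + 2 * pi * of_int (w P)"
    by metis
  have w': "\<theta>' (fst P) (before N (fst P) (snd P)) = angle \<theta>' (prev_node N P) + 2 * pi * of_int (w P)"
    if P: "P \<in> N" for P
  proof -
    have j: "fst P < comps K" using cn P by (auto simp: circle_nodes_def)
    let ?s = "before N (fst P) (snd P)"
    have "?s = frac ?s + of_int \<lfloor>?s\<rfloor>" by (simp add: frac_def)
    then have "\<theta>' (fst P) ?s - \<theta>' (fst P) (frac ?s) = \<theta> (fst P) ?s - \<theta> (fst P) (frac ?s)"
      using shift[OF j, of "frac ?s" "\<lfloor>?s\<rfloor>"] by simp
    then show ?thesis using w[OF P] by (simp add: angle_def prev_node_def)
  qed
  have dp: "double_points K' = double_points K" "pairs K' = pairs K"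
    using d by (simp_all add: double_points_def pairs_def)
  let ?R = "\<lambda>L \<phi>. state_sum N (prev_node N) (\<lambda>P. hol (2 * w P) 0)
    (\<lambda>\<gamma>. (\<Prod>P\<in>N - double_points K. one (fst (\<gamma> P)) (snd (\<gamma> P))) *
      (\<Prod>(P, Q)\<in>pairs K. normal_tensor (sector (angle \<phi> P - angle \<phi> Q))
         (sector (angle \<phi> P - angle \<phi> Q)) 0 (mark L P) (\<gamma> P) (\<gamma> Q)))"
  have "diagram_sum K' N \<theta>' = ?R K' \<theta>'"
    using diagram_sum_normal_form[OF K' \<theta>' N', of w] w' unfolding dp by blast
  also have "\<dots> = ?R K \<theta>"
  proof (rule state_sum_cong, goal_cases)
    case (4 \<gamma>)
    show ?case
    proof (intro arg_cong2[where f="(*)"] prod.cong refl)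
      fix c assume "c \<in> pairs K"
      then obtain P Q where PQ: "c = (P, Q)" "double K P Q" by (auto simp: pairs_def)
      then show "(case c of (P, Q) \<Rightarrow> normal_tensor (sector (angle \<theta>' P - angle \<theta>' Q))
           (sector (angle \<theta>' P - angle \<theta>' Q)) 0 (mark K' P) (\<gamma> P) (\<gamma> Q)) =
        (case c of (P, Q) \<Rightarrow> normal_tensor (sector (angle \<theta> P - angle \<theta> Q))
           (sector (angle \<theta> P - angle \<theta> Q)) 0 (mark K P) (\<gamma> P) (\<gamma> Q))"
        using sec[OF PQ(2)] m[OF doubleD(1)[OF PQ(2)]] by simp
    qed
  qed (use prev_node_in[OF cn] in auto)
  also have "\<dots> = diagram_sum K N \<theta>"
    using diagram_sum_normal_form[OF K \<theta> N, of w] w by metis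
  finally show ?thesis .
qed

end

context link_tensors
begin

definition invariant :: "virtual_link_data \<Rightarrow> 'k" where
  "invariant K = diagram_sum K (SOME N. admissible K N) (SOME \<theta>. tangent_lift K \<theta>)"

lemma invariant_eq:
  assumes K: "virtual_link_diagram K" and "tangent_lift K \<theta>" "admissible K N"
  shows "invariant K = diagram_sum K N \<theta>"
proof -
  define N0 \<theta>0 where "N0 = (SOME N. admissible K N)" and "\<theta>0 = (SOME \<theta>. tangent_lift K \<theta>)"
  have N0: "admissible K N0" unfolding N0_def using ex_admissible[OF K] by (rule someI_ex)
  have "tangent_lift K \<theta>0" unfolding \<theta>0_def using ex_tangent_lift[OF K] by (rule someI_ex)
  then have "diagram_sum K N0 \<theta>0 = diagram_sum K N \<theta>"
    using diagram_sum_nodes[OF K _ N0 assms(3)] diagram_sum_lift[OF _ assms(2)] assms(3)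
    by (simp add: admissible_def)
  then show ?thesis by (simp add: invariant_def N0_def \<theta>0_def)
qed

end

section \<open>Planar isotopy\<close>

lemma sector_constant:
  fixes f :: "'a::topological_space \<Rightarrow> real"
  assumes "connected S" "continuous_on S f" "x \<in> S" "y \<in> S"
    and "\<And>z n. z \<in> S \<Longrightarrow> f z \<noteq> of_int n * pi"
  shows "sector (f x) = sector (f y)"
proof -
  have *: "\<not> sector (f x) < sector (f y)" if xy: "x \<in> S" "y \<in> S" for x y
  proof
    assume l: "sector (f x) < sector (f y)"
    define k where "k = sector (f y)"
    have "of_int k * pi \<le> f y" using sector_eq_iff[of "f y" k] by (simp add: k_def)
    moreover have "f x < of_int k * pi"
    proof -
      have "f x < (of_int (sector (f x)) + 1) * pi" using sector_eq_iff[of "f x" "sector (f x)"] by simp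
      also have "\<dots> = of_int (sector (f x) + 1) * pi" by simp
      also have "\<dots> \<le> of_int k * pi" using l unfolding k_def by (intro mult_right_mono) (simp_all only: of_int_le_iff, auto)
      finally show ?thesis .
    qed
    moreover have "connected (f ` S)" using assms(1,2) by (rule connected_continuous_image[rotated])
    ultimately have "of_int k * pi \<in> f ` S"
      using xy unfolding connected_iff_interval by (meson image_eqI less_imp_le)
    then show False using assms(5) by (metis imageE)
  qed
  show ?thesis using *[OF assms(3,4)] *[OF assms(4,3)] by simp
qed

lemma linear_complex_expand:
  fixes L :: "complex \<Rightarrow> complex"
  assumes "linear L" shows "L w = Re w *\<^sub>R L 1 + Im w *\<^sub>R L \<i>"
proof -
  have "w = Re w *\<^sub>R 1 + Im w *\<^sub>R \<i>" by (simp add: complex_eq_iff)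
  then have "L w = L (Re w *\<^sub>R 1 + Im w *\<^sub>R \<i>)" by simp
  then show ?thesis by (simp only: linear_add[OF assms] linear_scale[OF assms])
qed

lemma wedge_linear_inj:
  assumes L: "linear L" "inj L" and w: "wedge a b \<noteq> 0"
  shows "wedge (L a) (L b) \<noteq> 0"
proof
  assume 0: "wedge (L a) (L b) = 0"
  have eq: "Re (L b) *\<^sub>R L a = Re (L a) *\<^sub>R L b" "Im (L b) *\<^sub>R L a = Im (L a) *\<^sub>R L b"
    using 0 by (auto simp: complex_eq_iff wedge_def algebra_simps)
  have "y *\<^sub>R a = x *\<^sub>R b" if "y *\<^sub>R L a = x *\<^sub>R L b" for x y
  proof -
    have "L (y *\<^sub>R a) = L (x *\<^sub>R b)" using that by (simp add: linear_scale[OF L(1)])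
    then show ?thesis using L(2) by (simp add: inj_eq)
  qed
  from this[OF eq(1)] this[OF eq(2)]
  have h: "Re (L b) *\<^sub>R a = Re (L a) *\<^sub>R b" "Im (L b) *\<^sub>R a = Im (L a) *\<^sub>R b" by blast+
  have wz: "u * wedge a b = 0" if "u *\<^sub>R a = v *\<^sub>R b" for u v
  proof -
    have "u * wedge a b = wedge (u *\<^sub>R a) b" by (simp add: wedge_def algebra_simps)
    also have "\<dots> = 0" unfolding that by (simp add: wedge_def)
    finally show ?thesis .
  qed
  have "L b = 0" using wz[OF h(1)] wz[OF h(2)] w by (simp add: complex_eq_iff)
  then have "b = 0" using L linear_injective_0 by blast
  then show False using w by (simp add: wedge_def)
qed

lemma wedge_directions_zero:
  assumes "direction z x" "direction w y" "x - y = of_int n * pi"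
  shows "wedge z w = 0"
proof -
  obtain r s where "z = of_real r * cis x" "w = of_real s * cis y" using assms by (auto simp: direction_def)
  then have "wedge z w = r * s * sin (y - x)" by (simp add: wedge_polar)
  also have "y - x = - (pi * of_int n)" using assms(3) by (simp add: mult.commute)
  finally show ?thesis by (simp only: sin_minus sin_npi_int minus_zero mult_zero_right)
qed

lemma vector_derivative_compose:
  fixes h :: "complex \<Rightarrow> complex"
  assumes "(h has_derivative L) (at (c t))" "c differentiable at t"
  shows "vector_derivative (h \<circ> c) (at t) = L (vector_derivative c (at t))"
proof -
  have "(c has_derivative (\<lambda>x. x *\<^sub>R vector_derivative c (at t))) (at t)"
    using assms(2) by (simp add: vector_derivative_works has_vector_derivative_def)
  then have "((h \<circ> c) has_derivative (L \<circ> (\<lambda>x. x *\<^sub>R vector_derivative c (at t)))) (at t)"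
    using assms(1) by (rule diff_chain_at)
  moreover have "L \<circ> (\<lambda>x. x *\<^sub>R vector_derivative c (at t)) = (\<lambda>x. x *\<^sub>R L (vector_derivative c (at t)))"
    using has_derivative_linear[OF assms(1)] by (simp add: fun_eq_iff linear_scale)
  ultimately show ?thesis by (simp add: has_vector_derivative_def vector_derivative_at)
qed

context rotational_tensors
begin

text \<open>One continuous angle \<open>\<Theta>\<close> is chosen for the tangents of all diagrams of the isotopy at once, which is possible
  since the strip \<open>[0,1] \<times> \<real>\<close> is contractible. Rotation numbers are then constant because they are integral,
  and the sectors of the angle differences at the crossings because the tangents there remain linearly
  independent.\<close>

lemma invariant_planar_isotopy:
  assumes K: "virtual_link_diagram K" and K': "virtual_link_diagram K'" and iso: "planar_isotopy K K'"
  shows "invariant K' = invariant K"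
proof -
  obtain H where c: "comps K' = comps K" and H: "ambient_isotopy H"
    and crv: "\<And>j t. j < comps K \<Longrightarrow> curve K' j t = H 1 (curve K j t)"
    and mk: "\<And>P. P \<in> double_points K \<Longrightarrow> mark K' P = mark K P"
    using iso unfolding planar_isotopy_def by blast
  obtain D where H0: "\<And>z. H 0 z = z" and bijH: "\<And>s. s \<in> {0..1} \<Longrightarrow> bij (H s)"
    and D: "\<And>s z. s \<in> {0..1} \<Longrightarrow> (H s has_derivative D s z) (at z)"
    and Dinj: "\<And>s z. s \<in> {0..1} \<Longrightarrow> inj (D s z)"
    and Dcont: "\<And>w. continuous_on ({0..1} \<times> UNIV) (\<lambda>(s, z). D s z w)"
    using H unfolding ambient_isotopy_def by blast
  have Dlin: "linear (D s z)" if "s \<in> {0..1}" for s z using D[OF that] by (rule has_derivative_linear)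
  define v where "v j t = vector_derivative (curve K j) (at t)" for j t
  define V where "V j = (\<lambda>(s, t). D s (curve K j t) (v j t))" for j
  have S: "contractible ({0..1::real} \<times> (UNIV :: real set))"
    by (intro convex_imp_contractible convex_Times) auto
  have ccont: "continuous_on UNIV (curve K j)" if "j < comps K" for j
    using diagram_curve(4)[OF K that] differentiable_imp_continuous_within
    by (auto simp: continuous_on_eq_continuous_within)
  have Vcont: "continuous_on ({0..1} \<times> UNIV) (V j)" if j: "j < comps K" for j
  proof -
    have vc: "continuous_on UNIV (v j)" using diagram_curve(5)[OF K j] by (simp add: v_def)
    have 1: "continuous_on ({0..1} \<times> UNIV) (\<lambda>x. D (fst x) (curve K j (snd x)) w)" for w
    proof -
      have "continuous_on ({0..1} \<times> UNIV) (\<lambda>x::real \<times> real. (fst x, curve K j (snd x)))"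
        by (intro continuous_intros continuous_on_compose2[OF ccont[OF j]]) auto
      then have "continuous_on ({0..1} \<times> UNIV) (\<lambda>x. (\<lambda>(s, z). D s z w) (fst x, curve K j (snd x)))"
        by (rule continuous_on_compose2[OF Dcont]) auto
      then show ?thesis by simp
    qed
    have 2: "continuous_on ({0..1} \<times> UNIV) (\<lambda>x::real \<times> real. v j (snd x))"
      by (intro continuous_on_compose2[OF vc] continuous_intros) auto
    have "continuous_on ({0..1} \<times> UNIV) (\<lambda>x. Re (v j (snd x)) *\<^sub>R D (fst x) (curve K j (snd x)) 1 +
        Im (v j (snd x)) *\<^sub>R D (fst x) (curve K j (snd x)) \<i>)"
      by (intro continuous_intros 1 2)
    then show ?thesis
      by (rule continuous_on_eq) (auto simp: V_def linear_complex_expand[OF Dlin, symmetric])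
  qed
  have Vnz: "V j x \<noteq> 0" if j: "j < comps K" and x0: "x \<in> {0..1} \<times> UNIV" for j x
  proof -
    obtain s t where x: "x = (s, t)" "s \<in> {0..1}" using x0 by (elim SigmaE)
    have "v j t \<noteq> 0" using diagram_curve(3)[OF K j] by (simp add: v_def)
    then show ?thesis using Dlin[OF x(2)] Dinj[OF x(2)] linear_injective_0 by (auto simp: V_def x)
  qed
  have "\<exists>\<Theta>. continuous_on ({0..1} \<times> UNIV) \<Theta> \<and> (\<forall>x\<in>{0..1} \<times> UNIV. direction (V j x) (\<Theta> x))"
    if "j < comps K" for j
    using ex_direction_lift[OF S Vcont Vnz] that by blast
  then obtain \<Theta> where \<Theta>c: "\<And>j. j < comps K \<Longrightarrow> continuous_on ({0..1} \<times> UNIV) (\<Theta> j)"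
    and \<Theta>d: "\<And>j s t. j < comps K \<Longrightarrow> s \<in> {0..1} \<Longrightarrow> direction (V j (s, t)) (\<Theta> j (s, t))"
    by (metis SigmaI UNIV_I)
  have \<Theta>t: "continuous_on UNIV (\<lambda>t. \<Theta> j (s, t))" if "j < comps K" "s \<in> {0..1}" for j s
    using that by (intro continuous_on_compose2[OF \<Theta>c] continuous_intros) auto
  have \<Theta>s: "continuous_on {0..1} (\<lambda>s. \<Theta> j (s, t))" if "j < comps K" for j t
    using that by (intro continuous_on_compose2[OF \<Theta>c] continuous_intros) auto
  define \<theta> where "\<theta> j t = \<Theta> j (0, t)" for j t
  define \<theta>' where "\<theta>' j t = \<Theta> j (1, t)" for j t
  have lift: "tangent_lift K \<theta>"
    unfolding tangent_lift_def
  proof (intro allI impI conjI)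
    fix j t assume j: "j < comps K"
    show "continuous_on UNIV (\<theta> j)" using \<Theta>t[OF j, of 0] by (simp add: \<theta>_def)
    have "H 0 = (\<lambda>z. z)" using H0 by auto
    then have "((\<lambda>z. z) has_derivative D 0 (curve K j t)) (at (curve K j t))"
      using D[of 0 "curve K j t"] by simp
    then have "D 0 (curve K j t) = (\<lambda>z. z)" by (rule has_derivative_unique) (rule has_derivative_ident)
    then have "V j (0, t) = vector_derivative (curve K j) (at t)" by (simp add: V_def v_def)
    then show "direction (vector_derivative (curve K j) (at t)) (\<theta> j t)"
      using \<Theta>d[OF j, of 0 t] by (simp add: \<theta>_def)
  qed
  have lift': "tangent_lift K' \<theta>'"
    unfolding tangent_lift_def c
  proof (intro allI impI conjI)
    fix j t assume j: "j < comps K"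
    show "continuous_on UNIV (\<theta>' j)" using \<Theta>t[OF j, of 1] by (simp add: \<theta>'_def)
    have "curve K' j = H 1 \<circ> curve K j" using crv[OF j] by auto
    then have "V j (1, t) = vector_derivative (curve K' j) (at t)"
      using vector_derivative_compose[OF D diagram_curve(4)[OF K j], of 1 t] by (simp add: V_def v_def)
    then show "direction (vector_derivative (curve K' j) (at t)) (\<theta>' j t)"
      using \<Theta>d[OF j, of 1 t] by (simp add: \<theta>'_def)
  qed
  have dbl: "double K' = double K"
  proof (intro ext)
    fix P Q
    have "pos K' P = H 1 (pos K P)" if "P \<in> source K" for P
      using that crv by (auto simp: pos_def source_def)
    then show "double K' P Q = double K P Q"
      using bijH[of 1] by (auto simp: double_def source_def c bij_def inj_eq)
  qed
  obtain N where N: "admissible K N" using ex_admissible[OF K] ..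
  have N': "admissible K' N" using N c dbl by (simp add: admissible_def double_points_def)
  have "diagram_sum K' N \<theta>' = diagram_sum K N \<theta>"
  proof (rule diagram_sum_eqI[OF K K' lift lift' N c dbl mk])
    fix j t assume j: "j < comps K"
    have "V j (s, t + 1) = V j (s, t)" for s
      using diagram_curve(2)[OF K j] derivative_periodic[OF K j] by (simp add: V_def v_def)
    then have "direction (V j (s, t)) (\<Theta> j (s, t + 1))" if "s \<in> {0..1}" for s
      using \<Theta>d[OF j that, of "t + 1"] by simp
    then have "\<exists>n::int. \<forall>s\<in>{0..1}. \<Theta> j (s, t + 1) = \<Theta> j (s, t) + 2 * pi * of_int n"
      using \<Theta>s[OF j] \<Theta>d[OF j]
      by (intro direction_lift_unique[where v="\<lambda>s. V j (s, t)"]) auto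
    then show "\<theta>' j (t + 1) - \<theta>' j t = \<theta> j (t + 1) - \<theta> j t" by (auto simp: \<theta>_def \<theta>'_def)
  next
    fix P Q assume d: "double K P Q"
    obtain i t j u where PQ: "P = (i, t)" "Q = (j, u)" by (cases P; cases Q)
    have ij: "i < comps K" "j < comps K" and eq: "curve K i t = curve K j u"
      using d by (auto simp: double_def PQ source_def pos_def)
    let ?f = "\<lambda>s. \<Theta> i (s, t) - \<Theta> j (s, u)"
    have "sector (?f 1) = sector (?f 0)"
    proof (rule sector_constant[of "{0..1}" ?f 1 0])
      show "continuous_on {0..1} ?f" by (intro continuous_on_diff \<Theta>s ij)
      fix s and n :: int assume s: "s \<in> {0..1::real}"
      have "wedge (v i t) (v j u) \<noteq> 0"
        using diagram_double(1)[OF K d] by (simp add: tangent_def v_def PQ)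
      then have "wedge (V i (s, t)) (V j (s, u)) \<noteq> 0"
        unfolding V_def prod.case eq by (rule wedge_linear_inj[OF Dlin[OF s] Dinj[OF s]])
      then show "?f s \<noteq> of_int n * pi"
        using wedge_directions_zero[OF \<Theta>d[OF ij(1) s] \<Theta>d[OF ij(2) s]] by blast
    qed auto
    then show "sector (angle \<theta>' P - angle \<theta>' Q) = sector (angle \<theta> P - angle \<theta> Q)"
      by (simp add: angle_def PQ \<theta>_def \<theta>'_def)
  qed
  then show ?thesis using invariant_eq[OF K lift N] invariant_eq[OF K' lift' N'] by simp
qed

end

section \<open>Reparametrization\<close>

locale circle_lift =
  fixes \<psi> :: "real \<Rightarrow> real"
  assumes C1: "\<psi> C1_differentiable_on UNIV"
    and nz: "\<And>t. vector_derivative \<psi> (at t) \<noteq> 0"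
    and per: "(\<forall>t. \<psi> (t + 1) = \<psi> t + 1) \<or> (\<forall>t. \<psi> (t + 1) = \<psi> t - 1)"
begin

definition d where "d t = vector_derivative \<psi> (at t)"

definition backward :: bool where "backward \<longleftrightarrow> d 0 < 0"

lemma deriv: "(\<psi> has_real_derivative d t) (at t)"
  using C1 unfolding C1_differentiable_on_eq d_def
  by (simp add: has_real_derivative_iff_has_vector_derivative vector_derivative_works)

lemma cont: "continuous_on UNIV \<psi>"
  using deriv by (auto intro!: DERIV_continuous simp: continuous_on_eq_continuous_within)

lemma sign_d: "d t < 0 \<longleftrightarrow> backward" "d t > 0 \<longleftrightarrow> \<not> backward"
proof -
  have dc: "continuous_on UNIV d" using C1 by (simp add: C1_differentiable_on_eq d_def)
  have conn: "connected (range d)" using dc connected_UNIV by (rule connected_continuous_image)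
  have d0: "d x \<noteq> 0" for x using nz by (simp add: d_def)
  have "\<not> (d x < 0 \<and> d y > 0)" for x y
  proof
    assume "d x < 0 \<and> d y > 0"
    then have "0 \<in> range d" using connectedD_interval[OF conn rangeI rangeI, of x 0 y] by simp
    then show False using d0 by (metis imageE)
  qed
  then have neg: "d t < 0 \<longleftrightarrow> d 0 < 0" using d0[of t] d0[of 0] by (meson linorder_neqE_linordered_idom)
  then show "d t < 0 \<longleftrightarrow> backward" by (simp add: backward_def)
  show "d t > 0 \<longleftrightarrow> \<not> backward" using neg d0[of t] by (auto simp: backward_def)
qed

lemma less_iff: "\<psi> s < \<psi> t \<longleftrightarrow> (if backward then t < s else s < t)"
proof -
  have inc: "\<psi> s < \<psi> t" if "s < t" "\<not> backward" for s t
  proof (rule DERIV_pos_imp_increasing[of s t \<psi>])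
    show "\<exists>y. (\<psi> has_real_derivative y) (at x) \<and> y > 0" for x
      using deriv[of x] sign_d(2)[of x] that(2) by blast
  qed fact
  have dec: "\<psi> t < \<psi> s" if "s < t" "backward" for s t
  proof (rule DERIV_neg_imp_decreasing[of s t \<psi>])
    show "\<exists>y. (\<psi> has_real_derivative y) (at x) \<and> y < 0" for x
      using deriv[of x] sign_d(1)[of x] that(2) by blast
  qed fact
  show ?thesis using inc[of s t] inc[of t s] dec[of s t] dec[of t s] by (cases s t rule: linorder_cases) auto
qed

lemma eq_iff: "\<psi> s = \<psi> t \<longleftrightarrow> s = t"
proof
  assume "\<psi> s = \<psi> t"
  then have "\<not> \<psi> s < \<psi> t" "\<not> \<psi> t < \<psi> s" by simp_all
  then show "s = t" unfolding less_iff by (auto split: if_splits)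
qed simp

definition sg :: int where "sg = (if backward then - 1 else 1)"

lemma sg [simp]: "sg * sg = 1" by (simp add: sg_def)

lemma shift: "\<psi> (t + of_int n) = \<psi> t + of_int (sg * n)"
proof -
  have "\<psi> (t + 1) = \<psi> t + of_int sg" for t
  proof -
    have "\<psi> t < \<psi> (t + 1) \<longleftrightarrow> \<not> backward" by (simp add: less_iff)
    then show ?thesis using per by (auto simp: sg_def)
  qed
  then have "\<psi> (t + 1) - of_int sg * (t + 1) = \<psi> t - of_int sg * t" for t by (simp add: distrib_left)
  from int_shift[of "\<lambda>t. \<psi> t - of_int sg * t", OF this] show ?thesis by (simp add: algebra_simps)
qed

lemma frac_psi_frac: "frac (\<psi> (frac t)) = frac (\<psi> t)"
proof -
  have "\<psi> t = \<psi> (frac t) + of_int (sg * \<lfloor>t\<rfloor>)"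
    using shift[of "frac t" "\<lfloor>t\<rfloor>"] by (simp add: frac_def)
  then show ?thesis by (simp only: frac_add_of_int_right)
qed

lemma surj: "\<exists>t. \<psi> t = y"
proof -
  define k where "k = \<lfloor>y - \<psi> 0\<rfloor>"
  define a :: real where "a = of_int (sg * k)"
  define b :: real where "b = of_int (sg * (k + 1))"
  have "\<psi> a = \<psi> 0 + of_int k" using shift[of 0 "sg * k"] by (simp add: a_def mult.assoc[symmetric] del: of_int_mult)
  moreover have "\<psi> b = \<psi> 0 + of_int (k + 1)" using shift[of 0 "sg * (k + 1)"] by (simp add: b_def mult.assoc[symmetric] del: of_int_mult of_int_add)
  ultimately have "\<psi> a \<le> y" "y \<le> \<psi> b" unfolding k_def by linarith+
  moreover have "connected (range \<psi>)" using cont connected_UNIV by (rule connected_continuous_image)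
  ultimately have "y \<in> range \<psi>" using connectedD_interval[OF _ rangeI rangeI] by metis
  then show ?thesis by auto
qed

lemma frac_eq_iff: "frac (\<psi> s) = frac (\<psi> t) \<longleftrightarrow> frac s = frac t"
proof
  assume "frac (\<psi> s) = frac (\<psi> t)"
  then obtain n where "\<psi> s = \<psi> t + of_int n" by (elim frac_eqE)
  then have "\<psi> s = \<psi> (t + of_int (sg * n))" using shift[of t "sg * n"] by (simp add: mult.assoc[symmetric])
  then have "s = t + of_int (sg * n)" by (simp only: eq_iff)
  then show "frac s = frac t" by (simp only: frac_add_of_int_right)
next
  assume "frac s = frac t"
  then show "frac (\<psi> s) = frac (\<psi> t)" using frac_psi_frac by metis
qed

lemma consec_image:
  assumes S: "\<And>t. t \<in> S' \<longleftrightarrow> \<psi> t \<in> S" and st: "consec S' s t" and t: "t \<in> S'"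
  shows "if backward then consec S (\<psi> t) (\<psi> s) else consec S (\<psi> s) (\<psi> t)"
proof -
  have "y \<notin> S" if "y \<in> {min (\<psi> s) (\<psi> t)<..<max (\<psi> s) (\<psi> t)}" for y
  proof -
    obtain x where x: "y = \<psi> x" using surj by metis
    have "s < x \<and> x < t"
      using that st less_iff[of s x] less_iff[of x t] less_iff[of t x] less_iff[of x s] less_iff[of s t] less_iff[of t s]
      by (auto simp: x consec_def min_def max_def split: if_splits)
    then show ?thesis using st S by (auto simp: x consec_def)
  qed
  then show ?thesis
    using st t S less_iff[of s t] less_iff[of t s] by (auto simp: consec_def min_def max_def)
qed

end

lemma direction_scale:
  assumes "direction z x" "r \<noteq> 0"
  shows "direction (r *\<^sub>R z) (x + (if r < 0 then pi else 0))"
proof -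
  obtain q where q: "q > 0" "z = of_real q * cis x" using assms by (auto simp: direction_def)
  show ?thesis
  proof (cases "r < 0")
    case True
    have "r *\<^sub>R z = of_real (- r * q) * cis (x + pi)"
      by (simp add: q scaleR_conv_of_real cis_mult[symmetric])
    then show ?thesis using True q unfolding direction_def by (intro exI[of _ "- r * q"]) (simp add: mult_neg_pos)
  next
    case False
    have "r *\<^sub>R z = of_real (r * q) * cis x" by (simp add: q scaleR_conv_of_real)
    then show ?thesis using False assms(2) q unfolding direction_def by (intro exI[of _ "r * q"]) simp
  qed
qed

lemma upward_scale:
  assumes "z \<noteq> 0" "r \<noteq> 0"
  shows "upward (r *\<^sub>R z) \<longleftrightarrow> (if r < 0 then \<not> upward z else upward z)"
  using assms by (auto simp: upward_def complex_eq_iff zero_less_mult_iff)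

lemma up_vec_scale:
  assumes "z \<noteq> 0" "r \<noteq> 0" shows "up_vec (r *\<^sub>R z) = \<bar>r\<bar> *\<^sub>R up_vec z"
  using assms by (auto simp: up_vec_def upward_scale)

lemma wedge_scale: "wedge (r *\<^sub>R z) (q *\<^sub>R w) = r * q * wedge z w"
  by (simp add: wedge_def algebra_simps)

context link_tensors
begin

lemma one_swap: "one a b = one b a"
  by (auto simp: one_def)

text \<open>Traversing a circle backwards adds a half turn to the angle, and exchanges arrival and departure at each
  node. The labels at the upper and lower ends of the passages, on which the tensors of the crossings
  depend, stay the same.\<close>

lemma invariant_reparametrization:
  assumes K: "virtual_link_diagram K" and K': "virtual_link_diagram K'"
    and rep: "reparametrization K K'"
  shows "invariant K' = invariant K"
proof -
  obtain \<pi> \<psi> where c: "comps K' = comps K" and \<pi>: "bij_betw \<pi> {..<comps K} {..<comps K}"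
    and \<psi>: "\<And>j. j < comps K \<Longrightarrow> circle_lift (\<psi> j)"
    and crv: "\<And>j t. j < comps K \<Longrightarrow> curve K' j t = curve K (\<pi> j) (\<psi> j t)"
    and mk: "\<And>j t. (j, t) \<in> double_points K' \<Longrightarrow> mark K' (j, t) = mark K (\<pi> j, frac (\<psi> j t))"
    using rep unfolding reparametrization_def circle_lift_def by blast
  have \<pi>K: "\<pi> j < comps K" if "j < comps K" for j using \<pi> that by (auto simp: bij_betw_def)
  have \<pi>inj: "i = j" if "\<pi> i = \<pi> j" "i < comps K" "j < comps K" for i j
    using \<pi> that by (auto simp: bij_betw_def inj_on_def)
  define f where "f P = (\<pi> (fst P), frac (\<psi> (fst P) (snd P)))" for P
  define bw where "bw P = circle_lift.backward (\<psi> (fst P))" for P :: "nat \<times> real"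
  have src: "P \<in> source K \<longleftrightarrow> fst P < comps K \<and> 0 \<le> snd P \<and> snd P < 1" for P
    by (cases P) (auto simp: source_def)
  have src': "source K' = source K" by (simp add: source_def c)
  have f_src: "f P \<in> source K" if "P \<in> source K" for P
    using that \<pi>K by (simp add: src f_def frac_lt_1)
  have f_inj: "P = Q" if "f P = f Q" "P \<in> source K" "Q \<in> source K" for P Q
  proof -
    have "fst P = fst Q" using that \<pi>inj by (simp add: f_def src)
    moreover have "frac (snd P) = frac (snd Q)"
      using that calculation circle_lift.frac_eq_iff[OF \<psi>] by (simp add: f_def src)
    ultimately show ?thesis using that by (simp add: src prod_eq_iff frac_eq)
  qed
  have f_surj: "\<exists>Q\<in>source K. f Q = P" if P: "P \<in> source K" for P
  proof -
    obtain j where j: "j < comps K" "\<pi> j = fst P" using \<pi> P by (auto simp: bij_betw_def src) (metis imageE lessThan_iff)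
    obtain t where t: "\<psi> j t = snd P" using circle_lift.surj[OF \<psi>[OF j(1)]] by blast
    have "f (j, frac t) = P"
      using P by (simp add: f_def j circle_lift.frac_psi_frac[OF \<psi>[OF j(1)]] t prod_eq_iff frac_eq src)
    then show ?thesis using j by (intro bexI[of _ "(j, frac t)"]) (simp_all add: src frac_lt_1)
  qed
  define dd where "dd P = circle_lift.d (\<psi> (fst P)) (snd P)" for P
  have dd: "dd P < 0 \<longleftrightarrow> bw P" "dd P \<noteq> 0" if "P \<in> source K" for P
    using circle_lift.sign_d[OF \<psi>, of "fst P" "snd P"] that by (auto simp: dd_def bw_def src)
  have vd: "vector_derivative (curve K' j) (at t) =
      circle_lift.d (\<psi> j) t *\<^sub>R vector_derivative (curve K (\<pi> j)) (at (\<psi> j t))" if j: "j < comps K" for j t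
  proof -
    have "curve K' j = curve K (\<pi> j) \<circ> \<psi> j" using crv[OF j] by auto
    moreover have "((curve K (\<pi> j) \<circ> \<psi> j) has_vector_derivative
        circle_lift.d (\<psi> j) t *\<^sub>R vector_derivative (curve K (\<pi> j)) (at (\<psi> j t))) (at t)"
      using circle_lift.deriv[OF \<psi>[OF j], of t] diagram_curve(4)[OF K \<pi>K[OF j], of "\<psi> j t"]
      by (intro vector_diff_chain_at)
        (simp_all add: has_real_derivative_iff_has_vector_derivative vector_derivative_works)
    ultimately show ?thesis by (simp add: vector_derivative_at)
  qed
  have tan: "tangent K' P = dd P *\<^sub>R tangent K (f P)" if P: "P \<in> source K" for P
  proof -
    have j: "fst P < comps K" using P by (simp add: src)
    have "vector_derivative (curve K (\<pi> (fst P))) (at (frac (\<psi> (fst P) (snd P)))) =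
      vector_derivative (curve K (\<pi> (fst P))) (at (\<psi> (fst P) (snd P)))"
      using derivative_periodic[OF K \<pi>K[OF j]]
      by (rule frac_shift[where f="\<lambda>t. vector_derivative (curve K (\<pi> (fst P))) (at t)"])
    then show ?thesis by (simp add: tangent_def vd[OF j] f_def dd_def)
  qed
  have tan_nz: "tangent K (f P) \<noteq> 0" if "P \<in> source K" for P
    using diagram_curve(3)[OF K] f_src[OF that] by (simp add: tangent_def src)
  have posf: "pos K' P = pos K (f P)" if P: "P \<in> source K" for P
  proof -
    have j: "fst P < comps K" using P by (simp add: src)
    have "curve K (\<pi> (fst P)) (frac (\<psi> (fst P) (snd P))) = curve K (\<pi> (fst P)) (\<psi> (fst P) (snd P))"
      using diagram_curve(2)[OF K \<pi>K[OF j]] by (rule frac_shift)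
    then show ?thesis by (simp add: pos_def f_def crv[OF j])
  qed
  have dbl: "double K' P Q \<longleftrightarrow> double K (f P) (f Q)" if "P \<in> source K" "Q \<in> source K" for P Q
  proof -
    have "f P = f Q \<longleftrightarrow> P = Q" using f_inj[OF _ that] by blast
    then show ?thesis using that by (simp add: double_def src' posf f_src)
  qed
  have dblS: "P \<in> source K \<and> Q \<in> source K" if "double K P Q \<or> double K' P Q" for P Q
    using that by (auto simp: double_def src')
  have dp: "P \<in> double_points K' \<longleftrightarrow> f P \<in> double_points K" if P: "P \<in> source K" for P
  proof
    assume "P \<in> double_points K'"
    then obtain Q where "double K' P Q" by (auto simp: double_points_def)
    then show "f P \<in> double_points K" using dbl dblS doubleD(1) by blast
  next
    assume "f P \<in> double_points K"
    then obtain Q where Q: "double K (f P) Q" by (auto simp: double_points_def)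
    then obtain Q' where "Q' \<in> source K" "f Q' = Q" using f_surj dblS by blast
    then show "P \<in> double_points K'" using Q dbl P doubleD(1) by blast
  qed
  obtain \<theta> where \<theta>: "tangent_lift K \<theta>" using ex_tangent_lift[OF K] ..
  define \<theta>' where "\<theta>' j t = \<theta> (\<pi> j) (\<psi> j t) + (if circle_lift.backward (\<psi> j) then pi else 0)" for j t
  have \<theta>': "tangent_lift K' \<theta>'"
    unfolding tangent_lift_def c
  proof (intro allI impI conjI)
    fix j t assume j: "j < comps K"
    have th: "continuous_on UNIV (\<theta> (\<pi> j))"
      "\<And>t. direction (vector_derivative (curve K (\<pi> j)) (at t)) (\<theta> (\<pi> j) t)"
      using \<theta> \<pi>K[OF j] by (auto simp: tangent_lift_def)
    show "continuous_on UNIV (\<theta>' j)" unfolding \<theta>'_def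
      by (intro continuous_intros continuous_on_compose2[OF th(1)] circle_lift.cont[OF \<psi>[OF j]]) auto
    show "direction (vector_derivative (curve K' j) (at t)) (\<theta>' j t)"
      unfolding vd[OF j] \<theta>'_def
      using direction_scale[OF th(2)[of "\<psi> j t"], of "circle_lift.d (\<psi> j) t"]
        circle_lift.sign_d[OF \<psi>[OF j], of t] by (cases "circle_lift.backward (\<psi> j)") auto
  qed
  obtain N' where N': "admissible K' N'" using ex_admissible[OF K'] ..
  define N where "N = f ` N'"
  have cn': "circle_nodes (comps K) N'" using N' c by (simp add: admissible_def)
  have N'src: "P \<in> source K" if "P \<in> N'" for P using cn' that by (auto simp: circle_nodes_def source_def)
  have fbij: "bij_betw f N' N"
    unfolding N_def bij_betw_def inj_on_def using f_inj N'src by blast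
  have fN: "f P \<in> N \<longleftrightarrow> P \<in> N'" if "P \<in> source K" for P
    using that f_inj N'src unfolding N_def by blast
  have cn: "circle_nodes (comps K) N"
    unfolding circle_nodes_def
  proof (intro conjI allI impI)
    show "finite N" using cn' by (simp add: N_def circle_nodes_def)
    have "N \<subseteq> source K" unfolding N_def using f_src N'src by blast
    then show "N \<subseteq> {..<comps K} \<times> {0..<1}" by (simp add: source_def)
    fix j assume "j < comps K"
    then obtain i where i: "i < comps K" "\<pi> i = j" using \<pi> by (auto simp: bij_betw_def) (metis imageE lessThan_iff)
    then obtain t where "(i, t) \<in> N'" using cn' by (auto simp: circle_nodes_def)
    then show "\<exists>t. (j, t) \<in> N" using i by (force simp: N_def f_def)
  qed
  have N: "admissible K N"
    unfolding admissible_def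
  proof (intro conjI cn subsetI)
    fix P assume P: "P \<in> double_points K"
    then have "P \<in> source K" by (auto simp: double_points_def double_def)
    then obtain Q where Q: "Q \<in> source K" "f Q = P" using f_surj by blast
    then have "Q \<in> double_points K'" using dp P by simp
    then have "Q \<in> N'" using N' by (auto simp: admissible_def)
    then show "P \<in> N" using Q by (auto simp: N_def)
  qed
  have covf: "t \<in> cov N' j \<longleftrightarrow> \<psi> j t \<in> cov N (\<pi> j)" if j: "j < comps K" for j t
  proof -
    have "f (j, frac t) = (\<pi> j, frac (\<psi> j t))" by (simp add: f_def circle_lift.frac_psi_frac[OF \<psi>[OF j]])
    then show ?thesis using fN[of "(j, frac t)"] j by (simp add: cov_def src frac_lt_1)
  qed
  have prev_f: "if bw P then before N (\<pi> (fst P)) (\<psi> (fst P) (before N' (fst P) (snd P))) = \<psi> (fst P) (snd P)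
    else before N (\<pi> (fst P)) (\<psi> (fst P) (snd P)) = \<psi> (fst P) (before N' (fst P) (snd P))"
    if P: "P \<in> N'" for P
  proof -
    have j: "fst P < comps K" using N'src[OF P] by (simp add: src)
    have "snd P \<in> cov N' (fst P)" using node_in_cov[OF cn'] P by simp
    from circle_lift.consec_image[OF \<psi>[OF j] covf[OF j] before_consec[OF cn' j] this]
    show ?thesis by (auto simp: bw_def intro!: before_eqI)
  qed
  have f_prev: "f (prev_node N' P) = (\<pi> (fst P), frac (\<psi> (fst P) (before N' (fst P) (snd P))))"
    if P: "P \<in> N'" for P
  proof -
    have j: "fst P < comps K" using N'src[OF P] by (simp add: src)
    show ?thesis by (simp add: f_def prev_node_def circle_lift.frac_psi_frac[OF \<psi>[OF j]])
  qed
  have frac_before: "frac (before N j (frac t)) = frac (before N j t)" if "j < comps K" for j t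
  proof -
    have "before N j t = before N j (frac t) + of_int \<lfloor>t\<rfloor>"
      using before_shift[OF cn that, of "frac t" "\<lfloor>t\<rfloor>"] by (simp add: frac_def)
    then show ?thesis by (simp only: frac_add_of_int_right)
  qed
  have frac_hol: "arc_hol N \<theta> j (frac t) = arc_hol N \<theta> j t" if "j < comps K" for j t
    using arc_hol_shift[OF K \<theta> that cn, of "frac t" "\<lfloor>t\<rfloor>"] by (simp add: frac_def)
  have "diagram_sum K' N' \<theta>' = diagram_sum K N \<theta>"
    unfolding diagram_sum_def
  proof (rule state_sum_iso[where f=f and bw=bw])
    show "finite N'" using cn' by (simp add: circle_nodes_def)
    show "bij_betw (prev_node N') N' N'" by (rule prev_node_bij[OF cn'])
    show "bw (prev_node N' P) = bw P" for P by (simp add: bw_def prev_node_def)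
    show "f (prev_node N' P) = prev_node N (f P) \<and>
        arc_hol N' \<theta>' (fst P) (snd P) = arc_hol N \<theta> (fst (f P)) (snd (f P))"
      if P: "P \<in> N'" and b: "\<not> bw P" for P
    proof -
      have j: "\<pi> (fst P) < comps K" using N'src[OF P] \<pi>K by (simp add: src)
      have "before N (\<pi> (fst P)) (\<psi> (fst P) (snd P)) = \<psi> (fst P) (before N' (fst P) (snd P))"
        using prev_f[OF P] b by simp
      moreover have "\<not> circle_lift.backward (\<psi> (fst P))" using b by (simp add: bw_def)
      ultimately show ?thesis unfolding f_prev[OF P]
        by (simp add: prev_node_def f_def frac_before[OF j] frac_hol[OF j])
          (simp add: arc_hol_def \<theta>'_def)
    qed
    show "prev_node N (f (prev_node N' P)) = f P \<and>
        arc_hol N' \<theta>' (fst P) (snd P) = transposed (arc_hol N \<theta> (fst (f (prev_node N' P))) (snd (f (prev_node N' P))))"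
      if P: "P \<in> N'" and b: "bw P" for P
    proof -
      have j: "\<pi> (fst P) < comps K" using N'src[OF P] \<pi>K by (simp add: src)
      have bf: "before N (\<pi> (fst P)) (\<psi> (fst P) (before N' (fst P) (snd P))) = \<psi> (fst P) (snd P)"
        using prev_f[OF P] b by simp
      have sp: "sector (x + pi) = sector x + 1" for x
      proof -
        have "(x + pi) / pi = x / pi + of_int 1" by (simp add: add_divide_distrib)
        then show ?thesis unfolding sector_def by (simp only: floor_add_int)
      qed
      have "circle_lift.backward (\<psi> (fst P))" using b by (simp add: bw_def)
      then have "arc_hol N' \<theta>' (fst P) (snd P) =
          transposed (arc_hol N \<theta> (\<pi> (fst P)) (\<psi> (fst P) (before N' (fst P) (snd P))))"
        by (simp add: arc_hol_def \<theta>'_def bf sp fun_eq_iff transposed_def hol_reverse)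
      then show ?thesis unfolding f_prev[OF P]
        by (simp add: prev_node_def f_def[of P] frac_before[OF j] frac_hol[OF j] bf)
    qed
    fix \<gamma> assume \<gamma>: "\<gamma> \<in> N \<rightarrow>\<^sub>E I \<times> I"
    let ?r = "relabel N' bw f \<gamma>"
    have rel: "?r P = (if bw P then prod.swap (\<gamma> (f P)) else \<gamma> (f P))" if "P \<in> N'" for P
      using that by (simp add: relabel_def)
    have up: "upward (tangent K' P) = (if bw P then \<not> upward (tangent K (f P)) else upward (tangent K (f P)))"
      if "P \<in> N'" for P
      using upward_scale[OF tan_nz dd(2)] dd(1) tan N'src[OF that] by simp
    have lab: "lab_up K' ?r P = lab_up K \<gamma> (f P)" "lab_down K' ?r P = lab_down K \<gamma> (f P)" if "P \<in> N'" for P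
      using rel[OF that] up[OF that] by (auto simp: lab_up_def lab_down_def)
    have crs: "(P, Q) \<in> cross K' \<longleftrightarrow> (f P, f Q) \<in> cross K" if PQ: "P \<in> source K" "Q \<in> source K" for P Q
    proof -
      have "wedge (up_vec (tangent K' Q)) (up_vec (tangent K' P)) =
        \<bar>dd Q\<bar> * \<bar>dd P\<bar> * wedge (up_vec (tangent K (f Q))) (up_vec (tangent K (f P)))"
        using PQ by (simp add: tan up_vec_scale[OF tan_nz dd(2)] wedge_scale)
      moreover have "\<bar>dd Q\<bar> * \<bar>dd P\<bar> > 0" using dd(2)[OF PQ(1)] dd(2)[OF PQ(2)] by simp
      ultimately have "wedge (up_vec (tangent K' Q)) (up_vec (tangent K' P)) > 0 \<longleftrightarrow>
          wedge (up_vec (tangent K (f Q))) (up_vec (tangent K (f P))) > 0"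
        using zero_less_mult_iff[of "\<bar>dd Q\<bar> * \<bar>dd P\<bar>"] by (metis less_asym)
      then show ?thesis using dbl[OF PQ] by (simp add: cross_def)
    qed
    have crN: "P \<in> N' \<and> Q \<in> N'" if "(P, Q) \<in> cross K'" for P Q
      using crossD[OF that] N' by (auto simp: admissible_def)
    have bijc: "bij_betw (map_prod f f) (cross K') (cross K)"
    proof (rule bij_betwI')
      fix x y assume xy: "x \<in> cross K'" "y \<in> cross K'"
      obtain P Q P' Q' where e: "x = (P, Q)" "y = (P', Q')" by (meson surj_pair)
      have "P \<in> source K" "Q \<in> source K" "P' \<in> source K" "Q' \<in> source K"
        using crN N'src xy e by blast+
      then have "f P = f P' \<longleftrightarrow> P = P'" "f Q = f Q' \<longleftrightarrow> Q = Q'" using f_inj by blast+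
      then show "map_prod f f x = map_prod f f y \<longleftrightarrow> x = y" by (simp add: e)
    next
      fix x assume x: "x \<in> cross K'"
      obtain P Q where e: "x = (P, Q)" by (cases x)
      then have "P \<in> source K" "Q \<in> source K" using crN N'src x by blast+
      then show "map_prod f f x \<in> cross K" using crs x by (simp add: e)
    next
      fix y assume y: "y \<in> cross K"
      obtain P Q where PQ: "y = (P, Q)" by (cases y)
      then have "P \<in> source K" "Q \<in> source K" using y by (auto simp: cross_def double_def)
      then obtain P' Q' where "P' \<in> source K" "f P' = P" "Q' \<in> source K" "f Q' = Q" using f_surj by metis
      then show "\<exists>x\<in>cross K'. y = map_prod f f x"
        using crs[of P' Q'] y PQ by (intro bexI[of _ "(P', Q')"]) simp_all
    qed
    have bijd: "bij_betw f (N' - double_points K') (N - double_points K)"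
    proof -
      have "f ` (N' - double_points K') = N - double_points K"
        unfolding N_def using dp N'src by blast
      moreover have "inj_on f (N' - double_points K')" using fbij by (auto simp: bij_betw_def inj_on_def)
      ultimately show ?thesis by (simp add: bij_betw_def)
    qed
    show "node_tensor K' N' ?r = node_tensor K N \<gamma>"
      unfolding node_tensor_def
    proof (intro arg_cong2[where f="(*)"])
      have "(\<Prod>P\<in>N - double_points K. one (fst (\<gamma> P)) (snd (\<gamma> P))) =
        (\<Prod>P\<in>N' - double_points K'. one (fst (\<gamma> (f P))) (snd (\<gamma> (f P))))"
        using prod.reindex_bij_betw[OF bijd, of "\<lambda>P. one (fst (\<gamma> P)) (snd (\<gamma> P))"] by simp
      also have "\<dots> = (\<Prod>P\<in>N' - double_points K'. one (fst (?r P)) (snd (?r P)))"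
        by (intro prod.cong refl) (auto simp: rel one_swap)
      finally show "(\<Prod>P\<in>N' - double_points K'. one (fst (?r P)) (snd (?r P))) =
        (\<Prod>P\<in>N - double_points K. one (fst (\<gamma> P)) (snd (\<gamma> P)))" ..
      let ?X = "\<lambda>(P, Q). X (mark K P) (lab_up K \<gamma> P) (lab_up K \<gamma> Q) (lab_down K \<gamma> Q) (lab_down K \<gamma> P)"
      have "prod ?X (cross K) = (\<Prod>x\<in>cross K'. ?X (map_prod f f x))"
        using prod.reindex_bij_betw[OF bijc, of ?X] by simp
      also have "\<dots> = (\<Prod>(P, Q)\<in>cross K'. X (mark K' P) (lab_up K' ?r P) (lab_up K' ?r Q)
          (lab_down K' ?r Q) (lab_down K' ?r P))"
      proof (intro prod.cong refl)
        fix x assume x: "x \<in> cross K'"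
        obtain P Q where PQ: "x = (P, Q)" by (cases x)
        have "mark K' P = mark K (f P)"
          using mk[of "fst P" "snd P"] crossD(3)[of P Q K'] x by (simp add: PQ f_def)
        then show "?X (map_prod f f x) = (case x of (P, Q) \<Rightarrow>
            X (mark K' P) (lab_up K' ?r P) (lab_up K' ?r Q) (lab_down K' ?r Q) (lab_down K' ?r P))"
          using x crN[of P Q] by (simp add: PQ lab)
      qed
      finally show "(\<Prod>(P, Q)\<in>cross K'. X (mark K' P) (lab_up K' ?r P) (lab_up K' ?r Q)
          (lab_down K' ?r Q) (lab_down K' ?r P)) = prod ?X (cross K)" ..
    qed
  qed (rule fbij)
  then show ?thesis using invariant_eq[OF K \<theta> N] invariant_eq[OF K' \<theta>' N'] by simp
qed

end

section \<open>The evaluation in general position\<close>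

lemma Im_curve_deriv:
  assumes "virtual_link_diagram K" "j < comps K"
  shows "((\<lambda>t. Im (curve K j t)) has_real_derivative Im (vector_derivative (curve K j) (at t))) (at t)"
proof -
  have "(curve K j has_vector_derivative vector_derivative (curve K j) (at t)) (at t)"
    using diagram_curve(4)[OF assms] by (simp add: vector_derivative_works)
  then have "((\<lambda>t. Im (curve K j t)) has_vector_derivative Im (vector_derivative (curve K j) (at t))) (at t)"
    by (rule bounded_linear.has_vector_derivative[OF bounded_linear_Im])
  then show ?thesis by (simp add: has_real_derivative_iff_has_vector_derivative)
qed

lemma Im_curve_cont:
  assumes "virtual_link_diagram K" "j < comps K"
  shows "continuous_on S (\<lambda>t. Im (curve K j t))"
  using Im_curve_deriv[OF assms] DERIV_continuous
  by (intro continuous_at_imp_continuous_on) (blast)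

lemma tangent_frac:
  assumes "virtual_link_diagram K" "j < comps K"
  shows "tangent K (j, frac t) = vector_derivative (curve K j) (at t)"
  using derivative_periodic[OF assms]
    frac_shift[of "\<lambda>t. vector_derivative (curve K j) (at t)" t] by (simp add: tangent_def)

lemma ex_critical_point:
  assumes K: "virtual_link_diagram K" and j: "j < comps K"
  shows "\<exists>t. (j, t) \<in> critical_points K"
proof -
  let ?h = "\<lambda>t. Im (curve K j t)"
  obtain t0 where t0: "t0 \<in> {0..1}" "\<And>t. t \<in> {0..1} \<Longrightarrow> ?h t \<le> ?h t0"
    using continuous_attains_sup[OF compact_Icc _ Im_curve_cont[OF K j], of 0 1] by auto
  have max: "?h t \<le> ?h t0" for t
  proof -
    have "?h t = ?h (frac t)" using diagram_curve(2)[OF K j] frac_shift[of "curve K j" t] by simp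
    then show ?thesis using t0(2)[of "frac t"] frac_lt_1[of t] by (simp add: less_imp_le)
  qed
  have "Im (vector_derivative (curve K j) (at t0)) = 0"
    using Im_curve_deriv[OF K j] by (rule DERIV_local_max[of _ _ t0 1]) (use max in auto)
  then have "Im (tangent K (j, frac t0)) = 0" by (simp add: tangent_frac[OF K j])
  then show ?thesis using j by (auto simp: critical_points_def source_def frac_lt_1 intro!: exI[of _ "frac t0"])
qed

lemma general_position_admissible:
  assumes gp: "general_position K" shows "admissible K (nodes K)"
proof -
  have K: "virtual_link_diagram K" and fin: "finite (critical_points K)"
    using gp by (auto simp: general_position_def)
  have "nodes K \<subseteq> {..<comps K} \<times> {0..<1}"
    by (auto simp: nodes_def critical_points_def double_points_def double_def source_def)
  moreover have "finite (nodes K)" using fin finite_double_points[OF K] by (simp add: nodes_def)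
  moreover have "\<forall>j<comps K. \<exists>t. (j, t) \<in> nodes K"
    using ex_critical_point[OF K] unfolding nodes_def by blast
  ultimately show ?thesis by (simp add: admissible_def circle_nodes_def nodes_def)
qed

lemma direction_horizontal:
  assumes "direction z x" shows "Im z = 0 \<longleftrightarrow> (\<exists>n::int. x = of_int n * pi)"
proof -
  obtain r where "r > 0" "z = of_real r * cis x" using assms by (auto simp: direction_def)
  then show ?thesis by (simp add: sin_zero_iff_int2)
qed

lemma direction_even:
  assumes "direction z x" "Im z \<noteq> 0" shows "Im z > 0 \<longleftrightarrow> even (sector x)"
  using upward_direction[OF assms(1)] assms(2) by (auto simp: upward_def)

definition after :: "(nat \<times> real) set \<Rightarrow> nat \<Rightarrow> real \<Rightarrow> real" where
  "after N j q = (THE t. t \<in> cov N j \<and> consec (cov N j) q t)"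

lemma after_eqI:
  assumes "t \<in> cov N j" "consec (cov N j) q t" shows "after N j q = t"
  unfolding after_def using assms consec_unique_right by (intro the_equality) blast+

lemma after_consec:
  assumes N: "circle_nodes n N" and j: "j < n" and q: "q \<in> cov N j"
  shows "after N j q \<in> cov N j" "consec (cov N j) q (after N j q)"
proof -
  have "(j, frac q) \<in> prev_node N ` N" using prev_node_bij[OF N] q by (simp add: bij_betw_def cov_def)
  then obtain t where t: "(j, t) \<in> N" "frac (before N j t) = frac q" by (auto simp: prev_node_def)
  then obtain m :: int where m: "before N j t = q + of_int m" by (elim frac_eqE)
  have "consec (cov N j) (q + of_int m) (t - of_int m + of_int m)"
    using before_consec[OF N j, of t] by (simp add: m)
  then have c: "consec (cov N j) q (t - of_int m)" by (simp only: consec_shift)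
  have "t - of_int m \<in> cov N j" using node_in_cov[OF N t(1)] cov_shift[of t "- m" N j] by simp
  with c have "after N j q = t - of_int m" "t - of_int m \<in> cov N j" using after_eqI by blast+
  with c show "after N j q \<in> cov N j" "consec (cov N j) q (after N j q)" by simp_all
qed

lemma after_shift:
  assumes N: "circle_nodes n N" and j: "j < n" and q: "q \<in> cov N j"
  shows "after N j (q + of_int m) = after N j q + of_int m"
  using after_consec[OF assms] by (intro after_eqI) (simp_all add: consec_shift)

text \<open>In general position the sector is constant in the interior of an arc, so that for the arc that leaves
  \<open>q\<close> it can be read off at the middle.\<close>

definition out_sector :: "(nat \<times> real) set \<Rightarrow> (nat \<Rightarrow> real \<Rightarrow> real) \<Rightarrow> nat \<Rightarrow> real \<Rightarrow> int" where
  "out_sector N \<theta> j q = sector (\<theta> j ((q + after N j q) / 2))"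

locale general_diagram =
  fixes K \<theta>
  assumes gp: "general_position K" and \<theta>: "tangent_lift K \<theta>"
begin

abbreviation "N \<equiv> nodes K"

lemma K: "virtual_link_diagram K" using gp by (simp add: general_position_def)

lemma adm: "admissible K N" using general_position_admissible[OF gp] .

lemma cn: "circle_nodes (comps K) N" using adm by (simp add: admissible_def)

lemma dir: "j < comps K \<Longrightarrow> direction (vector_derivative (curve K j) (at t)) (\<theta> j t)"
  using \<theta> by (simp add: tangent_lift_def)

lemma \<theta>_cont: "j < comps K \<Longrightarrow> continuous_on S (\<theta> j)"
  using \<theta> unfolding tangent_lift_def by (meson continuous_on_subset subset_UNIV)

lemma not_horizontal:
  assumes j: "j < comps K" and u: "(j, frac u) \<notin> critical_points K"
  shows "Im (vector_derivative (curve K j) (at u)) \<noteq> 0" "\<theta> j u \<noteq> of_int n * pi"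
proof -
  have "(j, frac u) \<in> source K" using j by (simp add: source_def frac_lt_1)
  then show *: "Im (vector_derivative (curve K j) (at u)) \<noteq> 0"
    using u by (auto simp: critical_points_def tangent_frac[OF K j])
  show "\<theta> j u \<noteq> of_int n * pi" using * direction_horizontal[OF dir[OF j]] by blast
qed

lemma arc_free:
  assumes j: "j < comps K" and c: "consec (cov N j) s t" and u: "s < u" "u < t"
  shows "(j, frac u) \<notin> critical_points K"
  using c u by (auto simp: consec_def cov_def nodes_def)

lemma arc_sector:
  assumes j: "j < comps K" and c: "consec (cov N j) s t" and u: "s < u" "u < t"
    and t: "t \<in> cov N j"
  shows "sector (\<theta> j u) = out_sector N \<theta> j s"
proof -
  have a: "after N j s = t" using after_eqI[OF t c] .
  have "sector (\<theta> j u) = sector (\<theta> j ((s + t) / 2))"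
  proof (rule sector_constant[of "{s<..<t}" "\<theta> j" u "(s + t) / 2"])
    show "continuous_on {s<..<t} (\<theta> j)" by (rule \<theta>_cont[OF j])
    fix z n assume "z \<in> {s<..<t}"
    then show "\<theta> j z \<noteq> of_int n * pi" using not_horizontal(2)[OF j arc_free[OF j c]] by auto
  qed (use u in \<open>auto simp: field_simps\<close>)
  then show ?thesis by (simp add: out_sector_def a)
qed

text \<open>In the interior of an arc without critical points the sector is constant. By continuity the angle at an end
  lies in the closure of this sector; it can leave the sector itself only at a horizontal tangent.\<close>

lemma end_sector:
  assumes j: "j < comps K" and c: "consec (cov N j) s t" and t: "t \<in> cov N j"
  shows "\<theta> j s = of_int n * pi \<Longrightarrow> out_sector N \<theta> j s \<in> {n - 1, n}"
    and "\<theta> j t = of_int n * pi \<Longrightarrow> out_sector N \<theta> j s \<in> {n - 1, n}"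
    and "(j, frac s) \<notin> critical_points K \<Longrightarrow> sector (\<theta> j s) = out_sector N \<theta> j s"
    and "(j, frac t) \<notin> critical_points K \<Longrightarrow> sector (\<theta> j t) = out_sector N \<theta> j s"
proof -
  define k where "k = out_sector N \<theta> j s"
  have st: "s < t" using c by (simp add: consec_def)
  have cl: "closure {s<..<t} = {s..t}" using st by (simp add: closure_greaterThanLessThan)
  have in_arc: "of_int k * pi \<le> \<theta> j u \<and> \<theta> j u \<le> (of_int k + 1) * pi" if "u \<in> {s<..<t}" for u
    using arc_sector[OF j c _ _ t, of u] that sector_eq_iff[of "\<theta> j u" k] by (auto simp: k_def)
  have closed_arc: "of_int k * pi \<le> \<theta> j u" "\<theta> j u \<le> (of_int k + 1) * pi" if "u \<in> {s..t}" for u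
  proof -
    have "continuous_on (closure {s<..<t}) (\<theta> j)" by (rule \<theta>_cont[OF j])
    then show "of_int k * pi \<le> \<theta> j u" "\<theta> j u \<le> (of_int k + 1) * pi"
      using continuous_ge_on_closure[of "{s<..<t}" "\<theta> j" u "of_int k * pi"]
        continuous_le_on_closure[of "{s<..<t}" "\<theta> j" u "(of_int k + 1) * pi"] in_arc that cl by auto
  qed
  have crit: "k \<in> {n - 1, n}" if "u \<in> {s..t}" "\<theta> j u = of_int n * pi" for u
  proof -
    have "of_int k * pi \<le> of_int n * pi" "of_int n * pi \<le> of_int (k + 1) * pi"
      using closed_arc[OF that(1)] by (simp_all add: that(2))
    then have "k \<le> n" "n \<le> k + 1" by (simp_all only: mult_le_cancel_right_pos[OF pi_gt_zero] of_int_le_iff)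
    then show ?thesis by auto
  qed
  have noncrit: "sector (\<theta> j u) = k" if "u \<in> {s..t}" "(j, frac u) \<notin> critical_points K" for u
  proof -
    have "\<theta> j u \<noteq> of_int (k + 1) * pi" by (rule not_horizontal(2)[OF j that(2)])
    then show ?thesis using closed_arc[OF that(1)] by (simp add: sector_eq_iff)
  qed
  show "\<theta> j s = of_int n * pi \<Longrightarrow> out_sector N \<theta> j s \<in> {n - 1, n}"
    "\<theta> j t = of_int n * pi \<Longrightarrow> out_sector N \<theta> j s \<in> {n - 1, n}"
    "(j, frac s) \<notin> critical_points K \<Longrightarrow> sector (\<theta> j s) = out_sector N \<theta> j s"
    "(j, frac t) \<notin> critical_points K \<Longrightarrow> sector (\<theta> j t) = out_sector N \<theta> j s"
    using crit[of s] crit[of t] noncrit[of s] noncrit[of t] st unfolding k_def by auto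
qed

lemma arc_direction:
  assumes j: "j < comps K" and c: "consec (cov N j) s t" and t: "t \<in> cov N j"
    and uv: "s \<le> u" "u < v" "v \<le> t"
  shows "if even (out_sector N \<theta> j s) then Im (curve K j u) < Im (curve K j v)
     else Im (curve K j u) > Im (curve K j v)"
proof -
  have sg: "Im (vector_derivative (curve K j) (at x)) > 0 \<longleftrightarrow> even (out_sector N \<theta> j s)"
    "Im (vector_derivative (curve K j) (at x)) \<noteq> 0" if "u < x" "x < v" for x
  proof -
    have x: "s < x" "x < t" using that uv by auto
    show nz: "Im (vector_derivative (curve K j) (at x)) \<noteq> 0"
      using not_horizontal(1)[OF j arc_free[OF j c x]] .
    show "Im (vector_derivative (curve K j) (at x)) > 0 \<longleftrightarrow> even (out_sector N \<theta> j s)"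
      using direction_even[OF dir[OF j] nz] arc_sector[OF j c x t] by simp
  qed
  show ?thesis
  proof (cases "even (out_sector N \<theta> j s)")
    case True
    have "Im (curve K j u) < Im (curve K j v)"
    proof (rule DERIV_pos_imp_increasing_open[OF uv(2), of "\<lambda>t. Im (curve K j t)"])
      show "\<exists>y. ((\<lambda>t. Im (curve K j t)) has_real_derivative y) (at x) \<and> 0 < y" if "u < x" "x < v" for x
        using Im_curve_deriv[OF K j] sg[OF that] True by blast
    qed (rule Im_curve_cont[OF K j])
    then show ?thesis using True by simp
  next
    case False
    have "Im (curve K j u) > Im (curve K j v)"
    proof (rule DERIV_neg_imp_decreasing_open[OF uv(2), of "\<lambda>t. Im (curve K j t)"])
      show "\<exists>y. ((\<lambda>t. Im (curve K j t)) has_real_derivative y) (at x) \<and> y < 0" if "u < x" "x < v" for x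
        using Im_curve_deriv[OF K j] sg[OF that] False by (meson linorder_neqE_linordered_idom)
    qed (rule Im_curve_cont[OF K j])
    then show ?thesis using False by simp
  qed
qed

definition in_sec :: "nat \<times> real \<Rightarrow> int" where
  "in_sec P = out_sector N \<theta> (fst P) (before N (fst P) (snd P))"

definition out_sec :: "nat \<times> real \<Rightarrow> int" where
  "out_sec P = out_sector N \<theta> (fst P) (snd P)"

lemma node_arcs:
  assumes P: "P \<in> N"
  shows "fst P < comps K" "snd P \<in> cov N (fst P)" "frac (snd P) = snd P"
    "consec (cov N (fst P)) (before N (fst P) (snd P)) (snd P)"
    "after N (fst P) (snd P) \<in> cov N (fst P)"
    "consec (cov N (fst P)) (snd P) (after N (fst P) (snd P))"
proof -
  show j: "fst P < comps K" and "frac (snd P) = snd P"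
    using P cn by (auto simp: circle_nodes_def frac_eq)
  show t: "snd P \<in> cov N (fst P)" using node_in_cov[OF cn] P by simp
  show "consec (cov N (fst P)) (before N (fst P) (snd P)) (snd P)" by (rule before_consec[OF cn j])
  show "after N (fst P) (snd P) \<in> cov N (fst P)"
    "consec (cov N (fst P)) (snd P) (after N (fst P) (snd P))" by (rule after_consec[OF cn j t])+
qed

lemma sectors_noncritical:
  assumes P: "P \<in> N" and nc: "P \<notin> critical_points K"
  shows "in_sec P = sector (angle \<theta> P)" "out_sec P = sector (angle \<theta> P)"
proof -
  note a = node_arcs[OF P]
  have nc': "(fst P, frac (snd P)) \<notin> critical_points K" using nc a(3) by simp
  show "in_sec P = sector (angle \<theta> P)" "out_sec P = sector (angle \<theta> P)"
    using end_sector(4)[OF a(1,4,2) nc'] end_sector(3)[OF a(1,6,5) nc']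
    by (simp_all add: in_sec_def out_sec_def angle_def)
qed

lemma sectors_critical:
  assumes P: "P \<in> critical_points K"
  obtains n where "in_sec P \<in> {n - 1, n}" "out_sec P \<in> {n - 1, n}" "Re (tangent K P) > 0 \<longleftrightarrow> even n"
proof -
  have PN: "P \<in> N" using P by (simp add: nodes_def)
  note a = node_arcs[OF PN]
  have d: "direction (tangent K P) (angle \<theta> P)"
    using dir[OF a(1)] by (simp add: tangent_def angle_def)
  have im: "Im (tangent K P) = 0" using P by (simp add: critical_points_def)
  then obtain n where n: "angle \<theta> P = of_int n * pi" using direction_horizontal[OF d] by blast
  have "sector (angle \<theta> P) = n" unfolding n sector_def by simp
  then have "Re (tangent K P) > 0 \<longleftrightarrow> even n" using upward_direction[OF d] im by (simp add: upward_def)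
  moreover have "in_sec P \<in> {n - 1, n}" "out_sec P \<in> {n - 1, n}"
    using end_sector(2)[OF a(1,4,2), of n] end_sector(1)[OF a(1,6,5), of n] n
    by (simp_all add: in_sec_def out_sec_def angle_def)
  ultimately show ?thesis using that by blast
qed

lemma frequently_sides:
  assumes "s < t" "t < (r::real)" and e: "eventually Q (at t)"
  shows "\<exists>u. s < u \<and> u < t \<and> Q u" "\<exists>u. t < u \<and> u < r \<and> Q u"
proof -
  obtain d where d: "d > 0" "\<And>x. x \<noteq> t \<Longrightarrow> dist x t < d \<Longrightarrow> Q x"
    using e unfolding eventually_at by auto
  define e where "e = min (d / 2) (min ((t - s) / 2) ((r - t) / 2))"
  have e: "e > 0" "e < d" "e < t - s" "e < r - t" using d(1) assms by (auto simp: e_def min_def)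
  have "Q (t - e)" "Q (t + e)" using e by (intro d(2); simp add: dist_real_def)+
  then show "\<exists>u. s < u \<and> u < t \<and> Q u" "\<exists>u. t < u \<and> u < r \<and> Q u" using e
    by (intro exI[of _ "t - e"] exI[of _ "t + e"] conjI; linarith)+
qed

lemma maximum_sectors:
  assumes P: "P \<in> maxima K" shows "even (in_sec P)" "odd (out_sec P)"
proof -
  have PN: "P \<in> N" using P by (auto simp: nodes_def maxima_def)
  note a = node_arcs[OF PN]
  have ev: "eventually (\<lambda>s. Im (curve K (fst P) s) < Im (curve K (fst P) (snd P))) (at (snd P))"
    using P by (auto simp: maxima_def)
  let ?s = "before N (fst P) (snd P)" and ?r = "after N (fst P) (snd P)"
  have o: "?s < snd P" "snd P < ?r" using a(4,6) by (auto simp: consec_def)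
  obtain u where u: "?s < u" "u < snd P" "Im (curve K (fst P) u) < Im (curve K (fst P) (snd P))"
    using frequently_sides(1)[OF o ev] by blast
  show "even (in_sec P)" using arc_direction[OF a(1,4,2), of u "snd P"] u
    by (auto simp: in_sec_def split: if_splits)
  obtain u where u: "snd P < u" "u < ?r" "Im (curve K (fst P) u) < Im (curve K (fst P) (snd P))"
    using frequently_sides(2)[OF o ev] by blast
  show "odd (out_sec P)" using arc_direction[OF a(1,6,5), of "snd P" u] u
    by (auto simp: out_sec_def split: if_splits)
qed

lemma minimum_sectors:
  assumes P: "P \<in> minima K" shows "odd (in_sec P)" "even (out_sec P)"
proof -
  have PN: "P \<in> N" using P by (auto simp: nodes_def minima_def)
  note a = node_arcs[OF PN]
  have ev: "eventually (\<lambda>s. Im (curve K (fst P) s) > Im (curve K (fst P) (snd P))) (at (snd P))"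
    using P by (auto simp: minima_def)
  let ?s = "before N (fst P) (snd P)" and ?r = "after N (fst P) (snd P)"
  have o: "?s < snd P" "snd P < ?r" using a(4,6) by (auto simp: consec_def)
  obtain u where u: "?s < u" "u < snd P" "Im (curve K (fst P) u) > Im (curve K (fst P) (snd P))"
    using frequently_sides(1)[OF o ev] by blast
  show "odd (in_sec P)" using arc_direction[OF a(1,4,2), of u "snd P"] u
    by (auto simp: in_sec_def split: if_splits)
  obtain u where u: "snd P < u" "u < ?r" "Im (curve K (fst P) u) > Im (curve K (fst P) (snd P))"
    using frequently_sides(2)[OF o ev] by blast
  show "even (out_sec P)" using arc_direction[OF a(1,6,5), of "snd P" u] u
    by (auto simp: out_sec_def split: if_splits)
qed

lemma cross_crossings: "cross K = crossings K"
proof -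
  have "up_vec (tangent K P) = up_tangent K P" if "P \<in> double_points K" for P
  proof -
    have "P \<in> source K" "P \<notin> critical_points K"
      using that gp by (auto simp: general_position_def double_points_def double_def)
    then have "Im (tangent K P) \<noteq> 0" by (auto simp: critical_points_def)
    then show ?thesis by (auto simp: up_vec_def upward_def up_tangent_def)
  qed
  then show ?thesis using doubleD unfolding cross_def crossings_def
    by (intro Collect_cong) (metis (no_types, lifting) case_prodE case_prodI2 prod.case)
qed

end

context rotational_tensors
begin

lemma leg_conj_one: "x \<in> I \<times> I \<Longrightarrow> leg_conj one one F x = F x"
proof -
  assume x: "x \<in> I \<times> I"
  have "leg_conj one one F x = (\<Sum>y\<in>I \<times> I. if y = x then F y else 0)"
    unfolding leg_conj_def using x by (intro sum.cong refl) (auto simp: one_def)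
  also have "\<dots> = F x" using x finI by simp
  finally show ?thesis .
qed

text \<open>For a diagram in general position, a change of basis at the critical points moves the holonomy of the
  arcs to the maxima and minima.\<close>

lemma invariant_general_position:
  assumes gp: "general_position K"
  shows "invariant K = (\<Sum>\<sigma>\<in>nodes K \<rightarrow>\<^sub>E I.
    (\<Prod>P\<in>maxima K. A (\<sigma> (arc_left K P)) (\<sigma> (arc_right K P))) *
    (\<Prod>P\<in>minima K. B (\<sigma> (arc_left K P)) (\<sigma> (arc_right K P))) *
    (\<Prod>(P, Q)\<in>crossings K. X (mark K P)
       (\<sigma> (arc_up K P)) (\<sigma> (arc_up K Q)) (\<sigma> (arc_down K Q)) (\<sigma> (arc_down K P))))"
proof -
  have K: "virtual_link_diagram K" using gp by (simp add: general_position_def)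
  obtain \<theta> where \<theta>: "tangent_lift K \<theta>" using ex_tangent_lift[OF K] ..
  interpret gd: general_diagram K \<theta> by unfold_locales fact+
  let ?N = "nodes K" and ?C = "critical_points K"
  let ?k = "\<lambda>P. sector (angle \<theta> P)"
  have cn: "circle_nodes (comps K) ?N" by (rule gd.cn)
  have fin: "finite ?N" using cn by (simp add: circle_nodes_def)
  have disj: "?C \<inter> double_points K = {}" and CN: "?N = ?C \<union> double_points K"
    and Cmm: "?C = maxima K \<union> minima K"
    using gp by (auto simp: general_position_def nodes_def)
  have NC: "?N - double_points K = ?C" using CN disj by auto
  have pvN: "prev_node ?N P \<in> ?N" if "P \<in> ?N" for P using prev_node_in[OF cn that] .
  \<comment> \<open>The change of basis transports the labels at a node from its direction to the direction of the arc
  that leaves it. It is trivial except at the critical points.\<close>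
  let ?H = "\<lambda>P. hol (gd.in_sec P) (gd.out_sec P)"
  let ?T = "node_tensor K ?N"
  have "state_sum ?N (prev_node ?N) ?H ?T = state_sum ?N (prev_node ?N) (\<lambda>P. arc_hol ?N \<theta> (fst P) (snd P))
    (\<lambda>\<gamma>'. \<Sum>\<gamma>\<in>?N \<rightarrow>\<^sub>E I \<times> I. (\<Prod>P\<in>?N. hol (?k P) (gd.out_sec P) (fst (\<gamma>' P)) (fst (\<gamma> P)) *
       hol (gd.out_sec P) (?k P) (snd (\<gamma> P)) (snd (\<gamma>' P))) * ?T \<gamma>)"
  proof (rule state_sum_gauge[OF fin prev_node_bij[OF cn]])
    fix P assume P: "P \<in> ?N"
    note a = gd.node_arcs[OF P]
    let ?j = "fst P" and ?s = "before ?N (fst P) (snd P)" and ?R = "prev_node ?N P"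
    have s: "frac ?s \<in> cov ?N ?j" using a(4) by (simp add: consec_def cov_def)
    have sf: "?s = frac ?s + of_int \<lfloor>?s\<rfloor>" by (simp add: frac_def)
    obtain m :: int where m: "\<And>t. sector (\<theta> ?j (t + of_int \<lfloor>?s\<rfloor>)) = sector (\<theta> ?j t) + 2 * m"
      using sector_periodic[OF K \<theta> a(1)] by blast
    have R: "?R = (?j, frac ?s)" by (simp add: prev_node_def)
    have 1: "sector (\<theta> ?j ?s) = ?k ?R + 2 * m"
      using m[of "frac ?s"] sf by (simp add: R angle_def)
    have "(frac ?s + of_int \<lfloor>?s\<rfloor> + (after ?N ?j (frac ?s) + of_int \<lfloor>?s\<rfloor>)) / 2 =
        (frac ?s + after ?N ?j (frac ?s)) / 2 + of_int \<lfloor>?s\<rfloor>" by (simp add: field_simps)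
    then have 2: "gd.in_sec P = gd.out_sec ?R + 2 * m"
      unfolding gd.in_sec_def gd.out_sec_def R out_sector_def fst_conv snd_conv
      using after_shift[OF cn a(1) s, of "\<lfloor>?s\<rfloor>"] m sf by metis
    have "arc_hol ?N \<theta> ?j (snd P) = hol (?k ?R + 2 * m) (?k P)"
      by (simp add: arc_hol_def 1 angle_def)
    moreover have "hol (gd.out_sec ?R) (?k ?R) = hol (gd.in_sec P) (?k ?R + 2 * m)"
      unfolding 2 by (rule hol_periodic[symmetric])
    ultimately show "?H P = mat_mul (hol (gd.out_sec ?R) (?k ?R))
        (mat_mul (arc_hol ?N \<theta> ?j (snd P)) (hol (?k P) (gd.out_sec P)))"
      by simp
  qed
  also have "\<dots> = diagram_sum K ?N \<theta>"
    unfolding diagram_sum_def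
  proof (rule state_sum_cong)
    fix \<gamma>' assume g': "\<gamma>' \<in> ?N \<rightarrow>\<^sub>E I \<times> I"
    let ?t = "\<lambda>(P, Q). sector_tensor (sector (angle \<theta> P - angle \<theta> Q)) (?k P) (?k Q) (mark K P)"
    have "(\<Sum>\<gamma>\<in>?N \<rightarrow>\<^sub>E I \<times> I. (\<Prod>P\<in>?N. hol (?k P) (gd.out_sec P) (fst (\<gamma>' P)) (fst (\<gamma> P)) *
       hol (gd.out_sec P) (?k P) (snd (\<gamma> P)) (snd (\<gamma>' P))) * ?T \<gamma>) =
      (\<Prod>P\<in>?N - double_points K. one (fst (\<gamma>' P)) (snd (\<gamma>' P))) *
      (\<Prod>(P, Q)\<in>pairs K. leg_conj (hol (?k P) (gd.out_sec P)) (hol (gd.out_sec P) (?k P))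
        (\<lambda>x. leg_conj (hol (?k Q) (gd.out_sec Q)) (hol (gd.out_sec Q) (?k Q)) (\<lambda>y. ?t (P, Q) x y) (\<gamma>' Q)) (\<gamma>' P))"
      unfolding node_tensor_pairs[OF K \<theta>]
      using conj_node_tensor[OF K gd.adm g', of "\<lambda>P. hol (?k P) (gd.out_sec P)"
          "\<lambda>P. hol (gd.out_sec P) (?k P)" ?t] by simp
    also have "\<dots> = ?T \<gamma>'"
      unfolding node_tensor_pairs[OF K \<theta>]
    proof (intro arg_cong2[where f="(*)"] prod.cong refl)
      fix c assume c: "c \<in> pairs K"
      obtain P Q where PQ: "c = (P, Q)" by (cases c)
      have "double K P Q" using c by (simp add: PQ pairs_def)
      note d = doubleD[OF this]
      have PN: "P \<in> ?N" "Q \<in> ?N" "P \<notin> ?C" "Q \<notin> ?C" using d disj CN by auto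
      have l: "\<gamma>' P \<in> I \<times> I" "\<gamma>' Q \<in> I \<times> I" using g' PN by (auto simp: PiE_iff)
      show "(case c of (P, Q) \<Rightarrow> leg_conj (hol (?k P) (gd.out_sec P)) (hol (gd.out_sec P) (?k P))
        (\<lambda>x. leg_conj (hol (?k Q) (gd.out_sec Q)) (hol (gd.out_sec Q) (?k Q)) (\<lambda>y. ?t (P, Q) x y) (\<gamma>' Q)) (\<gamma>' P)) =
        (case c of (P, Q) \<Rightarrow> sector_tensor (sector (angle \<theta> P - angle \<theta> Q)) (?k P) (?k Q) (mark K P) (\<gamma>' P) (\<gamma>' Q))"
        using gd.sectors_noncritical(2)[OF PN(1,3)] gd.sectors_noncritical(2)[OF PN(2,4)] l
        by (simp add: PQ leg_conj_one)
    qed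
    finally show "(\<Sum>\<gamma>\<in>?N \<rightarrow>\<^sub>E I \<times> I. (\<Prod>P\<in>?N. hol (?k P) (gd.out_sec P) (fst (\<gamma>' P)) (fst (\<gamma> P)) *
       hol (gd.out_sec P) (?k P) (snd (\<gamma> P)) (snd (\<gamma>' P))) * ?T \<gamma>) = ?T \<gamma>'" .
  qed (use pvN in auto)
  also have "\<dots> = invariant K" by (rule invariant_eq[OF K \<theta> gd.adm, symmetric])
  finally have inv: "invariant K = state_sum ?N (prev_node ?N) ?H ?T" ..

  \<comment> \<open>Only labellings that come from one label for each arc contribute: the matrix of an arc that arrives
  at a double point is now the identity, and at a critical point so is the tensor of the node.\<close>
  define ext where "ext \<sigma> = (\<lambda>P\<in>?N. (if P \<in> ?C then \<sigma> P else \<sigma> (prev_node ?N P), \<sigma> P))" for \<sigma> :: "nat \<times> real \<Rightarrow> 'i"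
  let ?F = "\<lambda>\<gamma>. (\<Prod>P\<in>?N. ?H P (snd (\<gamma> (prev_node ?N P))) (fst (\<gamma> P))) * ?T \<gamma>"
  have Hd: "?H P = one" if "P \<in> double_points K" for P
  proof -
    have "P \<in> ?N" "P \<notin> ?C" using that CN disj by blast+
    from gd.sectors_noncritical[OF this] show ?thesis by simp
  qed
  have "invariant K = (\<Sum>\<gamma>\<in>ext ` (?N \<rightarrow>\<^sub>E I). ?F \<gamma>)"
    unfolding inv state_sum_def
  proof (rule sum.mono_neutral_right)
    show "finite (?N \<rightarrow>\<^sub>E I \<times> I)" using fin finI by (intro finite_PiE) auto
    show "ext ` (?N \<rightarrow>\<^sub>E I) \<subseteq> ?N \<rightarrow>\<^sub>E I \<times> I"
      using pvN by (auto simp: ext_def PiE_iff)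
    show "\<forall>\<gamma>\<in>(?N \<rightarrow>\<^sub>E I \<times> I) - ext ` (?N \<rightarrow>\<^sub>E I). ?F \<gamma> = 0"
    proof
      fix \<gamma> assume g: "\<gamma> \<in> (?N \<rightarrow>\<^sub>E I \<times> I) - ext ` (?N \<rightarrow>\<^sub>E I)"
      define \<sigma> where "\<sigma> = (\<lambda>P\<in>?N. snd (\<gamma> P))"
      have "\<sigma> \<in> ?N \<rightarrow>\<^sub>E I" using g by (auto simp: \<sigma>_def PiE_iff mem_Times_iff)
      then have "ext \<sigma> \<noteq> \<gamma>" using g by auto
      moreover have "ext \<sigma> P = \<gamma> P" if "P \<notin> ?N" for P
        using g that PiE_arb[of \<gamma> ?N _ P] by (auto simp: ext_def)
      ultimately obtain P where P: "P \<in> ?N" "ext \<sigma> P \<noteq> \<gamma> P" by (metis ext)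
      then have ne: "fst (\<gamma> P) \<noteq> (if P \<in> ?C then snd (\<gamma> P) else snd (\<gamma> (prev_node ?N P)))"
        using pvN[OF P(1)] by (auto simp: ext_def \<sigma>_def prod_eq_iff split: if_splits)
      show "?F \<gamma> = 0"
      proof (cases "P \<in> ?C")
        case True
        then have "(\<Prod>P\<in>?N - double_points K. one (fst (\<gamma> P)) (snd (\<gamma> P))) = 0"
          unfolding NC using ne fin CN by (intro prod_zero bexI[of _ P]) (simp_all add: one_def)
        then show ?thesis by (simp add: node_tensor_def)
      next
        case False
        then have "P \<in> double_points K" using P CN by auto
        then have "?H P (snd (\<gamma> (prev_node ?N P))) (fst (\<gamma> P)) = 0" using ne False by (auto simp: Hd one_def)
        then have "(\<Prod>P\<in>?N. ?H P (snd (\<gamma> (prev_node ?N P))) (fst (\<gamma> P))) = 0"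
          using fin P(1) by (intro prod_zero) blast+
        then show ?thesis by simp
      qed
    qed
  qed
  also have "\<dots> = (\<Sum>\<sigma>\<in>?N \<rightarrow>\<^sub>E I. ?F (ext \<sigma>))"
  proof -
    have "inj_on ext (?N \<rightarrow>\<^sub>E I)"
    proof (rule inj_onI)
      fix \<sigma> \<sigma>' assume s: "\<sigma> \<in> ?N \<rightarrow>\<^sub>E I" "\<sigma>' \<in> ?N \<rightarrow>\<^sub>E I" "ext \<sigma> = ext \<sigma>'"
      have "\<sigma> P = \<sigma>' P" if "P \<in> ?N" for P
        using fun_cong[OF s(3), of P] that by (simp add: ext_def)
      then show "\<sigma> = \<sigma>'" by (rule PiE_ext[OF s(1,2)])
    qed
    from sum.reindex[OF this, of ?F] show ?thesis by (simp only: comp_def)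
  qed
  also have "\<dots> = (\<Sum>\<sigma>\<in>?N \<rightarrow>\<^sub>E I.
    (\<Prod>P\<in>maxima K. A (\<sigma> (arc_left K P)) (\<sigma> (arc_right K P))) *
    (\<Prod>P\<in>minima K. B (\<sigma> (arc_left K P)) (\<sigma> (arc_right K P))) *
    (\<Prod>(P, Q)\<in>crossings K. X (mark K P)
       (\<sigma> (arc_up K P)) (\<sigma> (arc_up K Q)) (\<sigma> (arc_down K Q)) (\<sigma> (arc_down K P))))"
  proof (intro sum.cong refl)
    fix \<sigma> assume \<sigma>: "\<sigma> \<in> ?N \<rightarrow>\<^sub>E I"
    have lab: "\<sigma> P \<in> I" if "P \<in> ?N" for P using \<sigma> that by (auto simp: PiE_iff)
    have ain: "arc_in K P = prev_node ?N P" if "P \<in> ?N" for P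
      using arc_in_prev_node[OF cn that] .
    have eP: "snd (ext \<sigma> (prev_node ?N P)) = \<sigma> (prev_node ?N P)" "snd (ext \<sigma> P) = \<sigma> P"
      "fst (ext \<sigma> P) = (if P \<in> ?C then \<sigma> P else \<sigma> (prev_node ?N P))" if "P \<in> ?N" for P
      using that pvN[OF that] by (simp_all add: ext_def)
    have dC: "maxima K \<inter> minima K = {}" using gd.maximum_sectors gd.minimum_sectors by blast
    have finC: "finite (maxima K)" "finite (minima K)" "finite (double_points K)"
      using fin CN Cmm by (auto intro: finite_subset)
    have hmax: "?H P a b = (if Re (tangent K P) > 0 then A a b else A b a)"
      if P: "P \<in> maxima K" and ab: "a \<in> I" "b \<in> I" for P a b
    proof -
      obtain n where n: "gd.in_sec P \<in> {n - 1, n}" "gd.out_sec P \<in> {n - 1, n}" "Re (tangent K P) > 0 \<longleftrightarrow> even n"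
        using gd.sectors_critical P Cmm by blast
      show ?thesis
      proof (cases "even n")
        case True
        then have "gd.in_sec P = n" "gd.out_sec P = n - 1" using n gd.maximum_sectors[OF P] by auto
        then show ?thesis using hol_step_inv[of "n - 1"] True ab n(3) by (simp add: step_inv_def)
      next
        case False
        then have "gd.in_sec P = n - 1" "gd.out_sec P = n" using n gd.maximum_sectors[OF P] by auto
        then show ?thesis using hol_step[of "n - 1"] False ab n(3) by (simp add: step_def)
      qed
    qed
    have hmin: "?H P a b = (if Re (tangent K P) > 0 then B a b else B b a)"
      if P: "P \<in> minima K" and ab: "a \<in> I" "b \<in> I" for P a b
    proof -
      obtain n where n: "gd.in_sec P \<in> {n - 1, n}" "gd.out_sec P \<in> {n - 1, n}" "Re (tangent K P) > 0 \<longleftrightarrow> even n"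
        using gd.sectors_critical P Cmm by blast
      show ?thesis
      proof (cases "even n")
        case True
        then have "gd.in_sec P = n - 1" "gd.out_sec P = n" using n gd.minimum_sectors[OF P] by auto
        then show ?thesis using hol_step[of "n - 1"] True ab n(3) by (simp add: step_def)
      next
        case False
        then have "gd.in_sec P = n" "gd.out_sec P = n - 1" using n gd.minimum_sectors[OF P] by auto
        then show ?thesis using hol_step_inv[of "n - 1"] False ab n(3) by (simp add: step_inv_def)
      qed
    qed
    have "(\<Prod>P\<in>?N. ?H P (snd (ext \<sigma> (prev_node ?N P))) (fst (ext \<sigma> P))) =
      (\<Prod>P\<in>maxima K \<union> minima K. ?H P (snd (ext \<sigma> (prev_node ?N P))) (fst (ext \<sigma> P))) *
      (\<Prod>P\<in>double_points K. ?H P (snd (ext \<sigma> (prev_node ?N P))) (fst (ext \<sigma> P)))"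
      unfolding CN Cmm using finC disj Cmm by (intro prod.union_disjoint) auto
    also have "(\<Prod>P\<in>double_points K. ?H P (snd (ext \<sigma> (prev_node ?N P))) (fst (ext \<sigma> P))) = 1"
    proof (intro prod.neutral ballI)
      fix P assume P: "P \<in> double_points K"
      then have "P \<in> ?N" "P \<notin> ?C" using CN disj by auto
      then show "?H P (snd (ext \<sigma> (prev_node ?N P))) (fst (ext \<sigma> P)) = 1"
        using lab pvN by (simp add: Hd[OF P] eP one_def)
    qed
    also have "(\<Prod>P\<in>maxima K \<union> minima K. ?H P (snd (ext \<sigma> (prev_node ?N P))) (fst (ext \<sigma> P))) =
      (\<Prod>P\<in>maxima K. ?H P (snd (ext \<sigma> (prev_node ?N P))) (fst (ext \<sigma> P))) *
      (\<Prod>P\<in>minima K. ?H P (snd (ext \<sigma> (prev_node ?N P))) (fst (ext \<sigma> P)))"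
      using finC dC by (intro prod.union_disjoint) auto
    also have "(\<Prod>P\<in>maxima K. ?H P (snd (ext \<sigma> (prev_node ?N P))) (fst (ext \<sigma> P))) =
      (\<Prod>P\<in>maxima K. A (\<sigma> (arc_left K P)) (\<sigma> (arc_right K P)))"
    proof (intro prod.cong refl)
      fix P assume P: "P \<in> maxima K"
      then have PN: "P \<in> ?N" "P \<in> ?C" using Cmm CN by auto
      show "?H P (snd (ext \<sigma> (prev_node ?N P))) (fst (ext \<sigma> P)) = A (\<sigma> (arc_left K P)) (\<sigma> (arc_right K P))"
        using PN lab pvN by (simp add: hmax[OF P] eP arc_left_def arc_right_def arc_out_def ain)
    qed
    also have "(\<Prod>P\<in>minima K. ?H P (snd (ext \<sigma> (prev_node ?N P))) (fst (ext \<sigma> P))) =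
      (\<Prod>P\<in>minima K. B (\<sigma> (arc_left K P)) (\<sigma> (arc_right K P)))"
    proof (intro prod.cong refl)
      fix P assume P: "P \<in> minima K"
      then have PN: "P \<in> ?N" "P \<in> ?C" using Cmm CN by auto
      show "?H P (snd (ext \<sigma> (prev_node ?N P))) (fst (ext \<sigma> P)) = B (\<sigma> (arc_left K P)) (\<sigma> (arc_right K P))"
        using PN lab pvN by (simp add: hmin[OF P] eP arc_left_def arc_right_def arc_out_def ain)
    qed
    finally have 1: "(\<Prod>P\<in>?N. ?H P (snd (ext \<sigma> (prev_node ?N P))) (fst (ext \<sigma> P))) =
      (\<Prod>P\<in>maxima K. A (\<sigma> (arc_left K P)) (\<sigma> (arc_right K P))) *
      (\<Prod>P\<in>minima K. B (\<sigma> (arc_left K P)) (\<sigma> (arc_right K P)))" by simp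
    have "(\<Prod>P\<in>?N - double_points K. one (fst (ext \<sigma> P)) (snd (ext \<sigma> P))) = 1"
      unfolding NC using lab by (intro prod.neutral ballI) (auto simp: eP one_def nodes_def)
    moreover have "(\<Prod>(P, Q)\<in>cross K. X (mark K P) (lab_up K (ext \<sigma>) P) (lab_up K (ext \<sigma>) Q)
        (lab_down K (ext \<sigma>) Q) (lab_down K (ext \<sigma>) P)) =
      (\<Prod>(P, Q)\<in>crossings K. X (mark K P)
       (\<sigma> (arc_up K P)) (\<sigma> (arc_up K Q)) (\<sigma> (arc_down K Q)) (\<sigma> (arc_down K P)))"
      unfolding gd.cross_crossings
    proof (intro prod.cong refl)
      fix c assume c: "c \<in> crossings K"
      obtain P Q where PQ: "c = (P, Q)" by (cases c)
      have "double K P Q" using c by (simp add: PQ crossings_def)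
      note d = doubleD[OF this]
      have l: "lab_up K (ext \<sigma>) P = \<sigma> (arc_up K P)" "lab_down K (ext \<sigma>) P = \<sigma> (arc_down K P)"
        if "P \<in> double_points K" for P
      proof -
        have P: "P \<in> ?N" "P \<notin> ?C" using that CN disj by auto
        have "P \<in> source K" using that by (auto simp: double_points_def double_def)
        then have "Im (tangent K P) \<noteq> 0" using P by (auto simp: critical_points_def)
        then show "lab_up K (ext \<sigma>) P = \<sigma> (arc_up K P)" "lab_down K (ext \<sigma>) P = \<sigma> (arc_down K P)"
          using P by (auto simp: lab_up_def lab_down_def arc_up_def arc_down_def upward_def arc_out_def ain eP)
      qed
      show "(case c of (P, Q) \<Rightarrow> X (mark K P) (lab_up K (ext \<sigma>) P) (lab_up K (ext \<sigma>) Q)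
        (lab_down K (ext \<sigma>) Q) (lab_down K (ext \<sigma>) P)) = (case c of (P, Q) \<Rightarrow> X (mark K P)
       (\<sigma> (arc_up K P)) (\<sigma> (arc_up K Q)) (\<sigma> (arc_down K Q)) (\<sigma> (arc_down K P)))"
        by (simp add: PQ l d)
    qed
    ultimately show "?F (ext \<sigma>) = (\<Prod>P\<in>maxima K. A (\<sigma> (arc_left K P)) (\<sigma> (arc_right K P))) *
      (\<Prod>P\<in>minima K. B (\<sigma> (arc_left K P)) (\<sigma> (arc_right K P))) *
      (\<Prod>(P, Q)\<in>crossings K. X (mark K P)
       (\<sigma> (arc_up K P)) (\<sigma> (arc_up K Q)) (\<sigma> (arc_down K Q)) (\<sigma> (arc_down K P)))"
      by (simp only: 1 node_tensor_def) simp
  qed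
  finally show ?thesis .
qed

end

section \<open>Local changes in a box\<close>

lemma nonzero_same_sign:
  fixes f :: "'a::topological_space \<Rightarrow> real"
  assumes "connected S" "continuous_on S f" "\<And>z. z \<in> S \<Longrightarrow> f z \<noteq> 0" "x \<in> S" "y \<in> S"
  shows "f x > 0 \<longleftrightarrow> f y > 0"
proof -
  have c: "connected (f ` S)" using assms(2,1) by (rule connected_continuous_image)
  have "0 \<in> f ` S" if "x \<in> S" "y \<in> S" "f x < 0" "f y > 0" for x y
    using connectedD_interval[OF c imageI[OF that(1)] imageI[OF that(2)], of 0] that by simp
  then have *: "\<not> (f x < 0 \<and> f y > 0)" if "x \<in> S" "y \<in> S" for x y
    using assms(3) that by (metis imageE)
  show ?thesis using *[OF assms(4,5)] *[OF assms(5,4)] assms(3)[OF assms(4)] assms(3)[OF assms(5)] by linarith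
qed

locale strand_box =
  fixes K m c u v p q
  assumes K: "virtual_link_diagram K" and box: "strands_in_box K m c u v p q"
begin

text \<open>The circles are cut at the ends of the strands. \<open>E\<close> consists of the ends at which the circle leaves the
  box, so that the arcs that arrive there lie inside. The base points guarantee that every circle has a
  node outside.\<close>

definition E :: "(nat \<times> real) set" where "E = (\<Union>i<m. {(c i, v i)})"

definition Nout :: "(nat \<times> real) set" where
  "Nout = {P \<in> double_points K. pos K P \<notin> cbox p q} \<union> {..<comps K} \<times> {0} \<union>
     (\<Union>i<m. {(c i, u i), (c i, v i)})"

definition vd :: "nat \<Rightarrow> real \<Rightarrow> complex" where
  "vd i t = vector_derivative (curve K (c i)) (at t)"

definition h :: "nat \<Rightarrow> real \<Rightarrow> real" where "h i t = Im (curve K (c i) t)"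

definition up :: "nat \<Rightarrow> bool" where "up i \<longleftrightarrow> Im (vd i (u i)) > 0"

lemma pq: "Re p < Re q" "Im p < Im q"
  using box by (auto simp: strands_in_box_def)

lemma str: assumes "i < m" shows "c i < comps K" "0 < u i" "u i < v i" "v i < 1"
  using box assms by (auto simp: strands_in_box_def)

lemma str_source: "i < m \<Longrightarrow> t \<in> {u i..v i} \<Longrightarrow> (c i, t) \<in> source K"
  using str[of i] by (auto simp: source_def)

lemma inbox:
  assumes "P \<in> source K"
  shows "pos K P \<in> cbox p q \<longleftrightarrow> (\<exists>i<m. fst P = c i \<and> snd P \<in> {u i..v i})"
proof -
  have "{P \<in> source K. pos K P \<in> cbox p q} = (\<Union>i<m. {c i} \<times> {u i..v i})"
    using box unfolding strands_in_box_def by blast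
  then have "pos K P \<in> cbox p q \<longleftrightarrow> P \<in> (\<Union>i<m. {c i} \<times> {u i..v i})" using assms by blast
  then show ?thesis by (cases P) auto
qed

lemma strand_unique:
  assumes "i < m" "i' < m" "c i = c i'" "t \<in> {u i..v i}" "t \<in> {u i'..v i'}"
  shows "i = i'"
proof (rule ccontr)
  assume "i \<noteq> i'"
  then have "({c i} \<times> {u i..v i}) \<inter> ({c i'} \<times> {u i'..v i'}) = {}"
    using box assms(1,2) unfolding strands_in_box_def by blast
  moreover have "(c i, t) \<in> ({c i} \<times> {u i..v i}) \<inter> ({c i'} \<times> {u i'..v i'})" using assms by simp
  ultimately show False by blast
qed

lemma vd_nz: "i < m \<Longrightarrow> t \<in> {u i..v i} \<Longrightarrow> Im (vd i t) \<noteq> 0"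
  using box by (auto simp: strands_in_box_def tangent_def vd_def)

lemma vd_sign: "i < m \<Longrightarrow> t \<in> {u i..v i} \<Longrightarrow> Im (vd i t) > 0 \<longleftrightarrow> up i"
proof -
  assume i: "i < m" and t: "t \<in> {u i..v i}"
  have "continuous_on {u i..v i} (vd i)"
    using diagram_curve(5)[OF K str(1)[OF i]] continuous_on_subset unfolding vd_def by blast
  then have "continuous_on {u i..v i} (\<lambda>t. Im (vd i t))" by (intro continuous_intros)
  then show "Im (vd i t) > 0 \<longleftrightarrow> up i"
    unfolding up_def using vd_nz[OF i] t str(3)[OF i]
    by (intro nonzero_same_sign[of "{u i..v i}" "\<lambda>t. Im (vd i t)"]) auto
qed

lemma tangent_vd: "tangent K (c i, t) = vd i t"
  by (simp add: tangent_def vd_def)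

lemma upward_strand: "i < m \<Longrightarrow> t \<in> {u i..v i} \<Longrightarrow> upward (tangent K (c i, t)) \<longleftrightarrow> up i"
  using vd_sign[of i t] vd_nz[of i t] by (auto simp: upward_def tangent_vd)

lemma h_deriv: "i < m \<Longrightarrow> (h i has_real_derivative Im (vd i t)) (at t)"
  unfolding h_def vd_def by (rule Im_curve_deriv[OF K str(1)])

lemma h_cont: "i < m \<Longrightarrow> continuous_on S (h i)"
  unfolding h_def by (rule Im_curve_cont[OF K str(1)])

lemma h_mono:
  assumes i: "i < m" and st: "u i \<le> s" "s < t" "t \<le> v i"
  shows "if up i then h i s < h i t else h i t < h i s"
proof (cases "up i")
  case True
  have "h i s < h i t"
  proof (rule DERIV_pos_imp_increasing[OF st(2)])
    show "\<exists>y. (h i has_real_derivative y) (at x) \<and> y > 0" if "s \<le> x" "x \<le> t" for x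
      using h_deriv[OF i, of x] vd_sign[OF i, of x] that st True by auto
  qed
  then show ?thesis using True by simp
next
  case False
  have "h i t < h i s"
  proof (rule DERIV_neg_imp_decreasing[OF st(2)])
    show "\<exists>y. (h i has_real_derivative y) (at x) \<and> y < 0" if "s \<le> x" "x \<le> t" for x
    proof -
      have "x \<in> {u i..v i}" using that st by auto
      then show ?thesis using h_deriv[OF i, of x] vd_sign[OF i, of x] vd_nz[OF i, of x] False
        by (meson linorder_neqE_linordered_idom)
    qed
  qed
  then show ?thesis using False by simp
qed

lemma h_less_iff:
  assumes i: "i < m" and st: "s \<in> {u i..v i}" "t \<in> {u i..v i}"
  shows "h i s < h i t \<longleftrightarrow> (if up i then s < t else t < s)"
  using h_mono[OF i, of s t] h_mono[OF i, of t s] st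
  by (cases s t rule: linorder_cases) (auto split: if_splits)

lemma h_inj: "i < m \<Longrightarrow> inj_on (h i) {u i..v i}"
  using h_less_iff by (intro inj_onI) (metis less_irrefl linorder_neqE_linordered_idom)

lemma h_ends:
  assumes i: "i < m"
  shows "h i (u i) = (if up i then Im p else Im q)" "h i (v i) = (if up i then Im q else Im p)"
proof -
  have "{Im (pos K (c i, u i)), Im (pos K (c i, v i))} = {Im p, Im q}"
    using box i unfolding strands_in_box_def by blast
  then have "{h i (u i), h i (v i)} = {Im p, Im q}" by (simp add: pos_def h_def)
  then show "h i (u i) = (if up i then Im p else Im q)" "h i (v i) = (if up i then Im q else Im p)"
    using h_mono[OF i order.refl str(3)[OF i] order.refl] pq
    by (auto simp: doubleton_eq_iff split: if_splits)
qed

lemma h_range: assumes i: "i < m" and t: "t \<in> {u i..v i}" shows "h i t \<in> {Im p..Im q}"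
  using h_ends[OF i] h_less_iff[OF i, of t "u i"] h_less_iff[OF i, of "u i" t]
    h_less_iff[OF i, of t "v i"] h_less_iff[OF i, of "v i" t] t str(3)[OF i]
  by (auto split: if_splits)

lemma double_in_box:
  assumes "double K P Q" "pos K P \<in> cbox p q"
  shows "Im p < Im (pos K P)" "Im (pos K P) < Im q"
  using box assms doubleD(1)[OF assms(1)] unfolding strands_in_box_def by blast+

lemma end_not_double:
  assumes i: "i < m" and t: "t = u i \<or> t = v i" shows "(c i, t) \<notin> double_points K"
proof
  assume d: "(c i, t) \<in> double_points K"
  have t': "t \<in> {u i..v i}" using t str(3)[OF i] by auto
  then have "pos K (c i, t) \<in> cbox p q" using inbox[OF str_source[OF i t']] i by auto
  then have "Im p < h i t" "h i t < Im q"
    using d double_in_box[of "(c i, t)"] by (auto simp: double_points_def pos_def h_def)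
  then show False using t h_ends[OF i] by (auto split: if_splits)
qed

lemma Nout_source: "Nout \<subseteq> source K"
  using str by (force simp: Nout_def double_points_def double_def source_def)

lemma Nout_interior:
  assumes P: "P \<in> Nout" and i: "i < m" "fst P = c i" shows "snd P \<notin> {u i<..<v i}"
proof
  assume s: "snd P \<in> {u i<..<v i}"
  consider "P \<in> source K" "pos K P \<notin> cbox p q" | "snd P = 0"
    | i' where "i' < m" "P = (c i', u i') \<or> P = (c i', v i')"
    using P Nout_source unfolding Nout_def by fastforce
  then show False
  proof cases
    case 1
    moreover have "\<exists>i<m. fst P = c i \<and> snd P \<in> {u i..v i}" using i s by (intro exI[of _ i]) auto
    ultimately show False using inbox[of P] by blast
  next
    case 2
    then show False using s str(2)[OF i(1)] by auto
  next
    case 3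
    then have "snd P \<in> {u i'..v i'}" "c i = c i'" using i str(3) by (auto simp: less_imp_le)
    then have "i = i'" using strand_unique[OF i(1) 3(1), of "snd P"] s by simp
    then show False using 3 s by auto
  qed
qed

lemma Nout_nodes: "circle_nodes (comps K) Nout"
  using Nout_source finite_double_points[OF K]
  by (auto simp: circle_nodes_def source_def Nout_def intro: finite_subset[of _ "double_points K"])

lemma out_arc_free:
  assumes P: "P \<in> Nout - E" and x: "before Nout (fst P) (snd P) < x" "x < snd P"
    and i: "i < m" "c i = fst P"
  shows "frac x \<notin> {u i..v i}"
proof
  assume fx: "frac x \<in> {u i..v i}"
  define n where "n = \<lfloor>x\<rfloor>"
  have xn: "x = frac x + of_int n" by (simp add: n_def frac_def)
  have P': "fst P < comps K" "0 \<le> snd P" "snd P < 1" using P Nout_source by (auto simp: source_def)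
  let ?s = "before Nout (fst P) (snd P)"
  have cs: "consec (cov Nout (fst P)) ?s (snd P)" by (rule before_consec[OF Nout_nodes P'(1)])
  have ends: "u i + of_int n \<in> cov Nout (fst P)" "v i + of_int n \<in> cov Nout (fst P)"
  proof -
    have "(c i, u i) \<in> Nout" "(c i, v i) \<in> Nout" using i(1) by (auto simp: Nout_def)
    then show "u i + of_int n \<in> cov Nout (fst P)" "v i + of_int n \<in> cov Nout (fst P)"
      using i(2) str[OF i(1)] by (simp_all add: cov_unit)
  qed
  have nb: "\<not> (?s < y \<and> y < snd P)" if "y \<in> cov Nout (fst P)" for y
    using cs that by (auto simp: consec_def)
  have 1: "snd P \<le> v i + of_int n" "u i + of_int n \<le> ?s"
    using nb[OF ends(1)] nb[OF ends(2)] x fx xn by auto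
  have "of_int n < (1::real)" "of_int n > (-1::real)" using 1 P' x str[OF i(1)] by linarith+
  then have "n = 0" by linarith
  then have "snd P \<in> {u i<..v i}" using 1 x by auto
  moreover have "snd P \<noteq> v i" using P i by (cases P) (auto simp: E_def)
  ultimately show False using Nout_interior[of P i] P i by auto
qed

end

text \<open>Two nodes on each strand, which must include all crossings in the box, and one intermediate arc between
  them: in each of the moves, a strand takes part in at most two crossings.\<close>

locale box_nodes = strand_box +
  fixes lo hi :: "nat \<Rightarrow> real"
  assumes lohi: "\<And>i. i < m \<Longrightarrow> lo i \<in> {u i<..<v i}" "\<And>i. i < m \<Longrightarrow> hi i \<in> {u i<..<v i}"
      "\<And>i. i < m \<Longrightarrow> h i (lo i) < h i (hi i)"
    and dbl_sub: "\<And>P. P \<in> double_points K \<Longrightarrow> pos K P \<in> cbox p q \<Longrightarrow>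
      P \<in> (\<Union>i<m. {(c i, lo i), (c i, hi i)})"
begin

definition Nin :: "(nat \<times> real) set" where "Nin = (\<Union>i<m. {(c i, lo i), (c i, hi i)})"

definition N :: "(nat \<times> real) set" where "N = Nout \<union> Nin"

definition a :: "nat \<Rightarrow> real" where "a i = min (lo i) (hi i)"
definition b :: "nat \<Rightarrow> real" where "b i = max (lo i) (hi i)"

lemma ab: assumes "i < m"
  shows "u i < a i" "a i < b i" "b i < v i" "lo i = (if up i then a i else b i)"
    "hi i = (if up i then b i else a i)" "lo i \<noteq> hi i"
proof -
  have l: "lo i \<in> {u i..v i}" "hi i \<in> {u i..v i}" using lohi[OF assms] by auto
  have "if up i then lo i < hi i else hi i < lo i" using h_less_iff[OF assms l] lohi(3)[OF assms] by auto
  then show "u i < a i" "a i < b i" "b i < v i" "lo i = (if up i then a i else b i)"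
    "hi i = (if up i then b i else a i)" "lo i \<noteq> hi i"
    using lohi[OF assms] by (auto simp: a_def b_def split: if_splits)
qed

lemma Nin_ab: "Nin = (\<Union>i<m. {(c i, a i), (c i, b i)})"
  unfolding Nin_def using ab by (intro SUP_cong refl) auto

lemma Nin_iff:
  assumes "i < m" "t \<in> {u i..v i}" shows "(c i, t) \<in> Nin \<longleftrightarrow> t = a i \<or> t = b i"
proof
  assume "(c i, t) \<in> Nin"
  then obtain i' where i': "i' < m" "c i = c i'" "t = a i' \<or> t = b i'" by (auto simp: Nin_ab)
  then have "t \<in> {u i'..v i'}" using ab[OF i'(1)] by auto
  then have "i = i'" using strand_unique[OF assms(1) i'(1,2) assms(2)] by simp
  then show "t = a i \<or> t = b i" using i' by simp
qed (use assms in \<open>auto simp: Nin_ab\<close>)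

lemma Nin_inbox: assumes "P \<in> Nin" shows "P \<in> source K" "pos K P \<in> cbox p q"
proof -
  obtain i where i: "i < m" "P = (c i, a i) \<or> P = (c i, b i)" using assms by (auto simp: Nin_ab)
  then have s: "snd P \<in> {u i..v i}" "fst P = c i" using ab[OF i(1)] by auto
  then show "P \<in> source K" using str_source[OF i(1) s(1)] by (cases P) auto
  then show "pos K P \<in> cbox p q" using inbox s i by blast
qed

lemma disjoint: "Nout \<inter> Nin = {}"
proof -
  have "(c i, t) \<notin> Nout" if "i < m" "t = a i \<or> t = b i" for i t
    using Nout_interior[of "(c i, t)" i] ab[OF that(1)] that by auto
  then show ?thesis by (auto simp: Nin_ab)
qed

lemma finite_NN: "finite Nout" "finite Nin"
  using Nout_nodes by (auto simp: circle_nodes_def Nin_def)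

lemma N_admissible: "admissible K N"
proof -
  have "circle_nodes (comps K) N"
    using Nout_nodes Nin_inbox(1) finite_NN unfolding circle_nodes_def N_def source_def by blast
  moreover have "double_points K \<subseteq> N"
    using dbl_sub by (auto simp: N_def Nout_def Nin_def)
  ultimately show ?thesis by (simp add: admissible_def)
qed

lemma E_Nout: "E \<subseteq> Nout"
  by (auto simp: E_def Nout_def)

lemma before_out:
  assumes P: "P \<in> Nout - E" shows "before N (fst P) (snd P) = before Nout (fst P) (snd P)"
proof (rule before_eqI, unfold consec_def, intro conjI equals0I)
  have j: "fst P < comps K" using P Nout_source by (auto simp: source_def)
  have cs: "consec (cov Nout (fst P)) (before Nout (fst P) (snd P)) (snd P)"
    by (rule before_consec[OF Nout_nodes j])
  show "before Nout (fst P) (snd P) \<in> cov N (fst P)" "before Nout (fst P) (snd P) < snd P"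
    using cs by (auto simp: consec_def cov_def N_def)
  fix y assume y: "y \<in> cov N (fst P) \<inter> {before Nout (fst P) (snd P)<..<snd P}"
  then have "y \<notin> cov Nout (fst P)" using cs by (auto simp: consec_def)
  then have "(fst P, frac y) \<in> Nin" using y by (auto simp: cov_def N_def)
  then obtain i where i: "i < m" "c i = fst P" "frac y = a i \<or> frac y = b i" by (auto simp: Nin_ab)
  then have "frac y \<in> {u i..v i}" using ab(1-3)[OF i(1)] by auto
  moreover have "frac y \<notin> {u i..v i}" using y by (intro out_arc_free[OF P _ _ i(1,2)]) simp_all
  ultimately show False by simp
qed

lemma prev_out:
  assumes P: "P \<in> Nout - E" shows "prev_node N P = prev_node Nout P" "prev_node N P \<in> Nout"
proof -
  show e: "prev_node N P = prev_node Nout P" by (simp add: prev_node_def before_out[OF P])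
  show "prev_node N P \<in> Nout" unfolding e using prev_node_in[OF Nout_nodes] P by blast
qed

lemma before_in:
  assumes i: "i < m" and st: "u i \<le> s" "s < t" "t \<le> v i" and s: "(c i, s) \<in> N"
    and free: "\<And>y. s < y \<Longrightarrow> y < t \<Longrightarrow> y \<noteq> a i \<and> y \<noteq> b i"
  shows "before N (c i) t = s" "prev_node N (c i, t) = (c i, s)"
proof -
  have s01: "0 \<le> s" "s < 1" using st str[OF i] by auto
  show 1: "before N (c i) t = s"
  proof (rule before_eqI, unfold consec_def, intro conjI equals0I)
    show "s \<in> cov N (c i)" using s s01 by (simp add: cov_unit)
    show "s < t" by fact
    fix y assume y: "y \<in> cov N (c i) \<inter> {s<..<t}"
    then have "0 \<le> y" "y < 1" using s01 st str[OF i] by auto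
    then have yN: "(c i, y) \<in> N" using y by (simp add: cov_unit)
    have "(c i, y) \<notin> Nout" using Nout_interior[of "(c i, y)" i] i y st by auto
    then have "(c i, y) \<in> Nin" using yN by (simp add: N_def)
    then have "y = a i \<or> y = b i" using Nin_iff[OF i, of y] y st by auto
    then show False using free y by auto
  qed
  show "prev_node N (c i, t) = (c i, s)" using 1 s01 by (simp add: prev_node_def frac_eq)
qed

lemma prev_in:
  assumes i: "i < m"
  shows "prev_node N (c i, a i) = (c i, u i)" "before N (c i) (a i) = u i"
    "prev_node N (c i, b i) = (c i, a i)" "before N (c i) (b i) = a i"
    "prev_node N (c i, v i) = (c i, b i)" "before N (c i) (v i) = b i"
proof -
  have n: "(c i, u i) \<in> N" "(c i, a i) \<in> N" "(c i, b i) \<in> N"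
    using i by (auto simp: N_def Nout_def Nin_ab)
  note l = ab(1-3)[OF i]
  show "prev_node N (c i, a i) = (c i, u i)" "before N (c i) (a i) = u i"
    using before_in[OF i _ _ _ n(1), of "a i"] l by auto
  show "prev_node N (c i, b i) = (c i, a i)" "before N (c i) (b i) = a i"
    using before_in[OF i _ _ _ n(2), of "b i"] l by auto
  show "prev_node N (c i, v i) = (c i, b i)" "before N (c i) (v i) = b i"
    using before_in[OF i _ _ _ n(3), of "v i"] l by auto
qed

definition idx :: "nat \<times> real \<Rightarrow> nat" where
  "idx P = (THE i. i < m \<and> fst P = c i \<and> snd P \<in> {u i..v i})"

lemma idx: assumes "i < m" "t \<in> {u i..v i}" shows "idx (c i, t) = i"
  unfolding idx_def using assms strand_unique by (intro the_equality) auto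

text \<open>The labels of the ends of the passages in the box, in terms of the labels of the strands at the bottom, in
  the middle and at the top.\<close>

definition in_down :: "(nat \<Rightarrow> 'i) \<Rightarrow> (nat \<Rightarrow> 'i) \<Rightarrow> nat \<times> real \<Rightarrow> 'i" where
  "in_down bt \<mu> P = (if snd P = lo (idx P) then bt (idx P) else \<mu> (idx P))"

definition in_up :: "(nat \<Rightarrow> 'i) \<Rightarrow> (nat \<Rightarrow> 'i) \<Rightarrow> nat \<times> real \<Rightarrow> 'i" where
  "in_up tp \<mu> P = (if snd P = lo (idx P) then \<mu> (idx P) else tp (idx P))"

lemma in_simps:
  assumes "i < m"
  shows "in_down bt \<mu> (c i, lo i) = bt i" "in_down bt \<mu> (c i, hi i) = \<mu> i"
    "in_up tp \<mu> (c i, lo i) = \<mu> i" "in_up tp \<mu> (c i, hi i) = tp i"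
  using idx[of i "lo i"] idx[of i "hi i"] lohi[OF assms] ab(6)[OF assms] assms
  by (auto simp: in_down_def in_up_def less_imp_le)

definition Cin :: "((nat \<times> real) \<times> (nat \<times> real)) set" where
  "Cin = {(P, Q) \<in> cross K. pos K P \<in> cbox p q}"

definition Cout :: "((nat \<times> real) \<times> (nat \<times> real)) set" where
  "Cout = {(P, Q) \<in> cross K. pos K P \<notin> cbox p q}"

lemma Cin_Nin: assumes "(P, Q) \<in> Cin" shows "P \<in> Nin" "Q \<in> Nin"
proof -
  have d: "double K P Q" "pos K P \<in> cbox p q" using assms crossD(1) by (auto simp: Cin_def)
  then have "pos K Q \<in> cbox p q" by (simp add: double_def)
  then show "P \<in> Nin" "Q \<in> Nin" using dbl_sub d doubleD[OF d(1)] by (auto simp: Nin_def)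
qed

lemma Cout_Nout: assumes "(P, Q) \<in> Cout" shows "P \<in> Nout" "Q \<in> Nout"
proof -
  have d: "double K P Q" "pos K P \<notin> cbox p q" using assms crossD(1) by (auto simp: Cout_def)
  then have "pos K Q \<notin> cbox p q" by (simp add: double_def)
  then show "P \<in> Nout" "Q \<in> Nout" using d doubleD[OF d(1)] by (auto simp: Nout_def)
qed

lemma cross_finite: "finite (cross K)"
  by (rule finite_subset[of _ "double_points K \<times> double_points K"])
    (auto simp: finite_double_points[OF K] dest: crossD)

lemma cross_split: "cross K = Cout \<union> Cin" "Cout \<inter> Cin = {}" "finite Cout" "finite Cin"
  using cross_finite by (auto simp: Cin_def Cout_def intro: finite_subset)

end

locale box_sum = rotational_tensors I A B X + box_nodes K m c u v p q lo hi
  for I :: "'i set" and A B :: "'i \<Rightarrow> 'i \<Rightarrow> 'k::comm_ring_1"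
    and X :: "passage \<Rightarrow> 'i \<Rightarrow> 'i \<Rightarrow> 'i \<Rightarrow> 'i \<Rightarrow> 'k"
    and K m c u v p q lo hi
begin

text \<open>\<open>bt\<close> and \<open>tp\<close> are the labels of the strands at the bottom and at the top of the box, \<open>\<mu>\<close> those of the intermediate
  arcs.\<close>

definition box_tensor :: "(nat \<Rightarrow> 'i) \<Rightarrow> (nat \<Rightarrow> 'i) \<Rightarrow> (nat \<Rightarrow> 'i) \<Rightarrow> 'k" where
  "box_tensor bt tp \<mu> = (\<Prod>P\<in>Nin - double_points K. one (in_down bt \<mu> P) (in_up tp \<mu> P)) *
    (\<Prod>(P, Q)\<in>Cin. X (mark K P) (in_up tp \<mu> P) (in_up tp \<mu> Q) (in_down bt \<mu> Q) (in_down bt \<mu> P))"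

definition out_weight :: "(nat \<Rightarrow> real \<Rightarrow> real) \<Rightarrow> (nat \<times> real \<Rightarrow> 'i \<times> 'i) \<Rightarrow> 'k" where
  "out_weight \<theta> \<gamma> =
    (\<Prod>P\<in>Nout - E. arc_hol Nout \<theta> (fst P) (snd P) (snd (\<gamma> (prev_node Nout P))) (fst (\<gamma> P))) *
    ((\<Prod>P\<in>Nout - double_points K. one (fst (\<gamma> P)) (snd (\<gamma> P))) *
     (\<Prod>(P, Q)\<in>Cout. X (mark K P) (lab_up K \<gamma> P) (lab_up K \<gamma> Q) (lab_down K \<gamma> Q) (lab_down K \<gamma> P)))"

definition bot_lab :: "(nat \<times> real \<Rightarrow> 'i \<times> 'i) \<Rightarrow> nat \<Rightarrow> 'i" where
  "bot_lab \<gamma> i = (if up i then snd (\<gamma> (c i, u i)) else fst (\<gamma> (c i, v i)))"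

definition top_lab :: "(nat \<times> real \<Rightarrow> 'i \<times> 'i) \<Rightarrow> nat \<Rightarrow> 'i" where
  "top_lab \<gamma> i = (if up i then fst (\<gamma> (c i, v i)) else snd (\<gamma> (c i, u i)))"

text \<open>As the strands are never horizontal in the box, the arcs there carry the identity matrix, which leaves one
  label \<open>\<mu> i\<close> for each strand between the two nodes.\<close>

lemma diagram_sum_box:
  assumes \<theta>: "tangent_lift K \<theta>"
  shows "diagram_sum K N \<theta> = (\<Sum>\<gamma>\<in>Nout \<rightarrow>\<^sub>E I \<times> I. out_weight \<theta> \<gamma> *
    (\<Sum>\<mu>\<in>{..<m} \<rightarrow>\<^sub>E I. box_tensor (bot_lab \<gamma>) (top_lab \<gamma>) \<mu>))"
proof -
  let ?H = "\<lambda>P. arc_hol N \<theta> (fst P) (snd P)"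
  let ?X = "\<lambda>\<gamma> (P, Q). X (mark K P) (lab_up K \<gamma> P) (lab_up K \<gamma> Q) (lab_down K \<gamma> Q) (lab_down K \<gamma> P)"
  define T0 where "T0 \<gamma> = (\<Prod>P\<in>Nout - double_points K. one (fst (\<gamma> P)) (snd (\<gamma> P))) * prod (?X \<gamma>) Cout" for \<gamma>
  define T1 where "T1 \<gamma> = (\<Prod>P\<in>Nin - double_points K. one (fst (\<gamma> P)) (snd (\<gamma> P))) * prod (?X \<gamma>) Cin" for \<gamma>
  have T: "node_tensor K (Nout \<union> Nin) \<gamma> = T0 \<gamma> * T1 \<gamma>" for \<gamma>
  proof -
    have "prod (?X \<gamma>) (cross K) = prod (?X \<gamma>) Cout * prod (?X \<gamma>) Cin"
      unfolding cross_split(1) using cross_split by (intro prod.union_disjoint) auto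
    moreover have "(\<Prod>P\<in>Nout \<union> Nin - double_points K. one (fst (\<gamma> P)) (snd (\<gamma> P))) =
      (\<Prod>P\<in>Nout - double_points K. one (fst (\<gamma> P)) (snd (\<gamma> P))) * (\<Prod>P\<in>Nin - double_points K. one (fst (\<gamma> P)) (snd (\<gamma> P)))"
      unfolding Un_Diff using finite_NN disjoint by (intro prod.union_disjoint) auto
    ultimately show ?thesis by (simp add: node_tensor_def T0_def T1_def ac_simps)
  qed
  have T0: "T0 \<gamma> = T0 \<gamma>'" if "\<And>P. P \<in> Nout \<Longrightarrow> \<gamma> P = \<gamma>' P" for \<gamma> \<gamma>'
    unfolding T0_def lab_up_def lab_down_def using that Cout_Nout
    by (intro arg_cong2[where f="(*)"] prod.cong refl) (auto split: prod.split)
  have sector_in: "arc_hol N \<theta> (c i) t = one" if i: "i < m" and t: "t = a i \<or> t = b i \<or> t = v i" for i t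
  proof -
    note l = ab(1-3)[OF i]
    have t': "t \<in> {u i..v i}" "before N (c i) t \<in> {u i..v i}"
      using t l prev_in(2,4,6)[OF i] by auto
    have th: "continuous_on {u i..v i} (\<theta> (c i))" "\<And>t. direction (vd i t) (\<theta> (c i) t)"
      using \<theta> str(1)[OF i] continuous_on_subset unfolding tangent_lift_def vd_def by blast+
    have "sector (\<theta> (c i) (before N (c i) t)) = sector (\<theta> (c i) t)"
    proof (rule sector_constant[of "{u i..v i}" "\<theta> (c i)"])
      show "\<theta> (c i) z \<noteq> of_int n * pi" if "z \<in> {u i..v i}" for z n
        using direction_horizontal[OF th(2)] vd_nz[OF i that] by blast
    qed (use th t' in auto)
    then show ?thesis by (simp add: arc_hol_def)
  qed
  have Hin: "?H P = one" if "P \<in> Nin \<union> E" for P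
    using that sector_in by (auto simp: Nin_ab E_def)
  have "diagram_sum K N \<theta> = (\<Sum>\<gamma>\<in>Nout \<rightarrow>\<^sub>E I \<times> I.
    ((\<Prod>P\<in>Nout - E. ?H P (snd (\<gamma> (prev_node N P))) (fst (\<gamma> P))) * T0 \<gamma>) *
    (\<Sum>\<delta>\<in>Nin \<rightarrow>\<^sub>E I \<times> I. let \<epsilon> = (\<lambda>P. if P \<in> Nout then \<gamma> P else \<delta> P) in
       (\<Prod>P\<in>Nin \<union> E. ?H P (snd (\<epsilon> (prev_node N P))) (fst (\<epsilon> P))) * T1 \<epsilon>))"
    unfolding diagram_sum_def
    using state_sum_split[where Nout=Nout and Nin=Nin and E=E and pv="prev_node N" and H="?H"
        and T="node_tensor K N", OF finite_NN disjoint E_Nout prev_out(2) T[folded N_def] T0]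
    by (simp add: N_def)
  also have "\<dots> = (\<Sum>\<gamma>\<in>Nout \<rightarrow>\<^sub>E I \<times> I. out_weight \<theta> \<gamma> *
    (\<Sum>\<mu>\<in>{..<m} \<rightarrow>\<^sub>E I. box_tensor (bot_lab \<gamma>) (top_lab \<gamma>) \<mu>))"
  proof (intro sum.cong refl arg_cong2[where f="(*)"])
    fix \<gamma> assume \<gamma>: "\<gamma> \<in> Nout \<rightarrow>\<^sub>E I \<times> I"
    show "(\<Prod>P\<in>Nout - E. ?H P (snd (\<gamma> (prev_node N P))) (fst (\<gamma> P))) * T0 \<gamma> = out_weight \<theta> \<gamma>"
    proof -
      have "(\<Prod>P\<in>Nout - E. ?H P (snd (\<gamma> (prev_node N P))) (fst (\<gamma> P))) =
        (\<Prod>P\<in>Nout - E. arc_hol Nout \<theta> (fst P) (snd P) (snd (\<gamma> (prev_node Nout P))) (fst (\<gamma> P)))"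
        by (intro prod.cong refl) (simp add: prev_out(1) arc_hol_def before_out)
      then show ?thesis by (simp add: out_weight_def T0_def)
    qed
    define S where "S i = snd (\<gamma> (c i, u i))" for i
    define F where "F i = fst (\<gamma> (c i, v i))" for i
    have lab: "S i \<in> I" "F i \<in> I" if "i < m" for i
    proof -
      have "(c i, u i) \<in> Nout" "(c i, v i) \<in> Nout" using that by (auto simp: Nout_def)
      then show "S i \<in> I" "F i \<in> I" using \<gamma> by (auto simp: S_def F_def PiE_iff mem_Times_iff)
    qed
    define ext where "ext \<mu> = (\<lambda>P\<in>Nin. if snd P = a (idx P) then (S (idx P), \<mu> (idx P)) else (\<mu> (idx P), F (idx P)))"
      for \<mu> :: "nat \<Rightarrow> 'i"
    define mer where "mer \<delta> P = (if P \<in> Nout then \<gamma> P else \<delta> P)" for \<delta> :: "nat \<times> real \<Rightarrow> 'i \<times> 'i" and P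
    have nodes: "(c i, a i) \<in> Nin" "(c i, b i) \<in> Nin" "(c i, a i) \<notin> Nout" "(c i, b i) \<notin> Nout"
      "(c i, u i) \<in> Nout" "(c i, v i) \<in> Nout" if "i < m" for i
    proof -
      show "(c i, a i) \<in> Nin" "(c i, b i) \<in> Nin" using that by (auto simp: Nin_ab)
      then show "(c i, a i) \<notin> Nout" "(c i, b i) \<notin> Nout" using disjoint by auto
      show "(c i, u i) \<in> Nout" "(c i, v i) \<in> Nout" using that by (auto simp: Nout_def)
    qed
    have idx_ab: "idx (c i, a i) = i" "idx (c i, b i) = i" if "i < m" for i
      using idx[OF that] ab[OF that] by auto
    have ext_ab: "ext \<mu> (c i, a i) = (S i, \<mu> i)" "ext \<mu> (c i, b i) = (\<mu> i, F i)" if "i < m" for i \<mu>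
      using nodes[OF that] idx_ab[OF that] ab(2)[OF that] by (simp_all add: ext_def)
    let ?W = "\<lambda>\<delta>. \<Prod>P\<in>Nin \<union> E. one (snd (mer \<delta> (prev_node N P))) (fst (mer \<delta> P))"
    have factors: "one (snd (mer \<delta> (prev_node N (c i, a i)))) (fst (mer \<delta> (c i, a i))) = one (S i) (fst (\<delta> (c i, a i)))"
      "one (snd (mer \<delta> (prev_node N (c i, b i)))) (fst (mer \<delta> (c i, b i))) = one (snd (\<delta> (c i, a i))) (fst (\<delta> (c i, b i)))"
      "one (snd (mer \<delta> (prev_node N (c i, v i)))) (fst (mer \<delta> (c i, v i))) = one (snd (\<delta> (c i, b i))) (F i)"
      if "i < m" for i \<delta>
      using nodes[OF that] prev_in[OF that] by (simp_all add: mer_def S_def F_def)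
    have "(\<Sum>\<delta>\<in>Nin \<rightarrow>\<^sub>E I \<times> I. let \<epsilon> = (\<lambda>P. if P \<in> Nout then \<gamma> P else \<delta> P) in
       (\<Prod>P\<in>Nin \<union> E. ?H P (snd (\<epsilon> (prev_node N P))) (fst (\<epsilon> P))) * T1 \<epsilon>) =
      (\<Sum>\<delta>\<in>Nin \<rightarrow>\<^sub>E I \<times> I. ?W \<delta> * T1 (mer \<delta>))"
    proof (intro sum.cong refl)
      fix \<delta>
      have m: "(\<lambda>P. if P \<in> Nout then \<gamma> P else \<delta> P) = mer \<delta>" by (simp add: fun_eq_iff mer_def)
      have "(\<Prod>P\<in>Nin \<union> E. ?H P (snd (mer \<delta> (prev_node N P))) (fst (mer \<delta> P))) = ?W \<delta>"
        by (intro prod.cong refl) (simp add: Hin)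
      then show "(let \<epsilon> = (\<lambda>P. if P \<in> Nout then \<gamma> P else \<delta> P) in
       (\<Prod>P\<in>Nin \<union> E. ?H P (snd (\<epsilon> (prev_node N P))) (fst (\<epsilon> P))) * T1 \<epsilon>) = ?W \<delta> * T1 (mer \<delta>)"
        unfolding Let_def m by simp
    qed
    also have "\<dots> = (\<Sum>\<delta>\<in>ext ` ({..<m} \<rightarrow>\<^sub>E I). ?W \<delta> * T1 (mer \<delta>))"
    proof (rule sum.mono_neutral_right)
      show "finite (Nin \<rightarrow>\<^sub>E I \<times> I)" using finite_NN finI by (intro finite_PiE) auto
      show "ext ` ({..<m} \<rightarrow>\<^sub>E I) \<subseteq> Nin \<rightarrow>\<^sub>E I \<times> I"
      proof
        fix \<delta> assume "\<delta> \<in> ext ` ({..<m} \<rightarrow>\<^sub>E I)"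
        then obtain \<mu> where mu: "\<mu> \<in> {..<m} \<rightarrow>\<^sub>E I" "\<delta> = ext \<mu>" by blast
        have "ext \<mu> P \<in> I \<times> I" if PN: "P \<in> Nin" for P
        proof -
          obtain i where i: "i < m" "P = (c i, a i) \<or> P = (c i, b i)" using PN by (auto simp: Nin_ab)
          have "\<mu> i \<in> I" using mu(1) i by (auto simp: PiE_iff)
          then show ?thesis using i lab[OF i(1)] ext_ab[OF i(1)] by auto
        qed
        moreover have "ext \<mu> \<in> extensional Nin" by (simp add: ext_def)
        ultimately show "\<delta> \<in> Nin \<rightarrow>\<^sub>E I \<times> I" unfolding mu(2) PiE_iff by blast
      qed
      show "\<forall>\<delta>\<in>(Nin \<rightarrow>\<^sub>E I \<times> I) - ext ` ({..<m} \<rightarrow>\<^sub>E I). ?W \<delta> * T1 (mer \<delta>) = 0"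
      proof
        fix \<delta> assume d: "\<delta> \<in> (Nin \<rightarrow>\<^sub>E I \<times> I) - ext ` ({..<m} \<rightarrow>\<^sub>E I)"
        define \<mu> where "\<mu> = (\<lambda>i\<in>{..<m}. snd (\<delta> (c i, a i)))"
        have mu: "\<mu> \<in> {..<m} \<rightarrow>\<^sub>E I"
          using d nodes(1) by (auto simp: \<mu>_def PiE_iff mem_Times_iff)
        then have "ext \<mu> \<noteq> \<delta>" using d by auto
        moreover have "ext \<mu> P = \<delta> P" if "P \<notin> Nin" for P
          using d that PiE_arb[of \<delta> Nin _ P] by (auto simp: ext_def)
        ultimately obtain P where P: "P \<in> Nin" "ext \<mu> P \<noteq> \<delta> P" by (metis ext)
        then obtain i where i: "i < m" "P = (c i, a i) \<or> P = (c i, b i)" by (auto simp: Nin_ab)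
        have "S i \<noteq> fst (\<delta> (c i, a i)) \<or> snd (\<delta> (c i, a i)) \<noteq> fst (\<delta> (c i, b i)) \<or> snd (\<delta> (c i, b i)) \<noteq> F i"
        proof (rule ccontr)
          have mi: "\<mu> i = snd (\<delta> (c i, a i))" using i(1) by (simp add: \<mu>_def)
          assume "\<not> ?thesis"
          then have "ext \<mu> (c i, a i) = \<delta> (c i, a i)" "ext \<mu> (c i, b i) = \<delta> (c i, b i)"
            unfolding ext_ab[OF i(1)] by (simp_all add: mi prod_eq_iff)
          then show False using P(2) i(2) by auto
        qed
        then have "\<exists>P\<in>Nin \<union> E. one (snd (mer \<delta> (prev_node N P))) (fst (mer \<delta> P)) = 0"
        proof (elim disjE)
          assume "S i \<noteq> fst (\<delta> (c i, a i))"
          then show ?thesis using nodes[OF i(1)] factors[OF i(1)]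
            by (intro bexI[of _ "(c i, a i)"]) (auto simp: one_def)
        next
          assume "snd (\<delta> (c i, a i)) \<noteq> fst (\<delta> (c i, b i))"
          then show ?thesis using nodes[OF i(1)] factors[OF i(1)]
            by (intro bexI[of _ "(c i, b i)"]) (auto simp: one_def)
        next
          assume "snd (\<delta> (c i, b i)) \<noteq> F i"
          then show ?thesis using i factors[OF i(1)]
            by (intro bexI[of _ "(c i, v i)"]) (auto simp: one_def E_def)
        qed
        then have "?W \<delta> = 0" using finite_NN E_Nout by (intro prod_zero) (auto intro: finite_subset)
        then show "?W \<delta> * T1 (mer \<delta>) = 0" by simp
      qed
    qed
    also have "\<dots> = (\<Sum>\<mu>\<in>{..<m} \<rightarrow>\<^sub>E I. ?W (ext \<mu>) * T1 (mer (ext \<mu>)))"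
    proof -
      have "inj_on ext ({..<m} \<rightarrow>\<^sub>E I)"
      proof (rule inj_onI)
        fix \<mu> \<mu>' assume s: "\<mu> \<in> {..<m} \<rightarrow>\<^sub>E I" "\<mu>' \<in> {..<m} \<rightarrow>\<^sub>E I" "ext \<mu> = ext \<mu>'"
        have "\<mu> i = \<mu>' i" if "i \<in> {..<m}" for i
          using fun_cong[OF s(3), of "(c i, a i)"] ext_ab(1)[of i] that by simp
        then show "\<mu> = \<mu>'" by (rule PiE_ext[OF s(1,2)])
      qed
      from sum.reindex[OF this, of "\<lambda>\<delta>. ?W \<delta> * T1 (mer \<delta>)"] show ?thesis by (simp only: comp_def)
    qed
    also have "\<dots> = (\<Sum>\<mu>\<in>{..<m} \<rightarrow>\<^sub>E I. box_tensor (bot_lab \<gamma>) (top_lab \<gamma>) \<mu>)"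
    proof (intro sum.cong refl)
      fix \<mu> assume mu: "\<mu> \<in> {..<m} \<rightarrow>\<^sub>E I"
      have muI: "\<mu> i \<in> I" if "i < m" for i using mu that by (auto simp: PiE_iff)
      have one_refl: "one x x = 1" if "x \<in> I" for x using that by (simp add: one_def)
      have "?W (ext \<mu>) = 1"
      proof (intro prod.neutral ballI)
        fix P assume "P \<in> Nin \<union> E"
        then obtain i where i: "i < m" "P = (c i, a i) \<or> P = (c i, b i) \<or> P = (c i, v i)"
          by (auto simp: Nin_ab E_def)
        show "one (snd (mer (ext \<mu>) (prev_node N P))) (fst (mer (ext \<mu>) P)) = 1"
          using i(2) one_refl lab[OF i(1)] muI[OF i(1)]
          by (elim disjE) (simp_all add: factors[OF i(1)] ext_ab[OF i(1)])
      qed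
      moreover have "T1 (mer (ext \<mu>)) = box_tensor (bot_lab \<gamma>) (top_lab \<gamma>) \<mu>"
      proof -
        have eps: "mer (ext \<mu>) (c i, lo i) = (if up i then (S i, \<mu> i) else (\<mu> i, F i))"
          "mer (ext \<mu>) (c i, hi i) = (if up i then (\<mu> i, F i) else (S i, \<mu> i))" if "i < m" for i
          using nodes[OF that] ext_ab[OF that] ab(4,5)[OF that] by (auto simp: mer_def)
        have uw: "upward (tangent K (c i, lo i)) = up i" "upward (tangent K (c i, hi i)) = up i" if "i < m" for i
          using upward_strand[OF that] lohi[OF that] by auto
        have lb: "lab_up K (mer (ext \<mu>)) P = in_up (top_lab \<gamma>) \<mu> P"
            "lab_down K (mer (ext \<mu>)) P = in_down (bot_lab \<gamma>) \<mu> P"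
            "one (fst (mer (ext \<mu>) P)) (snd (mer (ext \<mu>) P)) = one (in_down (bot_lab \<gamma>) \<mu> P) (in_up (top_lab \<gamma>) \<mu> P)"
          if PN: "P \<in> Nin" for P
        proof -
          obtain i where i: "i < m" "P = (c i, lo i) \<or> P = (c i, hi i)" using PN by (auto simp: Nin_def)
          show "lab_up K (mer (ext \<mu>)) P = in_up (top_lab \<gamma>) \<mu> P"
            "lab_down K (mer (ext \<mu>)) P = in_down (bot_lab \<gamma>) \<mu> P"
            "one (fst (mer (ext \<mu>) P)) (snd (mer (ext \<mu>) P)) = one (in_down (bot_lab \<gamma>) \<mu> P) (in_up (top_lab \<gamma>) \<mu> P)"
            using i(2) eps[OF i(1)] uw[OF i(1)]
            by (auto simp: lab_up_def lab_down_def in_simps[OF i(1)] bot_lab_def top_lab_def S_def F_def one_swap)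
        qed
        have "(\<Prod>P\<in>Nin - double_points K. one (fst (mer (ext \<mu>) P)) (snd (mer (ext \<mu>) P))) =
          (\<Prod>P\<in>Nin - double_points K. one (in_down (bot_lab \<gamma>) \<mu> P) (in_up (top_lab \<gamma>) \<mu> P))"
          using lb(3) by (intro prod.cong refl) simp
        moreover have "prod (?X (mer (ext \<mu>))) Cin = (\<Prod>(P, Q)\<in>Cin. X (mark K P) (in_up (top_lab \<gamma>) \<mu> P)
          (in_up (top_lab \<gamma>) \<mu> Q) (in_down (bot_lab \<gamma>) \<mu> Q) (in_down (bot_lab \<gamma>) \<mu> P))"
        proof (intro prod.cong refl)
          fix x assume x: "x \<in> Cin"
          obtain P Q where PQ: "x = (P, Q)" by (cases x)
          then have "P \<in> Nin" "Q \<in> Nin" using Cin_Nin x by blast+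
          then show "?X (mer (ext \<mu>)) x = (case x of (P, Q) \<Rightarrow> X (mark K P) (in_up (top_lab \<gamma>) \<mu> P)
            (in_up (top_lab \<gamma>) \<mu> Q) (in_down (bot_lab \<gamma>) \<mu> Q) (in_down (bot_lab \<gamma>) \<mu> P))"
            by (simp add: PQ lb)
        qed
        ultimately show ?thesis by (simp add: T1_def box_tensor_def)
      qed
      ultimately show "?W (ext \<mu>) * T1 (mer (ext \<mu>)) = box_tensor (bot_lab \<gamma>) (top_lab \<gamma>) \<mu>" by simp
    qed
    finally show "(\<Sum>\<delta>\<in>Nin \<rightarrow>\<^sub>E I \<times> I. let \<epsilon> = (\<lambda>P. if P \<in> Nout then \<gamma> P else \<delta> P) in
       (\<Prod>P\<in>Nin \<union> E. ?H P (snd (\<epsilon> (prev_node N P))) (fst (\<epsilon> P))) * T1 \<epsilon>) =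
       (\<Sum>\<mu>\<in>{..<m} \<rightarrow>\<^sub>E I. box_tensor (bot_lab \<gamma>) (top_lab \<gamma>) \<mu>)" .
  qed
  finally show ?thesis .
qed

end

lemma eq_at_limit:
  fixes f f' :: "real \<Rightarrow> 'a::real_normed_vector"
  assumes "s < t" "continuous_on UNIV f" "continuous_on UNIV f'" "\<And>x. s < x \<Longrightarrow> x < t \<Longrightarrow> f x = f' x"
    and x: "x \<in> {s..t}"
  shows "f x = f' x"
proof -
  have cl: "closure {s<..<t} = {s..t}" using assms(1) by (simp add: closure_greaterThanLessThan)
  have "continuous_on (closure {s<..<t}) (\<lambda>x. norm (f x - f' x))"
    using assms(2,3) by (intro continuous_intros continuous_on_subset[OF assms(2)] continuous_on_subset[OF assms(3)]) auto
  then have "norm (f x - f' x) \<le> 0"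
    by (rule continuous_le_on_closure) (use assms cl in auto)
  then show ?thesis by simp
qed

context strand_box
begin

lemma right_free:
  assumes i: "i < m"
  shows "\<exists>e>0. v i + e < 1 \<and> (\<forall>x i'. v i < x \<and> x < v i + e \<and> i' < m \<and> c i' = c i \<longrightarrow> x \<notin> {u i'..v i'})"
proof -
  define S where "S = insert ((1 - v i) / 2) ((\<lambda>i'. u i' - v i) ` {i'. i' < m \<and> c i' = c i \<and> u i' > v i})"
  have S: "finite S" "S \<noteq> {}" "\<And>x. x \<in> S \<Longrightarrow> x > 0" using str(4)[OF i] by (auto simp: S_def)
  define e where "e = Min S"
  have e: "e > 0" using S Min_in[OF S(1,2)] by (simp add: e_def)
  have eS: "e \<le> x" if "x \<in> S" for x using S(1) that by (simp add: e_def)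
  have "v i + e < 1" using eS[of "(1 - v i) / 2"] str(4)[OF i] by (simp add: S_def)
  moreover have "x \<notin> {u i'..v i'}" if x: "v i < x" "x < v i + e" and i': "i' < m" "c i' = c i" for x i'
  proof
    assume xi: "x \<in> {u i'..v i'}"
    show False
    proof (cases "u i' > v i")
      case True
      then have "e \<le> u i' - v i" using i' by (intro eS) (auto simp: S_def)
      then show False using x xi by auto
    next
      case False
      then have "v i \<in> {u i'..v i'}" "v i \<in> {u i..v i}" using x xi str(3)[OF i] by auto
      then have "i' = i" using strand_unique[OF i'(1) i i'(2)] by blast
      then show False using x xi by auto
    qed
  qed
  ultimately show ?thesis using e by blast
qed

lemma curve_cont: "j < comps K \<Longrightarrow> continuous_on UNIV (curve K j)"
  using differentiable_imp_continuous_within[OF diagram_curve(4)[OF K]]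
  by (simp add: continuous_on_eq_continuous_within)

lemma Nout_double: assumes "P \<in> Nout" "pos K P \<in> cbox p q" shows "P \<notin> double_points K"
proof -
  have s: "P \<in> source K" using assms(1) Nout_source by blast
  then obtain i where i: "i < m" "fst P = c i" "snd P \<in> {u i..v i}" using inbox assms(2) by blast
  have "snd P = u i \<or> snd P = v i" using Nout_interior[OF assms(1) i(1,2)] i(3) by auto
  then show ?thesis using end_not_double[OF i(1), of "snd P"] i(2) by (cases P) auto
qed

lemma u_not_E: "i < m \<Longrightarrow> (c i, u i) \<in> Nout - E"
proof -
  assume i: "i < m"
  have "u i \<noteq> v i'" if "i' < m" "c i = c i'" for i'
    using strand_unique[OF i that, of "u i"] str(3)[OF i] str(3)[OF that(1)] by auto
  then show ?thesis using i by (auto simp: Nout_def E_def)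
qed

end

locale box_pair = B: strand_box K m c u v p q + B': strand_box K' m c u v p q
  for K K' m c u v p q +
  assumes lc: "local_change K K' m c u v p q"
begin

lemma comps: "comps K' = comps K"
  using lc by (simp add: local_change_def)

lemma source: "source K' = source K"
  by (simp add: source_def comps)

lemma inbox_iff: "P \<in> source K \<Longrightarrow> pos K' P \<in> cbox p q \<longleftrightarrow> pos K P \<in> cbox p q"
  using B.inbox[of P] B'.inbox[of P] source by simp

lemma pos_out: "P \<in> source K \<Longrightarrow> pos K P \<notin> cbox p q \<Longrightarrow> pos K' P = pos K P"
  using lc by (simp add: local_change_def)

lemma curve_out:
  assumes j: "j < comps K" and t: "\<And>i. i < m \<Longrightarrow> c i = j \<Longrightarrow> frac t \<notin> {u i..v i}"
  shows "curve K' j t = curve K j t"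
proof -
  have s: "(j, frac t) \<in> source K" using j by (simp add: source_def frac_lt_1)
  then have "pos K (j, frac t) \<notin> cbox p q" using B.inbox[OF s] t by auto
  then have "curve K' j (frac t) = curve K j (frac t)" using pos_out[OF s] by (simp add: pos_def)
  moreover have "curve K j (frac t) = curve K j t"
    using diagram_curve(2)[OF B.K j] by (rule frac_shift)
  moreover have "curve K' j (frac t) = curve K' j t"
    using diagram_curve(2)[OF B'.K] j comps by (intro frac_shift) simp
  ultimately show ?thesis by simp
qed

text \<open>At the ends of an interval on which the curves agree, the tangents agree by continuity of the
  derivatives; this applies to the boundary points of the box, where the two curves may separate.\<close>

lemma derivative_out:
  assumes j: "j < comps K" and st: "s < t"
    and free: "\<And>x i. s < x \<Longrightarrow> x < t \<Longrightarrow> i < m \<Longrightarrow> c i = j \<Longrightarrow> frac x \<notin> {u i..v i}"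
    and x: "x \<in> {s..t}"
  shows "vector_derivative (curve K' j) (at x) = vector_derivative (curve K j) (at x)"
proof (rule eq_at_limit[OF st _ _ _ x])
  show "continuous_on UNIV (\<lambda>x. vector_derivative (curve K' j) (at x))"
    "continuous_on UNIV (\<lambda>x. vector_derivative (curve K j) (at x))"
    using diagram_curve(5)[OF B.K j] diagram_curve(5)[OF B'.K] j comps by auto
  fix x assume x: "s < x" "x < t"
  have d: "(curve K j has_vector_derivative vector_derivative (curve K j) (at x)) (at x)"
    using diagram_curve(4)[OF B.K j] by (simp add: vector_derivative_works)
  have "(curve K' j has_vector_derivative vector_derivative (curve K j) (at x)) (at x)"
  proof (rule has_vector_derivative_transform_within_open[OF d, of "{s<..<t}"])
    show "curve K j y = curve K' j y" if "y \<in> {s<..<t}" for y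
      using curve_out[OF j, of y] free that by auto
  qed (use x in auto)
  then show "vector_derivative (curve K' j) (at x) = vector_derivative (curve K j) (at x)"
    by (rule vector_derivative_at)
qed

lemma double_out:
  assumes "double K P Q" "pos K P \<notin> cbox p q" shows "double K' P Q" "pos K' P \<notin> cbox p q"
  using assms pos_out[of P] pos_out[of Q] source by (auto simp: double_def)

lemma double_out':
  assumes "double K' P Q" "pos K' P \<notin> cbox p q" shows "double K P Q" "pos K P \<notin> cbox p q"
proof -
  have s: "P \<in> source K" "Q \<in> source K" using assms source by (auto simp: double_def)
  have o: "pos K P \<notin> cbox p q" "pos K Q \<notin> cbox p q"
    using assms inbox_iff[OF s(1)] inbox_iff[OF s(2)] by (auto simp: double_def)
  show "pos K P \<notin> cbox p q" by (rule o)
  show "double K P Q" using assms(1) pos_out[OF s(1) o(1)] pos_out[OF s(2) o(2)] s by (simp add: double_def)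
qed

lemma Nout: "B'.Nout = B.Nout"
proof -
  have "{P \<in> double_points K'. pos K' P \<notin> cbox p q} = {P \<in> double_points K. pos K P \<notin> cbox p q}"
    using double_out double_out' unfolding double_points_def by blast
  then show ?thesis by (simp add: B.Nout_def B'.Nout_def comps)
qed

lemma Nout_double_iff:
  assumes "P \<in> B.Nout" shows "P \<in> double_points K' \<longleftrightarrow> P \<in> double_points K"
proof (cases "pos K P \<in> cbox p q")
  case True
  have s: "P \<in> source K" using assms B.Nout_source by blast
  then show ?thesis using B.Nout_double[OF assms True] B'.Nout_double[of P] assms Nout inbox_iff[OF s] True by simp
next
  case False
  moreover have "P \<in> source K" using assms B.Nout_source by blast
  ultimately have "pos K' P \<notin> cbox p q" using inbox_iff by blast
  then show ?thesis using False double_out double_out' unfolding double_points_def by blast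
qed

lemma derivative_arc:
  assumes P: "P \<in> B.Nout - B.E" and x: "x \<in> {before B.Nout (fst P) (snd P)..snd P}"
  shows "vector_derivative (curve K' (fst P)) (at x) = vector_derivative (curve K (fst P)) (at x)"
proof (rule derivative_out[OF _ _ _ x])
  show j: "fst P < comps K" using P B.Nout_source by (auto simp: source_def)
  show "before B.Nout (fst P) (snd P) < snd P"
    using before_consec[OF B.Nout_nodes j] by (simp add: consec_def)
  show "frac x \<notin> {u i..v i}" if "before B.Nout (fst P) (snd P) < x" "x < snd P" "i < m" "c i = fst P" for x i
    using B.out_arc_free[OF P that] .
qed

lemma tangent_out:
  assumes P: "P \<in> B.Nout - B.E" shows "tangent K' P = tangent K P"
proof -
  have j: "fst P < comps K" using P B.Nout_source by (auto simp: source_def)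
  have "before B.Nout (fst P) (snd P) < snd P"
    using before_consec[OF B.Nout_nodes j] by (simp add: consec_def)
  then show ?thesis using derivative_arc[OF P, of "snd P"] by (simp add: tangent_def)
qed

lemma up: assumes i: "i < m" shows "B'.up i = B.up i"
  using tangent_out[OF B.u_not_E[OF i]] by (simp add: B.up_def B'.up_def B.vd_def B'.vd_def tangent_def)

lemma curve_ends:
  assumes i: "i < m" shows "curve K' (c i) (u i) = curve K (c i) (u i)" "curve K' (c i) (v i) = curve K (c i) (v i)"
proof -
  have j: "c i < comps K" using B.str(1)[OF i] .
  have cont: "continuous_on UNIV (curve K' (c i))" "continuous_on UNIV (curve K (c i))"
    using B.curve_cont[OF j] B'.curve_cont j comps by auto
  let ?s = "before B.Nout (c i) (u i)"
  have "?s < u i" using before_consec[OF B.Nout_nodes j] by (simp add: consec_def)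
  then show "curve K' (c i) (u i) = curve K (c i) (u i)"
  proof (rule eq_at_limit[OF _ cont])
    show "curve K' (c i) x = curve K (c i) x" if "?s < x" "x < u i" for x
      using curve_out[OF j] B.out_arc_free[OF B.u_not_E[OF i]] that by simp
    show "u i \<in> {?s..u i}" using \<open>?s < u i\<close> by simp
  qed
  obtain e where e: "e > 0" "v i + e < 1"
    "\<And>x i'. v i < x \<Longrightarrow> x < v i + e \<Longrightarrow> i' < m \<Longrightarrow> c i' = c i \<Longrightarrow> x \<notin> {u i'..v i'}"
    using B.right_free[OF i] by blast
  show "curve K' (c i) (v i) = curve K (c i) (v i)"
  proof (rule eq_at_limit[OF _ cont])
    show "v i < v i + e" using e by simp
    show "v i \<in> {v i..v i + e}" using e by simp
    fix x assume x: "v i < x" "x < v i + e"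
    then have "0 \<le> x" "x < 1" using e B.str[OF i] by auto
    then have "frac x = x" by (simp add: frac_eq)
    then show "curve K' (c i) x = curve K (c i) x" using curve_out[OF j] e(3) x by simp
  qed
qed

end

locale box_change =
  L: box_sum I A B X K m c u v p q lo hi + L': box_sum I A B X K' m c u v p q lo' hi'
  for I :: "'i set" and A B :: "'i \<Rightarrow> 'i \<Rightarrow> 'k::comm_ring_1"
    and X :: "passage \<Rightarrow> 'i \<Rightarrow> 'i \<Rightarrow> 'i \<Rightarrow> 'i \<Rightarrow> 'k"
    and K K' m c u v p q lo hi lo' hi' +
  assumes change: "local_change K K' m c u v p q"
begin

lemma pair: "box_pair K K' m c u v p q"
  using L.strand_box_axioms L'.strand_box_axioms change
  by (simp add: box_pair_def box_pair_axioms_def)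

text \<open>Outside the box and at its boundary the curves and their tangents agree, so that the two state sums have
  the same outer factor.\<close>

lemma invariant_box_change:
  assumes eq: "\<And>bt tp. (\<And>i. i < m \<Longrightarrow> bt i \<in> I) \<Longrightarrow> (\<And>i. i < m \<Longrightarrow> tp i \<in> I) \<Longrightarrow>
    (\<Sum>\<mu>\<in>{..<m} \<rightarrow>\<^sub>E I. L'.box_tensor bt tp \<mu>) = (\<Sum>\<mu>\<in>{..<m} \<rightarrow>\<^sub>E I. L.box_tensor bt tp \<mu>)"
  shows "L.invariant K' = L.invariant K"
proof -
  interpret P: box_pair K K' m c u v p q by (rule pair)
  obtain \<theta> where \<theta>: "tangent_lift K \<theta>" using ex_tangent_lift[OF L.K] ..
  obtain \<theta>' where \<theta>': "tangent_lift K' \<theta>'" using ex_tangent_lift[OF L'.K] ..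
  have hol: "L.arc_hol L.Nout \<theta>' (fst P) (snd P) = L.arc_hol L.Nout \<theta> (fst P) (snd P)"
    if P: "P \<in> L.Nout - L.E" for P
  proof -
    have j: "fst P < comps K" using P L.Nout_source by (auto simp: source_def)
    let ?s = "before L.Nout (fst P) (snd P)"
    have st: "?s < snd P" using before_consec[OF L.Nout_nodes j] by (simp add: consec_def)
    have l: "continuous_on {?s..snd P} (\<theta> (fst P))" "continuous_on {?s..snd P} (\<theta>' (fst P))"
      "\<And>t. direction (vector_derivative (curve K (fst P)) (at t)) (\<theta> (fst P) t)"
      "\<And>t. direction (vector_derivative (curve K' (fst P)) (at t)) (\<theta>' (fst P) t)"
      using \<theta> \<theta>' j P.comps unfolding tangent_lift_def by (auto intro: continuous_on_subset)
    have "\<exists>n::int. \<forall>t\<in>{?s..snd P}. \<theta>' (fst P) t = \<theta> (fst P) t + 2 * pi * of_int n"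
    proof (rule direction_lift_unique)
      show "direction (vector_derivative (curve K (fst P)) (at t)) (\<theta>' (fst P) t)" if "t \<in> {?s..snd P}" for t
        using l(4)[of t] P.derivative_arc[OF P that] by simp
    qed (use l in auto)
    then obtain n :: int where n: "\<And>t. t \<in> {?s..snd P} \<Longrightarrow> \<theta>' (fst P) t = \<theta> (fst P) t + 2 * pi * of_int n"
      by blast
    have "?s \<in> {?s..snd P}" "snd P \<in> {?s..snd P}" using st by auto
    then show ?thesis by (simp add: L.arc_hol_def n sector_shift L.hol_periodic)
  qed
  have lab: "lab_up K' \<gamma> P = lab_up K \<gamma> P" "lab_down K' \<gamma> P = lab_down K \<gamma> P" "P \<in> L.Nout - L.E"
    if P: "P \<in> double_points K" "pos K P \<notin> cbox p q" for P and \<gamma> :: "nat \<times> real \<Rightarrow> 'i \<times> 'i"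
  proof -
    show PN: "P \<in> L.Nout - L.E"
      using P L.end_not_double unfolding L.Nout_def L.E_def by blast
    show "lab_up K' \<gamma> P = lab_up K \<gamma> P" "lab_down K' \<gamma> P = lab_down K \<gamma> P"
      by (simp_all add: lab_up_def lab_down_def P.tangent_out[OF PN])
  qed
  have cr: "(P, Q) \<in> cross K' \<longleftrightarrow> (P, Q) \<in> cross K" if d: "double K P Q" "pos K P \<notin> cbox p q" for P Q
  proof -
    have "pos K Q \<notin> cbox p q" using d by (simp add: double_def)
    then have "tangent K' P = tangent K P" "tangent K' Q = tangent K Q"
      using P.tangent_out lab(3) doubleD[OF d(1)] d(2) by blast+
    then show ?thesis using P.double_out[OF d] d by (simp add: cross_def)
  qed
  have Cout: "L'.Cout = L.Cout"
  proof -
    have "(P, Q) \<in> L'.Cout \<longleftrightarrow> (P, Q) \<in> L.Cout" for P Q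
      unfolding L'.Cout_def L.Cout_def using cr[of P Q] P.double_out[of P Q] P.double_out'[of P Q] crossD(1)
      by blast
    then show ?thesis by auto
  qed
  have out: "L'.out_weight \<theta>' \<gamma> = L.out_weight \<theta> \<gamma>" for \<gamma>
  proof -
    have 1: "(\<Prod>P\<in>L.Nout - L.E. L.arc_hol L.Nout \<theta>' (fst P) (snd P) (snd (\<gamma> (prev_node L.Nout P))) (fst (\<gamma> P))) =
      (\<Prod>P\<in>L.Nout - L.E. L.arc_hol L.Nout \<theta> (fst P) (snd P) (snd (\<gamma> (prev_node L.Nout P))) (fst (\<gamma> P)))"
      by (intro prod.cong refl) (simp only: hol)
    have "L.Nout - double_points K' = L.Nout - double_points K" using P.Nout_double_iff by blast
    then have 2: "(\<Prod>P\<in>L.Nout - double_points K'. L.one (fst (\<gamma> P)) (snd (\<gamma> P))) =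
      (\<Prod>P\<in>L.Nout - double_points K. L.one (fst (\<gamma> P)) (snd (\<gamma> P)))" by simp
    have 3: "(\<Prod>(P, Q)\<in>L.Cout. X (mark K' P) (lab_up K' \<gamma> P) (lab_up K' \<gamma> Q) (lab_down K' \<gamma> Q) (lab_down K' \<gamma> P)) =
      (\<Prod>(P, Q)\<in>L.Cout. X (mark K P) (lab_up K \<gamma> P) (lab_up K \<gamma> Q) (lab_down K \<gamma> Q) (lab_down K \<gamma> P))"
    proof (intro prod.cong refl)
      fix x assume x: "x \<in> L.Cout"
      obtain P Q where PQ: "x = (P, Q)" by (cases x)
      have d: "double K P Q" "pos K P \<notin> cbox p q" using x crossD(1) by (auto simp: PQ L.Cout_def)
      then have dq: "pos K Q \<notin> cbox p q" by (simp add: double_def)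
      have "mark K' P = mark K P" using change d(2) doubleD(1)[OF d(1)] by (simp add: local_change_def)
      then show "(case x of (P, Q) \<Rightarrow> X (mark K' P) (lab_up K' \<gamma> P) (lab_up K' \<gamma> Q) (lab_down K' \<gamma> Q) (lab_down K' \<gamma> P)) =
        (case x of (P, Q) \<Rightarrow> X (mark K P) (lab_up K \<gamma> P) (lab_up K \<gamma> Q) (lab_down K \<gamma> Q) (lab_down K \<gamma> P))"
        using lab(1,2)[OF doubleD(1)[OF d(1)] d(2)] lab(1,2)[OF doubleD(2)[OF d(1)] dq] by (simp add: PQ)
    qed
    show ?thesis
      unfolding L'.out_weight_def L.out_weight_def P.Nout Cout by (simp only: 1 2 3)
  qed
  have "L.diagram_sum K' L'.N \<theta>' = L.diagram_sum K L.N \<theta>"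
    unfolding L'.diagram_sum_box[OF \<theta>'] L.diagram_sum_box[OF \<theta>] P.Nout out
  proof (rule sum.cong[OF refl])
    fix \<gamma> assume \<gamma>: "\<gamma> \<in> L.Nout \<rightarrow>\<^sub>E I \<times> I"
    define bt tp where "bt = L.bot_lab \<gamma>" and "tp = L.top_lab \<gamma>"
    have lI: "bt i \<in> I" "tp i \<in> I" if "i < m" for i
    proof -
      have "(c i, u i) \<in> L.Nout" "(c i, v i) \<in> L.Nout" using that by (auto simp: L.Nout_def)
      then have "\<gamma> (c i, u i) \<in> I \<times> I" "\<gamma> (c i, v i) \<in> I \<times> I" using \<gamma> by (auto simp: PiE_iff)
      then show "bt i \<in> I" "tp i \<in> I" by (auto simp: bt_def tp_def L.bot_lab_def L.top_lab_def mem_Times_iff)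
    qed
    have same: "L'.bot_lab \<gamma> i = bt i" "L'.top_lab \<gamma> i = tp i" if "i < m" for i
      using P.up[OF that]
      by (simp_all add: bt_def tp_def L.bot_lab_def L.top_lab_def L'.bot_lab_def L'.top_lab_def)
    have "L'.box_tensor (L'.bot_lab \<gamma>) (L'.top_lab \<gamma>) \<mu> = L'.box_tensor bt tp \<mu>" for \<mu>
    proof -
      have e: "L'.in_down (L'.bot_lab \<gamma>) \<mu> P = L'.in_down bt \<mu> P"
        "L'.in_up (L'.top_lab \<gamma>) \<mu> P = L'.in_up tp \<mu> P" if PN: "P \<in> L'.Nin" for P
      proof -
        obtain i where i: "i < m" "P = (c i, lo' i) \<or> P = (c i, hi' i)" using PN by (auto simp: L'.Nin_def)
        then show "L'.in_down (L'.bot_lab \<gamma>) \<mu> P = L'.in_down bt \<mu> P"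
          "L'.in_up (L'.top_lab \<gamma>) \<mu> P = L'.in_up tp \<mu> P"
          by (auto simp: L'.in_simps[OF i(1)] same[OF i(1)])
      qed
      show ?thesis unfolding L'.box_tensor_def
      proof (intro arg_cong2[where f="(*)"] prod.cong refl)
        fix P assume "P \<in> L'.Nin - double_points K'"
        then show "L.one (L'.in_down (L'.bot_lab \<gamma>) \<mu> P) (L'.in_up (L'.top_lab \<gamma>) \<mu> P) =
          L.one (L'.in_down bt \<mu> P) (L'.in_up tp \<mu> P)" using e by simp
      next
        fix x assume x: "x \<in> L'.Cin"
        obtain P Q where PQ: "x = (P, Q)" by (cases x)
        then have "P \<in> L'.Nin" "Q \<in> L'.Nin" using L'.Cin_Nin x by blast+
        then show "(case x of (P, Q) \<Rightarrow> X (mark K' P) (L'.in_up (L'.top_lab \<gamma>) \<mu> P) (L'.in_up (L'.top_lab \<gamma>) \<mu> Q)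
            (L'.in_down (L'.bot_lab \<gamma>) \<mu> Q) (L'.in_down (L'.bot_lab \<gamma>) \<mu> P)) =
          (case x of (P, Q) \<Rightarrow> X (mark K' P) (L'.in_up tp \<mu> P) (L'.in_up tp \<mu> Q)
            (L'.in_down bt \<mu> Q) (L'.in_down bt \<mu> P))" by (simp add: PQ e)
      qed
    qed
    then have "(\<Sum>\<mu>\<in>{..<m} \<rightarrow>\<^sub>E I. L'.box_tensor (L'.bot_lab \<gamma>) (L'.top_lab \<gamma>) \<mu>) =
      (\<Sum>\<mu>\<in>{..<m} \<rightarrow>\<^sub>E I. L.box_tensor (L.bot_lab \<gamma>) (L.top_lab \<gamma>) \<mu>)"
      using eq[of bt tp, OF lI] by (simp add: bt_def tp_def)
    then show "L.out_weight \<theta> \<gamma> * (\<Sum>\<mu>\<in>{..<m} \<rightarrow>\<^sub>E I. L'.box_tensor (L'.bot_lab \<gamma>) (L'.top_lab \<gamma>) \<mu>) =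
      L.out_weight \<theta> \<gamma> * (\<Sum>\<mu>\<in>{..<m} \<rightarrow>\<^sub>E I. L.box_tensor (L.bot_lab \<gamma>) (L.top_lab \<gamma>) \<mu>)"
      by (simp only:)
  qed
  then show ?thesis
    using L.invariant_eq[OF L.K \<theta> L.N_admissible] L.invariant_eq[OF L'.K \<theta>' L'.N_admissible] by simp
qed

end

section \<open>Strands as graphs over the height\<close>

context strand_box
begin

text \<open>The height \<open>h i\<close> is strictly monotone on strand \<open>i\<close>, so the strand is the graph of its horizontal position
  \<open>xx i\<close> over the height \<open>y\<close>; \<open>g i y\<close> is the parameter at height \<open>y\<close>.\<close>

definition g :: "nat \<Rightarrow> real \<Rightarrow> real" where "g i = the_inv_into {u i..v i} (h i)"

definition xx :: "nat \<Rightarrow> real \<Rightarrow> real" where "xx i y = Re (curve K (c i) (g i y))"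

definition slope :: "nat \<Rightarrow> real \<Rightarrow> real" where "slope i y = Re (vd i (g i y)) / Im (vd i (g i y))"

lemma h_image: assumes i: "i < m" shows "h i ` {u i..v i} = {Im p..Im q}"
proof
  show "h i ` {u i..v i} \<subseteq> {Im p..Im q}" using h_range[OF i] by blast
  have c: "connected (h i ` {u i..v i})" by (intro connected_continuous_image h_cont[OF i]) simp
  have e: "u i \<in> {u i..v i}" "v i \<in> {u i..v i}" using str(3)[OF i] by auto
  have "Im p \<in> h i ` {u i..v i}" "Im q \<in> h i ` {u i..v i}"
    using h_ends[OF i] imageI[OF e(1), of "h i"] imageI[OF e(2), of "h i"] by (auto split: if_splits)
  then show "{Im p..Im q} \<subseteq> h i ` {u i..v i}" using connectedD_interval[OF c] by (meson atLeastAtMost_iff subsetI)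
qed

lemma g: assumes "i < m" "y \<in> {Im p..Im q}" shows "g i y \<in> {u i..v i}" "h i (g i y) = y"
  using h_image[OF assms(1)] assms(2) the_inv_into_into[OF h_inj[OF assms(1)] _ order.refl, of y]
    f_the_inv_into_f[OF h_inj[OF assms(1)], of y] by (auto simp: g_def)

lemma g_h: assumes "i < m" "t \<in> {u i..v i}" shows "g i (h i t) = t"
  using the_inv_into_f_f[OF h_inj[OF assms(1)] assms(2)] by (simp add: g_def)

lemma g_cont: assumes i: "i < m" shows "continuous_on {Im p..Im q} (g i)"
  using continuous_on_inv_into[OF h_cont[OF i] compact_Icc h_inj[OF i]] by (simp add: g_def h_image[OF i])

lemma g_interior: assumes i: "i < m" and y: "Im p < y" "y < Im q" shows "g i y \<in> {u i<..<v i}"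
proof -
  have "g i y \<in> {u i..v i}" "h i (g i y) = y" using g[OF i, of y] y by auto
  moreover have "g i y \<noteq> u i" "g i y \<noteq> v i" using calculation h_ends[OF i] y by (auto split: if_splits)
  ultimately show ?thesis by auto
qed

lemma g_less: assumes i: "i < m" and y: "y \<in> {Im p..Im q}" "z \<in> {Im p..Im q}"
  shows "g i y < g i z \<longleftrightarrow> (if up i then y < z else z < y)"
proof -
  have "g i y < g i z \<longleftrightarrow> (if up i then h i (g i y) < h i (g i z) else h i (g i z) < h i (g i y))"
    using h_less_iff[OF i g(1)[OF i y(1)] g(1)[OF i y(2)]] h_less_iff[OF i g(1)[OF i y(2)] g(1)[OF i y(1)]] by auto
  then show ?thesis using g(2)[OF i] y by simp
qed

lemma curve_g: assumes "i < m" "y \<in> {Im p..Im q}" shows "curve K (c i) (g i y) = Complex (xx i y) y"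
  using g(2)[OF assms] by (simp add: complex_eq_iff xx_def h_def)

lemma g_deriv:
  assumes i: "i < m" and y: "Im p < y" "y < Im q"
  shows "(g i has_real_derivative inverse (Im (vd i (g i y)))) (at y)"
proof (rule DERIV_inverse_function[of "h i" _ "g i" y "Im p" "Im q"])
  show "(h i has_real_derivative Im (vd i (g i y))) (at (g i y))" by (rule h_deriv[OF i])
  show "Im (vd i (g i y)) \<noteq> 0" using vd_nz[OF i] g(1)[OF i, of y] y by auto
  show "h i (g i z) = z" if "Im p < z" "z < Im q" for z using g(2)[OF i, of z] that by auto
  have "continuous_on {Im p<..<Im q} (g i)" by (rule continuous_on_subset[OF g_cont[OF i]]) auto
  then show "isCont (g i) y" using y by (simp add: continuous_on_eq_continuous_at)
qed (use y in auto)

lemma xx_cont: assumes i: "i < m" shows "continuous_on {Im p..Im q} (xx i)"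
  unfolding xx_def
  by (intro continuous_intros continuous_on_compose2[OF curve_cont[OF str(1)[OF i]] g_cont[OF i]]) auto

lemma xx_deriv:
  assumes i: "i < m" and y: "Im p < y" "y < Im q"
  shows "(xx i has_real_derivative slope i y) (at y)"
proof -
  have "(curve K (c i) has_vector_derivative vd i (g i y)) (at (g i y))"
    using diagram_curve(4)[OF K str(1)[OF i]] by (simp add: vector_derivative_works vd_def)
  then have "((\<lambda>t. Re (curve K (c i) t)) has_vector_derivative Re (vd i (g i y))) (at (g i y))"
    by (rule bounded_linear.has_vector_derivative[OF bounded_linear_Re])
  then have "((\<lambda>t. Re (curve K (c i) t)) has_real_derivative Re (vd i (g i y))) (at (g i y))"
    by (simp add: has_real_derivative_iff_has_vector_derivative)
  from DERIV_chain2[OF this g_deriv[OF i y]] show ?thesis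
    by (simp add: xx_def[abs_def] slope_def divide_inverse)
qed

lemma meets_iff:
  assumes "i < m" "i' < m"
  shows "(t, t') \<in> meets K c u v i i' \<longleftrightarrow>
    (\<exists>y\<in>{Im p..Im q}. t = g i y \<and> t' = g i' y \<and> xx i y = xx i' y)"
proof
  assume "(t, t') \<in> meets K c u v i i'"
  then have t: "t \<in> {u i..v i}" "t' \<in> {u i'..v i'}" "curve K (c i) t = curve K (c i') t'"
    by (auto simp: meets_def pos_def)
  then have "h i t = h i' t'" by (simp add: h_def)
  then show "\<exists>y\<in>{Im p..Im q}. t = g i y \<and> t' = g i' y \<and> xx i y = xx i' y"
    using t h_range[OF assms(1) t(1)] g_h[OF assms(1) t(1)] g_h[OF assms(2) t(2)]
    by (intro bexI[of _ "h i t"]) (auto simp: xx_def)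
next
  assume "\<exists>y\<in>{Im p..Im q}. t = g i y \<and> t' = g i' y \<and> xx i y = xx i' y"
  then obtain y where y: "y \<in> {Im p..Im q}" "t = g i y" "t' = g i' y" "xx i y = xx i' y" by blast
  then show "(t, t') \<in> meets K c u v i i'"
    using g(1)[OF assms(1) y(1)] g(1)[OF assms(2) y(1)] curve_g[OF assms(1) y(1)] curve_g[OF assms(2) y(1)]
    by (simp add: meets_def pos_def)
qed

definition pt :: "nat \<Rightarrow> real \<Rightarrow> nat \<times> real" where "pt i y = (c i, g i y)"

lemma double_pt:
  assumes i: "i < m" "i' < m" "i \<noteq> i'" and y: "y \<in> {Im p..Im q}" "xx i y = xx i' y"
  shows "double K (pt i y) (pt i' y)" "Im p < y" "y < Im q" "pos K (pt i y) \<in> cbox p q"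
proof -
  have "pt i y \<noteq> pt i' y"
    using strand_unique[OF i(1,2) _ g(1)[OF i(1) y(1)]] g(1)[OF i(2) y(1)] i(3) by (auto simp: pt_def)
  then show d: "double K (pt i y) (pt i' y)"
    using str_source[OF i(1) g(1)[OF i(1) y(1)]] str_source[OF i(2) g(1)[OF i(2) y(1)]]
      curve_g[OF i(1) y(1)] curve_g[OF i(2) y(1)] y(2) by (simp add: double_def pt_def pos_def)
  then have "pt i y \<in> source K" by (simp add: double_def)
  then show b: "pos K (pt i y) \<in> cbox p q"
    using inbox[of "pt i y"] i(1) g(1)[OF i(1) y(1)] by (auto simp: pt_def)
  show "Im p < y" "y < Im q"
    using double_in_box[OF d b] curve_g[OF i(1) y(1)] by (auto simp: pt_def pos_def)
qed

lemma double_ptE: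
  assumes d: "double K P Q" "pos K P \<in> cbox p q"
  obtains i i' y where "i < m" "i' < m" "i \<noteq> i'" "y \<in> {Im p..Im q}" "xx i y = xx i' y"
    "P = pt i y" "Q = pt i' y"
proof -
  have s: "P \<in> source K" "Q \<in> source K" "pos K Q \<in> cbox p q" using d by (auto simp: double_def)
  obtain i where i: "i < m" "fst P = c i" "snd P \<in> {u i..v i}" using inbox[OF s(1)] d(2) by blast
  obtain i' where i': "i' < m" "fst Q = c i'" "snd Q \<in> {u i'..v i'}" using inbox[OF s(2)] s(3) by blast
  have eq: "curve K (c i) (snd P) = curve K (c i') (snd Q)" using d(1) i i' by (simp add: double_def pos_def)
  then have h: "h i (snd P) = h i' (snd Q)" by (simp add: h_def)
  let ?y = "h i (snd P)"
  have P: "P = pt i ?y" and Q: "Q = pt i' ?y"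
    using i i' g_h[OF i(1,3)] g_h[OF i'(1,3)] h by (auto simp: pt_def prod_eq_iff)
  have "i \<noteq> i'" using P Q d(1) by (auto simp: double_def)
  moreover have "xx i ?y = xx i' ?y"
    using eq g_h[OF i(1,3)] g_h[OF i'(1,3)] h by (simp add: xx_def)
  ultimately show ?thesis using that[of i i' ?y] i i' h_range[OF i(1,3)] P Q by blast
qed

text \<open>Of two branches traversed upwards, the one with smaller slope \<open>dx/dy\<close> runs from lower right to upper left.\<close>

lemma cross_pt:
  assumes i: "i < m" "i' < m" "i \<noteq> i'" and y: "y \<in> {Im p..Im q}" "xx i y = xx i' y"
  shows "(pt i y, pt i' y) \<in> cross K \<longleftrightarrow> slope i y < slope i' y" "slope i y \<noteq> slope i' y"
proof -
  note d = double_pt[OF assms]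
  have nz: "Im (vd i (g i y)) \<noteq> 0" "Im (vd i' (g i' y)) \<noteq> 0" using vd_nz g(1) i y by blast+
  have w: "wedge (vd i (g i y)) (vd i' (g i' y)) \<noteq> 0"
    using diagram_double(1)[OF K d(1)] by (simp add: pt_def tangent_vd)
  then show "slope i y \<noteq> slope i' y" using nz by (auto simp: slope_def wedge_def field_simps)
  have uv: "up_vec z = (if Im z > 0 then z else - z)" if "Im z \<noteq> 0" for z
    using that by (auto simp: up_vec_def upward_def)
  have "wedge (up_vec z') (up_vec z) > 0 \<longleftrightarrow> Re z / Im z < Re z' / Im z'" if "Im z \<noteq> 0" "Im z' \<noteq> 0" for z z'
    using that unfolding uv[OF that(1)] uv[OF that(2)]
    by (auto simp: wedge_def divide_less_cancel pos_divide_less_eq pos_less_divide_eq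
        neg_divide_less_eq neg_less_divide_eq mult.commute not_less_iff_gr_or_eq)
  from this[OF nz] show "(pt i y, pt i' y) \<in> cross K \<longleftrightarrow> slope i y < slope i' y"
    using d(1) by (simp add: cross_def pt_def tangent_vd slope_def)
qed

end

lemma one_zero:
  fixes f :: "real \<Rightarrow> real"
  assumes f: "continuous_on {\<alpha>..\<beta>} f" and y0: "\<alpha> < y0" "y0 < \<beta>"
    and zero: "\<And>y. y \<in> {\<alpha>..\<beta>} \<Longrightarrow> f y = 0 \<longleftrightarrow> y = y0"
    and d: "(f has_real_derivative d) (at y0)" "d \<noteq> 0"
  shows "f \<alpha> > 0 \<longleftrightarrow> d < 0"
    "\<alpha> \<le> y \<Longrightarrow> y < y0 \<Longrightarrow> f y > 0 \<longleftrightarrow> f \<alpha> > 0"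
    "y0 < y \<Longrightarrow> y \<le> \<beta> \<Longrightarrow> f y > 0 \<longleftrightarrow> \<not> f \<alpha> > 0"
proof -
  have low: "f y > 0 \<longleftrightarrow> f z > 0" if "\<alpha> \<le> y" "y < y0" "\<alpha> \<le> z" "z < y0" for y z
  proof (rule nonzero_same_sign[of "{\<alpha>..<y0}" f])
    show "continuous_on {\<alpha>..<y0} f" by (rule continuous_on_subset[OF f]) (use y0 in auto)
    show "f x \<noteq> 0" if "x \<in> {\<alpha>..<y0}" for x using zero[of x] that y0 by auto
  qed (use that in auto)
  have high: "f y > 0 \<longleftrightarrow> f z > 0" if "y0 < y" "y \<le> \<beta>" "y0 < z" "z \<le> \<beta>" for y z
  proof (rule nonzero_same_sign[of "{y0<..\<beta>}" f])
    show "continuous_on {y0<..\<beta>} f" by (rule continuous_on_subset[OF f]) (use y0 in auto)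
    show "f x \<noteq> 0" if "x \<in> {y0<..\<beta>}" for x using zero[of x] that y0 by auto
  qed (use that in auto)
  have f0: "f y0 = 0" using zero[of y0] y0 by auto
  have near: "\<exists>l r. \<alpha> \<le> l \<and> l < y0 \<and> y0 < r \<and> r \<le> \<beta> \<and> (f l > 0 \<longleftrightarrow> d < 0) \<and> (f r > 0 \<longleftrightarrow> d > 0)"
  proof (cases "d > 0")
    case True
    obtain e1 where e1: "e1 > 0" "\<And>k. 0 < k \<Longrightarrow> k < e1 \<Longrightarrow> f y0 < f (y0 + k)"
      using DERIV_pos_inc_right[OF d(1) True] by blast
    obtain e2 where e2: "e2 > 0" "\<And>k. 0 < k \<Longrightarrow> k < e2 \<Longrightarrow> f (y0 - k) < f y0"
      using DERIV_pos_inc_left[OF d(1) True] by blast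
    define k where "k = min (min (e1 / 2) (e2 / 2)) (min (y0 - \<alpha>) (\<beta> - y0))"
    have k: "0 < k" "k < e1" "k < e2" "k \<le> y0 - \<alpha>" "k \<le> \<beta> - y0"
      using e1(1) e2(1) y0 by (auto simp: k_def min_def)
    show ?thesis using k e1(2)[OF k(1,2)] e2(2)[OF k(1,3)] f0 True
      by (intro exI[of _ "y0 - k"] exI[of _ "y0 + k"]) auto
  next
    case False
    then have neg: "d < 0" using d(2) by auto
    obtain e1 where e1: "e1 > 0" "\<And>k. 0 < k \<Longrightarrow> k < e1 \<Longrightarrow> f y0 > f (y0 + k)"
      using DERIV_neg_dec_right[OF d(1) neg] by blast
    obtain e2 where e2: "e2 > 0" "\<And>k. 0 < k \<Longrightarrow> k < e2 \<Longrightarrow> f (y0 - k) > f y0"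
      using DERIV_neg_dec_left[OF d(1) neg] by blast
    define k where "k = min (min (e1 / 2) (e2 / 2)) (min (y0 - \<alpha>) (\<beta> - y0))"
    have k: "0 < k" "k < e1" "k < e2" "k \<le> y0 - \<alpha>" "k \<le> \<beta> - y0"
      using e1(1) e2(1) y0 by (auto simp: k_def min_def)
    show ?thesis using k e1(2)[OF k(1,2)] e2(2)[OF k(1,3)] f0 neg
      by (intro exI[of _ "y0 - k"] exI[of _ "y0 + k"]) auto
  qed
  then obtain l r where lr: "\<alpha> \<le> l" "l < y0" "y0 < r" "r \<le> \<beta>" "f l > 0 \<longleftrightarrow> d < 0" "f r > 0 \<longleftrightarrow> d > 0"
    by blast
  show 1: "f \<alpha> > 0 \<longleftrightarrow> d < 0" using low[of \<alpha> l] lr y0 by auto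
  show "\<alpha> \<le> y \<Longrightarrow> y < y0 \<Longrightarrow> f y > 0 \<longleftrightarrow> f \<alpha> > 0" using low[of \<alpha> y] y0 by auto
  show "y0 < y \<Longrightarrow> y \<le> \<beta> \<Longrightarrow> f y > 0 \<longleftrightarrow> \<not> f \<alpha> > 0" using high[of y r] lr 1 d(2) by auto
qed

section \<open>The moves\<close>

declare One_nat_def [simp del]

lemma (in box_pair) local_change_sym: "local_change K' K m c u v p q"
  unfolding local_change_def
proof (intro conjI ballI impI)
  show "comps K = comps K'" using comps by simp
  show "strands_in_box K' m c u v p q" "strands_in_box K m c u v p q" by (rule B'.box, rule B.box)
  show "pos K P = pos K' P" if "P \<in> source K'" "pos K' P \<notin> cbox p q" for P
    using that pos_out[of P] inbox_iff[of P] source by simp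
  show "mark K P = mark K' P" if P: "P \<in> double_points K'" "pos K' P \<notin> cbox p q" for P
  proof -
    obtain Q where "double K' P Q" using P(1) by (auto simp: double_points_def)
    then have "double K P Q" "pos K P \<notin> cbox p q" using double_out' P(2) by blast+
    then show ?thesis using lc doubleD(1) by (simp add: local_change_def)
  qed
qed

lemma (in box_pair) bottom: assumes i: "i < m" shows "B'.xx i (Im p) = B.xx i (Im p)"
proof -
  have e: "u i \<in> {u i..v i}" "v i \<in> {u i..v i}" using B.str(3)[OF i] by auto
  have "B.g i (Im p) = (if B.up i then u i else v i)"
    using B.g_h[OF i e(1)] B.g_h[OF i e(2)] B.h_ends[OF i] by (auto split: if_splits)
  moreover have "B'.g i (Im p) = (if B.up i then u i else v i)"
    using B'.g_h[OF i e(1)] B'.g_h[OF i e(2)] B'.h_ends[OF i] up[OF i] by (auto split: if_splits)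
  ultimately show ?thesis using curve_ends[OF i] by (simp add: B.xx_def B'.xx_def)
qed

context strand_box
begin

lemma box_nodes_heights:
  assumes lk: "\<And>i. i < m \<Longrightarrow> Im p < l i \<and> l i < k i \<and> k i < Im q"
    and zero: "\<And>i i' y. i < m \<Longrightarrow> i' < m \<Longrightarrow> i \<noteq> i' \<Longrightarrow> y \<in> {Im p..Im q} \<Longrightarrow> xx i y = xx i' y \<Longrightarrow> y = l i \<or> y = k i"
  shows "box_nodes K m c u v p q (\<lambda>i. g i (l i)) (\<lambda>i. g i (k i))"
proof unfold_locales
  fix i assume i: "i < m"
  show "g i (l i) \<in> {u i<..<v i}" "g i (k i) \<in> {u i<..<v i}"
    using lk[OF i] by (intro g_interior[OF i]; linarith)+
  show "h i (g i (l i)) < h i (g i (k i))" using lk[OF i] by (simp add: g(2)[OF i])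
next
  fix P assume P: "P \<in> double_points K" "pos K P \<in> cbox p q"
  then obtain Q where "double K P Q" by (auto simp: double_points_def)
  from double_ptE[OF this P(2)] obtain i i' y where i: "i < m" "i' < m" "i \<noteq> i'" "y \<in> {Im p..Im q}"
    "xx i y = xx i' y" "P = pt i y" by metis
  then show "P \<in> (\<Union>i<m. {(c i, g i (l i)), (c i, g i (k i))})"
    using zero[OF i(1-5)] by (auto simp: pt_def)
qed

text \<open>At a transversal crossing the difference of the horizontal positions has a simple zero and changes
  sign. So the strand that is on the right below a single crossing runs to the upper left, and is on the left
  above it.\<close>

lemma crossing_slope:
  assumes i: "i < m" "i' < m" "i \<noteq> i'" and y0: "Im p < y0" "y0 < \<beta>" "\<beta> \<le> Im q" "Im p \<le> \<alpha>" "\<alpha> < y0"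
    and zero: "\<And>y. y \<in> {\<alpha>..\<beta>} \<Longrightarrow> xx i y = xx i' y \<longleftrightarrow> y = y0"
  shows "xx i \<alpha> < xx i' \<alpha> \<longleftrightarrow> slope i' y0 < slope i y0"
    "\<alpha> \<le> y \<Longrightarrow> y < y0 \<Longrightarrow> xx i y < xx i' y \<longleftrightarrow> xx i \<alpha> < xx i' \<alpha>"
    "y0 < y \<Longrightarrow> y \<le> \<beta> \<Longrightarrow> xx i y < xx i' y \<longleftrightarrow> \<not> xx i \<alpha> < xx i' \<alpha>"
proof -
  let ?f = "\<lambda>y. xx i' y - xx i y"
  have z0: "xx i y0 = xx i' y0" using zero[of y0] y0 by auto
  have c: "continuous_on {\<alpha>..\<beta>} ?f"
    using y0 by (intro continuous_intros continuous_on_subset[OF xx_cont[OF i(1)]]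
        continuous_on_subset[OF xx_cont[OF i(2)]]) auto
  have d: "(?f has_real_derivative slope i' y0 - slope i y0) (at y0)"
    using y0 by (intro DERIV_diff xx_deriv i) auto
  have nz: "slope i' y0 - slope i y0 \<noteq> 0"
    using cross_pt(2)[OF i, of y0] y0 z0 by auto
  have zero': "?f y = 0 \<longleftrightarrow> y = y0" if "y \<in> {\<alpha>..\<beta>}" for y using zero[OF that] by auto
  note oz = one_zero[of \<alpha> \<beta> ?f y0, OF c y0(5) y0(2) zero' d nz]
  show "xx i \<alpha> < xx i' \<alpha> \<longleftrightarrow> slope i' y0 < slope i y0" using oz(1) by simp
  show "\<alpha> \<le> y \<Longrightarrow> y < y0 \<Longrightarrow> xx i y < xx i' y \<longleftrightarrow> xx i \<alpha> < xx i' \<alpha>" using oz(2)[of y] by simp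
  show "y0 < y \<Longrightarrow> y \<le> \<beta> \<Longrightarrow> xx i y < xx i' y \<longleftrightarrow> \<not> xx i \<alpha> < xx i' \<alpha>" using oz(3)[of y] by simp
qed

end

context box_nodes
begin

lemma prod_Nin:
  fixes F :: "nat \<times> real \<Rightarrow> 'k::comm_monoid_mult"
  shows "(\<Prod>P\<in>Nin. F P) = (\<Prod>i<m. F (c i, lo i) * F (c i, hi i))"
proof -
  have "(\<Prod>P\<in>Nin. F P) = (\<Prod>i<m. \<Prod>P\<in>{(c i, lo i), (c i, hi i)}. F P)"
    unfolding Nin_def
  proof (rule prod.UNION_disjoint)
    show "\<forall>i\<in>{..<m}. \<forall>j\<in>{..<m}. i \<noteq> j \<longrightarrow> {(c i, lo i), (c i, hi i)} \<inter> {(c j, lo j), (c j, hi j)} = {}"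
    proof (intro ballI impI equals0I)
      fix i j P assume ij: "i \<in> {..<m}" "j \<in> {..<m}" "i \<noteq> j"
        and P: "P \<in> {(c i, lo i), (c i, hi i)} \<inter> {(c j, lo j), (c j, hi j)}"
      have "snd P \<in> {u i..v i}" "snd P \<in> {u j..v j}" "c i = c j"
        using P lohi(1,2)[of i] lohi(1,2)[of j] ij by (auto simp: less_imp_le)
      then show False using strand_unique[of i j "snd P"] ij by auto
    qed
  qed auto
  also have "\<dots> = (\<Prod>i<m. F (c i, lo i) * F (c i, hi i))"
    using ab(6) by (intro prod.cong refl) auto
  finally show ?thesis .
qed

lemma Cin_iff:
  "(P, Q) \<in> Cin \<longleftrightarrow> (\<exists>i i' y. i < m \<and> i' < m \<and> i \<noteq> i' \<and> y \<in> {Im p..Im q} \<and> xx i y = xx i' y \<and>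
     P = pt i y \<and> Q = pt i' y \<and> slope i y < slope i' y)" (is "_ \<longleftrightarrow> ?R")
proof
  assume "(P, Q) \<in> Cin"
  then have c: "(P, Q) \<in> cross K" "pos K P \<in> cbox p q" by (auto simp: Cin_def)
  from double_ptE[OF crossD(1)[OF c(1)] c(2)] obtain i i' y where
    i: "i < m" "i' < m" "i \<noteq> i'" "y \<in> {Im p..Im q}" "xx i y = xx i' y" "P = pt i y" "Q = pt i' y" by metis
  then have "slope i y < slope i' y" using cross_pt(1)[OF i(1-5)] c by simp
  then show ?R using i by blast
next
  assume ?R
  then obtain i i' y where i: "i < m" "i' < m" "i \<noteq> i'" "y \<in> {Im p..Im q}" "xx i y = xx i' y"
    "P = pt i y" "Q = pt i' y" "slope i y < slope i' y" by blast
  then show "(P, Q) \<in> Cin"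
    using cross_pt(1)[OF i(1-5)] double_pt(4)[OF i(1-5)] by (simp add: Cin_def)
qed

end

lemma sum_PiE_two:
  "(\<Sum>\<mu>\<in>{..<2::nat} \<rightarrow>\<^sub>E J. F (\<mu> 0) (\<mu> 1)) = (\<Sum>i\<in>J. \<Sum>j\<in>J. F i j)"
proof -
  have "{..<2::nat} = {0, 1}" by auto
  then show ?thesis using sum_PiE_pair[of 0 "1::nat" "\<lambda>\<mu>. F (\<mu> 0) (\<mu> 1)" J] by simp
qed

lemma sum_PiE_three:
  assumes "{..<3::nat} = {a, b, d}" "distinct [a, b, d]"
  shows "(\<Sum>\<mu>\<in>{..<3::nat} \<rightarrow>\<^sub>E J. F (\<mu> a) (\<mu> b) (\<mu> d)) = (\<Sum>i\<in>J. \<Sum>j\<in>J. \<Sum>k\<in>J. F i j k)"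
proof -
  have e: "{..<3::nat} = {a} \<union> {b, d}" using assms(1) by auto
  have "(\<Sum>\<mu>\<in>({a} \<union> {b, d}) \<rightarrow>\<^sub>E J. F (\<mu> a) (\<mu> b) (\<mu> d)) =
    (\<Sum>\<mu>1\<in>{a} \<rightarrow>\<^sub>E J. \<Sum>\<mu>2\<in>{b, d} \<rightarrow>\<^sub>E J. F (\<mu>1 a) (\<mu>2 b) (\<mu>2 d))"
    using assms(2) by (subst sum_PiE_Un) auto
  also have "\<dots> = (\<Sum>i\<in>J. \<Sum>j\<in>J. \<Sum>k\<in>J. F i j k)"
    using assms(2) by (simp add: sum_PiE_singleton sum_PiE_pair)
  finally show ?thesis unfolding e .
qed

text \<open>The combinations of crossing types for which the braid relation holds: two of the three crossings
  are virtual, or the three strands are stacked above each other.\<close>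

definition triangle :: "passage \<Rightarrow> passage \<Rightarrow> passage \<Rightarrow> bool" where
  "triangle x y z \<longleftrightarrow> (x = Virt \<and> y = Virt) \<or> (y = Virt \<and> z = Virt) \<or> (x = Virt \<and> z = Virt) \<or>
     (Virt \<notin> {x, y, z} \<and> \<not> (x = z \<and> y = opp x))"

text \<open>In the braid relation three strands are numbered from left to right at the bottom, and \<open>x\<close>, \<open>y\<close>, \<open>z\<close> are the
  types of the strand that runs to the upper left, at the crossings of the first with the second, the first
  with the third, and the second with the third strand.\<close>

locale moves = rotational_tensors I A B X
  for I :: "'i set" and A B :: "'i \<Rightarrow> 'i \<Rightarrow> 'k::comm_ring_1"
    and X :: "passage \<Rightarrow> 'i \<Rightarrow> 'i \<Rightarrow> 'i \<Rightarrow> 'i \<Rightarrow> 'k" +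
  assumes inverse: "\<And>x a b c d. a \<in> I \<Longrightarrow> b \<in> I \<Longrightarrow> c \<in> I \<Longrightarrow> d \<in> I \<Longrightarrow>
      (\<Sum>i\<in>I. \<Sum>j\<in>I. X (opp x) a b i j * X x i j c d) = kronecker a c * kronecker b d"
    and braid: "\<And>x y z a b c d e f. triangle x y z \<Longrightarrow>
      a \<in> I \<Longrightarrow> b \<in> I \<Longrightarrow> c \<in> I \<Longrightarrow> d \<in> I \<Longrightarrow> e \<in> I \<Longrightarrow> f \<in> I \<Longrightarrow>
      (\<Sum>i\<in>I. \<Sum>j\<in>I. \<Sum>k\<in>I. X z a b i j * X y j c k f * X x i k d e) =
      (\<Sum>i\<in>I. \<Sum>j\<in>I. \<Sum>k\<in>I. X x b c i j * X y a i d k * X z k j e f)"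
begin

text \<open>The strands exchange their sides at the first crossing and return at the second. So one strand runs to the
  upper left at the first crossing and the other one at the second, and the two tensors belong to
  opposite types; their composition is the identity, as is that of two strands without crossings.\<close>

lemma invariant_move_II:
  assumes K: "virtual_link_diagram K" and K': "virtual_link_diagram K'"
    and lc: "local_change K K' 2 c u v p q"
    and none: "meets K c u v 0 1 = {}" and two: "card (meets K' c u v 0 1) = 2"
    and mk: "\<forall>(t, t')\<in>meets K' c u v 0 1. mark K' (c 0, t) = x"
  shows "invariant K' = invariant K"
proof -
  interpret B: strand_box K 2 c u v p q
    using K lc by unfold_locales (auto simp: local_change_def)
  interpret B': strand_box K' 2 c u v p q
    using K' lc by unfold_locales (auto simp: local_change_def)
  let ?W = "{Im p..Im q}"
  have lt: "(0::nat) < 2" "(1::nat) < 2" "(0::nat) \<noteq> 1" by simp_all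
  have two_cases: "(i = 0 \<and> i' = 1) \<or> (i = 1 \<and> i' = 0)" if "i < 2" "i' < 2" "i \<noteq> i'" for i i' :: nat
    using that by linarith
  have noK: "B.xx i y \<noteq> B.xx i' y" if "i < 2" "i' < 2" "i \<noteq> i'" "y \<in> ?W" for i i' y
  proof -
    have "B.xx 0 y \<noteq> B.xx 1 y" using B.meets_iff[OF lt(1,2), of "B.g 0 y" "B.g 1 y"] none that(4) by blast
    then show ?thesis using two_cases[OF that(1-3)] by auto
  qed
  \<comment> \<open>The diagram without crossings gets two trivial nodes on each strand, at any two heights.\<close>
  define l where "l = (2 * Im p + Im q) / 3"
  define k where "k = (Im p + 2 * Im q) / 3"
  have bn: "box_nodes K 2 c u v p q (\<lambda>i. B.g i l) (\<lambda>i. B.g i k)"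
    using B.pq noK by (intro B.box_nodes_heights) (auto simp: l_def k_def)
  define Y where "Y = {y \<in> ?W. B'.xx 0 y = B'.xx 1 y}"
  have mY: "meets K' c u v 0 1 = (\<lambda>y. (B'.g 0 y, B'.g 1 y)) ` Y"
  proof -
    have e: "(t, t') \<in> meets K' c u v 0 1 \<longleftrightarrow> (t, t') \<in> (\<lambda>y. (B'.g 0 y, B'.g 1 y)) ` Y" for t t'
      unfolding B'.meets_iff[OF lt(1,2)] Y_def by blast
    show ?thesis
    proof (rule Set.set_eqI)
      fix x show "x \<in> meets K' c u v 0 1 \<longleftrightarrow> x \<in> (\<lambda>y. (B'.g 0 y, B'.g 1 y)) ` Y"
        using e[of "fst x" "snd x"] by (simp only: prod.collapse)
    qed
  qed
  have "inj_on (\<lambda>y. (B'.g 0 y, B'.g 1 y)) Y"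
    using B'.g(2)[OF lt(1)] unfolding Y_def inj_on_def by (metis (no_types, lifting) mem_Collect_eq prod.inject)
  then have "card Y = 2" using two by (simp add: mY card_image)
  then obtain r s where "Y = {r, s}" "r \<noteq> s" by (auto simp: card_2_iff)
  then obtain y1 y2 where Y: "Y = {y1, y2}" "y1 < y2"
    by (metis insert_commute linorder_neqE_linordered_idom)
  have yW: "y1 \<in> ?W" "y2 \<in> ?W" and z: "B'.xx 0 y1 = B'.xx 1 y1" "B'.xx 0 y2 = B'.xx 1 y2"
    using Y by (auto simp: Y_def)
  have int: "Im p < y1" "y2 < Im q"
    using B'.double_pt(2)[OF lt yW(1) z(1)] B'.double_pt(3)[OF lt yW(2) z(2)] by auto
  have zero: "y = y1 \<or> y = y2" if "i < 2" "i' < 2" "i \<noteq> i'" "y \<in> ?W" "B'.xx i y = B'.xx i' y" for i i' y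
  proof -
    have "y \<in> Y" using two_cases[OF that(1-3)] that(4,5) by (auto simp: Y_def)
    then show ?thesis using Y by auto
  qed
  have bn': "box_nodes K' 2 c u v p q (\<lambda>i. B'.g i y1) (\<lambda>i. B'.g i y2)"
    using int Y(2) zero by (intro B'.box_nodes_heights) auto
  interpret C: box_change I A B X K K' 2 c u v p q "\<lambda>i. B.g i l" "\<lambda>i. B.g i k" "\<lambda>i. B'.g i y1" "\<lambda>i. B'.g i y2"
    using bn bn' lc rotational_tensors_axioms
    by (simp add: box_change_def box_change_axioms_def box_sum_def)
  \<comment> \<open>Splitting the box at this height separates the two crossings.\<close>
  define mid where "mid = (y1 + y2) / 2"
  have mid: "y1 < mid" "mid < y2" using Y(2) by (auto simp: mid_def)
  have z1: "B'.xx 0 y = B'.xx 1 y \<longleftrightarrow> y = y1" if "y \<in> {Im p..mid}" for y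
  proof
    assume "B'.xx 0 y = B'.xx 1 y"
    then show "y = y1" using zero[OF lt, of y] that mid int by auto
  qed (use z in simp)
  have z2: "B'.xx 0 y = B'.xx 1 y \<longleftrightarrow> y = y2" if "y \<in> {mid..Im q}" for y
  proof
    assume "B'.xx 0 y = B'.xx 1 y"
    then show "y = y2" using zero[OF lt, of y] that mid int by auto
  qed (use z in simp)
  have sl: "B'.slope 0 y1 < B'.slope 1 y1 \<longleftrightarrow> B'.slope 1 y2 < B'.slope 0 y2"
  proof -
    have 1: "B'.xx 0 (Im p) < B'.xx 1 (Im p) \<longleftrightarrow> B'.slope 1 y1 < B'.slope 0 y1"
      "B'.xx 0 mid < B'.xx 1 mid \<longleftrightarrow> \<not> B'.xx 0 (Im p) < B'.xx 1 (Im p)"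
      using B'.crossing_slope(1)[OF lt, of y1 mid "Im p", OF _ _ _ _ _ z1]
        B'.crossing_slope(3)[OF lt, of y1 mid "Im p" mid, OF _ _ _ _ _ z1] int mid by simp_all
    have "B'.xx 0 mid < B'.xx 1 mid \<longleftrightarrow> B'.slope 1 y2 < B'.slope 0 y2"
      using B'.crossing_slope(1)[OF lt, of y2 "Im q" mid, OF _ _ _ _ _ z2] int mid by simp
    then show ?thesis using 1 B'.cross_pt(2)[OF lt yW(1) z(1)] by auto
  qed
  have nsl: "B'.slope 0 y1 \<noteq> B'.slope 1 y1" by (rule B'.cross_pt(2)[OF lt yW(1) z(1)])
  have Cin: "C.L'.Cin = (if B'.slope 0 y1 < B'.slope 1 y1
      then {(B'.pt 0 y1, B'.pt 1 y1), (B'.pt 1 y2, B'.pt 0 y2)}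
      else {(B'.pt 1 y1, B'.pt 0 y1), (B'.pt 0 y2, B'.pt 1 y2)})" (is "_ = ?C")
  proof -
    have "(P, Q) \<in> C.L'.Cin \<longleftrightarrow> (P, Q) \<in> ?C" for P Q
    proof
      assume "(P, Q) \<in> C.L'.Cin"
      then obtain i i' y where i: "i < 2" "i' < 2" "i \<noteq> i'" "y \<in> ?W" "B'.xx i y = B'.xx i' y"
        "P = B'.pt i y" "Q = B'.pt i' y" "B'.slope i y < B'.slope i' y"
        unfolding C.L'.Cin_iff by blast
      then show "(P, Q) \<in> ?C" using zero[OF i(1-5)] two_cases[OF i(1-3)] sl by auto
    next
      assume PQ: "(P, Q) \<in> ?C"
      have nsl2: "B'.slope 0 y2 \<noteq> B'.slope 1 y2" by (rule B'.cross_pt(2)[OF lt yW(2) z(2)])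
      show "(P, Q) \<in> C.L'.Cin"
      proof (cases "B'.slope 0 y1 < B'.slope 1 y1")
        case True
        then consider "P = B'.pt 0 y1" "Q = B'.pt 1 y1" | "P = B'.pt 1 y2" "Q = B'.pt 0 y2" using PQ by auto
        then show ?thesis
        proof cases
          case 1
          then show ?thesis unfolding C.L'.Cin_iff using True yW z lt by blast
        next
          case 2
          then show ?thesis unfolding C.L'.Cin_iff using True sl yW z[symmetric] lt by (metis zero_neq_one)
        qed
      next
        case False
        then have s: "B'.slope 1 y1 < B'.slope 0 y1" "B'.slope 0 y2 < B'.slope 1 y2" using sl nsl nsl2 by auto
        consider "P = B'.pt 1 y1" "Q = B'.pt 0 y1" | "P = B'.pt 0 y2" "Q = B'.pt 1 y2" using PQ False by auto
        then show ?thesis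
        proof cases
          case 1
          then show ?thesis unfolding C.L'.Cin_iff using s yW z[symmetric] lt by (metis zero_neq_one)
        next
          case 2
          then show ?thesis unfolding C.L'.Cin_iff using s yW z lt by blast
        qed
      qed
    qed
    then show ?thesis by (metis (no_types, lifting) subrelI subset_antisym)
  qed
  have pts: "B'.pt i y1 = (c i, B'.g i y1)" "B'.pt i y2 = (c i, B'.g i y2)" for i by (simp_all add: B'.pt_def)
  have marks: "mark K' (B'.pt 0 y1) = x" "mark K' (B'.pt 0 y2) = x"
    "mark K' (B'.pt 1 y1) = opp x" "mark K' (B'.pt 1 y2) = opp x"
  proof -
    have "(B'.g 0 y, B'.g 1 y) \<in> meets K' c u v 0 1" if "y \<in> Y" for y using that mY by blast
    then show 1: "mark K' (B'.pt 0 y1) = x" "mark K' (B'.pt 0 y2) = x" using mk Y(1) by (auto simp: B'.pt_def)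
    show "mark K' (B'.pt 1 y1) = opp x"
      using diagram_double(2)[OF K' B'.double_pt(1)[OF lt yW(1) z(1)]] 1 by simp
    show "mark K' (B'.pt 1 y2) = opp x"
      using diagram_double(2)[OF K' B'.double_pt(1)[OF lt yW(2) z(2)]] 1 by simp
  qed
  have ne: "B'.pt 0 y1 \<noteq> B'.pt 1 y2" "B'.pt 1 y1 \<noteq> B'.pt 0 y2"
  proof -
    have "B'.h 0 (B'.g 0 y1) \<noteq> B'.h 0 (B'.g 0 y2)" using B'.g(2)[OF lt(1)] yW Y(2) by simp
    then have a: "B'.pt 0 y1 \<noteq> B'.pt 0 y2" by (auto simp: B'.pt_def)
    have d: "double K' (B'.pt 0 y1) (B'.pt 1 y1)" "double K' (B'.pt 0 y2) (B'.pt 1 y2)"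
      using B'.double_pt(1)[OF lt] yW z by blast+
    show "B'.pt 0 y1 \<noteq> B'.pt 1 y2" "B'.pt 1 y1 \<noteq> B'.pt 0 y2"
    proof -
      have g0: "B'.g 0 y1 \<in> {u 0..v 0}" "B'.g 0 y2 \<in> {u 0..v 0}" "B'.g 1 y1 \<in> {u 1..v 1}" "B'.g 1 y2 \<in> {u 1..v 1}"
        using B'.g(1) lt yW by blast+
      show "B'.pt 0 y1 \<noteq> B'.pt 1 y2" "B'.pt 1 y1 \<noteq> B'.pt 0 y2"
        using B'.strand_unique[OF lt(1,2)] g0 lt(3) by (auto simp: B'.pt_def) metis+
    qed
  qed
  have dN: "C.L'.Nin - double_points K' = {}"
  proof -
    have "P \<in> double_points K'" if "P \<in> C.L'.Nin" for P
    proof -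
      obtain i where i: "i < 2" "P = B'.pt i y1 \<or> P = B'.pt i y2"
        using \<open>P \<in> C.L'.Nin\<close> by (auto simp: C.L'.Nin_def B'.pt_def)
      have "double K' (B'.pt 0 y1) (B'.pt 1 y1)" "double K' (B'.pt 0 y2) (B'.pt 1 y2)"
        using B'.double_pt(1)[OF lt] yW z by blast+
      moreover have "i = 0 \<or> i = 1" using i(1) by auto
      ultimately show ?thesis using i(2) doubleD by blast
    qed
    then show ?thesis by blast
  qed
  show ?thesis
  proof (rule C.invariant_box_change)
    fix bt tp :: "nat \<Rightarrow> 'i" assume I: "\<And>i. i < 2 \<Longrightarrow> bt i \<in> I" "\<And>i. i < 2 \<Longrightarrow> tp i \<in> I"
    have "(\<Sum>\<mu>\<in>{..<2} \<rightarrow>\<^sub>E I. C.L'.box_tensor bt tp \<mu>) = kronecker (tp 0) (bt 0) * kronecker (tp 1) (bt 1)"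
    proof (cases "B'.slope 0 y1 < B'.slope 1 y1")
      case True
      have "C.L'.box_tensor bt tp \<mu> = X (opp x) (tp 1) (tp 0) (\<mu> 0) (\<mu> 1) * X x (\<mu> 0) (\<mu> 1) (bt 1) (bt 0)" for \<mu>
        unfolding C.L'.box_tensor_def dN Cin
        using True ne by (simp add: marks) (simp add: pts C.L'.in_simps)
      then show ?thesis
        using sum_PiE_two[of "\<lambda>i j. X (opp x) (tp 1) (tp 0) i j * X x i j (bt 1) (bt 0)" I] inverse I
        by (simp add: mult.commute)
    next
      case False
      have "C.L'.box_tensor bt tp \<mu> = X x (tp 0) (tp 1) (\<mu> 1) (\<mu> 0) * X (opp x) (\<mu> 1) (\<mu> 0) (bt 0) (bt 1)" for \<mu>
        unfolding C.L'.box_tensor_def dN Cin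
        using False ne by (simp add: marks) (simp add: pts C.L'.in_simps)
      then have "(\<Sum>\<mu>\<in>{..<2} \<rightarrow>\<^sub>E I. C.L'.box_tensor bt tp \<mu>) =
          (\<Sum>i\<in>I. \<Sum>j\<in>I. X x (tp 0) (tp 1) j i * X (opp x) j i (bt 0) (bt 1))"
        using sum_PiE_two[of "\<lambda>i j. X x (tp 0) (tp 1) j i * X (opp x) j i (bt 0) (bt 1)" I] by simp
      also have "\<dots> = (\<Sum>j\<in>I. \<Sum>i\<in>I. X x (tp 0) (tp 1) j i * X (opp x) j i (bt 0) (bt 1))" by (rule sum.swap)
      also have "\<dots> = kronecker (tp 0) (bt 0) * kronecker (tp 1) (bt 1)"
        using inverse[of "tp 0" "tp 1" "bt 0" "bt 1" "opp x"] I by simp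
      finally show ?thesis .
    qed
    also have "\<dots> = (\<Prod>i<2. one (bt i) (tp i))"
    proof -
      have "(\<Prod>i<2. one (bt i) (tp i)) = one (bt 0) (tp 0) * one (bt 1) (tp 1)"
        by (simp add: numeral_2_eq_2 One_nat_def mult.commute)
      moreover have "kronecker (tp i) (bt i) = one (bt i) (tp i)" if "i < 2" for i
        using I(1)[OF that] by (auto simp: kronecker_def one_def)
      ultimately show ?thesis using lt by simp
    qed
    also have "\<dots> = (\<Prod>i<2. \<Sum>a\<in>I. one (bt i) a * one a (tp i))"
    proof (intro prod.cong refl)
      fix i :: nat assume "i \<in> {..<2}"
      then have "bt i \<in> I" "tp i \<in> I" using I by auto
      then have "mat_mul one one (bt i) (tp i) = (\<Sum>a\<in>I. one (bt i) a * one a (tp i))" by (simp only: mat_mul_def simp_thms if_True)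
      then show "one (bt i) (tp i) = (\<Sum>a\<in>I. one (bt i) a * one a (tp i))" by simp
    qed
    also have "\<dots> = (\<Sum>\<mu>\<in>{..<2} \<rightarrow>\<^sub>E I. \<Prod>i<2. one (bt i) (\<mu> i) * one (\<mu> i) (tp i))"
      using finI by (intro prod_sum_PiE) auto
    also have "\<dots> = (\<Sum>\<mu>\<in>{..<2} \<rightarrow>\<^sub>E I. C.L.box_tensor bt tp \<mu>)"
    proof (intro sum.cong refl)
      fix \<mu>
      have "C.L.Cin = {}"
      proof -
        have "(P, Q) \<notin> C.L.Cin" for P Q unfolding C.L.Cin_iff using noK by blast
        then show ?thesis by auto
      qed
      moreover have "C.L.Nin \<inter> double_points K = {}"
      proof (rule equals0I)
        fix P assume P: "P \<in> C.L.Nin \<inter> double_points K"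
        then obtain Q where "double K P Q" by (auto simp: double_points_def)
        moreover have "pos K P \<in> cbox p q" using P C.L.Nin_inbox(2) by blast
        ultimately show False using B.double_ptE noK by metis
      qed
      then have "C.L.Nin - double_points K = C.L.Nin" by auto
      ultimately show "(\<Prod>i<2. one (bt i) (\<mu> i) * one (\<mu> i) (tp i)) = C.L.box_tensor bt tp \<mu>"
        unfolding C.L.box_tensor_def C.L.prod_Nin by (simp add: C.L.prod_Nin C.L.in_simps)
    qed
    finally show "(\<Sum>\<mu>\<in>{..<2} \<rightarrow>\<^sub>E I. C.L'.box_tensor bt tp \<mu>) = (\<Sum>\<mu>\<in>{..<2} \<rightarrow>\<^sub>E I. C.L.box_tensor bt tp \<mu>)" .
  qed
qed

end

lemma (in strand_box) pt_eq_iff: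
  assumes "i < m" "i' < m" "y \<in> {Im p..Im q}" "y' \<in> {Im p..Im q}"
  shows "pt i y = pt i' y' \<longleftrightarrow> i = i' \<and> y = y'"
proof
  assume e: "pt i y = pt i' y'"
  then have "i = i'"
    using strand_unique[OF assms(1,2), of "g i y"] g(1)[OF assms(1,3)] g(1)[OF assms(2,4)] by (auto simp: pt_def)
  moreover have "h i (g i y) = h i (g i y')" using e calculation by (simp add: pt_def)
  ultimately show "i = i' \<and> y = y'" using g(2)[OF assms(1)] assms(3,4) by simp
qed auto

text \<open>Numbering the strands by their order at the bottom of the box turns the combinatorics of a triangle
  into inequalities between heights.\<close>

locale three_strands = strand_box K m c u v p q
  for K m c u v p q +
  fixes i0 i1 i2 :: nat and y01 y02 y12 :: real
  assumes m: "m = 3" and ind: "{..<3} = {i0, i1, i2}" "distinct [i0, i1, i2]"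
    and bottom_order: "xx i0 (Im p) < xx i1 (Im p)" "xx i1 (Im p) < xx i2 (Im p)"
    and yW: "y01 \<in> {Im p..Im q}" "y02 \<in> {Im p..Im q}" "y12 \<in> {Im p..Im q}"
    and zeros: "\<And>y. y \<in> {Im p..Im q} \<Longrightarrow> xx i0 y = xx i1 y \<longleftrightarrow> y = y01"
      "\<And>y. y \<in> {Im p..Im q} \<Longrightarrow> xx i0 y = xx i2 y \<longleftrightarrow> y = y02"
      "\<And>y. y \<in> {Im p..Im q} \<Longrightarrow> xx i1 y = xx i2 y \<longleftrightarrow> y = y12"
begin

lemma i_less: "i0 < m" "i1 < m" "i2 < m"
  using ind(1) m by auto

lemma i_ne: "i0 \<noteq> i1" "i0 \<noteq> i2" "i1 \<noteq> i2"
  using ind(2) by auto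

lemma at_zero: "xx i0 y01 = xx i1 y01" "xx i0 y02 = xx i2 y02" "xx i1 y12 = xx i2 y12"
  using zeros yW by auto

lemma doubles: "double K (pt i0 y01) (pt i1 y01)" "double K (pt i0 y02) (pt i2 y02)" "double K (pt i1 y12) (pt i2 y12)"
  using double_pt(1) i_less i_ne yW at_zero by blast+

lemma interior: "Im p < y01" "y01 < Im q" "Im p < y02" "y02 < Im q" "Im p < y12" "y12 < Im q"
  using double_pt(2,3)[OF i_less(1,2) i_ne(1) yW(1) at_zero(1)]
    double_pt(2,3)[OF i_less(1,3) i_ne(2) yW(2) at_zero(2)]
    double_pt(2,3)[OF i_less(2,3) i_ne(3) yW(3) at_zero(3)] by auto

lemma slopes: "slope i1 y01 < slope i0 y01" "slope i2 y02 < slope i0 y02" "slope i2 y12 < slope i1 y12"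
proof -
  have b: "xx i0 (Im p) < xx i2 (Im p)" using bottom_order by linarith
  show "slope i1 y01 < slope i0 y01"
    using crossing_slope(1)[OF i_less(1,2) i_ne(1), of y01 "Im q" "Im p", OF _ _ _ _ _ zeros(1)] interior bottom_order by simp
  show "slope i2 y02 < slope i0 y02"
    using crossing_slope(1)[OF i_less(1,3) i_ne(2), of y02 "Im q" "Im p", OF _ _ _ _ _ zeros(2)] interior b by simp
  show "slope i2 y12 < slope i1 y12"
    using crossing_slope(1)[OF i_less(2,3) i_ne(3), of y12 "Im q" "Im p", OF _ _ _ _ _ zeros(3)] interior bottom_order by simp
qed

lemma no_triple: "y01 \<noteq> y02" "y02 \<noteq> y12"
proof -
  have p12: "pt i1 y \<noteq> pt i2 y" "pt i0 y \<noteq> pt i1 y" if "y \<in> {Im p..Im q}" for y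
    using pt_eq_iff[OF _ _ that that] i_less i_ne by auto
  show "y01 \<noteq> y02"
  proof
    assume "y01 = y02"
    then have "double K (pt i0 y01) (pt i2 y01)" using doubles(2) by simp
    then show False using diagram_double(3)[OF K doubles(1)] p12(1)[OF yW(1)] by metis
  qed
  show "y02 \<noteq> y12"
  proof
    assume "y02 = y12"
    then have "double K (pt i2 y02) (pt i1 y02)" using doubles(3) double_sym by simp
    then show False using diagram_double(3)[OF K double_sym[OF doubles(2)]] p12(2)[OF yW(2)] by metis
  qed
qed

text \<open>The outer strands meet when exactly one of them has crossed the middle strand.\<close>

lemma heights_order: "(y01 < y02 \<and> y02 < y12) \<or> (y12 < y02 \<and> y02 < y01)"
proof -
  have a: "xx i0 y02 < xx i1 y02 \<longleftrightarrow> y02 < y01"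
  proof (cases "y02 < y01")
    case True
    then show ?thesis
      using crossing_slope(2)[OF i_less(1,2) i_ne(1), of y01 "Im q" "Im p" y02, OF _ _ _ _ _ zeros(1)] interior bottom_order by simp
  next
    case False
    then have "y01 < y02" using no_triple by auto
    then show ?thesis
      using crossing_slope(3)[OF i_less(1,2) i_ne(1), of y01 "Im q" "Im p" y02, OF _ _ _ _ _ zeros(1)] interior bottom_order by simp
  qed
  have b: "xx i1 y02 < xx i2 y02 \<longleftrightarrow> y02 < y12"
  proof (cases "y02 < y12")
    case True
    then show ?thesis
      using crossing_slope(2)[OF i_less(2,3) i_ne(3), of y12 "Im q" "Im p" y02, OF _ _ _ _ _ zeros(3)] interior bottom_order by simp
  next
    case False
    then have "y12 < y02" using no_triple by auto
    then show ?thesis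
      using crossing_slope(3)[OF i_less(2,3) i_ne(3), of y12 "Im q" "Im p" y02, OF _ _ _ _ _ zeros(3)] interior bottom_order by simp
  qed
  have "xx i0 y02 \<noteq> xx i1 y02" "xx i1 y02 \<noteq> xx i2 y02" using zeros(1)[OF yW(2)] zeros(3)[OF yW(2)] no_triple by auto
  then show ?thesis using a b at_zero(2) no_triple by linarith
qed

lemma zero_cases:
  assumes "i < m" "i' < m" "i \<noteq> i'" "y \<in> {Im p..Im q}" "xx i y = xx i' y"
  shows "(y = y01 \<and> {i, i'} = {i0, i1}) \<or> (y = y02 \<and> {i, i'} = {i0, i2}) \<or> (y = y12 \<and> {i, i'} = {i1, i2})"
proof -
  have "i \<in> {i0, i1, i2}" "i' \<in> {i0, i1, i2}" using assms(1,2) ind(1) m by auto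
  then show ?thesis using assms(3,5) zeros[OF assms(4)] by (elim insertE emptyE) (auto simp: insert_commute)
qed

lemma slope_cases:
  "(\<exists>i i' y. i < m \<and> i' < m \<and> i \<noteq> i' \<and> y \<in> {Im p..Im q} \<and> xx i y = xx i' y \<and>
     P = pt i y \<and> Q = pt i' y \<and> slope i y < slope i' y) \<longleftrightarrow>
   (P, Q) \<in> {(pt i1 y01, pt i0 y01), (pt i2 y02, pt i0 y02), (pt i2 y12, pt i1 y12)}" (is "?L \<longleftrightarrow> ?R")
proof
  assume ?L
  then obtain i i' y where i: "i < m" "i' < m" "i \<noteq> i'" "y \<in> {Im p..Im q}" "xx i y = xx i' y"
     "P = pt i y" "Q = pt i' y" "slope i y < slope i' y" by blast
  then show ?R using zero_cases[OF i(1-5)] slopes by (auto simp: doubleton_eq_iff)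
next
  assume ?R
  then consider "P = pt i1 y01" "Q = pt i0 y01" | "P = pt i2 y02" "Q = pt i0 y02" | "P = pt i2 y12" "Q = pt i1 y12"
    by auto
  then show ?L
  proof cases
    case 1
    then show ?thesis using i_less i_ne yW at_zero slopes
      by (intro exI[of _ i1] exI[of _ i0] exI[of _ y01]) auto
  next
    case 2
    then show ?thesis using i_less i_ne yW at_zero slopes
      by (intro exI[of _ i2] exI[of _ i0] exI[of _ y02]) auto
  next
    case 3
    then show ?thesis using i_less i_ne yW at_zero slopes
      by (intro exI[of _ i2] exI[of _ i1] exI[of _ y12]) auto
  qed
qed

lemma crossings_distinct:
  "pt i1 y01 \<noteq> pt i2 y02" "pt i1 y01 \<noteq> pt i2 y12" "pt i2 y02 \<noteq> pt i2 y12"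
  using pt_eq_iff i_less i_ne yW no_triple by auto

end

context box_sum
begin

lemma box_tensor_three:
  assumes S: "three_strands K m c u v p q i0 i1 i2 y01 y02 y12"
    and lohi: "\<And>i. i < m \<Longrightarrow> lo i = g i (l i)" "\<And>i. i < m \<Longrightarrow> hi i = g i (k i)"
    and lk: "\<And>i. i \<in> {i0, i1, i2} \<Longrightarrow> {l i, k i} = (if i = i0 then {y01, y02} else if i = i1 then {y01, y12} else {y02, y12})"
  shows "box_tensor bt tp \<mu> =
    X (mark K (pt i1 y01)) (in_up tp \<mu> (pt i1 y01)) (in_up tp \<mu> (pt i0 y01)) (in_down bt \<mu> (pt i0 y01)) (in_down bt \<mu> (pt i1 y01)) *
    X (mark K (pt i2 y02)) (in_up tp \<mu> (pt i2 y02)) (in_up tp \<mu> (pt i0 y02)) (in_down bt \<mu> (pt i0 y02)) (in_down bt \<mu> (pt i2 y02)) *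
    X (mark K (pt i2 y12)) (in_up tp \<mu> (pt i2 y12)) (in_up tp \<mu> (pt i1 y12)) (in_down bt \<mu> (pt i1 y12)) (in_down bt \<mu> (pt i2 y12))"
proof -
  interpret S: three_strands K m c u v p q i0 i1 i2 y01 y02 y12 by (rule S)
  have Cin: "Cin = {(pt i1 y01, pt i0 y01), (pt i2 y02, pt i0 y02), (pt i2 y12, pt i1 y12)}" (is "_ = ?C")
  proof -
    have "(P, Q) \<in> Cin \<longleftrightarrow> (P, Q) \<in> ?C" for P Q
      unfolding Cin_iff S.slope_cases ..
    then show ?thesis by (metis (no_types, lifting) subrelI subset_antisym)
  qed
  have "P \<in> double_points K" if PN: "P \<in> Nin" for P
  proof -
    obtain i where i: "i < m" "P = (c i, lo i) \<or> P = (c i, hi i)" using PN by (auto simp: Nin_def)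
    have ii: "i \<in> {i0, i1, i2}" using i(1) S.ind(1) S.m by auto
    obtain w where w: "P = pt i w" "w \<in> {l i, k i}" using i lohi by (auto simp: pt_def)
    have "w \<in> (if i = i0 then {y01, y02} else if i = i1 then {y01, y12} else {y02, y12})"
      using w(2) unfolding lk[OF ii] .
    then have "P \<in> {pt i0 y01, pt i0 y02, pt i1 y01, pt i1 y12, pt i2 y02, pt i2 y12}"
      using w(1) ii by (auto split: if_splits)
    then show ?thesis using doubleD[OF S.doubles(1)] doubleD[OF S.doubles(2)] doubleD[OF S.doubles(3)] by auto
  qed
  then have dN: "Nin - double_points K = {}" by blast
  show ?thesis
    unfolding box_tensor_def Cin dN using S.crossings_distinct by (simp add: mult.assoc)
qed

end

context moves
begin

text \<open>The tensors of the two boxes are the two sides of the braid relation, with the intermediate labels of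
  the three strands as summation indices.\<close>

lemma invariant_braid:
  assumes lc: "local_change K K' 3 c u v p q"
    and S: "three_strands K 3 c u v p q i0 i1 i2 y01 y02 y12"
    and S': "three_strands K' 3 c u v p q i0 i1 i2 z01 z02 z12"
    and LT: "y01 < y02" "y02 < y12" and RT: "z12 < z02" "z02 < z01"
    and tri: "triangle x y z"
    and mk: "\<And>t t'. (t, t') \<in> meets K c u v i1 i0 \<Longrightarrow> mark K (c i1, t) = x"
      "\<And>t t'. (t, t') \<in> meets K c u v i2 i0 \<Longrightarrow> mark K (c i2, t) = y"
      "\<And>t t'. (t, t') \<in> meets K c u v i2 i1 \<Longrightarrow> mark K (c i2, t) = z"
    and mk': "\<And>t t'. (t, t') \<in> meets K' c u v i1 i0 \<Longrightarrow> mark K' (c i1, t) = x"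
      "\<And>t t'. (t, t') \<in> meets K' c u v i2 i0 \<Longrightarrow> mark K' (c i2, t) = y"
      "\<And>t t'. (t, t') \<in> meets K' c u v i2 i1 \<Longrightarrow> mark K' (c i2, t) = z"
  shows "invariant K' = invariant K"
proof -
  interpret S: three_strands K 3 c u v p q i0 i1 i2 y01 y02 y12 by (rule S)
  interpret S': three_strands K' 3 c u v p q i0 i1 i2 z01 z02 z12 by (rule S')
  note i = S.i_less and ne = S.i_ne
  define l where "l i = (if i = i2 then y02 else y01)" for i
  define k where "k i = (if i = i0 then y02 else y12)" for i
  define l' where "l' i = (if i = i0 then z02 else z12)" for i
  define k' where "k' i = (if i = i2 then z02 else z01)" for i
  have icase: "j = i0 \<or> j = i1 \<or> j = i2" if "j < 3" for j using that S.ind(1) by auto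
  have bn: "box_nodes K 3 c u v p q (\<lambda>i. S.g i (l i)) (\<lambda>i. S.g i (k i))"
  proof (rule S.box_nodes_heights)
    show "Im p < l j \<and> l j < k j \<and> k j < Im q" if "j < 3" for j
      using icase[OF that] LT S.interior ne by (auto simp: l_def k_def)
    show "w = l j \<or> w = k j" if "j < 3" "j' < 3" "j \<noteq> j'" "w \<in> {Im p..Im q}" "S.xx j w = S.xx j' w" for j j' w
      using S.zero_cases[OF that] ne by (auto simp: l_def k_def doubleton_eq_iff)
  qed
  have bn': "box_nodes K' 3 c u v p q (\<lambda>i. S'.g i (l' i)) (\<lambda>i. S'.g i (k' i))"
  proof (rule S'.box_nodes_heights)
    show "Im p < l' j \<and> l' j < k' j \<and> k' j < Im q" if "j < 3" for j
      using icase[OF that] RT S'.interior ne by (auto simp: l'_def k'_def)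
    show "w = l' j \<or> w = k' j" if "j < 3" "j' < 3" "j \<noteq> j'" "w \<in> {Im p..Im q}" "S'.xx j w = S'.xx j' w" for j j' w
      using S'.zero_cases[OF that] ne by (auto simp: l'_def k'_def doubleton_eq_iff)
  qed
  interpret C: box_change I A B X K K' 3 c u v p q "\<lambda>i. S.g i (l i)" "\<lambda>i. S.g i (k i)"
    "\<lambda>i. S'.g i (l' i)" "\<lambda>i. S'.g i (k' i)"
    using bn bn' lc rotational_tensors_axioms
    by (simp add: box_change_def box_change_axioms_def box_sum_def)
  have marks: "mark K (S.pt i1 y01) = x" "mark K (S.pt i2 y02) = y" "mark K (S.pt i2 y12) = z"
    unfolding S.pt_def
    using mk(1)[of "S.g i1 y01" "S.g i0 y01"] S.meets_iff[OF i(2,1)]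
      mk(2)[of "S.g i2 y02" "S.g i0 y02"] S.meets_iff[OF i(3,1)]
      mk(3)[of "S.g i2 y12" "S.g i1 y12"] S.meets_iff[OF i(3,2)] S.at_zero S.yW by metis+
  have marks': "mark K' (S'.pt i1 z01) = x" "mark K' (S'.pt i2 z02) = y" "mark K' (S'.pt i2 z12) = z"
    unfolding S'.pt_def
    using mk'(1)[of "S'.g i1 z01" "S'.g i0 z01"] S'.meets_iff[OF i(2,1)]
      mk'(2)[of "S'.g i2 z02" "S'.g i0 z02"] S'.meets_iff[OF i(3,1)]
      mk'(3)[of "S'.g i2 z12" "S'.g i1 z12"] S'.meets_iff[OF i(3,2)] S'.at_zero S'.yW by metis+
  have pts: "S.pt i1 y01 = (c i1, S.g i1 (l i1))" "S.pt i0 y01 = (c i0, S.g i0 (l i0))"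
    "S.pt i2 y02 = (c i2, S.g i2 (l i2))" "S.pt i0 y02 = (c i0, S.g i0 (k i0))"
    "S.pt i2 y12 = (c i2, S.g i2 (k i2))" "S.pt i1 y12 = (c i1, S.g i1 (k i1))"
    using ne by (auto simp: S.pt_def l_def k_def)
  have pts': "S'.pt i1 z01 = (c i1, S'.g i1 (k' i1))" "S'.pt i0 z01 = (c i0, S'.g i0 (k' i0))"
    "S'.pt i2 z02 = (c i2, S'.g i2 (k' i2))" "S'.pt i0 z02 = (c i0, S'.g i0 (l' i0))"
    "S'.pt i2 z12 = (c i2, S'.g i2 (l' i2))" "S'.pt i1 z12 = (c i1, S'.g i1 (l' i1))"
    using ne by (auto simp: S'.pt_def l'_def k'_def)
  show ?thesis
  proof (rule C.invariant_box_change)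
    fix bt tp :: "nat \<Rightarrow> 'i" assume I: "\<And>i. i < 3 \<Longrightarrow> bt i \<in> I" "\<And>i. i < 3 \<Longrightarrow> tp i \<in> I"
    have L: "C.L.box_tensor bt tp \<mu> = X z (tp i2) (tp i1) (\<mu> i1) (\<mu> i2) *
        X y (\<mu> i2) (tp i0) (\<mu> i0) (bt i2) * X x (\<mu> i1) (\<mu> i0) (bt i0) (bt i1)" for \<mu>
    proof -
      have "{l j, k j} = (if j = i0 then {y01, y02} else if j = i1 then {y01, y12} else {y02, y12})"
        if "j \<in> {i0, i1, i2}" for j using that ne by (auto simp: l_def k_def)
      from C.L.box_tensor_three[OF S refl refl this, of bt tp \<mu>]
      show ?thesis unfolding marks unfolding pts C.L.in_simps[OF i(1)] C.L.in_simps[OF i(2)] C.L.in_simps[OF i(3)]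
        by (simp add: ac_simps)
    qed
    have L': "C.L'.box_tensor bt tp \<mu> = X x (tp i1) (tp i0) (\<mu> i0) (\<mu> i1) *
        X y (tp i2) (\<mu> i0) (bt i0) (\<mu> i2) * X z (\<mu> i2) (\<mu> i1) (bt i1) (bt i2)" for \<mu>
    proof -
      have "{l' j, k' j} = (if j = i0 then {z01, z02} else if j = i1 then {z01, z12} else {z02, z12})"
        if "j \<in> {i0, i1, i2}" for j using that ne by (auto simp: l'_def k'_def)
      from C.L'.box_tensor_three[OF S' refl refl this, of bt tp \<mu>]
      show ?thesis unfolding marks' unfolding pts' C.L'.in_simps[OF i(1)] C.L'.in_simps[OF i(2)] C.L'.in_simps[OF i(3)]
        by (simp add: ac_simps)
    qed
    have s1: "{..<3} = {i1, i2, i0}" "distinct [i1, i2, i0]" using S.ind by auto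
    have "(\<Sum>\<mu>\<in>{..<3} \<rightarrow>\<^sub>E I. C.L.box_tensor bt tp \<mu>) = (\<Sum>i\<in>I. \<Sum>j\<in>I. \<Sum>k\<in>I.
        X z (tp i2) (tp i1) i j * X y j (tp i0) k (bt i2) * X x i k (bt i0) (bt i1))"
      unfolding L using sum_PiE_three[OF s1, of "\<lambda>i j k. X z (tp i2) (tp i1) i j * X y j (tp i0) k (bt i2) * X x i k (bt i0) (bt i1)" I] .
    also have "\<dots> = (\<Sum>i\<in>I. \<Sum>j\<in>I. \<Sum>k\<in>I.
        X x (tp i1) (tp i0) i j * X y (tp i2) i (bt i0) k * X z k j (bt i1) (bt i2))"
      using I i by (intro braid[OF tri]) auto
    also have "\<dots> = (\<Sum>\<mu>\<in>{..<3} \<rightarrow>\<^sub>E I. C.L'.box_tensor bt tp \<mu>)"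
      unfolding L' using sum_PiE_three[OF S.ind, of "\<lambda>i j k. X x (tp i1) (tp i0) i j * X y (tp i2) i (bt i0) k * X z k j (bt i1) (bt i2)" I] by simp
    finally show "(\<Sum>\<mu>\<in>{..<3} \<rightarrow>\<^sub>E I. C.L'.box_tensor bt tp \<mu>) = (\<Sum>\<mu>\<in>{..<3} \<rightarrow>\<^sub>E I. C.L.box_tensor bt tp \<mu>)" ..
  qed
qed

text \<open>Reversing the order of the crossings on the leftmost strand exchanges the two possible orders of all three
  heights, by \<open>heights_order\<close>. Reversing all the orders on the strands is therefore the same as
  passing from one side of the braid relation to the other.\<close>

lemma invariant_move_III:
  assumes K: "virtual_link_diagram K" and K': "virtual_link_diagram K'" and mv: "move_III T K K'"
    and T: "\<And>y i0 i1 i2. T y \<Longrightarrow> {..<3::nat} = {i0, i1, i2} \<Longrightarrow> distinct [i0, i1, i2] \<Longrightarrow>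
      (\<And>i i'. i < 3 \<Longrightarrow> i' < 3 \<Longrightarrow> i \<noteq> i' \<Longrightarrow> y i' i = opp (y i i')) \<Longrightarrow>
      triangle (y i1 i0) (y i2 i0) (y i2 i1)"
  shows "invariant K' = invariant K"
proof -
  obtain c u v p q \<tau> \<tau>' y where lc: "local_change K K' 3 c u v p q"
    and pair: "\<forall>i<3. \<forall>i'<3. i \<noteq> i' \<longrightarrow>
      meets K c u v i i' = {(\<tau> i i', \<tau> i' i)} \<and> meets K' c u v i i' = {(\<tau>' i i', \<tau>' i' i)} \<and>
      mark K (c i, \<tau> i i') = y i i' \<and> mark K' (c i, \<tau>' i i') = y i i'"
    and reverse: "\<forall>i<3. \<forall>i'<3. \<forall>i''<3. distinct [i, i', i''] \<longrightarrow>
      (\<tau> i i' < \<tau> i i'' \<longleftrightarrow> \<tau>' i i'' < \<tau>' i i')"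
    and Ty: "T y"
    using mv unfolding move_III_def by blast
  have met: "meets K c u v i i' = {(\<tau> i i', \<tau> i' i)}" "meets K' c u v i i' = {(\<tau>' i i', \<tau>' i' i)}"
    and mk: "mark K (c i, \<tau> i i') = y i i'" "mark K' (c i, \<tau>' i i') = y i i'"
    if "i < 3" "i' < 3" "i \<noteq> i'" for i i'
    using pair that by blast+
  have flip: "\<tau> i i' < \<tau> i i'' \<longleftrightarrow> \<tau>' i i'' < \<tau>' i i'"
    if "i < 3" "i' < 3" "i'' < 3" "distinct [i, i', i'']" for i i' i''
    using reverse that by blast
  interpret B: strand_box K 3 c u v p q
    using K lc by unfold_locales (auto simp: local_change_def)
  interpret B': strand_box K' 3 c u v p q
    using K' lc by unfold_locales (auto simp: local_change_def)
  interpret P: box_pair K K' 3 c u v p q by unfold_locales (rule lc)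
  let ?W = "{Im p..Im q}"
  have height: "B.h i (\<tau> i i') \<in> ?W" "\<tau> i i' = B.g i (B.h i (\<tau> i i'))"
      "w \<in> ?W \<Longrightarrow> B.xx i w = B.xx i' w \<longleftrightarrow> w = B.h i (\<tau> i i')"
      if i: "i < 3" "i' < 3" "i \<noteq> i'" for i i' w
  proof -
    have "(\<tau> i i', \<tau> i' i) \<in> meets K c u v i i'" using met(1)[OF i] by simp
    then obtain z where z: "z \<in> ?W" "\<tau> i i' = B.g i z" "B.xx i z = B.xx i' z"
      unfolding B.meets_iff[OF i(1,2)] by blast
    then have hz: "B.h i (\<tau> i i') = z" using B.g(2)[OF i(1)] by simp
    show "B.h i (\<tau> i i') \<in> ?W" "\<tau> i i' = B.g i (B.h i (\<tau> i i'))" using hz z by simp_all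
    have "w = z" if w: "w \<in> ?W" "B.xx i w = B.xx i' w"
    proof -
      have "(B.g i w, B.g i' w) \<in> meets K c u v i i'" unfolding B.meets_iff[OF i(1,2)] using w by blast
      then have "B.g i w = \<tau> i i'" using met(1)[OF i] by simp
      then show ?thesis using hz B.g(2)[OF i(1) w(1)] by simp
    qed
    then show "w \<in> ?W \<Longrightarrow> B.xx i w = B.xx i' w \<longleftrightarrow> w = B.h i (\<tau> i i')" using hz z by auto
  qed
  have height': "B'.h i (\<tau>' i i') \<in> ?W" "\<tau>' i i' = B'.g i (B'.h i (\<tau>' i i'))"
      "w \<in> ?W \<Longrightarrow> B'.xx i w = B'.xx i' w \<longleftrightarrow> w = B'.h i (\<tau>' i i')"
      if i: "i < 3" "i' < 3" "i \<noteq> i'" for i i' w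
  proof -
    have "(\<tau>' i i', \<tau>' i' i) \<in> meets K' c u v i i'" using met(2)[OF i] by simp
    then obtain z where z: "z \<in> ?W" "\<tau>' i i' = B'.g i z" "B'.xx i z = B'.xx i' z"
      unfolding B'.meets_iff[OF i(1,2)] by blast
    then have hz: "B'.h i (\<tau>' i i') = z" using B'.g(2)[OF i(1)] by simp
    show "B'.h i (\<tau>' i i') \<in> ?W" "\<tau>' i i' = B'.g i (B'.h i (\<tau>' i i'))" using hz z by simp_all
    have "w = z" if w: "w \<in> ?W" "B'.xx i w = B'.xx i' w"
    proof -
      have "(B'.g i w, B'.g i' w) \<in> meets K' c u v i i'" unfolding B'.meets_iff[OF i(1,2)] using w by blast
      then have "B'.g i w = \<tau>' i i'" using met(2)[OF i] by simp
      then show ?thesis using hz B'.g(2)[OF i(1) w(1)] by simp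
    qed
    then show "w \<in> ?W \<Longrightarrow> B'.xx i w = B'.xx i' w \<longleftrightarrow> w = B'.h i (\<tau>' i i')" using hz z by auto
  qed
  have pW: "Im p \<in> ?W" using B.pq by simp
  have bne: "B.xx i (Im p) \<noteq> B.xx i' (Im p)" if "i < 3" "i' < 3" "i \<noteq> i'" for i i'
    using B.double_pt(2)[OF that pW] by auto
  obtain i0 i1 i2 where ind: "{..<3::nat} = {i0, i1, i2}" "distinct [i0, i1, i2]"
    and bo: "B.xx i0 (Im p) < B.xx i1 (Im p)" "B.xx i1 (Im p) < B.xx i2 (Im p)"
  proof -
    have sets: "{..<3::nat} = {0, 1, 2}" by auto
    have n: "B.xx 0 (Im p) \<noteq> B.xx 1 (Im p)" "B.xx 0 (Im p) \<noteq> B.xx 2 (Im p)" "B.xx 1 (Im p) \<noteq> B.xx 2 (Im p)"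
      using bne by simp_all
    let ?x = "\<lambda>i. B.xx i (Im p)"
    consider "?x 0 < ?x 1" "?x 1 < ?x 2" | "?x 0 < ?x 2" "?x 2 < ?x 1" | "?x 1 < ?x 0" "?x 0 < ?x 2"
      | "?x 1 < ?x 2" "?x 2 < ?x 0" | "?x 2 < ?x 0" "?x 0 < ?x 1" | "?x 2 < ?x 1" "?x 1 < ?x 0"
      using n by linarith
    then show thesis
    proof cases
      case 1
      show thesis by (rule that[of 0 1 2]) (use sets 1 in auto)
    next
      case 2
      show thesis by (rule that[of 0 2 1]) (use sets 2 in auto)
    next
      case 3
      show thesis by (rule that[of 1 0 2]) (use sets 3 in auto)
    next
      case 4
      show thesis by (rule that[of 1 2 0]) (use sets 4 in auto)
    next
      case 5
      show thesis by (rule that[of 2 0 1]) (use sets 5 in auto)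
    next
      case 6
      show thesis by (rule that[of 2 1 0]) (use sets 6 in auto)
    qed
  qed
  have i: "i0 < 3" "i1 < 3" "i2 < 3" and ne: "i0 \<noteq> i1" "i0 \<noteq> i2" "i1 \<noteq> i2" using ind by auto
  define y01 y02 y12 where "y01 = B.h i0 (\<tau> i0 i1)" and "y02 = B.h i0 (\<tau> i0 i2)" and "y12 = B.h i1 (\<tau> i1 i2)"
  define z01 z02 z12 where "z01 = B'.h i0 (\<tau>' i0 i1)" and "z02 = B'.h i0 (\<tau>' i0 i2)" and "z12 = B'.h i1 (\<tau>' i1 i2)"
  have S: "three_strands K 3 c u v p q i0 i1 i2 y01 y02 y12"
    using ind bo height[OF i(1,2) ne(1)] height[OF i(1,3) ne(2)] height[OF i(2,3) ne(3)]
    by unfold_locales (simp_all add: y01_def y02_def y12_def)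
  have S': "three_strands K' 3 c u v p q i0 i1 i2 z01 z02 z12"
    using ind bo height'[OF i(1,2) ne(1)] height'[OF i(1,3) ne(2)] height'[OF i(2,3) ne(3)]
      P.bottom[OF i(1)] P.bottom[OF i(2)] P.bottom[OF i(3)]
    by unfold_locales (simp_all add: z01_def z02_def z12_def)
  have opps: "y i' i = opp (y i i')" if ii: "i < 3" "i' < 3" "i \<noteq> i'" for i i'
  proof -
    let ?w = "B.h i (\<tau> i i')"
    have w: "?w \<in> ?W" "B.xx i ?w = B.xx i' ?w" using height[OF ii] by auto
    have "(B.g i ?w, B.g i' ?w) \<in> meets K c u v i i'" unfolding B.meets_iff[OF ii(1,2)] using w by blast
    then have t: "B.g i ?w = \<tau> i i'" "B.g i' ?w = \<tau> i' i" using met(1)[OF ii] by auto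
    have "mark K (B.pt i' ?w) = opp (mark K (B.pt i ?w))"
      using diagram_double(2)[OF K B.double_pt(1)[OF ii w]] .
    then show ?thesis using mk(1)[OF ii] mk(1)[OF ii(2,1)] ii(3) by (simp add: B.pt_def t)
  qed
  have tri: "triangle (y i1 i0) (y i2 i0) (y i2 i1)" using T[OF Ty ind opps] .
  have m: "mark K (c j, t) = y j j'" if "j < 3" "j' < 3" "j \<noteq> j'" "(t, t') \<in> meets K c u v j j'" for j j' t t'
    using met(1)[OF that(1-3)] mk(1)[OF that(1-3)] that(4) by simp
  have m': "mark K' (c j, t) = y j j'" if "j < 3" "j' < 3" "j \<noteq> j'" "(t, t') \<in> meets K' c u v j j'" for j j' t t'
    using met(2)[OF that(1-3)] mk(2)[OF that(1-3)] that(4) by simp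
  \<comment> \<open>The orders on the strand are given by parameters; if it is traversed downwards, both orders
  of heights are reversed.\<close>
  have turn: "y01 < y02 \<longleftrightarrow> z02 < z01"
  proof -
    have "\<tau> i0 i1 < \<tau> i0 i2 \<longleftrightarrow> (if B.up i0 then y01 < y02 else y02 < y01)"
      "\<tau> i0 i2 < \<tau> i0 i1 \<longleftrightarrow> (if B.up i0 then y02 < y01 else y01 < y02)"
      using B.g_less[OF i(1)] height(1,2)[OF i(1,2) ne(1)] height(1,2)[OF i(1,3) ne(2)]
      unfolding y01_def y02_def by metis+
    moreover have "\<tau>' i0 i1 < \<tau>' i0 i2 \<longleftrightarrow> (if B.up i0 then z01 < z02 else z02 < z01)"
      "\<tau>' i0 i2 < \<tau>' i0 i1 \<longleftrightarrow> (if B.up i0 then z02 < z01 else z01 < z02)"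
      using B'.g_less[OF i(1)] height'(1,2)[OF i(1,2) ne(1)] height'(1,2)[OF i(1,3) ne(2)] P.up[OF i(1)]
      unfolding z01_def z02_def by metis+
    moreover have "\<tau> i0 i1 < \<tau> i0 i2 \<longleftrightarrow> \<tau>' i0 i2 < \<tau>' i0 i1" "\<tau> i0 i2 < \<tau> i0 i1 \<longleftrightarrow> \<tau>' i0 i1 < \<tau>' i0 i2"
      using flip[of i0 i1 i2] flip[of i0 i2 i1] i ne by auto
    ultimately show ?thesis by (auto split: if_splits)
  qed
  from three_strands.heights_order[OF S] show ?thesis
  proof
    assume y: "y01 < y02 \<and> y02 < y12"
    then have z: "z12 < z02" "z02 < z01" using turn three_strands.heights_order[OF S'] by auto
    show ?thesis
      by (rule invariant_braid[OF lc S S' _ _ z tri]) (use y i ne m m' in auto)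
  next
    assume y: "y12 < y02 \<and> y02 < y01"
    then have z: "z01 < z02" "z02 < z12" using turn three_strands.heights_order[OF S'] by auto
    have "invariant K = invariant K'"
      by (rule invariant_braid[OF P.local_change_sym S' S z _ _ tri]) (use y i ne m m' in auto)
    then show ?thesis ..
  qed
qed

lemma invariant_step:
  assumes "rotational_step K K'" shows "invariant K' = invariant K"
proof -
  have K: "virtual_link_diagram K" "virtual_link_diagram K'" using assms by (auto simp: rotational_step_def)
  have II: "invariant K' = invariant K" if "move_II S K K'" for S
    using that K invariant_move_II unfolding move_II_def by blast
  have perm: "(i = i0 \<and> i' = i1 \<and> i'' = i2) \<or> (i = i0 \<and> i' = i2 \<and> i'' = i1) \<or>
      (i = i1 \<and> i' = i0 \<and> i'' = i2) \<or> (i = i1 \<and> i' = i2 \<and> i'' = i0) \<or>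
      (i = i2 \<and> i' = i0 \<and> i'' = i1) \<or> (i = i2 \<and> i' = i1 \<and> i'' = i0)"
    if "{..<3::nat} = {i0, i1, i2}" "i < 3" "i' < 3" "i'' < 3" "distinct [i, i', i'']"
    for i0 i1 i2 i i' i'' :: nat
  proof -
    have "i \<in> {i0, i1, i2}" "i' \<in> {i0, i1, i2}" "i'' \<in> {i0, i1, i2}"
      using that(2-4) unfolding that(1)[symmetric] by auto
    then show ?thesis using that(5) by auto
  qed
  consider "reparametrization K K'" | "planar_isotopy K K'" | S where "move_II S K K'"
    | "classical_III K K'" | "virtual_III K K'" | "mixed_move K K'"
    using assms by (auto simp: rotational_step_def classical_II_def virtual_II_def)
  then show ?thesis
  proof cases
    case 1
    then show ?thesis using invariant_reparametrization K by blast
  next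
    case 2
    then show ?thesis using invariant_planar_isotopy K by blast
  next
    case 3
    then show ?thesis by (rule II)
  next
    case 4
    show ?thesis
    proof (rule invariant_move_III[OF K 4[unfolded classical_III_def]])
      fix y :: "nat \<Rightarrow> nat \<Rightarrow> passage" and i0 i1 i2 :: nat
      assume "\<exists>i<3. \<exists>i'<3. \<exists>i''<3. distinct [i, i', i''] \<and> y i i' = Over \<and> y i i'' = Over \<and> y i' i'' = Over"
        and ind: "{..<3::nat} = {i0, i1, i2}" "distinct [i0, i1, i2]"
        and op: "\<And>i i'. i < 3 \<Longrightarrow> i' < 3 \<Longrightarrow> i \<noteq> i' \<Longrightarrow> y i' i = opp (y i i')"
      then obtain i i' i'' where i: "i < 3" "i' < 3" "i'' < 3" "distinct [i, i', i'']"
        "y i i' = Over" "y i i'' = Over" "y i' i'' = Over" by blast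
      have "y i' i = Under" "y i'' i = Under" "y i'' i' = Under"
        using op[of i i'] op[of i i''] op[of i' i''] i by simp_all
      with i(5-) perm[OF ind(1) i(1-4)] show "triangle (y i1 i0) (y i2 i0) (y i2 i1)"
        by (elim disjE conjE) (simp_all add: triangle_def)
    qed
  next
    case 5
    show ?thesis
    proof (rule invariant_move_III[OF K 5[unfolded virtual_III_def]])
      fix y :: "nat \<Rightarrow> nat \<Rightarrow> passage" and i0 i1 i2 :: nat
      assume v: "\<forall>i<3. \<forall>i'<3. i \<noteq> i' \<longrightarrow> y i i' = Virt"
        and ind: "{..<3::nat} = {i0, i1, i2}" "distinct [i0, i1, i2]"
      have "i0 < 3" "i1 < 3" "i2 < 3" using ind(1) by auto
      then show "triangle (y i1 i0) (y i2 i0) (y i2 i1)" using v ind(2) by (simp add: triangle_def)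
    qed
  next
    case 6
    show ?thesis
    proof (rule invariant_move_III[OF K 6[unfolded mixed_move_def]])
      fix y :: "nat \<Rightarrow> nat \<Rightarrow> passage" and i0 i1 i2 :: nat
      assume "\<exists>i<3. \<exists>i'<3. \<exists>i''<3. distinct [i, i', i''] \<and> y i i' = Virt \<and> y i i'' = Virt \<and> y i' i'' \<noteq> Virt"
        and ind: "{..<3::nat} = {i0, i1, i2}" "distinct [i0, i1, i2]"
        and op: "\<And>i i'. i < 3 \<Longrightarrow> i' < 3 \<Longrightarrow> i \<noteq> i' \<Longrightarrow> y i' i = opp (y i i')"
      then obtain i i' i'' where i: "i < 3" "i' < 3" "i'' < 3" "distinct [i, i', i'']"
        "y i i' = Virt" "y i i'' = Virt" by blast
      have "y i' i = Virt" "y i'' i = Virt" using op[of i i'] op[of i i''] i by simp_all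
      with i(5-) perm[OF ind(1) i(1-4)] show "triangle (y i1 i0) (y i2 i0) (y i2 i1)"
        by (elim disjE conjE) (simp_all add: triangle_def)
    qed
  qed
qed

lemma invariant_isotopic:
  assumes "virtual_rotational_isotopic K K'" shows "invariant K = invariant K'"
  using assms unfolding virtual_rotational_isotopic_def
  by (induction rule: equivclp_induct) (metis invariant_step)+

end

section \<open>The braid relations\<close>

lemma sum_kronecker:
  fixes F :: "'i \<Rightarrow> 'k::comm_ring_1"
  assumes "finite I" "a \<in> I"
  shows "(\<Sum>i\<in>I. kronecker a i * F i) = F a" "(\<Sum>i\<in>I. kronecker i a * F i) = F a"
  using assms by (simp_all add: kronecker_def if_distrib[where f="\<lambda>x. x * _"] cong: if_cong)

lemma sum_triple:
  "(\<Sum>x\<in>I \<times> I \<times> I. F x) = (\<Sum>i\<in>I. \<Sum>j\<in>I. \<Sum>k\<in>I. F (i, j, k))"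
  by (simp add: sum.cartesian_product case_prod_unfold)

lemma sum_triple_eqI:
  assumes "\<And>i j k. i \<in> I \<Longrightarrow> j \<in> I \<Longrightarrow> k \<in> I \<Longrightarrow> F (i, j, k) = G i j k"
  shows "(\<Sum>x\<in>I \<times> I \<times> I. F x) = (\<Sum>i\<in>I. \<Sum>j\<in>I. \<Sum>k\<in>I. G i j k)"
  unfolding sum_triple using assms by (intro sum.cong refl) auto

context link_tensors
begin

text \<open>The six stackings of three strands follow from the single given braid relation by
  multiplication with inverses.\<close>

lemma braid_variants:
  assumes supp: "supp r1" "supp r2" "supp s1" "supp s2"
    and inv: "mat_mul r1 s1 = one" "mat_mul s1 r1 = one" "mat_mul r2 s2 = one" "mat_mul s2 r2 = one"
    and br: "mat_mul r1 (mat_mul r2 r1) = mat_mul r2 (mat_mul r1 r2)"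
  shows "mat_mul r1 (mat_mul r2 s1) = mat_mul s2 (mat_mul r1 r2)"
    and "mat_mul s1 (mat_mul r2 r1) = mat_mul r2 (mat_mul r1 s2)"
    and "mat_mul s1 (mat_mul s2 s1) = mat_mul s2 (mat_mul s1 s2)"
    and "mat_mul s1 (mat_mul s2 r1) = mat_mul r2 (mat_mul s1 s2)"
    and "mat_mul r1 (mat_mul s2 s1) = mat_mul s2 (mat_mul s1 r2)"
proof -
  have c: "mat_mul r1 (mat_mul s1 Y) = Y" "mat_mul s1 (mat_mul r1 Y) = Y" "mat_mul r2 (mat_mul s2 Y) = Y" "mat_mul s2 (mat_mul r2 Y) = Y"
    if "supp Y" for Y
    using that inv by (simp_all add: mat_mul_assoc[symmetric])
  have br': "mat_mul r1 (mat_mul r2 (mat_mul r1 Y)) = mat_mul r2 (mat_mul r1 (mat_mul r2 Y))" for Y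
  proof -
    have "mat_mul (mat_mul r1 (mat_mul r2 r1)) Y = mat_mul (mat_mul r2 (mat_mul r1 r2)) Y" by (simp only: br)
    then show ?thesis by (simp only: mat_mul_assoc)
  qed
  show v1: "mat_mul r1 (mat_mul r2 s1) = mat_mul s2 (mat_mul r1 r2)"
  proof -
    have "mat_mul r2 (mat_mul r1 (mat_mul r2 s1)) = mat_mul r1 (mat_mul r2 (mat_mul r1 s1))" by (simp only: br')
    also have "\<dots> = mat_mul r1 r2" by (simp add: inv supp)
    finally have "mat_mul s2 (mat_mul r2 (mat_mul r1 (mat_mul r2 s1))) = mat_mul s2 (mat_mul r1 r2)" by simp
    then show ?thesis by (simp add: c)
  qed
  show v2: "mat_mul s1 (mat_mul r2 r1) = mat_mul r2 (mat_mul r1 s2)"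
  proof -
    have "mat_mul r1 (mat_mul r2 (mat_mul r1 s2)) = mat_mul r2 (mat_mul r1 (mat_mul r2 s2))" by (simp only: br')
    also have "\<dots> = mat_mul r2 r1" by (simp add: inv supp)
    finally have "mat_mul s1 (mat_mul r1 (mat_mul r2 (mat_mul r1 s2))) = mat_mul s1 (mat_mul r2 r1)" by simp
    then show ?thesis by (simp add: c)
  qed
  show v3: "mat_mul s1 (mat_mul s2 s1) = mat_mul s2 (mat_mul s1 s2)"
  proof -
    have "mat_mul r2 (mat_mul r1 (mat_mul r2 (mat_mul s1 (mat_mul s2 s1)))) = mat_mul r1 (mat_mul r2 (mat_mul r1 (mat_mul s1 (mat_mul s2 s1))))" by (simp only: br')
    also have "\<dots> = one" by (simp add: c inv supp)
    finally have "mat_mul s2 (mat_mul s1 (mat_mul s2 (mat_mul r2 (mat_mul r1 (mat_mul r2 (mat_mul s1 (mat_mul s2 s1))))))) = mat_mul s2 (mat_mul s1 (mat_mul s2 one))" by simp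
    then show ?thesis by (simp add: c supp)
  qed
  have v3': "mat_mul s1 (mat_mul s2 (mat_mul s1 Y)) = mat_mul s2 (mat_mul s1 (mat_mul s2 Y))" for Y
  proof -
    have "mat_mul (mat_mul s1 (mat_mul s2 s1)) Y = mat_mul (mat_mul s2 (mat_mul s1 s2)) Y" by (simp only: v3)
    then show ?thesis by (simp only: mat_mul_assoc)
  qed
  show "mat_mul s1 (mat_mul s2 r1) = mat_mul r2 (mat_mul s1 s2)"
  proof -
    have "mat_mul s2 (mat_mul s1 (mat_mul s2 r1)) = mat_mul s1 (mat_mul s2 (mat_mul s1 r1))" by (simp only: v3')
    also have "\<dots> = mat_mul s1 s2" by (simp add: inv supp)
    finally have "mat_mul r2 (mat_mul s2 (mat_mul s1 (mat_mul s2 r1))) = mat_mul r2 (mat_mul s1 s2)" by simp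
    then show ?thesis by (simp add: c)
  qed
  show "mat_mul r1 (mat_mul s2 s1) = mat_mul s2 (mat_mul s1 r2)"
  proof -
    have "mat_mul s1 (mat_mul s2 (mat_mul s1 r2)) = mat_mul s2 (mat_mul s1 (mat_mul s2 r2))" by (simp only: v3')
    also have "\<dots> = mat_mul s2 s1" by (simp add: inv supp)
    finally have "mat_mul r1 (mat_mul s1 (mat_mul s2 (mat_mul s1 r2))) = mat_mul r1 (mat_mul s2 s1)" by simp
    then show ?thesis by (simp add: c)
  qed
qed

end

text \<open>A crossing of two adjacent ones of three strands as a matrix with triples as indices, so that
  stacking crossings becomes matrix multiplication.\<close>

definition strand12 :: "'i set \<Rightarrow> ('i \<Rightarrow> 'i \<Rightarrow> 'i \<Rightarrow> 'i \<Rightarrow> 'k::comm_ring_1) \<Rightarrow> 'i \<times> 'i \<times> 'i \<Rightarrow> 'i \<times> 'i \<times> 'i \<Rightarrow> 'k" where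
  "strand12 I Y x y = (if x \<in> I \<times> I \<times> I \<and> y \<in> I \<times> I \<times> I then
     case (x, y) of ((a, b, c), (d, e, f)) \<Rightarrow> kronecker c f * Y a b d e else 0)"

definition strand23 :: "'i set \<Rightarrow> ('i \<Rightarrow> 'i \<Rightarrow> 'i \<Rightarrow> 'i \<Rightarrow> 'k::comm_ring_1) \<Rightarrow> 'i \<times> 'i \<times> 'i \<Rightarrow> 'i \<times> 'i \<times> 'i \<Rightarrow> 'k" where
  "strand23 I Y x y = (if x \<in> I \<times> I \<times> I \<and> y \<in> I \<times> I \<times> I then
     case (x, y) of ((a, b, c), (d, e, f)) \<Rightarrow> kronecker a d * Y b c e f else 0)"

text \<open>If at least two crossings are virtual, both sides of the relation reduce, by the Kronecker deltas, to the tensor of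
  the remaining one.\<close>

lemma braid_relations:
  fixes R Rbar V :: "'i \<Rightarrow> 'i \<Rightarrow> 'i \<Rightarrow> 'i \<Rightarrow> 'k::comm_ring_1"
  assumes fin: "finite I"
    and RRb: "\<And>a b c d. a \<in> I \<Longrightarrow> b \<in> I \<Longrightarrow> c \<in> I \<Longrightarrow> d \<in> I \<Longrightarrow>
      (\<Sum>i\<in>I. \<Sum>j\<in>I. R a b i j * Rbar i j c d) = kronecker a c * kronecker b d"
    and RbR: "\<And>a b c d. a \<in> I \<Longrightarrow> b \<in> I \<Longrightarrow> c \<in> I \<Longrightarrow> d \<in> I \<Longrightarrow>
      (\<Sum>i\<in>I. \<Sum>j\<in>I. Rbar a b i j * R i j c d) = kronecker a c * kronecker b d"
    and yb: "\<And>a b c d e f. a \<in> I \<Longrightarrow> b \<in> I \<Longrightarrow> c \<in> I \<Longrightarrow> d \<in> I \<Longrightarrow> e \<in> I \<Longrightarrow> f \<in> I \<Longrightarrow>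
      (\<Sum>i\<in>I. \<Sum>j\<in>I. \<Sum>k\<in>I. R a b i j * R j c k f * R i k d e) =
      (\<Sum>i\<in>I. \<Sum>j\<in>I. \<Sum>k\<in>I. R b c i j * R a i d k * R k j e f)"
    and V: "V = (\<lambda>a b c d. kronecker a d * kronecker b c)"
    and tri: "triangle x y z" and abc: "a \<in> I" "b \<in> I" "c \<in> I" "d \<in> I" "e \<in> I" "f \<in> I"
  defines "Y \<equiv> crossing_tensor R Rbar V"
  shows "(\<Sum>i\<in>I. \<Sum>j\<in>I. \<Sum>k\<in>I. Y z a b i j * Y y j c k f * Y x i k d e) =
      (\<Sum>i\<in>I. \<Sum>j\<in>I. \<Sum>k\<in>I. Y x b c i j * Y y a i d k * Y z k j e f)"
proof -
  let ?J = "I \<times> I \<times> I"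
  \<comment> \<open>The algebra of matrices whose indices are triples of labels.\<close>
  interpret J: link_tensors ?J kronecker kronecker "\<lambda>_. undefined :: _ \<Rightarrow> _ \<Rightarrow> _ \<Rightarrow> _ \<Rightarrow> 'k"
    using fin by unfold_locales (simp_all add: kronecker_def if_distrib[where f="\<lambda>x. x * _"] cong: if_cong)
  let ?s = "strand12 I" and ?t = "strand23 I"
  have supp: "J.supp (?s U)" "J.supp (?t U)" for U :: "'i \<Rightarrow> 'i \<Rightarrow> 'i \<Rightarrow> 'i \<Rightarrow> 'k"
    by (auto simp: J.supp_def strand12_def strand23_def)
  note K = sum_kronecker[OF fin]
  have sts: "J.mat_mul (?s U) (J.mat_mul (?t W) (?s S)) (a, b, c) (d, e, f) =
      (\<Sum>i\<in>I. \<Sum>j\<in>I. \<Sum>k\<in>I. U a b i j * W j c k f * S i k d e)"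
    if "a \<in> I" "b \<in> I" "c \<in> I" "d \<in> I" "e \<in> I" "f \<in> I"
    for U W S :: "'i \<Rightarrow> 'i \<Rightarrow> 'i \<Rightarrow> 'i \<Rightarrow> 'k" and a b c d e f
  proof -
    have in1: "J.mat_mul (?t W) (?s S) (i, j, l) (d, e, f) = (\<Sum>k\<in>I. W j l k f * S i k d e)"
      if "i \<in> I" "j \<in> I" "l \<in> I" for i j l
    proof -
      have "J.mat_mul (?t W) (?s S) (i, j, l) (d, e, f) = (\<Sum>i'\<in>I. \<Sum>k\<in>I. \<Sum>f'\<in>I.
          kronecker i i' * (kronecker f' f * (W j l k f' * S i' k d e)))"
        using that \<open>d \<in> I\<close> \<open>e \<in> I\<close> \<open>f \<in> I\<close> unfolding J.mat_mul_def
        by (simp, intro sum_triple_eqI) (simp add: strand12_def strand23_def ac_simps)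
      also have "\<dots> = (\<Sum>i'\<in>I. kronecker i i' * (\<Sum>k\<in>I. \<Sum>f'\<in>I. kronecker f' f * (W j l k f' * S i' k d e)))"
        by (simp add: sum_distrib_left)
      finally show ?thesis using that \<open>f \<in> I\<close> by (simp add: K)
    qed
    have "J.mat_mul (?s U) (J.mat_mul (?t W) (?s S)) (a, b, c) (d, e, f) =
      (\<Sum>i\<in>I. \<Sum>j\<in>I. \<Sum>l\<in>I. kronecker c l * (U a b i j * (\<Sum>k\<in>I. W j l k f * S i k d e)))"
      using that unfolding J.mat_mul_def[of "?s U"]
      by (simp, intro sum_triple_eqI) (simp add: in1 strand12_def ac_simps)
    also have "\<dots> = (\<Sum>i\<in>I. \<Sum>j\<in>I. U a b i j * (\<Sum>k\<in>I. W j c k f * S i k d e))"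
      using \<open>c \<in> I\<close> by (simp add: K)
    finally show ?thesis by (simp add: sum_distrib_left mult.assoc)
  qed
  have tst: "J.mat_mul (?t U) (J.mat_mul (?s W) (?t S)) (a, b, c) (d, e, f) =
      (\<Sum>i\<in>I. \<Sum>j\<in>I. \<Sum>k\<in>I. U b c i j * W a i d k * S k j e f)"
    if "a \<in> I" "b \<in> I" "c \<in> I" "d \<in> I" "e \<in> I" "f \<in> I"
    for U W S :: "'i \<Rightarrow> 'i \<Rightarrow> 'i \<Rightarrow> 'i \<Rightarrow> 'k" and a b c d e f
  proof -
    have in1: "J.mat_mul (?s W) (?t S) (l, i, j) (d, e, f) = (\<Sum>k\<in>I. W l i d k * S k j e f)"
      if "i \<in> I" "j \<in> I" "l \<in> I" for i j l
    proof -
      have "J.mat_mul (?s W) (?t S) (l, i, j) (d, e, f) = (\<Sum>d'\<in>I. \<Sum>k\<in>I. \<Sum>j'\<in>I.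
          kronecker d' d * (kronecker j j' * (W l i d' k * S k j' e f)))"
        using that \<open>d \<in> I\<close> \<open>e \<in> I\<close> \<open>f \<in> I\<close> unfolding J.mat_mul_def
        by (simp, intro sum_triple_eqI) (simp add: strand12_def strand23_def ac_simps)
      also have "\<dots> = (\<Sum>d'\<in>I. kronecker d' d * (\<Sum>k\<in>I. \<Sum>j'\<in>I. kronecker j j' * (W l i d' k * S k j' e f)))"
        by (simp add: sum_distrib_left)
      finally show ?thesis using that \<open>d \<in> I\<close> by (simp add: K)
    qed
    have "J.mat_mul (?t U) (J.mat_mul (?s W) (?t S)) (a, b, c) (d, e, f) =
      (\<Sum>l\<in>I. \<Sum>i\<in>I. \<Sum>j\<in>I. kronecker a l * (U b c i j * (\<Sum>k\<in>I. W l i d k * S k j e f)))"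
      using that unfolding J.mat_mul_def[of "?t U"]
      by (simp, intro sum_triple_eqI) (simp add: in1 strand23_def ac_simps)
    also have "\<dots> = (\<Sum>l\<in>I. kronecker a l * (\<Sum>i\<in>I. \<Sum>j\<in>I. U b c i j * (\<Sum>k\<in>I. W l i d k * S k j e f)))"
      by (simp add: sum_distrib_left)
    also have "\<dots> = (\<Sum>i\<in>I. \<Sum>j\<in>I. U b c i j * (\<Sum>k\<in>I. W a i d k * S k j e f))"
      using \<open>a \<in> I\<close> by (simp add: K)
    finally show ?thesis by (simp add: sum_distrib_left mult.assoc)
  qed
  have inv: "J.mat_mul (?s U) (?s W) = J.one" "J.mat_mul (?t U) (?t W) = J.one"
    if UW: "\<And>a b c d. a \<in> I \<Longrightarrow> b \<in> I \<Longrightarrow> c \<in> I \<Longrightarrow> d \<in> I \<Longrightarrow>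
      (\<Sum>i\<in>I. \<Sum>j\<in>I. U a b i j * W i j c d) = kronecker a c * kronecker b d"
    for U W :: "'i \<Rightarrow> 'i \<Rightarrow> 'i \<Rightarrow> 'i \<Rightarrow> 'k"
  proof -
    have kr: "kronecker c f * (kronecker a d * kronecker b e) = J.one (a, b, c) (d, e, f)"
      if "a \<in> I" "b \<in> I" "c \<in> I" for a b c d e f
      using that by (auto simp: kronecker_def J.one_def)
    have "J.mat_mul (?s U) (?s W) (a, b, c) (d, e, f) = J.one (a, b, c) (d, e, f)"
      "J.mat_mul (?t U) (?t W) (a, b, c) (d, e, f) = J.one (a, b, c) (d, e, f)"
      if l: "a \<in> I" "b \<in> I" "c \<in> I" "d \<in> I" "e \<in> I" "f \<in> I" for a b c d e f
    proof -
      have "J.mat_mul (?s U) (?s W) (a, b, c) (d, e, f) =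
        (\<Sum>i\<in>I. \<Sum>j\<in>I. \<Sum>l\<in>I. kronecker c l * (kronecker l f * (U a b i j * W i j d e)))"
        using l unfolding J.mat_mul_def by (simp, intro sum_triple_eqI) (simp add: strand12_def ac_simps)
      also have "\<dots> = kronecker c f * (\<Sum>i\<in>I. \<Sum>j\<in>I. U a b i j * W i j d e)"
        using l by (simp add: K sum_distrib_left)
      finally show "J.mat_mul (?s U) (?s W) (a, b, c) (d, e, f) = J.one (a, b, c) (d, e, f)"
        using l by (simp add: UW kr)
      have "J.mat_mul (?t U) (?t W) (a, b, c) (d, e, f) =
        (\<Sum>l\<in>I. \<Sum>i\<in>I. \<Sum>j\<in>I. kronecker a l * (kronecker l d * (U b c i j * W i j e f)))"
        using l unfolding J.mat_mul_def by (simp, intro sum_triple_eqI) (simp add: strand23_def ac_simps)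
      also have "\<dots> = (\<Sum>l\<in>I. kronecker a l * (kronecker l d * (\<Sum>i\<in>I. \<Sum>j\<in>I. U b c i j * W i j e f)))"
        by (simp add: sum_distrib_left)
      also have "\<dots> = kronecker a d * (kronecker b e * kronecker c f)"
        using l by (simp add: K UW)
      finally show "J.mat_mul (?t U) (?t W) (a, b, c) (d, e, f) = J.one (a, b, c) (d, e, f)"
        using l kr[of a b c f d e] by (simp add: ac_simps)
    qed
    then have "J.mat_mul (?s U) (?s W) x y = J.one x y" "J.mat_mul (?t U) (?t W) x y = J.one x y"
      if "x \<in> ?J" "y \<in> ?J" for x y using that by auto
    moreover have "J.mat_mul P Q x y = 0" "J.one x y = 0" if "x \<notin> ?J \<or> y \<notin> ?J" for x y P Q
      using that by (auto simp: J.mat_mul_def J.one_def)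
    ultimately show "J.mat_mul (?s U) (?s W) = J.one" "J.mat_mul (?t U) (?t W) = J.one"
      by (intro ext; metis)+
  qed
  have mat_eq: "J.mat_mul (?s U) (J.mat_mul (?t W) (?s S)) = J.mat_mul (?t S) (J.mat_mul (?s W) (?t U))"
    if "\<And>a b c d e f. a \<in> I \<Longrightarrow> b \<in> I \<Longrightarrow> c \<in> I \<Longrightarrow> d \<in> I \<Longrightarrow> e \<in> I \<Longrightarrow> f \<in> I \<Longrightarrow>
      (\<Sum>i\<in>I. \<Sum>j\<in>I. \<Sum>k\<in>I. U a b i j * W j c k f * S i k d e) =
      (\<Sum>i\<in>I. \<Sum>j\<in>I. \<Sum>k\<in>I. S b c i j * W a i d k * U k j e f)"
    for U W S :: "'i \<Rightarrow> 'i \<Rightarrow> 'i \<Rightarrow> 'i \<Rightarrow> 'k"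
  proof (intro ext)
    fix x y :: "'i \<times> 'i \<times> 'i"
    show "J.mat_mul (?s U) (J.mat_mul (?t W) (?s S)) x y = J.mat_mul (?t S) (J.mat_mul (?s W) (?t U)) x y"
    proof (cases "x \<in> ?J \<and> y \<in> ?J")
      case True
      then obtain a b c d e f where xy: "x = (a, b, c)" "y = (d, e, f)"
        and l: "a \<in> I" "b \<in> I" "c \<in> I" "d \<in> I" "e \<in> I" "f \<in> I" by auto
      show ?thesis unfolding xy sts[OF l] tst[OF l] by (rule that[OF l])
    qed (auto simp: J.mat_mul_def)
  qed
  have br: "J.mat_mul (?s R) (J.mat_mul (?t R) (?s R)) = J.mat_mul (?t R) (J.mat_mul (?s R) (?t R))"
    by (rule mat_eq) (rule yb)
  note bv = J.braid_variants[OF supp(1)[of R] supp(2)[of R] supp(1)[of Rbar] supp(2)[of Rbar]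
      inv(1)[OF RRb] inv(1)[OF RbR] inv(2)[OF RRb] inv(2)[OF RbR] br]
  have classical: "J.mat_mul (?s (Y z)) (J.mat_mul (?t (Y y)) (?s (Y x))) = J.mat_mul (?t (Y x)) (J.mat_mul (?s (Y y)) (?t (Y z)))"
    if "Virt \<notin> {x, y, z}" "\<not> (x = z \<and> y = opp x)"
    using that bv br by (cases x; cases y; cases z) (simp_all add: Y_def crossing_tensor_def)
  show ?thesis
  proof (cases "Virt \<in> {x, y, z}")
    case False
    then have "\<not> (x = z \<and> y = opp x)" using tri by (auto simp: triangle_def)
    from classical[OF False this] sts[OF abc, of "Y z" "Y y" "Y x"] tst[OF abc, of "Y x" "Y y" "Y z"]
    show ?thesis by simp
  next
    case True
    have YV: "Y Virt = (\<lambda>a b c d. kronecker a d * kronecker b c)" by (simp add: Y_def crossing_tensor_def V)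
    have ks: "(\<Sum>i\<in>I. if P then F i else 0) = (if P then \<Sum>i\<in>I. F i else 0)" for P and F :: "'i \<Rightarrow> 'k" by simp
    consider "x = Virt" "y = Virt" | "y = Virt" "z = Virt" | "x = Virt" "z = Virt"
      using tri True by (auto simp: triangle_def)
    then show ?thesis
    proof cases
      case 1
      show ?thesis unfolding 1 YV using fin abc
        by (simp add: kronecker_def if_distrib[where f="\<lambda>x. x * _"] if_distrib[where f="\<lambda>x. _ * x"] ks cong: if_cong)
    next
      case 2
      show ?thesis unfolding 2 YV using fin abc
        by (simp add: kronecker_def if_distrib[where f="\<lambda>x. x * _"] if_distrib[where f="\<lambda>x. _ * x"] ks cong: if_cong)
    next
      case 3
      show ?thesis unfolding 3 YV using fin abc
        by (simp add: kronecker_def if_distrib[where f="\<lambda>x. x * _"] if_distrib[where f="\<lambda>x. _ * x"] ks cong: if_cong)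
    qed
  qed
qed

section \<open>Invariance of the evaluation\<close>

theorem mainTheorem3:
  fixes I :: "'i set"
    and Mmax Mmin :: "'i \<Rightarrow> 'i \<Rightarrow> 'k::comm_ring_1"
    and R Rbar V :: "'i \<Rightarrow> 'i \<Rightarrow> 'i \<Rightarrow> 'i \<Rightarrow> 'k"
    and K K' :: virtual_link_data
  assumes "finite I"
    and "\<forall>a\<in>I. \<forall>b\<in>I. (\<Sum>i\<in>I. Mmin a i * Mmax i b) = kronecker a b"
    and "\<forall>a\<in>I. \<forall>b\<in>I. \<forall>c\<in>I. \<forall>d\<in>I.
          (\<Sum>i\<in>I. \<Sum>j\<in>I. R a b i j * Rbar i j c d) = kronecker a c * kronecker b d"
    and "\<forall>a\<in>I. \<forall>b\<in>I. \<forall>c\<in>I. \<forall>d\<in>I. \<forall>e\<in>I. \<forall>f\<in>I.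
          (\<Sum>i\<in>I. \<Sum>j\<in>I. \<Sum>k\<in>I. R a b i j * R j c k f * R i k d e) =
          (\<Sum>i\<in>I. \<Sum>j\<in>I. \<Sum>k\<in>I. R b c i j * R a i d k * R k j e f)"
    and "\<forall>a\<in>I. \<forall>b\<in>I. \<forall>c\<in>I. \<forall>d\<in>I.
          (\<Sum>i\<in>I. R a i b c * Mmax i d) = (\<Sum>i\<in>I. Mmax b i * Rbar i a c d)"
    and "\<forall>a\<in>I. \<forall>b\<in>I. \<forall>c\<in>I. \<forall>d\<in>I.
          (\<Sum>i\<in>I. Rbar a i b c * Mmax i d) = (\<Sum>i\<in>I. Mmax b i * R i a c d)"
    and "V = (\<lambda>a b c d. kronecker a d * kronecker b c)"
    and "virtual_rotational_isotopic K K'"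
    and "general_position K" and "general_position K'"
  shows "evaluation I Mmax Mmin R Rbar V K = evaluation I Mmax Mmin R Rbar V K'"
proof -
  note fin = assms(1) and V = assms(7)
  have AB: "(\<Sum>i\<in>I. Mmax a i * Mmin i b) = kronecker a b" if "a \<in> I" "b \<in> I" for a b
    using left_inverse_imp_right_inverse[OF fin, of Mmin Mmax, OF _ that] assms(2)
    by (simp add: kronecker_def)
  have RbR: "(\<Sum>i\<in>I. \<Sum>j\<in>I. Rbar a b i j * R i j c d) = kronecker a c * kronecker b d"
    if "a \<in> I" "b \<in> I" "c \<in> I" "d \<in> I" for a b c d
  proof -
    have "(\<Sum>x\<in>I \<times> I. Rbar (fst (a, b)) (snd (a, b)) (fst x) (snd x) * R (fst x) (snd x) (fst (c, d)) (snd (c, d))) =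
      (if (a, b) = (c, d) then 1 else 0)"
    proof (rule left_inverse_imp_right_inverse[of "I \<times> I" "\<lambda>x y. R (fst x) (snd x) (fst y) (snd y)"
          "\<lambda>x y. Rbar (fst x) (snd x) (fst y) (snd y)" "(a, b)" "(c, d)"])
      fix x y assume "x \<in> I \<times> I" "y \<in> I \<times> I"
      then show "(\<Sum>w\<in>I \<times> I. R (fst x) (snd x) (fst w) (snd w) * Rbar (fst w) (snd w) (fst y) (snd y)) =
        (if x = y then 1 else 0)"
        using assms(3)[rule_format, of "fst x" "snd x" "fst y" "snd y"]
        by (auto simp: sum.cartesian_product case_prod_unfold kronecker_def prod_eq_iff mem_Times_iff)
    qed (use fin that in auto)
    then show ?thesis by (simp add: sum.cartesian_product case_prod_unfold kronecker_def)
  qed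
  let ?X = "crossing_tensor R Rbar V"
  interpret M: moves I Mmax Mmin ?X
  proof unfold_locales
    show "finite I" by (rule fin)
    show "(\<Sum>i\<in>I. Mmax a i * Mmin i b) = kronecker a b" if "a \<in> I" "b \<in> I" for a b by (rule AB[OF that])
    show "(\<Sum>i\<in>I. Mmin a i * Mmax i b) = kronecker a b" if "a \<in> I" "b \<in> I" for a b
      using assms(2) that by blast
    show "(\<Sum>i\<in>I. ?X (opp x) a i b c * Mmax i d) = (\<Sum>i\<in>I. Mmax b i * ?X x i a c d)"
      if l: "a \<in> I" "b \<in> I" "c \<in> I" "d \<in> I" for x a b c d
    proof (cases x)
      case Over
      then show ?thesis using assms(6) l by (simp add: crossing_tensor_def)
    next
      case Under
      then show ?thesis using assms(5) l by (simp add: crossing_tensor_def)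
    next
      case Virt
      have "(\<Sum>i\<in>I. V a i b c * Mmax i d) = kronecker a c * (\<Sum>i\<in>I. kronecker i b * Mmax i d)"
        by (simp add: V sum_distrib_left mult.assoc)
      also have "\<dots> = kronecker a c * (\<Sum>i\<in>I. kronecker i d * Mmax b i)"
        using l by (simp add: sum_kronecker[OF fin])
      also have "\<dots> = (\<Sum>i\<in>I. Mmax b i * V i a c d)"
        by (simp add: V sum_distrib_left ac_simps)
      finally show ?thesis using Virt by (simp add: crossing_tensor_def)
    qed
    show "(\<Sum>i\<in>I. \<Sum>j\<in>I. ?X (opp x) a b i j * ?X x i j c d) = kronecker a c * kronecker b d"
      if l: "a \<in> I" "b \<in> I" "c \<in> I" "d \<in> I" for x a b c d
    proof (cases x)
      case Over
      then show ?thesis using RbR[OF l] by (simp add: crossing_tensor_def)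
    next
      case Under
      then show ?thesis using assms(3) l by (simp add: crossing_tensor_def)
    next
      case Virt
      have "(\<Sum>i\<in>I. \<Sum>j\<in>I. V a b i j * V i j c d) =
        (\<Sum>i\<in>I. kronecker b i * (\<Sum>j\<in>I. kronecker a j * (kronecker i d * kronecker j c)))"
        by (simp add: V sum_distrib_left ac_simps)
      then show ?thesis using Virt l by (simp add: crossing_tensor_def sum_kronecker[OF fin] mult.commute)
    qed
    show "(\<Sum>i\<in>I. \<Sum>j\<in>I. \<Sum>k\<in>I. ?X z a b i j * ?X y j c k f * ?X x i k d e) =
      (\<Sum>i\<in>I. \<Sum>j\<in>I. \<Sum>k\<in>I. ?X x b c i j * ?X y a i d k * ?X z k j e f)"
      if "triangle x y z" "a \<in> I" "b \<in> I" "c \<in> I" "d \<in> I" "e \<in> I" "f \<in> I" for x y z a b c d e f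
      by (rule braid_relations[OF fin _ RbR _ V that]) (use assms(3,4) in auto)
  qed
  have "evaluation I Mmax Mmin R Rbar V L = M.invariant L" if "general_position L" for L
    unfolding evaluation_def M.invariant_general_position[OF that] ..
  then show ?thesis using M.invariant_isotopic[OF assms(8)] assms(9,10) by simp
qed

end
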